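(* For every integer $k\ge1$ and every unstable algebra $K\in\mathcal K$, the $nil_k$-localisation functor $l_k$ induces a functor from $K\text{-}\mathcal U$ to $l_k(K)\text{-}\mathcal U$.
   Context: $\mathcal A$ is the mod $2$ Steenrod algebra; $\mathcal U$ is the category of unstable $\mathcal A$-modules and $\mathcal K$ the category of unstable $\mathcal A$-algebras (commutative unital algebras $K$ in $\mathcal U$ with $Sq^{|x|}x=x^2$). For $K\in\mathcal K$, $K\text{-}\mathcal U$ is the category of $K$-modules in $\mathcal U$ (unstable modules $M$ with an action $K\otimes M\to M$ in $\mathcal U$). For a finite-dimensional $\mathbb F_2$-vector space $V$, $H^*(V):=H^*(BV;\mathbb F_2)$ and $T_V:\mathcal U\to\mathcal U$ is the left adjoint of $-\otimes H^*(V)$ (Lannes' functor), which is exact and commutes with tensor products. For $N\in\mathcal U$, $N^{<k}$ is the quotient of $N$ by its elements of degree $\ge k$; $\mathcal U^{<k}$ is the full subcategory of $\mathcal U$ of modules concentrated in degrees $<k$, with tensor product $(M\otimes N)^{<k}$. $f^{<k}$ sends $N\in\mathcal U$ to the functor $V\mapsto T_V(N)^{<k}$ (with values in $\mathcal U^{<k}$, equipped with their natural $H^*(V)^{<k}$-comodule structures); it is strong monoidal for the pointwise tensor product; $\mathcal F_\omega^{<k}$ is its essential image. $\mathcal Nil_k\subset\mathcal U$ is the Serre class of $k$-nilpotent modules; $N\in\mathcal Nil_k$ iff $f^{<k}(N)=0$. The quotient functor $r_k:\mathcal U\to\mathcal U/\mathcal Nil_k$ has a right adjoint $s_k$, and $l_k:=s_k\circ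 r_k$ is the $nil_k$-localisation. One has $l_k\cong m^{<k}\circ f^{<k}$, where $m^{<k}:\mathcal F^{<k}_\omega\to\mathcal U$ is the right adjoint of $f^{<k}$; $m^{<k}$ is lax monoidal, so $l_k$ is lax monoidal. For $K\in\mathcal K$, $l_k(K)$ with the induced multiplication is an unstable algebra. *)

theory Defs
  imports "HOL-Algebra.Ring"
begin

section \<open>Categories, functors, adjunctions\<close>

text \<open>Arrows carry their source and target.\<close>

datatype ('o, 'f) arrow = Arrow (src: 'o) (tgt: 'o) (app: 'f)

record ('o, 'm) category =
  Ob :: "'o set"
  Hom :: "'o \<Rightarrow> 'o \<Rightarrow> 'm set"
  Idn :: "'o \<Rightarrow> 'm"
  Comp :: "'m \<Rightarrow> 'm \<Rightarrow> 'm"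

definition is_category :: "('o, 'm) category \<Rightarrow> bool" where
  "is_category C \<longleftrightarrow>
    (\<forall>a\<in>Ob C. Idn C a \<in> Hom C a a) \<and>
    (\<forall>a\<in>Ob C. \<forall>b\<in>Ob C. \<forall>c\<in>Ob C. \<forall>f\<in>Hom C a b. \<forall>g\<in>Hom C b c.
       Comp C g f \<in> Hom C a c) \<and>
    (\<forall>a\<in>Ob C. \<forall>b\<in>Ob C. \<forall>f\<in>Hom C a b. Comp C f (Idn C a) = f \<and> Comp C (Idn C b) f = f) \<and>
    (\<forall>a\<in>Ob C. \<forall>b\<in>Ob C. \<forall>c\<in>Ob C. \<forall>d\<in>Ob C.
       \<forall>f\<in>Hom C a b. \<forall>g\<in>Hom C b c. \<forall>h\<in>Hom C c d.
       Comp C h (Comp C g f) = Comp C (Comp C h g) f)"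

definition is_functor ::
  "('o, 'm) category \<Rightarrow> ('p, 'n) category \<Rightarrow> ('o \<Rightarrow> 'p) \<Rightarrow> ('m \<Rightarrow> 'n) \<Rightarrow> bool" where
  "is_functor C D Fo Fm \<longleftrightarrow>
    is_category C \<and> is_category D \<and>
    (\<forall>a\<in>Ob C. Fo a \<in> Ob D) \<and>
    (\<forall>a\<in>Ob C. \<forall>b\<in>Ob C. \<forall>f\<in>Hom C a b. Fm f \<in> Hom D (Fo a) (Fo b)) \<and>
    (\<forall>a\<in>Ob C. Fm (Idn C a) = Idn D (Fo a)) \<and>
    (\<forall>a\<in>Ob C. \<forall>b\<in>Ob C. \<forall>c\<in>Ob C. \<forall>f\<in>Hom C a b. \<forall>g\<in>Hom C b c.
       Fm (Comp C g f) = Comp D (Fm g) (Fm f))"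

text \<open>The functor \<open>G : D \<rightarrow> C\<close> is right adjoint to \<open>F : C \<rightarrow> D\<close>, with the natural bijections
  \<open>\<phi> c d : D(F c, d) \<rightarrow> C(c, G d)\<close>.\<close>

definition is_adjunction ::
  "('o, 'm) category \<Rightarrow> ('p, 'n) category \<Rightarrow> ('o \<Rightarrow> 'p) \<Rightarrow> ('m \<Rightarrow> 'n) \<Rightarrow>
   ('p \<Rightarrow> 'o) \<Rightarrow> ('n \<Rightarrow> 'm) \<Rightarrow> ('o \<Rightarrow> 'p \<Rightarrow> 'n \<Rightarrow> 'm) \<Rightarrow> bool" where
  "is_adjunction C D Fo Fm Go Gm \<phi> \<longleftrightarrow>
    is_functor C D Fo Fm \<and> is_functor D C Go Gm \<and>
    (\<forall>c\<in>Ob C. \<forall>d\<in>Ob D. bij_betw (\<phi> c d) (Hom D (Fo c) d) (Hom C c (Go d))) \<and>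
    (\<forall>c\<in>Ob C. \<forall>c'\<in>Ob C. \<forall>d\<in>Ob D. \<forall>d'\<in>Ob D.
       \<forall>h\<in>Hom C c' c. \<forall>u\<in>Hom D (Fo c) d. \<forall>v\<in>Hom D d d'.
       \<phi> c' d' (Comp D v (Comp D u (Fm h))) = Comp C (Gm v) (Comp C (\<phi> c d u) h))"

section \<open>Unstable modules over the mod 2 Steenrod algebra\<close>

text \<open>
  \<open>gr M n\<close> is the degree \<open>n\<close> part of \<open>M\<close>; only the additive structure of the ring record is used.
  \<open>Sq M i n\<close> is the operation \<open>Sq\<^sup>i\<close> on degree \<open>n\<close>. Unstable modules vanish in negative degrees,
  so grading by \<open>nat\<close> loses nothing.

  A module has its elements in \<open>'a\<close>, which the main statement takes to be an arbitrary infinite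
  type. So \<open>'a\<close> plays the role of a universe: up to isomorphism, the modules over \<open>'a\<close> are those
  of cardinality at most that of \<open>'a\<close>, and these are closed under subobjects, quotients, tensor
  products, direct sums indexed by subsets of \<open>'a\<close>, and \<open>nil\<^sub>k\<close>-localisation (the category of
  unstable modules being locally noetherian).
\<close>

record 'a umod =
  gr :: "nat \<Rightarrow> 'a ring"
  Sq :: "nat \<Rightarrow> nat \<Rightarrow> 'a \<Rightarrow> 'a"

abbreviation el :: "'a umod \<Rightarrow> nat \<Rightarrow> 'a set" where
  "el M n \<equiv> carrier (gr M n)"

definition F2_space :: "'a ring \<Rightarrow> bool" where
  "F2_space V \<longleftrightarrow> abelian_group V \<and> (\<forall>x\<in>carrier V. x \<oplus>\<^bsub>V\<^esub> x = \<zero>\<^bsub>V\<^esub>)"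

abbreviation F2_linear :: "'a ring \<Rightarrow> 'b ring \<Rightarrow> ('a \<Rightarrow> 'b) set" where
  "F2_linear V W \<equiv> hom (add_monoid V) (add_monoid W)"

text \<open>The Steenrod algebra is generated by the \<open>Sq\<^sup>i\<close> subject to \<open>Sq\<^sup>0 = 1\<close> and the Adem relations
  \<open>Sq\<^sup>a Sq\<^sup>b = \<Sum>\<^sub>c (b-c-1 choose a-2c) Sq\<^bsup>a+b-c\<^esup> Sq\<^sup>c\<close> for \<open>0 < a < 2b\<close>, where \<open>0 \<le> c \<le> a/2\<close>;
  the sum is restricted here to the \<open>c\<close> with odd coefficient.\<close>

definition steenrod_module :: "'a umod \<Rightarrow> bool" where
  "steenrod_module M \<longleftrightarrow>
    (\<forall>n. F2_space (gr M n)) \<and>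
    (\<forall>i n. Sq M i n \<in> F2_linear (gr M n) (gr M (n + i))) \<and>
    (\<forall>n. \<forall>x\<in>el M n. Sq M 0 n x = x) \<and>
    (\<forall>a b n. 0 < a \<and> a < 2 * b \<longrightarrow> (\<forall>x\<in>el M n.
       Sq M a (n + b) (Sq M b n x) =
       (\<Oplus>\<^bsub>gr M (n + a + b)\<^esub> c \<in> {c. 2 * c \<le> a \<and> odd ((b - c - 1) choose (a - 2 * c))}.
          Sq M (a + b - c) (n + c) (Sq M c n x))))"

definition unstable_module :: "'a umod \<Rightarrow> bool" where
  "unstable_module M \<longleftrightarrow> steenrod_module M \<and>
    (\<forall>i n. n < i \<longrightarrow> (\<forall>x\<in>el M n. Sq M i n x = \<zero>\<^bsub>gr M (n + i)\<^esub>))"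

type_synonym 'a uarr = "('a umod, nat \<Rightarrow> 'a \<Rightarrow> 'a) arrow"

definition U :: "('a umod, 'a uarr) category" where
  "U = \<lparr>
    Ob = {M. unstable_module M},
    Hom = (\<lambda>M N. {f. src f = M \<and> tgt f = N \<and>
      (\<forall>n. app f n \<in> F2_linear (gr M n) (gr N n) \<inter> extensional (el M n)) \<and>
      (\<forall>i n. \<forall>x\<in>el M n. app f (n + i) (Sq M i n x) = Sq N i n (app f n x))}),
    Idn = (\<lambda>M. Arrow M M (\<lambda>n. \<lambda>x\<in>el M n. x)),
    Comp = (\<lambda>g f. Arrow (src f) (tgt g) (\<lambda>n. compose (el (src f) n) (app g n) (app f n)))\<rparr>"

section \<open>Tensor products\<close>

definition bilinear_pairing ::
  "(nat \<Rightarrow> 'a ring) \<Rightarrow> (nat \<Rightarrow> 'b ring) \<Rightarrow> (nat \<Rightarrow> 'c ring) \<Rightarrow>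
   (nat \<Rightarrow> nat \<Rightarrow> 'a \<Rightarrow> 'b \<Rightarrow> 'c) \<Rightarrow> bool" where
  "bilinear_pairing V W P \<beta> \<longleftrightarrow>
    (\<forall>i j. (\<forall>x\<in>carrier (V i). (\<lambda>y. \<beta> i j x y) \<in> F2_linear (W j) (P (i + j))) \<and>
           (\<forall>y\<in>carrier (W j). (\<lambda>x. \<beta> i j x y) \<in> F2_linear (V i) (P (i + j))))"

text \<open>\<open>P\<close> with \<open>\<tau>\<close> is the tensor product of \<open>M\<close> and \<open>N\<close> as graded \<open>\<bbbF>\<^sub>2\<close>-vector spaces, and the Steenrod
  operations of \<open>P\<close> are given by the Cartan formula.\<close>

definition is_tensor ::
  "'a umod \<Rightarrow> 'a umod \<Rightarrow> 'a umod \<Rightarrow> (nat \<Rightarrow> nat \<Rightarrow> 'a \<Rightarrow> 'a \<Rightarrow> 'a) \<Rightarrow> bool" where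
  "is_tensor M N P \<tau> \<longleftrightarrow>
    P \<in> Ob U \<and>
    bilinear_pairing (gr M) (gr N) (gr P) \<tau> \<and>
    (\<forall>W :: nat \<Rightarrow> 'a ring. \<forall>\<beta>. (\<forall>n. F2_space (W n)) \<and> bilinear_pairing (gr M) (gr N) W \<beta> \<longrightarrow>
      (\<exists>!h. (\<forall>n. h n \<in> F2_linear (gr P n) (W n) \<inter> extensional (el P n)) \<and>
            (\<forall>i j. \<forall>x\<in>el M i. \<forall>y\<in>el N j. h (i + j) (\<tau> i j x y) = \<beta> i j x y))) \<and>
    (\<forall>r i j. \<forall>x\<in>el M i. \<forall>y\<in>el N j.
      Sq P r (i + j) (\<tau> i j x y) =
      (\<Oplus>\<^bsub>gr P (i + j + r)\<^esub> a \<in> {0..r}.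
         \<tau> (i + a) (j + (r - a)) (Sq M a i x) (Sq N (r - a) j y)))"

text \<open>A choice of tensor products: \<open>tob T M N\<close> is \<open>M \<otimes> N\<close> and \<open>tel T M N i j x y\<close> is \<open>x \<otimes> y\<close>, for
  \<open>x\<close> of degree \<open>i\<close> and \<open>y\<close> of degree \<open>j\<close>.\<close>

record 'a tensor =
  tob :: "'a umod \<Rightarrow> 'a umod \<Rightarrow> 'a umod"
  tel :: "'a umod \<Rightarrow> 'a umod \<Rightarrow> nat \<Rightarrow> nat \<Rightarrow> 'a \<Rightarrow> 'a \<Rightarrow> 'a"

definition is_tensor_choice :: "'a tensor \<Rightarrow> bool" where
  "is_tensor_choice T \<longleftrightarrow> (\<forall>M\<in>Ob U. \<forall>N\<in>Ob U. is_tensor M N (tob T M N) (tel T M N))"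

definition tmap :: "'a tensor \<Rightarrow> 'a uarr \<Rightarrow> 'a uarr \<Rightarrow> 'a uarr" where
  "tmap T f g = (THE h. h \<in> Hom U (tob T (src f) (src g)) (tob T (tgt f) (tgt g)) \<and>
     (\<forall>i j. \<forall>x\<in>el (src f) i. \<forall>y\<in>el (src g) j.
        app h (i + j) (tel T (src f) (src g) i j x y) =
        tel T (tgt f) (tgt g) i j (app f i x) (app g j y)))"

definition assoc :: "'a tensor \<Rightarrow> 'a umod \<Rightarrow> 'a umod \<Rightarrow> 'a umod \<Rightarrow> 'a uarr" where
  "assoc T L M N = (THE h. h \<in> Hom U (tob T (tob T L M) N) (tob T L (tob T M N)) \<and>
     (\<forall>i j r. \<forall>x\<in>el L i. \<forall>y\<in>el M j. \<forall>z\<in>el N r.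
        app h (i + j + r) (tel T (tob T L M) N (i + j) r (tel T L M i j x y) z) =
        tel T L (tob T M N) i (j + r) x (tel T M N j r y z)))"

text \<open>The unit object is \<open>\<bbbF>\<^sub>2\<close> in degree 0, realised on two chosen distinct elements of \<open>'a\<close>.\<close>

definition bits :: "'a \<times> 'a" where
  "bits = (SOME p. fst p \<noteq> snd p)"

definition F2 :: "'a umod" where
  "F2 = \<lparr>
    gr = (\<lambda>n. \<lparr>carrier = (if n = 0 then {fst bits, snd bits} else {fst bits}),
              mult = undefined, one = undefined, zero = fst bits,
              add = (\<lambda>x y. if x = y then fst bits else snd bits)\<rparr>),
    Sq = (\<lambda>i n x. if i = 0 then x else fst bits)\<rparr>"

definition F2_gen :: 'a where
  "F2_gen = snd bits"

definition lunit :: "'a tensor \<Rightarrow> 'a umod \<Rightarrow> 'a uarr" where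
  "lunit T M = (THE h. h \<in> Hom U (tob T F2 M) M \<and>
     (\<forall>i. \<forall>x\<in>el M i. app h i (tel T F2 M 0 i F2_gen x) = x))"

definition runit :: "'a tensor \<Rightarrow> 'a umod \<Rightarrow> 'a uarr" where
  "runit T M = (THE h. h \<in> Hom U (tob T M F2) M \<and>
     (\<forall>i. \<forall>x\<in>el M i. app h i (tel T M F2 i 0 x F2_gen) = x))"

section \<open>Unstable algebras and their modules\<close>

record 'a ualg =
  umod_of :: "'a umod"
  amul :: "'a uarr"
  aunit :: "'a uarr"

abbreviation mult_el :: "'a tensor \<Rightarrow> 'a ualg \<Rightarrow> nat \<Rightarrow> nat \<Rightarrow> 'a \<Rightarrow> 'a \<Rightarrow> 'a" where
  "mult_el T K i j x y \<equiv> app (amul K) (i + j) (tel T (umod_of K) (umod_of K) i j x y)"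

abbreviation unity :: "'a ualg \<Rightarrow> 'a" where
  "unity K \<equiv> app (aunit K) 0 F2_gen"

definition unstable_algebra :: "'a tensor \<Rightarrow> 'a ualg \<Rightarrow> bool" where
  "unstable_algebra T K \<longleftrightarrow>
    umod_of K \<in> Ob U \<and>
    amul K \<in> Hom U (tob T (umod_of K) (umod_of K)) (umod_of K) \<and>
    aunit K \<in> Hom U F2 (umod_of K) \<and>
    (\<forall>i j r. \<forall>x\<in>el (umod_of K) i. \<forall>y\<in>el (umod_of K) j. \<forall>z\<in>el (umod_of K) r.
       mult_el T K (i + j) r (mult_el T K i j x y) z = mult_el T K i (j + r) x (mult_el T K j r y z)) \<and>
    (\<forall>i j. \<forall>x\<in>el (umod_of K) i. \<forall>y\<in>el (umod_of K) j. mult_el T K i j x y = mult_el T K j i y x) \<and>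
    (\<forall>i. \<forall>x\<in>el (umod_of K) i. mult_el T K 0 i (unity K) x = x) \<and>
    (\<forall>i. \<forall>x\<in>el (umod_of K) i. Sq (umod_of K) i i x = mult_el T K i i x x)"

text \<open>An object of \<open>K\<close>-\<open>\<U>\<close> is a pair \<open>(M, a)\<close> with action \<open>a : K \<otimes> M \<rightarrow> M\<close>.\<close>

type_synonym 'a kmod = "'a umod \<times> 'a uarr"

type_synonym 'a karr = "('a kmod, nat \<Rightarrow> 'a \<Rightarrow> 'a) arrow"

abbreviation act :: "'a tensor \<Rightarrow> 'a ualg \<Rightarrow> 'a kmod \<Rightarrow> nat \<Rightarrow> nat \<Rightarrow> 'a \<Rightarrow> 'a \<Rightarrow> 'a" where
  "act T K X i j x v \<equiv> app (snd X) (i + j) (tel T (umod_of K) (fst X) i j x v)"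

definition is_kmod :: "'a tensor \<Rightarrow> 'a ualg \<Rightarrow> 'a kmod \<Rightarrow> bool" where
  "is_kmod T K X \<longleftrightarrow>
    fst X \<in> Ob U \<and>
    snd X \<in> Hom U (tob T (umod_of K) (fst X)) (fst X) \<and>
    (\<forall>i j r. \<forall>x\<in>el (umod_of K) i. \<forall>y\<in>el (umod_of K) j. \<forall>v\<in>el (fst X) r.
       act T K X (i + j) r (mult_el T K i j x y) v = act T K X i (j + r) x (act T K X j r y v)) \<and>
    (\<forall>i. \<forall>v\<in>el (fst X) i. act T K X 0 i (unity K) v = v)"

definition under :: "'a karr \<Rightarrow> 'a uarr" where
  "under f = Arrow (fst (src f)) (fst (tgt f)) (app f)"

definition KU :: "'a tensor \<Rightarrow> 'a ualg \<Rightarrow> ('a kmod, 'a karr) category" where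
  "KU T K = \<lparr>
    Ob = {X. is_kmod T K X},
    Hom = (\<lambda>X Y. {f. src f = X \<and> tgt f = Y \<and> under f \<in> Hom U (fst X) (fst Y) \<and>
      (\<forall>i j. \<forall>x\<in>el (umod_of K) i. \<forall>v\<in>el (fst X) j.
         app f (i + j) (act T K X i j x v) = act T K Y i j x (app f j v))}),
    Idn = (\<lambda>X. Arrow X X (app (Idn U (fst X)))),
    Comp = (\<lambda>g f. Arrow (src f) (tgt g) (app (Comp U (under g) (under f))))\<rparr>"

section \<open>The Serre class of \<open>k\<close>-nilpotent modules\<close>

definition suspension :: "nat \<Rightarrow> 'a umod \<Rightarrow> 'a umod" where
  "suspension k M = \<lparr>
    gr = (\<lambda>n. if k \<le> n then gr M (n - k) else (gr M 0)\<lparr>carrier := {\<zero>\<^bsub>gr M 0\<^esub>}\<rparr>),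
    Sq = (\<lambda>i n x. if k \<le> n then Sq M i (n - k) x
                  else if k \<le> n + i then \<zero>\<^bsub>gr M (n + i - k)\<^esub> else \<zero>\<^bsub>gr M 0\<^esub>)\<rparr>"

definition injective :: "'a uarr \<Rightarrow> bool" where
  "injective f \<longleftrightarrow> (\<forall>n. inj_on (app f n) (el (src f) n))"

definition surjective :: "'a uarr \<Rightarrow> bool" where
  "surjective f \<longleftrightarrow> (\<forall>n. app f n ` el (src f) n = el (tgt f) n)"

definition exact_at :: "'a uarr \<Rightarrow> 'a uarr \<Rightarrow> bool" where
  "exact_at f g \<longleftrightarrow>
    (\<forall>n. app f n ` el (src f) n = {x \<in> el (src g) n. app g n x = \<zero>\<^bsub>gr (tgt g) n\<^esub>})"

definition serre_class :: "'a umod set \<Rightarrow> bool" where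
  "serre_class \<C> \<longleftrightarrow> \<C> \<noteq> {} \<and> \<C> \<subseteq> Ob U \<and>
    (\<forall>L\<in>Ob U. \<forall>M\<in>Ob U. \<forall>N\<in>Ob U. \<forall>f\<in>Hom U L M. \<forall>g\<in>Hom U M N.
       injective f \<and> exact_at f g \<and> surjective g \<longrightarrow> (M \<in> \<C> \<longleftrightarrow> L \<in> \<C> \<and> N \<in> \<C>))"

definition is_direct_sum :: "'a set \<Rightarrow> ('a \<Rightarrow> 'a umod) \<Rightarrow> ('a \<Rightarrow> 'a uarr) \<Rightarrow> 'a umod \<Rightarrow> bool" where
  "is_direct_sum I D \<iota> S \<longleftrightarrow>
    S \<in> Ob U \<and> (\<forall>i\<in>I. D i \<in> Ob U \<and> \<iota> i \<in> Hom U (D i) S) \<and>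
    (\<forall>n. \<forall>x\<in>el S n. \<exists>!y. y \<in> (\<Pi>\<^sub>E i\<in>I. el (D i) n) \<and>
       finite {i\<in>I. y i \<noteq> \<zero>\<^bsub>gr (D i) n\<^esub>} \<and>
       x = (\<Oplus>\<^bsub>gr S n\<^esub> i \<in> {i\<in>I. y i \<noteq> \<zero>\<^bsub>gr (D i) n\<^esub>}. app (\<iota> i) n (y i)))"

text \<open>Every colimit is a quotient of the direct sum of its terms, so a Serre class that is closed
  under direct sums is closed under colimits.\<close>

definition localizing :: "'a umod set \<Rightarrow> bool" where
  "localizing \<C> \<longleftrightarrow> serre_class \<C> \<and>
    (\<forall>I D \<iota> S. is_direct_sum I D \<iota> S \<and> (\<forall>i\<in>I. D i \<in> \<C>) \<longrightarrow> S \<in> \<C>)"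

text \<open>The smallest Serre class that is closed under colimits and contains all \<open>k\<close>-fold suspensions.\<close>

definition nilpotent :: "nat \<Rightarrow> 'a umod set" where
  "nilpotent k = \<Inter>{\<C>. localizing \<C> \<and> (\<forall>M\<in>Ob U. suspension k M \<in> \<C>)}"

section \<open>The quotient category and \<open>nil\<^sub>k\<close>-localisation\<close>

text \<open>Arrows with kernel \<open>L\<close> and cokernel \<open>C\<close> in \<open>nilpotent k\<close>.\<close>

definition nil_iso :: "nat \<Rightarrow> 'a uarr \<Rightarrow> bool" where
  "nil_iso k f \<longleftrightarrow> (\<exists>L\<in>nilpotent k. \<exists>C\<in>nilpotent k. \<exists>i\<in>Hom U L (src f). \<exists>p\<in>Hom U (tgt f) C.
     injective i \<and> exact_at i f \<and> exact_at f p \<and> surjective p)"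

text \<open>
  The quotient of \<open>\<U>\<close> by the Serre class \<open>nilpotent k\<close> is the localisation of \<open>\<U>\<close> at these arrows. They
  admit a calculus of fractions: a morphism from \<open>M\<close> to \<open>N\<close> is a class of roofs
  \<open>M \<leftarrow> A \<rightarrow> N\<close> whose left leg has kernel and cokernel in \<open>nilpotent k\<close>.
\<close>

type_synonym 'a roof = "'a uarr \<times> 'a uarr"

definition roofs :: "nat \<Rightarrow> 'a umod \<Rightarrow> 'a umod \<Rightarrow> 'a roof set" where
  "roofs k M N = {(s, f). \<exists>A\<in>Ob U. s \<in> Hom U A M \<and> nil_iso k s \<and> f \<in> Hom U A N}"

definition roof_equiv :: "nat \<Rightarrow> 'a roof \<Rightarrow> 'a roof \<Rightarrow> bool" where
  "roof_equiv k \<rho> \<sigma> \<longleftrightarrow> (\<exists>A\<in>Ob U. \<exists>t\<in>Hom U A (src (fst \<rho>)). \<exists>u\<in>Hom U A (src (fst \<sigma>)).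
     Comp U (fst \<rho>) t = Comp U (fst \<sigma>) u \<and> nil_iso k (Comp U (fst \<rho>) t) \<and>
     Comp U (snd \<rho>) t = Comp U (snd \<sigma>) u)"

type_synonym 'a qarr = "('a umod, 'a roof set) arrow"

definition frac :: "nat \<Rightarrow> 'a umod \<Rightarrow> 'a umod \<Rightarrow> 'a roof \<Rightarrow> 'a qarr" where
  "frac k M N \<rho> = Arrow M N {\<sigma> \<in> roofs k M N. roof_equiv k \<rho> \<sigma>}"

definition U_mod_nilpotent :: "nat \<Rightarrow> ('a umod, 'a qarr) category" where
  "U_mod_nilpotent k = \<lparr>
    Ob = Ob U,
    Hom = (\<lambda>M N. frac k M N ` roofs k M N),
    Idn = (\<lambda>M. frac k M M (Idn U M, Idn U M)),
    Comp = (\<lambda>G F. Arrow (src F) (tgt G) {\<sigma> \<in> roofs k (src F) (tgt G).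
      \<exists>(s, f)\<in>app F. \<exists>(t, g)\<in>app G. \<exists>A\<in>Ob U. \<exists>p\<in>Hom U A (src s). \<exists>q\<in>Hom U A (src t).
        nil_iso k p \<and> Comp U f p = Comp U t q \<and>
        roof_equiv k (Comp U s p, Comp U g q) \<sigma>})\<rparr>"

definition r_map :: "nat \<Rightarrow> 'a uarr \<Rightarrow> 'a qarr" where
  "r_map k f = frac k (src f) (tgt f) (Idn U (src f), f)"

text \<open>\<open>(so, sm)\<close> is a right adjoint \<open>s\<^sub>k\<close> of the quotient functor \<open>r\<^sub>k\<close>, which is the identity on
  objects. The localisation \<open>l\<^sub>k = s\<^sub>k \<circ> r\<^sub>k\<close> is then \<open>so\<close> on objects and \<open>l_map\<close> on arrows, with
  unit \<open>l_unit\<close>.\<close>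

definition is_right_adjoint_r ::
  "nat \<Rightarrow> ('a umod \<Rightarrow> 'a umod) \<Rightarrow> ('a qarr \<Rightarrow> 'a uarr) \<Rightarrow>
   ('a umod \<Rightarrow> 'a umod \<Rightarrow> 'a qarr \<Rightarrow> 'a uarr) \<Rightarrow> bool" where
  "is_right_adjoint_r k so sm \<phi> \<longleftrightarrow>
    is_adjunction U (U_mod_nilpotent k) (\<lambda>M. M) (r_map k) so sm \<phi>"

definition l_ob :: "('a umod \<Rightarrow> 'a umod) \<Rightarrow> 'a umod \<Rightarrow> 'a umod" where
  "l_ob so M = so M"

definition l_map :: "nat \<Rightarrow> ('a qarr \<Rightarrow> 'a uarr) \<Rightarrow> 'a uarr \<Rightarrow> 'a uarr" where
  "l_map k sm f = sm (r_map k f)"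

definition l_unit :: "nat \<Rightarrow> ('a umod \<Rightarrow> 'a umod \<Rightarrow> 'a qarr \<Rightarrow> 'a uarr) \<Rightarrow> 'a umod \<Rightarrow> 'a uarr" where
  "l_unit k \<phi> M = \<phi> M M (Idn (U_mod_nilpotent k) M)"

section \<open>Lax monoidal structures and induced modules\<close>

definition lax_monoidal ::
  "'a tensor \<Rightarrow> ('a umod \<Rightarrow> 'a umod) \<Rightarrow> ('a uarr \<Rightarrow> 'a uarr) \<Rightarrow>
   ('a umod \<Rightarrow> 'a umod \<Rightarrow> 'a uarr) \<Rightarrow> 'a uarr \<Rightarrow> bool" where
  "lax_monoidal T Lo Lm \<mu> \<epsilon> \<longleftrightarrow>
    is_functor U U Lo Lm \<and>
    \<epsilon> \<in> Hom U F2 (Lo F2) \<and>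
    (\<forall>M\<in>Ob U. \<forall>N\<in>Ob U. \<mu> M N \<in> Hom U (tob T (Lo M) (Lo N)) (Lo (tob T M N))) \<and>
    (\<forall>M\<in>Ob U. \<forall>M'\<in>Ob U. \<forall>N\<in>Ob U. \<forall>N'\<in>Ob U. \<forall>f\<in>Hom U M M'. \<forall>g\<in>Hom U N N'.
       Comp U (\<mu> M' N') (tmap T (Lm f) (Lm g)) = Comp U (Lm (tmap T f g)) (\<mu> M N)) \<and>
    (\<forall>L\<in>Ob U. \<forall>M\<in>Ob U. \<forall>N\<in>Ob U.
       Comp U (Lm (assoc T L M N))
         (Comp U (\<mu> (tob T L M) N) (tmap T (\<mu> L M) (Idn U (Lo N)))) =
       Comp U (\<mu> L (tob T M N))
         (Comp U (tmap T (Idn U (Lo L)) (\<mu> M N)) (assoc T (Lo L) (Lo M) (Lo N)))) \<and>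
    (\<forall>M\<in>Ob U.
       Comp U (Lm (lunit T M)) (Comp U (\<mu> F2 M) (tmap T \<epsilon> (Idn U (Lo M)))) = lunit T (Lo M) \<and>
       Comp U (Lm (runit T M)) (Comp U (\<mu> M F2) (tmap T (Idn U (Lo M)) \<epsilon>)) = runit T (Lo M))"

text \<open>
  Writing \<open>l\<^sub>k = m \<circ> f\<close> with \<open>f\<close> strong monoidal and \<open>m\<close> its lax monoidal right adjoint, the unit
  \<open>\<eta> : id \<rightarrow> m \<circ> f\<close> is a monoidal transformation. This determines the lax structure of \<open>l\<^sub>k\<close>, since
  \<open>\<eta> \<otimes> \<eta>\<close> is a \<open>nilpotent k\<close>-isomorphism and maps into \<open>l\<^sub>k\<close>-local modules extend uniquely along those.
\<close>

definition l_lax ::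
  "'a tensor \<Rightarrow> nat \<Rightarrow> ('a umod \<Rightarrow> 'a umod) \<Rightarrow> ('a qarr \<Rightarrow> 'a uarr) \<Rightarrow>
   ('a umod \<Rightarrow> 'a umod \<Rightarrow> 'a qarr \<Rightarrow> 'a uarr) \<Rightarrow>
   ('a umod \<Rightarrow> 'a umod \<Rightarrow> 'a uarr) \<Rightarrow> 'a uarr \<Rightarrow> bool" where
  "l_lax T k so sm \<phi> \<mu> \<epsilon> \<longleftrightarrow>
    lax_monoidal T (l_ob so) (l_map k sm) \<mu> \<epsilon> \<and>
    \<epsilon> = l_unit k \<phi> F2 \<and>
    (\<forall>M\<in>Ob U. \<forall>N\<in>Ob U.
       Comp U (\<mu> M N) (tmap T (l_unit k \<phi> M) (l_unit k \<phi> N)) = l_unit k \<phi> (tob T M N))"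

definition induced_alg ::
  "('a umod \<Rightarrow> 'a umod) \<Rightarrow> ('a uarr \<Rightarrow> 'a uarr) \<Rightarrow> ('a umod \<Rightarrow> 'a umod \<Rightarrow> 'a uarr) \<Rightarrow> 'a uarr \<Rightarrow>
   'a ualg \<Rightarrow> 'a ualg" where
  "induced_alg Lo Lm \<mu> \<epsilon> K = \<lparr>
    umod_of = Lo (umod_of K),
    amul = Comp U (Lm (amul K)) (\<mu> (umod_of K) (umod_of K)),
    aunit = Comp U (Lm (aunit K)) \<epsilon>\<rparr>"

definition induced_ob ::
  "('a umod \<Rightarrow> 'a umod) \<Rightarrow> ('a uarr \<Rightarrow> 'a uarr) \<Rightarrow> ('a umod \<Rightarrow> 'a umod \<Rightarrow> 'a uarr) \<Rightarrow>
   'a ualg \<Rightarrow> 'a kmod \<Rightarrow> 'a kmod" where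
  "induced_ob Lo Lm \<mu> K X = (Lo (fst X), Comp U (Lm (snd X)) (\<mu> (umod_of K) (fst X)))"

definition induced_map ::
  "('a umod \<Rightarrow> 'a umod) \<Rightarrow> ('a uarr \<Rightarrow> 'a uarr) \<Rightarrow> ('a umod \<Rightarrow> 'a umod \<Rightarrow> 'a uarr) \<Rightarrow>
   'a ualg \<Rightarrow> 'a karr \<Rightarrow> 'a karr" where
  "induced_map Lo Lm \<mu> K f =
    Arrow (induced_ob Lo Lm \<mu> K (src f)) (induced_ob Lo Lm \<mu> K (tgt f)) (app (Lm (under f)))"

end

theory Submission
  imports Defs
begin

text \<open>
  A module is local if maps into it extend uniquely along arrows with nilpotent kernel and cokernel.
  The adjunction makes every \<open>l\<^sub>k M\<close> local and gives the unit \<open>\<eta> : M \<rightarrow> l\<^sub>k M\<close> nilpotent kernel and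
  cokernel. Tensoring with a fixed module is exact, preserves direct sums and sends \<open>k\<close>-fold suspensions
  to \<open>k\<close>-fold suspensions, so it preserves nilpotent modules; hence \<open>\<eta> \<otimes> \<eta>\<close> also has nilpotent kernel
  and cokernel. So the lax structure exists as the extension of \<open>\<eta>\<close> along \<open>\<eta> \<otimes> \<eta>\<close>, and two arrows
  from a tensor product of localisations to a local module agree once they agree on tensors of elements
  \<open>\<eta> x\<close>. This reduces every multilinear axiom for \<open>l\<^sub>k K\<close> and \<open>l\<^sub>k M\<close> to the same axiom for \<open>K\<close> and \<open>M\<close>.

  The axiom \<open>Sq\<^sup>n x = x\<^sup>2\<close> in degree \<open>n\<close> is not bilinear. But in characteristic 2 both sides are arrows
  \<open>\<Phi> (l\<^sub>k K) \<rightarrow> l\<^sub>k K\<close> from the double, and \<open>\<Phi>\<close> is again exact and preserves nilpotent modules, so both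
  sides agree because they agree on \<open>\<Phi> K\<close>.
\<close>

section \<open>Vector spaces over the field with two elements\<close>

text \<open>The quotient category and the tensor product are given only by their defining
  properties, and this shapes the proof. What is known about roofs beyond their definition comes
  from the adjunction hypothesis: it contains the category laws of the quotient and the
  functoriality of \<open>r_map\<close>. These show that an arrow has nilpotent kernel and cokernel
  exactly when it becomes invertible in the quotient; hence such arrows compose, and
  \<open>\<eta>\<close> is one of them. Modules, and the targets in the universal property of the
  tensor product, all have their elements in the same type \<open>'a\<close>; so quotients are
  realised inside the given module as images of idempotents, and uniqueness becomes an induction
  over sums of tensors. Nilpotency is defined by minimality, without an elementwise criterion; a
  functor preserves it when the modules that it sends to nilpotent ones form a localizing class
  containing the suspensions. Exactness of the tensor product comes from splitting sequences over
  the field with two elements: the splittings ignore the squares, but they are equations between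
  linear maps, and tensoring preserves these.\<close>

lemma F2_spaceI: "abelian_group V \<Longrightarrow> (\<And>x. x \<in> carrier V \<Longrightarrow> x \<oplus>\<^bsub>V\<^esub> x = \<zero>\<^bsub>V\<^esub>) \<Longrightarrow> F2_space V"
  by (simp add: F2_space_def)

lemma F2_space_group: "F2_space V \<Longrightarrow> abelian_group V"
  by (simp add: F2_space_def)

lemma F2_space_monoid: "F2_space V \<Longrightarrow> abelian_monoid V"
  by (simp add: F2_space_group abelian_group.axioms(1))

lemma F2_add_self: "F2_space V \<Longrightarrow> x \<in> carrier V \<Longrightarrow> x \<oplus>\<^bsub>V\<^esub> x = \<zero>\<^bsub>V\<^esub>"
  by (simp add: F2_space_def)

lemma F2_zero: "F2_space V \<Longrightarrow> \<zero>\<^bsub>V\<^esub> \<in> carrier V"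
  by (simp add: F2_space_monoid abelian_monoid.zero_closed)

lemma F2_add: "F2_space V \<Longrightarrow> x \<in> carrier V \<Longrightarrow> y \<in> carrier V \<Longrightarrow> x \<oplus>\<^bsub>V\<^esub> y \<in> carrier V"
  by (simp add: F2_space_monoid abelian_monoid.a_closed)

lemma F2_add_zero:
  assumes "F2_space V" "x \<in> carrier V"
  shows "x \<oplus>\<^bsub>V\<^esub> \<zero>\<^bsub>V\<^esub> = x" "\<zero>\<^bsub>V\<^esub> \<oplus>\<^bsub>V\<^esub> x = x"
  using assms by (simp_all add: F2_space_monoid abelian_monoid.r_zero abelian_monoid.l_zero)

lemma F2_assoc:
  "F2_space V \<Longrightarrow> x \<in> carrier V \<Longrightarrow> y \<in> carrier V \<Longrightarrow> z \<in> carrier V \<Longrightarrow>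
    x \<oplus>\<^bsub>V\<^esub> y \<oplus>\<^bsub>V\<^esub> z = x \<oplus>\<^bsub>V\<^esub> (y \<oplus>\<^bsub>V\<^esub> z)"
  by (simp add: F2_space_monoid abelian_monoid.a_assoc)

lemma F2_comm: "F2_space V \<Longrightarrow> x \<in> carrier V \<Longrightarrow> y \<in> carrier V \<Longrightarrow> x \<oplus>\<^bsub>V\<^esub> y = y \<oplus>\<^bsub>V\<^esub> x"
  by (simp add: F2_space_monoid abelian_monoid.a_comm)

lemma F2_lcomm:
  "F2_space V \<Longrightarrow> x \<in> carrier V \<Longrightarrow> y \<in> carrier V \<Longrightarrow> z \<in> carrier V \<Longrightarrow>
    x \<oplus>\<^bsub>V\<^esub> (y \<oplus>\<^bsub>V\<^esub> z) = y \<oplus>\<^bsub>V\<^esub> (x \<oplus>\<^bsub>V\<^esub> z)"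
  by (metis F2_assoc F2_comm)

lemmas F2_ac = F2_assoc F2_comm F2_lcomm

lemma F2_cancel_self:
  "F2_space V \<Longrightarrow> x \<in> carrier V \<Longrightarrow> y \<in> carrier V \<Longrightarrow> x \<oplus>\<^bsub>V\<^esub> (x \<oplus>\<^bsub>V\<^esub> y) = y"
  by (metis F2_assoc F2_add_self F2_add_zero(2))

lemma F2_add_eq_zero_iff:
  "F2_space V \<Longrightarrow> x \<in> carrier V \<Longrightarrow> y \<in> carrier V \<Longrightarrow> x \<oplus>\<^bsub>V\<^esub> y = \<zero>\<^bsub>V\<^esub> \<longleftrightarrow> x = y"
  by (metis F2_cancel_self F2_add_self F2_add_zero(1))

section \<open>Finite sums in characteristic 2\<close>

lemma F2_finsum:
  "F2_space V \<Longrightarrow> (\<And>x. x \<in> A \<Longrightarrow> f x \<in> carrier V) \<Longrightarrow> finsum V f A \<in> carrier V"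
  by (simp add: F2_space_monoid abelian_monoid.finsum_closed Pi_iff)

lemma F2_finsum_zero:
  "F2_space V \<Longrightarrow> (\<And>x. x \<in> A \<Longrightarrow> f x = \<zero>\<^bsub>V\<^esub>) \<Longrightarrow> finsum V f A = \<zero>\<^bsub>V\<^esub>"
  unfolding finsum_def
  using comm_monoid.finprod_one_eqI[OF abelian_monoid.a_comm_monoid[OF F2_space_monoid], of V A f]
      by simp

lemma F2_finsum_insert:
  "F2_space V \<Longrightarrow> finite A \<Longrightarrow> a \<notin> A \<Longrightarrow> f \<in> A \<rightarrow> carrier V \<Longrightarrow> f a \<in> carrier V \<Longrightarrow>
    finsum V f (insert a A) = f a \<oplus>\<^bsub>V\<^esub> finsum V f A"
  by (simp add: F2_space_monoid abelian_monoid.finsum_insert)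

lemma F2_finsum_empty: "F2_space V \<Longrightarrow> finsum V f {} = \<zero>\<^bsub>V\<^esub>"
  by (simp add: F2_space_monoid abelian_monoid.finsum_empty)

lemma F2_finsum_cong:
  "F2_space V \<Longrightarrow> A = B \<Longrightarrow> (\<And>x. x \<in> B \<Longrightarrow> f x = g x) \<Longrightarrow>
    (\<And>x. x \<in> B \<Longrightarrow> g x \<in> carrier V) \<Longrightarrow> finsum V f A = finsum V g B"
  by (rule abelian_monoid.finsum_cong'[OF F2_space_monoid]) auto

lemma F2_finsum_add:
  "F2_space V \<Longrightarrow> f \<in> A \<rightarrow> carrier V \<Longrightarrow> g \<in> A \<rightarrow> carrier V \<Longrightarrow>
    (\<Oplus>\<^bsub>V\<^esub> x\<in>A. f x \<oplus>\<^bsub>V\<^esub> g x) = finsum V f A \<oplus>\<^bsub>V\<^esub> finsum V g A"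
  by (simp add: F2_space_monoid abelian_monoid.finsum_addf)

lemma F2_finsum_reindex:
  "F2_space V \<Longrightarrow> f \<in> h ` A \<rightarrow> carrier V \<Longrightarrow> inj_on h A \<Longrightarrow>
    finsum V f (h ` A) = (\<Oplus>\<^bsub>V\<^esub> x\<in>A. f (h x))"
  by (simp add: F2_space_monoid abelian_monoid.finsum_reindex)

lemma F2_finsum_single:
  assumes V: "F2_space V" and "finite A" "a \<in> A" "\<And>x. x \<in> A \<Longrightarrow> x \<noteq> a \<Longrightarrow> f x = \<zero>\<^bsub>V\<^esub>"
    "f a \<in> carrier V"
  shows "finsum V f A = f a"
proof -
  have "finsum V f A = finsum V f (insert a (A - {a}))"
    using assms by (simp add: insert_absorb)
  also have "\<dots> = f a \<oplus>\<^bsub>V\<^esub> finsum V f (A - {a})"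
    using assms by (intro F2_finsum_insert) (auto simp: F2_zero)
  also have "finsum V f (A - {a}) = \<zero>\<^bsub>V\<^esub>"
    using assms by (intro F2_finsum_zero) auto
  finally show ?thesis using assms by (simp add: F2_add_zero)
qed

lemma F2_finsum_mono_neutral:
  assumes V: "F2_space V" and B: "finite B" "A \<subseteq> B" "\<And>x. x \<in> B - A \<Longrightarrow> f x = \<zero>\<^bsub>V\<^esub>"
    "f \<in> A \<rightarrow> carrier V"
  shows "finsum V f A = finsum V f B"
proof -
  have f: "f \<in> B \<rightarrow> carrier V"
    using assms by (fastforce simp: F2_zero)
  have "finsum V f B = finsum V f (A \<union> (B - A))"
    using B by (simp add: Un_absorb1)
  also have "\<dots> = finsum V f A \<oplus>\<^bsub>V\<^esub> finsum V f (B - A)"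
    using assms f by (intro abelian_monoid.finsum_Un_disjoint[OF F2_space_monoid[OF V]])
      (auto intro: finite_subset)
  also have "finsum V f (B - A) = \<zero>\<^bsub>V\<^esub>"
    using assms by (intro F2_finsum_zero) auto
  finally show ?thesis using assms by (simp add: F2_add_zero F2_finsum Pi_iff)
qed

lemma F2_finsum_swap:
  assumes V: "F2_space V" and "finite A" "finite B"
    "\<And>x y. x \<in> A \<Longrightarrow> y \<in> B \<Longrightarrow> f x y \<in> carrier V"
  shows "(\<Oplus>\<^bsub>V\<^esub> x\<in>A. \<Oplus>\<^bsub>V\<^esub> y\<in>B. f x y) = (\<Oplus>\<^bsub>V\<^esub> y\<in>B. \<Oplus>\<^bsub>V\<^esub> x\<in>A. f x y)"
  using assms(2,4)
proof (induction A rule: finite_induct)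
  case empty
  show ?case using V by (simp add: F2_finsum_empty F2_finsum_zero)
next
  case (insert a A)
  have "(\<Oplus>\<^bsub>V\<^esub> x\<in>insert a A. \<Oplus>\<^bsub>V\<^esub> y\<in>B. f x y) =
      (\<Oplus>\<^bsub>V\<^esub> y\<in>B. f a y) \<oplus>\<^bsub>V\<^esub> (\<Oplus>\<^bsub>V\<^esub> x\<in>A. \<Oplus>\<^bsub>V\<^esub> y\<in>B. f x y)"
    using insert.hyps insert.prems V by (intro F2_finsum_insert) (auto intro!: F2_finsum)
  also have "\<dots> = (\<Oplus>\<^bsub>V\<^esub> y\<in>B. f a y) \<oplus>\<^bsub>V\<^esub> (\<Oplus>\<^bsub>V\<^esub> y\<in>B. \<Oplus>\<^bsub>V\<^esub> x\<in>A. f x y)"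
    using insert.IH insert.prems by simp
  also have "\<dots> = (\<Oplus>\<^bsub>V\<^esub> y\<in>B. f a y \<oplus>\<^bsub>V\<^esub> (\<Oplus>\<^bsub>V\<^esub> x\<in>A. f x y))"
    using insert.hyps insert.prems V by (intro F2_finsum_add[symmetric]) (auto intro!: F2_finsum)
  also have "\<dots> = (\<Oplus>\<^bsub>V\<^esub> y\<in>B. \<Oplus>\<^bsub>V\<^esub> x\<in>insert a A. f x y)"
    using insert.hyps insert.prems V by (intro F2_finsum_cong refl)
        (auto intro!: F2_finsum F2_add F2_finsum_insert[symmetric])
  finally show ?case .
qed

text \<open>The reflection \<open>a \<mapsto> r - a\<close> exchanges the two factors of a Cartan
  sum; \<open>cartan_swap\<close> rests on it.\<close>

lemma F2_finsum_rev:
  fixes r :: nat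
  assumes V: "F2_space V" and f: "\<And>a. a \<le> r \<Longrightarrow> f a \<in> carrier V"
  shows "(\<Oplus>\<^bsub>V\<^esub> a\<in>{0..r}. f (r - a)) = (\<Oplus>\<^bsub>V\<^esub> a\<in>{0..r}. f a)"
proof -
  have im: "(\<lambda>a. r - a) ` {0..r} = {0..r}"
  proof (intro Set.set_eqI iffI)
    fix a assume "a \<in> {0..r}"
    then have "a = r - (r - a)" "r - a \<in> {0..r}" by auto
    then show "a \<in> (\<lambda>a. r - a) ` {0..r}" by blast
  qed auto
  have "finsum V f ((\<lambda>a. r - a) ` {0..r}) = (\<Oplus>\<^bsub>V\<^esub> a\<in>{0..r}. f (r - a))"
    using f by (intro F2_finsum_reindex[OF V]) (auto simp: inj_on_def)
  then show ?thesis unfolding im by simp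
qed

text \<open>Pairs with \<open>a + b \<le> s\<close> are summed first by \<open>a\<close> and then by
  the total \<open>c = a + b\<close>. This is how the two iterated Cartan formulas on a triple
  tensor product are matched.\<close>

lemma F2_finsum_triangle:
  assumes V: "F2_space V"
    and f: "\<And>a b. a + b \<le> s \<Longrightarrow> f a b \<in> carrier V"
  shows "(\<Oplus>\<^bsub>V\<^esub> a\<in>{0..s}. \<Oplus>\<^bsub>V\<^esub> b\<in>{0..s - a}. f a b) =
    (\<Oplus>\<^bsub>V\<^esub> c\<in>{0..s::nat}. \<Oplus>\<^bsub>V\<^esub> a\<in>{0..c}. f a (c - a))"
proof -
  \<comment> \<open>Extension by zero lets both orders of summation run over the full square, where
    \<open>F2_finsum_swap\<close> applies.\<close>
  define g where "g a c = (if a \<le> c then f a (c - a) else \<zero>\<^bsub>V\<^esub>)" for a c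
  have g: "g a c \<in> carrier V" if "c \<le> s" for a c
    using that f V by (auto simp: g_def F2_zero)
  have "(\<Oplus>\<^bsub>V\<^esub> b\<in>{0..s - a}. f a b) = (\<Oplus>\<^bsub>V\<^esub> c\<in>{0..s}. g a c)" if a: "a \<le> s" for a
  proof -
    have "(\<Oplus>\<^bsub>V\<^esub> b\<in>{0..s - a}. f a b) = (\<Oplus>\<^bsub>V\<^esub> b\<in>{0..s - a}. g a (a + b))"
      using a f by (intro F2_finsum_cong[OF V]) (auto simp: g_def)
    also have "\<dots> = (\<Oplus>\<^bsub>V\<^esub> c\<in>(\<lambda>b. a + b) ` {0..s - a}. g a c)"
      using a g by (intro F2_finsum_reindex[OF V, symmetric]) auto
    also have "\<dots> = (\<Oplus>\<^bsub>V\<^esub> c\<in>{a..s}. g a c)"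
      using a by (simp del: atLeastAtMost_iff)
    also have "\<dots> = (\<Oplus>\<^bsub>V\<^esub> c\<in>{0..s}. g a c)"
      using a f by (intro F2_finsum_mono_neutral[OF V]) (auto simp: g_def)
    finally show ?thesis .
  qed
  then have "(\<Oplus>\<^bsub>V\<^esub> a\<in>{0..s}. \<Oplus>\<^bsub>V\<^esub> b\<in>{0..s - a}. f a b) = (\<Oplus>\<^bsub>V\<^esub> a\<in>{0..s}. \<Oplus>\<^bsub>V\<^esub> c\<in>{0..s}. g a c)"
    using g by (intro F2_finsum_cong[OF V refl] F2_finsum[OF V]) auto
  also have "\<dots> = (\<Oplus>\<^bsub>V\<^esub> c\<in>{0..s}. \<Oplus>\<^bsub>V\<^esub> a\<in>{0..s}. g a c)"
    using g by (intro F2_finsum_swap[OF V]) auto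
  also have "\<dots> = (\<Oplus>\<^bsub>V\<^esub> c\<in>{0..s}. \<Oplus>\<^bsub>V\<^esub> a\<in>{0..c}. f a (c - a))"
  proof (intro F2_finsum_cong[OF V refl])
    fix c assume c: "c \<in> {0..s}"
    have "(\<Oplus>\<^bsub>V\<^esub> a\<in>{0..c}. f a (c - a)) = (\<Oplus>\<^bsub>V\<^esub> a\<in>{0..c}. g a c)"
      using c f by (intro F2_finsum_cong[OF V]) (auto simp: g_def)
    also have "\<dots> = (\<Oplus>\<^bsub>V\<^esub> a\<in>{0..s}. g a c)"
      using c f by (intro F2_finsum_mono_neutral[OF V]) (auto simp: g_def)
    finally show "(\<Oplus>\<^bsub>V\<^esub> a\<in>{0..s}. g a c) = (\<Oplus>\<^bsub>V\<^esub> a\<in>{0..c}. f a (c - a))" ..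
  next
    show "(\<Oplus>\<^bsub>V\<^esub> a\<in>{0..c}. f a (c - a)) \<in> carrier V" if "c \<in> {0..s}" for c
      using that f by (auto intro!: F2_finsum[OF V])
  qed
  finally show ?thesis .
qed

text \<open>In characteristic 2, the off-diagonal terms of a symmetric sum cancel in pairs.\<close>

lemma F2_finsum_symmetric:
  fixes r :: nat
  assumes V: "F2_space V" and f: "\<And>a. a \<le> r \<Longrightarrow> f a \<in> carrier V"
    and sym: "\<And>a. a \<le> r \<Longrightarrow> f (r - a) = f a"
  shows "(\<Oplus>\<^bsub>V\<^esub> a\<in>{0..r}. f a) = (if even r then f (r div 2) else \<zero>\<^bsub>V\<^esub>)"
proof -
  define L where "L = {a::nat. 2 * a < r}"
  define H where "H = {a::nat. r < 2 * a \<and> a \<le> r}"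
  have fin: "finite L" "finite H"
    by (auto simp: L_def H_def intro: finite_subset[of _ "{0..r}"])
  have H: "H = (\<lambda>a. r - a) ` L"
  proof (intro Set.set_eqI iffI)
    fix a assume "a \<in> H"
    then have "r - a \<in> L" "a = r - (r - a)" by (auto simp: L_def H_def)
    then show "a \<in> (\<lambda>a. r - a) ` L" by blast
  qed (auto simp: L_def H_def)
  have fL: "f \<in> L \<rightarrow> carrier V" and fH: "f \<in> H \<rightarrow> carrier V"
    using f by (auto simp: L_def H_def)
  have "finsum V f H = (\<Oplus>\<^bsub>V\<^esub> a\<in>L. f (r - a))"
    unfolding H using fH by (intro F2_finsum_reindex[OF V]) (auto simp: H inj_on_def L_def)
  also have "\<dots> = finsum V f L"
    using f sym by (intro F2_finsum_cong[OF V]) (auto simp: L_def)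
  finally have HL: "finsum V f H = finsum V f L" .
  have "finsum V f (L \<union> H) = finsum V f L \<oplus>\<^bsub>V\<^esub> finsum V f H"
    using fin fL fH by (intro abelian_monoid.finsum_Un_disjoint[OF F2_space_monoid[OF V]])
      (auto simp: L_def H_def)
  then have zero: "finsum V f (L \<union> H) = \<zero>\<^bsub>V\<^esub>"
    using HL fL V by (simp add: F2_add_self F2_finsum Pi_iff)
  show ?thesis
  proof (cases "even r")
    case False
    have "{0..r} = L \<union> H"
    proof (intro Set.set_eqI iffI)
      fix a assume "a \<in> {0..r}"
      moreover have "2 * a \<noteq> r" using False by auto
      ultimately show "a \<in> L \<union> H" by (auto simp: L_def H_def)
    qed (auto simp: L_def H_def)
    with zero False show ?thesis by simp
  next
    case True
    then have "{0..r} = insert (r div 2) (L \<union> H)" "r div 2 \<notin> L \<union> H"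
      by (auto simp: L_def H_def)
    with zero True show ?thesis
      using fin fL fH f[of "r div 2"] V by (simp add: F2_finsum_insert F2_add_zero)
  qed
qed

text \<open>The simplifier rewrites the monoid record inside \<open>F2_linear\<close>; the following constant hides it.\<close>

definition lin :: "'a ring \<Rightarrow> 'b ring \<Rightarrow> ('a \<Rightarrow> 'b) set" where
  "lin V W = F2_linear V W"

section \<open>Linear maps\<close>

lemma linI:
  "(\<And>x. x \<in> carrier V \<Longrightarrow> f x \<in> carrier W) \<Longrightarrow>
   (\<And>x y. x \<in> carrier V \<Longrightarrow> y \<in> carrier V \<Longrightarrow> f (x \<oplus>\<^bsub>V\<^esub> y) = f x \<oplus>\<^bsub>W\<^esub> f y) \<Longrightarrow> f \<in> lin V W"
  by (auto simp: lin_def hom_def)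

lemma lin_closed: "f \<in> lin V W \<Longrightarrow> x \<in> carrier V \<Longrightarrow> f x \<in> carrier W"
  by (auto simp: lin_def hom_def)

lemma lin_add:
  "f \<in> lin V W \<Longrightarrow> x \<in> carrier V \<Longrightarrow> y \<in> carrier V \<Longrightarrow> f (x \<oplus>\<^bsub>V\<^esub> y) = f x \<oplus>\<^bsub>W\<^esub> f y"
  by (auto simp: lin_def hom_def)

lemma lin_cong:
  "f \<in> lin V W \<Longrightarrow> F2_space V \<Longrightarrow> (\<And>x. x \<in> carrier V \<Longrightarrow> f x = g x) \<Longrightarrow> g \<in> lin V W"
  by (rule linI) (metis lin_closed lin_add F2_add)+

lemma lin_zero:
  assumes "F2_space V" "F2_space W" "f \<in> lin V W"
  shows "f \<zero>\<^bsub>V\<^esub> = \<zero>\<^bsub>W\<^esub>"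
  by (metis assms F2_zero F2_add_self lin_closed lin_add)

lemma lin_finsum:
  assumes "F2_space V" "F2_space W" "f \<in> lin V W" "g \<in> A \<rightarrow> carrier V"
  shows "f (finsum V g A) = (\<Oplus>\<^bsub>W\<^esub> x\<in>A. f (g x))"
  using assms(4)
proof (induction A rule: infinite_finite_induct)
  \<comment> \<open>A sum over an infinite index set is zero by convention, so this case is the
    preservation of zero.\<close>
  case (infinite A)
  then show ?case
    using assms by (simp add: abelian_monoid.finsum_infinite F2_space_monoid lin_zero)
next
  case empty
  then show ?case using assms by (simp add: F2_finsum_empty lin_zero)
next
  case (insert x A)
  then have "f (g x \<oplus>\<^bsub>V\<^esub> finsum V g A) = f (g x) \<oplus>\<^bsub>W\<^esub> (\<Oplus>\<^bsub>W\<^esub> x\<in>A. f (g x))"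
    using assms by (subst lin_add[OF assms(3)]) (auto intro!: F2_finsum)
  moreover have "(\<Oplus>\<^bsub>W\<^esub> x\<in>insert x A. f (g x)) = f (g x) \<oplus>\<^bsub>W\<^esub> (\<Oplus>\<^bsub>W\<^esub> x\<in>A. f (g x))"
    using insert assms by (intro F2_finsum_insert) (auto intro: lin_closed)
  moreover have "finsum V g (insert x A) = g x \<oplus>\<^bsub>V\<^esub> finsum V g A"
    using insert assms by (intro F2_finsum_insert) auto
  ultimately show ?case by simp
qed

lemma lin_compose:
  "f \<in> lin V W \<Longrightarrow> g \<in> lin W Z \<Longrightarrow> (\<lambda>x. g (f x)) \<in> lin V Z"
  by (auto intro!: linI simp: lin_closed lin_add)

lemma lin_plus:
  assumes "F2_space W" "f \<in> lin V W" "g \<in> lin V W"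
  shows "(\<lambda>x. f x \<oplus>\<^bsub>W\<^esub> g x) \<in> lin V W"
  using assms
  by (intro linI) (auto simp: lin_closed lin_add F2_add F2_ac)

lemma lin_sum:
  assumes "F2_space W" "\<And>i. i \<in> A \<Longrightarrow> f i \<in> lin V W"
  shows "(\<lambda>x. \<Oplus>\<^bsub>W\<^esub> i\<in>A. f i x) \<in> lin V W"
proof (rule linI)
  fix x y assume "x \<in> carrier V" "y \<in> carrier V"
  then show "(\<Oplus>\<^bsub>W\<^esub> i\<in>A. f i (x \<oplus>\<^bsub>V\<^esub> y)) = (\<Oplus>\<^bsub>W\<^esub> i\<in>A. f i x) \<oplus>\<^bsub>W\<^esub> (\<Oplus>\<^bsub>W\<^esub> i\<in>A. f i y)"
    using assms
    by (subst F2_finsum_add[symmetric]) (auto intro!: F2_finsum_cong F2_add intro: lin_closed simp: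
        lin_add)
qed (use assms in \<open>auto intro!: F2_finsum intro: lin_closed\<close>)

lemma lin_const_zero: "F2_space W \<Longrightarrow> (\<lambda>x. \<zero>\<^bsub>W\<^esub>) \<in> lin V W"
  by (auto intro!: linI simp: F2_zero F2_add_zero)

lemma lin_id: "(\<lambda>x. x) \<in> lin V V"
  by (auto intro!: linI)

lemma lin_injI:
  assumes "F2_space V" "F2_space W" "f \<in> lin V W"
    and "\<And>x. x \<in> carrier V \<Longrightarrow> f x = \<zero>\<^bsub>W\<^esub> \<Longrightarrow> x = \<zero>\<^bsub>V\<^esub>"
  shows "inj_on f (carrier V)"
proof (rule inj_onI)
  fix x y assume xy: "x \<in> carrier V" "y \<in> carrier V" "f x = f y"
  then have "f (x \<oplus>\<^bsub>V\<^esub> y) = \<zero>\<^bsub>W\<^esub>"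
    using assms by (simp add: lin_add lin_closed F2_add_self)
  then show "x = y"
    using assms xy by (metis F2_add F2_add_eq_zero_iff)
qed

section \<open>Subspaces, complements and splittings\<close>

definition F2_subspace :: "'a set \<Rightarrow> 'a ring \<Rightarrow> bool" where
  "F2_subspace S V \<longleftrightarrow> S \<subseteq> carrier V \<and> \<zero>\<^bsub>V\<^esub> \<in> S \<and> (\<forall>x\<in>S. \<forall>y\<in>S. x \<oplus>\<^bsub>V\<^esub> y \<in> S)"

lemma F2_subspaceI:
  "S \<subseteq> carrier V \<Longrightarrow> \<zero>\<^bsub>V\<^esub> \<in> S \<Longrightarrow> (\<And>x y. x \<in> S \<Longrightarrow> y \<in> S \<Longrightarrow> x \<oplus>\<^bsub>V\<^esub> y \<in> S) \<Longrightarrow> F2_subspace S V"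
  by (simp add: F2_subspace_def)

lemma F2_subspaceD:
  assumes "F2_subspace S V"
  shows "S \<subseteq> carrier V" "\<zero>\<^bsub>V\<^esub> \<in> S" "\<And>x y. x \<in> S \<Longrightarrow> y \<in> S \<Longrightarrow> x \<oplus>\<^bsub>V\<^esub> y \<in> S"
  using assms by (auto simp: F2_subspace_def)

lemma F2_space_subspace:
  assumes V: "F2_space V" and S: "F2_subspace S V"
  shows "F2_space (V\<lparr>carrier := S\<rparr>)"
proof (rule F2_spaceI)
  have sub: "x \<in> carrier V" if "x \<in> S" for x
    using that F2_subspaceD(1)[OF S] by auto
  show "abelian_group (V\<lparr>carrier := S\<rparr>)"
    by (rule abelian_groupI)
      (use F2_subspaceD[OF S] sub V in \<open>auto simp: F2_ac F2_add_zero intro: F2_add_self\<close>)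
  show "x \<oplus>\<^bsub>V\<lparr>carrier := S\<rparr>\<^esub> x = \<zero>\<^bsub>V\<lparr>carrier := S\<rparr>\<^esub>" if "x \<in> carrier (V\<lparr>carrier := S\<rparr>)" for x
    using that sub V by (simp add: F2_add_self)
qed

lemma F2_subspace_image:
  assumes "F2_space V" "F2_space W" "f \<in> lin V W"
  shows "F2_subspace (f ` carrier V) W"
proof (rule F2_subspaceI)
  show "\<zero>\<^bsub>W\<^esub> \<in> f ` carrier V" by (metis assms F2_zero lin_zero image_eqI)
  fix x y assume "x \<in> f ` carrier V" "y \<in> f ` carrier V"
  then show "x \<oplus>\<^bsub>W\<^esub> y \<in> f ` carrier V"
  proof -
    obtain u v where "u \<in> carrier V" "v \<in> carrier V" "x = f u" "y = f v" using \<open>x \<in> _\<close> \<open>y \<in> _\<close> by blast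
    then have "x \<oplus>\<^bsub>W\<^esub> y = f (u \<oplus>\<^bsub>V\<^esub> v)" "u \<oplus>\<^bsub>V\<^esub> v \<in> carrier V"
      using assms by (simp_all add: lin_add F2_add)
    then show ?thesis by blast
  qed
qed (use assms in \<open>auto simp: lin_closed\<close>)

lemma F2_subspace_kernel:
  assumes "F2_space V" "F2_space W" "f \<in> lin V W"
  shows "F2_subspace {x \<in> carrier V. f x = \<zero>\<^bsub>W\<^esub>} V"
  using assms by (auto intro!: F2_subspaceI simp: F2_zero lin_zero F2_add lin_add F2_add_zero)

text \<open>A complement is a maximal subspace meeting \<open>S\<close> only in zero, which Zorn's
  lemma provides. A vector \<open>v\<close> outside \<open>S + C\<close> would allow
  \<open>C\<close> to be enlarged by \<open>v\<close> without meeting \<open>S\<close> any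
  further.\<close>

lemma F2_complement:
  assumes V: "F2_space V" and S: "F2_subspace S V"
  obtains C where "F2_subspace C V" "S \<inter> C = {\<zero>\<^bsub>V\<^esub>}"
    "\<And>v. v \<in> carrier V \<Longrightarrow> \<exists>s\<in>S. \<exists>c\<in>C. v = s \<oplus>\<^bsub>V\<^esub> c"
proof -
  let ?A = "{C. F2_subspace C V \<and> S \<inter> C = {\<zero>\<^bsub>V\<^esub>}}"
  have ne: "{\<zero>\<^bsub>V\<^esub>} \<in> ?A"
    using V F2_subspaceD(2)[OF S] by (auto intro!: F2_subspaceI simp: F2_zero F2_add_zero)
  have "\<exists>C\<in>?A. \<forall>X\<in>?A. C \<subseteq> X \<longrightarrow> X = C"
  proof (rule subset_Zorn_nonempty)
    fix \<C> assume "\<C> \<noteq> {}" and ch: "subset.chain ?A \<C>"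
    then obtain X0 where X0: "X0 \<in> \<C>" by blast
    have sub: "X \<in> ?A" if "X \<in> \<C>" for X
      using ch that by (auto simp: subset.chain_def)
    have "F2_subspace (\<Union>\<C>) V"
    proof (rule F2_subspaceI)
      show "\<Union>\<C> \<subseteq> carrier V" using F2_subspaceD(1) sub by blast
      show "\<zero>\<^bsub>V\<^esub> \<in> \<Union>\<C>" using sub X0 by (auto simp: F2_subspace_def)
      fix x y assume "x \<in> \<Union>\<C>" "y \<in> \<Union>\<C>"
      then obtain X Y where XY: "X \<in> \<C>" "Y \<in> \<C>" "x \<in> X" "y \<in> Y" by blast
      then have "X \<subseteq> Y \<or> Y \<subseteq> X" using ch by (auto simp: subset_chain_def)
      then obtain Z where "Z \<in> \<C>" "x \<in> Z" "y \<in> Z" using XY by blast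
      then show "x \<oplus>\<^bsub>V\<^esub> y \<in> \<Union>\<C>" using sub by (blast dest: F2_subspaceD(3))
    qed
    moreover have "S \<inter> \<Union>\<C> = {\<zero>\<^bsub>V\<^esub>}" using sub X0 by blast
    ultimately show "\<Union>\<C> \<in> ?A" by blast
  qed (use ne in blast)
  then obtain C where C: "F2_subspace C V" "S \<inter> C = {\<zero>\<^bsub>V\<^esub>}"
    and max: "\<And>X. F2_subspace X V \<Longrightarrow> S \<inter> X = {\<zero>\<^bsub>V\<^esub>} \<Longrightarrow> C \<subseteq> X \<Longrightarrow> X = C" by auto
  note SD = F2_subspaceD[OF S] and CD = F2_subspaceD[OF C(1)]
  have "\<exists>s\<in>S. \<exists>c\<in>C. v = s \<oplus>\<^bsub>V\<^esub> c" if v: "v \<in> carrier V" for v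
  proof (rule ccontr)
    assume no: "\<not> ?thesis"
    \<comment> \<open>The span of \<open>C\<close> and \<open>v\<close>: the only scalars are 0 and
      1, so it is a union of two cosets.\<close>
    define X where "X = C \<union> (\<lambda>c. v \<oplus>\<^bsub>V\<^esub> c) ` C"
    have "F2_subspace X V"
    proof (rule F2_subspaceI)
      show "X \<subseteq> carrier V" "\<zero>\<^bsub>V\<^esub> \<in> X" using v CD V by (auto simp: X_def F2_add)
      have vv: "(v \<oplus>\<^bsub>V\<^esub> c) \<oplus>\<^bsub>V\<^esub> (v \<oplus>\<^bsub>V\<^esub> d) = c \<oplus>\<^bsub>V\<^esub> d" if "c \<in> C" "d \<in> C" for c d
        using that v CD(1) V by (smt (verit) F2_add F2_assoc F2_cancel_self F2_lcomm subsetD)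
      have v1: "c \<oplus>\<^bsub>V\<^esub> (v \<oplus>\<^bsub>V\<^esub> d) = v \<oplus>\<^bsub>V\<^esub> (c \<oplus>\<^bsub>V\<^esub> d)" "(v \<oplus>\<^bsub>V\<^esub> c) \<oplus>\<^bsub>V\<^esub> d = v \<oplus>\<^bsub>V\<^esub> (c \<oplus>\<^bsub>V\<^esub> d)"
        if "c \<in> C" "d \<in> C" for c d
        using that v CD(1) V by (auto simp: F2_lcomm F2_assoc subset_iff)
      show "x \<oplus>\<^bsub>V\<^esub> y \<in> X" if "x \<in> X" "y \<in> X" for x y
        using that unfolding X_def using vv v1 CD(3) by auto
    qed
    moreover have "S \<inter> X = {\<zero>\<^bsub>V\<^esub>}"
    proof -
      have "v \<oplus>\<^bsub>V\<^esub> c \<notin> S" if "c \<in> C" for c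
      proof
        assume s: "v \<oplus>\<^bsub>V\<^esub> c \<in> S"
        have "v = (v \<oplus>\<^bsub>V\<^esub> c) \<oplus>\<^bsub>V\<^esub> c"
          using that v CD(1) V by (metis F2_add_self F2_add_zero(1) F2_assoc subsetD)
        with no s that show False by blast
      qed
      with C(2) show ?thesis by (auto simp: X_def)
    qed
    ultimately have "X = C" by (rule max) (auto simp: X_def)
    then have "v \<oplus>\<^bsub>V\<^esub> \<zero>\<^bsub>V\<^esub> \<in> C" using CD(2) by (auto simp: X_def)
    then have "v \<in> C" using v V by (simp add: F2_add_zero)
    moreover have "v = \<zero>\<^bsub>V\<^esub> \<oplus>\<^bsub>V\<^esub> v" using v V by (simp add: F2_add_zero)
    ultimately show False using no SD(2) by blast
  qed
  with C that show ?thesis by blast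
qed

text \<open>Generalised inverses make exactness an equational condition, hence one that is preserved by
  additive functors.\<close>

lemma lin_pinv:
  assumes V: "F2_space V" and W: "F2_space W" and g: "g \<in> lin V W"
  obtains a where "a \<in> lin W V" "\<And>x. x \<in> carrier V \<Longrightarrow> g (a (g x)) = g x"
proof -
  \<comment> \<open>\<open>K\<close> complements the kernel and \<open>C\<close>, below, the image,
    so \<open>g\<close> maps \<open>K\<close> isomorphically onto its image.\<close>
  obtain K where K: "F2_subspace K V" "{x \<in> carrier V. g x = \<zero>\<^bsub>W\<^esub>} \<inter> K = {\<zero>\<^bsub>V\<^esub>}"
    "\<And>v. v \<in> carrier V \<Longrightarrow> \<exists>s\<in>{x \<in> carrier V. g x = \<zero>\<^bsub>W\<^esub>}. \<exists>c\<in>K. v = s \<oplus>\<^bsub>V\<^esub> c"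
    using F2_complement[OF V F2_subspace_kernel[OF V W g]] by blast
  obtain C where C: "F2_subspace C W" "g ` carrier V \<inter> C = {\<zero>\<^bsub>W\<^esub>}"
    "\<And>w. w \<in> carrier W \<Longrightarrow> \<exists>s\<in>g ` carrier V. \<exists>c\<in>C. w = s \<oplus>\<^bsub>W\<^esub> c"
    using F2_complement[OF W F2_subspace_image[OF V W g]] by blast
  note KD = F2_subspaceD[OF K(1)] and CD = F2_subspaceD[OF C(1)]
  have gK: "\<exists>v'\<in>K. g v' = g v" if v: "v \<in> carrier V" for v
  proof -
    obtain s c where "s \<in> carrier V" "g s = \<zero>\<^bsub>W\<^esub>" "c \<in> K" "v = s \<oplus>\<^bsub>V\<^esub> c"
      using K(3)[OF v] by blast
    moreover from this have "g v = g c"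
      using g W KD(1) by (auto simp: lin_add F2_add_zero lin_closed subset_iff)
    ultimately show ?thesis by metis
  qed
  have ex: "\<exists>v\<in>K. \<exists>c\<in>C. w = g v \<oplus>\<^bsub>W\<^esub> c" if "w \<in> carrier W" for w
    using C(3)[OF that] gK by (metis imageE)
  have uniq: "v = v'"
    if "v \<in> K" "v' \<in> K" "c \<in> C" "c' \<in> C" "g v \<oplus>\<^bsub>W\<^esub> c = g v' \<oplus>\<^bsub>W\<^esub> c'" for v v' c c'
  proof -
    have in': "v \<in> carrier V" "v' \<in> carrier V" "c \<in> carrier W" "c' \<in> carrier W"
      "g v \<in> carrier W" "g v' \<in> carrier W"
      using that KD(1) CD(1) g lin_closed[OF g] by auto
    have "g v \<oplus>\<^bsub>W\<^esub> g v' = c \<oplus>\<^bsub>W\<^esub> c'"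
      using in' that(5) W by (smt (verit) F2_add F2_assoc F2_cancel_self F2_comm F2_lcomm)
    then have e: "g (v \<oplus>\<^bsub>V\<^esub> v') = c \<oplus>\<^bsub>W\<^esub> c'"
      using in' g by (simp add: lin_add)
    moreover have "c \<oplus>\<^bsub>W\<^esub> c' \<in> C" using that CD(3) by blast
    moreover have "g (v \<oplus>\<^bsub>V\<^esub> v') \<in> g ` carrier V" using in' V by (simp add: F2_add)
    ultimately have "g (v \<oplus>\<^bsub>V\<^esub> v') = \<zero>\<^bsub>W\<^esub>" using C(2) by auto
    moreover have "v \<oplus>\<^bsub>V\<^esub> v' \<in> K" using that KD(3) by blast
    moreover have "v \<oplus>\<^bsub>V\<^esub> v' \<in> carrier V" using in' V by (simp add: F2_add)
    ultimately have "v \<oplus>\<^bsub>V\<^esub> v' = \<zero>\<^bsub>V\<^esub>" using K(2) by blast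
    then show ?thesis using in' V by (simp add: F2_add_eq_zero_iff)
  qed
  \<comment> \<open>\<open>a\<close> inverts \<open>g\<close> on the image and kills
    \<open>C\<close>; the decomposition of \<open>w\<close> behind it exists by \<open>ex\<close>
    and is unique by \<open>uniq\<close>.\<close>
  define a where "a w = (THE v. v \<in> K \<and> (\<exists>c\<in>C. w = g v \<oplus>\<^bsub>W\<^esub> c))" for w
  have a_eq: "a (g v \<oplus>\<^bsub>W\<^esub> c) = v" if "v \<in> K" "c \<in> C" for v c
    unfolding a_def using that uniq by (intro the_equality) blast+
  show thesis
  proof
    show "a \<in> lin W V"
    proof (rule linI)
      show "a w \<in> carrier V" if "w \<in> carrier W" for w
        using ex[OF that] a_eq KD(1) by auto
      fix x y assume "x \<in> carrier W" "y \<in> carrier W"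
      then obtain u c v d where *: "u \<in> K" "c \<in> C" "x = g u \<oplus>\<^bsub>W\<^esub> c" "v \<in> K" "d \<in> C" "y = g v \<oplus>\<^bsub>W\<^esub> d"
        using ex by meson
      then have in': "u \<in> carrier V" "v \<in> carrier V" "c \<in> carrier W" "d \<in> carrier W"
        "g u \<in> carrier W" "g v \<in> carrier W"
        using KD(1) CD(1) lin_closed[OF g] by auto
      have "x \<oplus>\<^bsub>W\<^esub> y = g (u \<oplus>\<^bsub>V\<^esub> v) \<oplus>\<^bsub>W\<^esub> (c \<oplus>\<^bsub>W\<^esub> d)"
        unfolding *(3,6) using in' g W by (simp add: lin_add F2_add F2_ac)
      then show "a (x \<oplus>\<^bsub>W\<^esub> y) = a x \<oplus>\<^bsub>V\<^esub> a y"
        using * a_eq KD(3) CD(3) by auto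
    qed
    show "g (a (g x)) = g x" if x: "x \<in> carrier V" for x
    proof -
      obtain v where v: "v \<in> K" "g v = g x" using gK[OF x] by blast
      have "a (g v \<oplus>\<^bsub>W\<^esub> \<zero>\<^bsub>W\<^esub>) = v" using v(1) CD(2) by (rule a_eq)
      then show ?thesis using v x g W by (simp add: lin_closed F2_add_zero)
    qed
  qed
qed

text \<open>Given that \<open>g\<close> kills the image of \<open>f\<close>, the equation
  \<open>f b + a g = 1\<close> can be solved exactly when the sequence is exact in the middle. The
  solutions \<open>b\<close> and \<open>a\<close> are merely linear, which is all that
  \<open>tensor_univ\<close> asks for.\<close>

lemma lin_exact_split:
  assumes L: "F2_space L" and M: "F2_space M" and N: "F2_space N"
    and f: "f \<in> lin L M" and g: "g \<in> lin M N"
    and ex: "f ` carrier L = {x \<in> carrier M. g x = \<zero>\<^bsub>N\<^esub>}"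
  obtains b a where "b \<in> lin M L" "a \<in> lin N M"
    "\<And>x. x \<in> carrier M \<Longrightarrow> f (b x) \<oplus>\<^bsub>M\<^esub> a (g x) = x"
proof -
  obtain a where a: "a \<in> lin N M" "\<And>x. x \<in> carrier M \<Longrightarrow> g (a (g x)) = g x"
    using lin_pinv[OF M N g] by blast
  obtain b where b: "b \<in> lin M L" "\<And>x. x \<in> carrier L \<Longrightarrow> f (b (f x)) = f x"
    using lin_pinv[OF L M f] by blast
  \<comment> \<open>This is \<open>1 - a g\<close> in characteristic 2. Since
    \<open>g a g = g\<close>, its values lie in the kernel of \<open>g\<close>, which is the image
    of \<open>f\<close>.\<close>
  let ?d = "\<lambda>x. x \<oplus>\<^bsub>M\<^esub> a (g x)"
  have d: "?d \<in> lin M M"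
    using lin_plus[OF M lin_id lin_compose[OF g a(1)]] .
  show thesis
  proof
    show "(\<lambda>x. b (?d x)) \<in> lin M L" by (rule lin_compose[OF d b(1)])
    show "a \<in> lin N M" by (rule a)
    fix x assume x: "x \<in> carrier M"
    have ag: "a (g x) \<in> carrier M" using x a g by (simp add: lin_closed)
    have "g (?d x) = \<zero>\<^bsub>N\<^esub>"
      using x ag g N a(2) by (simp add: lin_add lin_closed F2_add_self)
    then have "?d x \<in> f ` carrier L" using ex x ag M by (simp add: F2_add)
    then have "f (b (?d x)) = ?d x" using b(2) by auto
    then show "f (b (?d x)) \<oplus>\<^bsub>M\<^esub> a (g x) = x"
      using x ag M by (simp add: F2_assoc F2_add_self F2_add_zero)
  qed
qed

section \<open>The category of unstable modules\<close>

lemma Ob_U: "M \<in> Ob U \<longleftrightarrow> unstable_module M"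
  by (simp add: U_def)

lemma mod_space: "M \<in> Ob U \<Longrightarrow> F2_space (gr M n)"
  by (simp add: Ob_U unstable_module_def steenrod_module_def)

lemma Sq_lin: "M \<in> Ob U \<Longrightarrow> Sq M i n \<in> lin (gr M n) (gr M (n + i))"
  by (simp add: Ob_U unstable_module_def steenrod_module_def lin_def)

lemma Sq_0: "M \<in> Ob U \<Longrightarrow> x \<in> el M n \<Longrightarrow> Sq M 0 n x = x"
  by (simp add: Ob_U unstable_module_def steenrod_module_def)

lemma Sq_adem:
  "M \<in> Ob U \<Longrightarrow> 0 < a \<Longrightarrow> a < 2 * b \<Longrightarrow> x \<in> el M n \<Longrightarrow>
    Sq M a (n + b) (Sq M b n x) =
       (\<Oplus>\<^bsub>gr M (n + a + b)\<^esub> c \<in> {c. 2 * c \<le> a \<and> odd ((b - c - 1) choose (a - 2 * c))}.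
          Sq M (a + b - c) (n + c) (Sq M c n x))"
  by (simp add: Ob_U unstable_module_def steenrod_module_def)

lemma Sq_unstable: "M \<in> Ob U \<Longrightarrow> n < i \<Longrightarrow> x \<in> el M n \<Longrightarrow> Sq M i n x = \<zero>\<^bsub>gr M (n + i)\<^esub>"
  by (simp add: Ob_U unstable_module_def)

lemma Sq_closed: "M \<in> Ob U \<Longrightarrow> x \<in> el M n \<Longrightarrow> Sq M i n x \<in> el M (n + i)"
  by (rule lin_closed[OF Sq_lin])

lemma Sq_zero: "M \<in> Ob U \<Longrightarrow> Sq M i n \<zero>\<^bsub>gr M n\<^esub> = \<zero>\<^bsub>gr M (n + i)\<^esub>"
  by (rule lin_zero[OF mod_space mod_space Sq_lin])

lemma el_zero: "M \<in> Ob U \<Longrightarrow> \<zero>\<^bsub>gr M n\<^esub> \<in> el M n"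
  by (simp add: mod_space F2_zero)

lemma unstableI:
  assumes "\<And>n. F2_space (gr M n)"
    and "\<And>i n. Sq M i n \<in> lin (gr M n) (gr M (n + i))"
    and "\<And>n x. x \<in> el M n \<Longrightarrow> Sq M 0 n x = x"
    and "\<And>a b n x. 0 < a \<Longrightarrow> a < 2 * b \<Longrightarrow> x \<in> el M n \<Longrightarrow>
      Sq M a (n + b) (Sq M b n x) =
       (\<Oplus>\<^bsub>gr M (n + a + b)\<^esub> c \<in> {c. 2 * c \<le> a \<and> odd ((b - c - 1) choose (a - 2 * c))}.
          Sq M (a + b - c) (n + c) (Sq M c n x))"
    and "\<And>i n x. n < i \<Longrightarrow> x \<in> el M n \<Longrightarrow> Sq M i n x = \<zero>\<^bsub>gr M (n + i)\<^esub>"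
  shows "M \<in> Ob U"
  unfolding Ob_U unstable_module_def steenrod_module_def using assms by (simp add: lin_def)

text \<open>\<open>a + b - c\<close> is truncated subtraction; the bound
  \<open>2 * c \<le> a\<close> makes it exact, so that the degrees of an Adem term add up.\<close>

lemma adem_term_closed:
  assumes "\<And>i n x. x \<in> el M n \<Longrightarrow> Sq M i n x \<in> el M (n + i)" and x: "x \<in> el M n" and c: "2 * c \<le> a"
      "a < 2 * b"
  shows "Sq M (a + b - c) (n + c) (Sq M c n x) \<in> el M (n + a + b)"
proof -
  have "n + c + (a + b - c) = n + a + b" using c by simp
  then show ?thesis using assms(1)[OF assms(1)[OF x], of "a + b - c" c] by metis
qed

section \<open>Morphisms of unstable modules\<close>

lemma Hom_U:
  "f \<in> Hom U M N \<longleftrightarrow> src f = M \<and> tgt f = N \<and>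
      (\<forall>n. app f n \<in> lin (gr M n) (gr N n) \<and> app f n \<in> extensional (el M n)) \<and>
      (\<forall>i n. \<forall>x\<in>el M n. app f (n + i) (Sq M i n x) = Sq N i n (app f n x))"
  by (auto simp: U_def lin_def)

lemma hom_src: "f \<in> Hom U M N \<Longrightarrow> src f = M" and hom_tgt: "f \<in> Hom U M N \<Longrightarrow> tgt f = N"
  by (simp_all add: Hom_U)

lemma hom_lin: "f \<in> Hom U M N \<Longrightarrow> app f n \<in> lin (gr M n) (gr N n)"
  by (simp add: Hom_U)

lemma hom_closed: "f \<in> Hom U M N \<Longrightarrow> x \<in> el M n \<Longrightarrow> app f n x \<in> el N n"
  by (rule lin_closed[OF hom_lin])

lemma hom_add:
  "f \<in> Hom U M N \<Longrightarrow> x \<in> el M n \<Longrightarrow> y \<in> el M n \<Longrightarrow> app f n (x \<oplus>\<^bsub>gr M n\<^esub> y) = app f n x \<oplus>\<^bsub>gr N n\<^esub> app f n y"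
  by (rule lin_add[OF hom_lin])

lemma hom_zero: "f \<in> Hom U M N \<Longrightarrow> M \<in> Ob U \<Longrightarrow> N \<in> Ob U \<Longrightarrow> app f n \<zero>\<^bsub>gr M n\<^esub> = \<zero>\<^bsub>gr N n\<^esub>"
  by (rule lin_zero[OF mod_space mod_space hom_lin])

lemma hom_Sq: "f \<in> Hom U M N \<Longrightarrow> x \<in> el M n \<Longrightarrow> app f (n + i) (Sq M i n x) = Sq N i n (app f n x)"
  by (simp add: Hom_U)

lemma hom_ext: "f \<in> Hom U M N \<Longrightarrow> app f n \<in> extensional (el M n)"
  by (simp add: Hom_U)

text \<open>Components are extensional off the carriers, so values on elements determine an
  arrow.\<close>

lemma hom_eqI:
  assumes f: "f \<in> Hom U M N" and g: "g \<in> Hom U M N"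
    and eq: "\<And>n x. x \<in> el M n \<Longrightarrow> app f n x = app g n x"
  shows "f = g"
proof -
  have "app f n = app g n" for n
    using hom_ext[OF f] hom_ext[OF g] eq by (rule extensionalityI)
  then have "app f = app g" ..
  with f g show ?thesis by (metis arrow.expand hom_src hom_tgt)
qed

text \<open>The restriction supplies the extensionality that \<open>Hom U\<close> demands, so an
  arrow can be given by any formula that is right on the carriers.\<close>

definition uarr :: "'a umod \<Rightarrow> 'a umod \<Rightarrow> (nat \<Rightarrow> 'a \<Rightarrow> 'a) \<Rightarrow> 'a uarr" where
  "uarr M N f = Arrow M N (\<lambda>n. restrict (f n) (el M n))"

lemma uarr_app: "x \<in> el M n \<Longrightarrow> app (uarr M N f) n x = f n x"
  by (simp add: uarr_def)

lemma uarr_in_Hom: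
  assumes M: "M \<in> Ob U"
    and "\<And>n. f n \<in> lin (gr M n) (gr N n)"
    and "\<And>i n x. x \<in> el M n \<Longrightarrow> f (n + i) (Sq M i n x) = Sq N i n (f n x)"
  shows "uarr M N f \<in> Hom U M N"
  unfolding Hom_U
proof (intro conjI allI ballI)
  show "app (uarr M N f) n \<in> lin (gr M n) (gr N n)" for n
    by (rule lin_cong[OF assms(2) mod_space[OF M]]) (simp add: uarr_def)
  show "app (uarr M N f) n \<in> extensional (el M n)" for n
    by (simp add: uarr_def)
  fix i n x assume x: "x \<in> el M n"
  then show "app (uarr M N f) (n + i) (Sq M i n x) = Sq N i n (app (uarr M N f) n x)"
    using assms(3) by (simp add: uarr_app Sq_closed[OF M])
qed (simp_all add: uarr_def)

lemma comp_src: "src (Comp U g f) = src f" and comp_tgt: "tgt (Comp U g f) = tgt g"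
  by (simp_all add: U_def)

lemma comp_app: "f \<in> Hom U L M \<Longrightarrow> x \<in> el L n \<Longrightarrow> app (Comp U g f) n x = app g n (app f n x)"
  by (simp add: U_def compose_def)

lemma comp_in_Hom:
  assumes f: "f \<in> Hom U L M" and g: "g \<in> Hom U M N" and L: "L \<in> Ob U"
  shows "Comp U g f \<in> Hom U L N"
  unfolding Hom_U
proof (intro conjI allI ballI)
  show "app (Comp U g f) n \<in> lin (gr L n) (gr N n)" for n
    by (rule lin_cong[OF lin_compose[OF hom_lin[OF f] hom_lin[OF g]] mod_space[OF L]])
      (simp add: comp_app[OF f])
  show "app (Comp U g f) n \<in> extensional (el L n)" for n
    using f by (simp add: U_def)
  fix i n x assume "x \<in> el L n"
  then show "app (Comp U g f) (n + i) (Sq L i n x) = Sq N i n (app (Comp U g f) n x)"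
    by (simp add: comp_app[OF f] Sq_closed[OF L] hom_Sq[OF f] hom_Sq[OF g] hom_closed[OF f])
qed (use f g in \<open>simp_all add: comp_src comp_tgt hom_src hom_tgt\<close>)

lemma id_app: "x \<in> el M n \<Longrightarrow> app (Idn U M) n x = x"
  by (simp add: U_def)

lemma id_in_Hom: "M \<in> Ob U \<Longrightarrow> Idn U M \<in> Hom U M M"
  using uarr_in_Hom[of M "\<lambda>n x. x" M] by (simp add: uarr_def U_def lin_id)

lemma comp_id:
  assumes "f \<in> Hom U M N" "M \<in> Ob U" "N \<in> Ob U"
  shows "Comp U f (Idn U M) = f" "Comp U (Idn U N) f = f"
  by (rule hom_eqI[OF comp_in_Hom assms(1)]; use assms in
    \<open>auto intro: id_in_Hom simp: comp_app[OF id_in_Hom] comp_app id_app hom_closed\<close>)+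

lemma comp_assoc:
  assumes "f \<in> Hom U K L" "g \<in> Hom U L M" "h \<in> Hom U M N" "K \<in> Ob U" "L \<in> Ob U" "M \<in> Ob U"
  shows "Comp U h (Comp U g f) = Comp U (Comp U h g) f"
  by (rule hom_eqI[of _ K N])
    (use assms in \<open>auto intro: comp_in_Hom simp: comp_app comp_app[OF comp_in_Hom] hom_closed\<close>)

lemma is_category_U: "is_category U"
  unfolding is_category_def
  by (intro conjI ballI; (rule id_in_Hom comp_in_Hom comp_id comp_assoc; assumption)?)

lemma zero_in_Hom:
  assumes "M \<in> Ob U" "N \<in> Ob U"
  shows "uarr M N (\<lambda>n x. \<zero>\<^bsub>gr N n\<^esub>) \<in> Hom U M N"
  using assms by (intro uarr_in_Hom) (simp_all add: lin_const_zero mod_space Sq_zero)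

section \<open>Submodules, quotients, kernels and cokernels\<close>

text \<open>Every module axiom is an equation between elements of \<open>L\<close>; it may be tested
  after the injective \<open>e\<close>, and there it is the axiom of \<open>M\<close>.\<close>

lemma unstable_embed:
  assumes M: "M \<in> Ob U" and L: "\<And>n. F2_space (gr L n)"
    and SqL: "\<And>i n. Sq L i n \<in> lin (gr L n) (gr L (n + i))"
    and e: "\<And>n. e n \<in> lin (gr L n) (gr M n)" "\<And>n. inj_on (e n) (el L n)"
    and eSq: "\<And>i n x. x \<in> el L n \<Longrightarrow> e (n + i) (Sq L i n x) = Sq M i n (e n x)"
  shows "L \<in> Ob U"
proof (rule unstableI[OF L SqL])
  note cl = lin_closed[OF SqL] and ecl = lin_closed[OF e(1)]
  show "Sq L 0 n x = x" if x: "x \<in> el L n" for n x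
    using inj_onD[OF e(2)[of n], of "Sq L 0 n x" x] x eSq[OF x, of 0] Sq_0[OF M ecl[OF x]]
      cl[OF x, of 0] by simp
  show "Sq L i n x = \<zero>\<^bsub>gr L (n + i)\<^esub>" if "n < i" and x: "x \<in> el L n" for i n x
    using inj_onD[OF e(2)[of "n + i"], of "Sq L i n x" "\<zero>\<^bsub>gr L (n + i)\<^esub>"] x
      eSq[OF x, of i] Sq_unstable[OF M \<open>n < i\<close> ecl[OF x]] cl[OF x, of i]
      lin_zero[OF L mod_space[OF M] e(1)] F2_zero[OF L] by simp
  fix a b n :: nat and x assume ab: "0 < a" "a < 2 * b" and x: "x \<in> el L n"
  let ?C = "{c. 2 * c \<le> a \<and> odd ((b - c - 1) choose (a - 2 * c))}"
  let ?N = "n + a + b"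
  have trm: "Sq L (a + b - c) (n + c) (Sq L c n x) \<in> el L ?N" if "c \<in> ?C" for c
    using that ab by (intro adem_term_closed[OF cl x]) auto
  have e_term: "e ?N (Sq L (a + b - c) (n + c) (Sq L c n x)) =
      Sq M (a + b - c) (n + c) (Sq M c n (e n x))" if "c \<in> ?C" for c
  proof -
    have N: "n + c + (a + b - c) = ?N" using that ab by simp
    show ?thesis using eSq[OF cl[OF x, of c], of "a + b - c"] eSq[OF x, of c] unfolding N by simp
  qed
  have l: "Sq L a (n + b) (Sq L b n x) \<in> el L ?N"
    using cl[OF cl[OF x, of b], of a] by (simp add: add_ac)
  have "e ?N (\<Oplus>\<^bsub>gr L ?N\<^esub> c \<in> ?C. Sq L (a + b - c) (n + c) (Sq L c n x)) =
      (\<Oplus>\<^bsub>gr M ?N\<^esub> c \<in> ?C. e ?N (Sq L (a + b - c) (n + c) (Sq L c n x)))"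
    using trm by (intro lin_finsum[OF L mod_space[OF M] e(1)]) auto
  also have "\<dots> = (\<Oplus>\<^bsub>gr M ?N\<^esub> c \<in> ?C. Sq M (a + b - c) (n + c) (Sq M c n (e n x)))"
    using e_term ecl[OF trm] by (intro F2_finsum_cong[OF mod_space[OF M] refl]) auto
  also have "\<dots> = Sq M a (n + b) (Sq M b n (e n x))"
    by (rule Sq_adem[OF M ab ecl[OF x], symmetric])
  also have "\<dots> = e ?N (Sq L a (n + b) (Sq L b n x))"
    using eSq[OF cl[OF x, of b], of a] eSq[OF x, of b] by (simp add: add_ac)
  finally have eq: "e ?N (\<Oplus>\<^bsub>gr L ?N\<^esub> c \<in> ?C. Sq L (a + b - c) (n + c) (Sq L c n x)) =
      e ?N (Sq L a (n + b) (Sq L b n x))" .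
  have "(\<Oplus>\<^bsub>gr L ?N\<^esub> c \<in> ?C. Sq L (a + b - c) (n + c) (Sq L c n x)) \<in> el L ?N"
    using trm by (rule F2_finsum[OF L])
  then show "Sq L a (n + b) (Sq L b n x) =
      (\<Oplus>\<^bsub>gr L ?N\<^esub> c \<in> ?C. Sq L (a + b - c) (n + c) (Sq L c n x))"
    using inj_onD[OF e(2) eq[symmetric] l] by blast
qed

text \<open>Dual to \<open>unstable_embed\<close>: elements of \<open>Q\<close> are lifted to
  \<open>M\<close>, where the axioms hold, and the equations are pushed down by
  \<open>q\<close>.\<close>

lemma unstable_quotient:
  assumes M: "M \<in> Ob U" and Q: "\<And>n. F2_space (gr Q n)"
    and SqQ: "\<And>i n. Sq Q i n \<in> lin (gr Q n) (gr Q (n + i))"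
    and q: "\<And>n. q n \<in> lin (gr M n) (gr Q n)" "\<And>n. q n ` el M n = el Q n"
    and qSq: "\<And>i n x. x \<in> el M n \<Longrightarrow> q (n + i) (Sq M i n x) = Sq Q i n (q n x)"
  shows "Q \<in> Ob U"
proof (rule unstableI[OF Q SqQ])
  note cl = Sq_closed[OF M] and qcl = lin_closed[OF q(1)]
  have lift: "\<exists>y\<in>el M n. x = q n y" if "x \<in> el Q n" for n x
    using that q(2)[of n] by auto
  show "Sq Q 0 n x = x" if "x \<in> el Q n" for n x
    using lift[OF that] qSq[of _ n 0] Sq_0[OF M] by auto
  show "Sq Q i n x = \<zero>\<^bsub>gr Q (n + i)\<^esub>" if "n < i" and "x \<in> el Q n" for i n x
    using lift[OF that(2)] qSq[of _ n i] Sq_unstable[OF M \<open>n < i\<close>]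
      lin_zero[OF mod_space[OF M] Q q(1)] by auto
  fix a b n :: nat and x assume ab: "0 < a" "a < 2 * b" and "x \<in> el Q n"
  then obtain y where y: "y \<in> el M n" "x = q n y" using lift by blast
  let ?C = "{c. 2 * c \<le> a \<and> odd ((b - c - 1) choose (a - 2 * c))}"
  let ?N = "n + a + b"
  have trm: "Sq M (a + b - c) (n + c) (Sq M c n y) \<in> el M ?N" if "c \<in> ?C" for c
    using that ab by (intro adem_term_closed[OF cl y(1)]) auto
  have q_term: "q ?N (Sq M (a + b - c) (n + c) (Sq M c n y)) =
      Sq Q (a + b - c) (n + c) (Sq Q c n x)" if "c \<in> ?C" for c
  proof -
    have N: "n + c + (a + b - c) = ?N" using that ab by simp
    show ?thesis
      using qSq[OF cl[OF y(1), of c], of "a + b - c"] qSq[OF y(1), of c] y(2) unfolding N by simp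
  qed
  have "Sq Q a (n + b) (Sq Q b n x) = q ?N (Sq M a (n + b) (Sq M b n y))"
    using qSq[OF cl[OF y(1), of b], of a] qSq[OF y(1), of b] y(2) by (simp add: add_ac)
  also have "\<dots> = q ?N (\<Oplus>\<^bsub>gr M ?N\<^esub> c \<in> ?C. Sq M (a + b - c) (n + c) (Sq M c n y))"
    using Sq_adem[OF M ab y(1)] by simp
  also have "\<dots> = (\<Oplus>\<^bsub>gr Q ?N\<^esub> c \<in> ?C. q ?N (Sq M (a + b - c) (n + c) (Sq M c n y)))"
    using trm by (intro lin_finsum[OF mod_space[OF M] Q q(1)]) auto
  also have "\<dots> = (\<Oplus>\<^bsub>gr Q ?N\<^esub> c \<in> ?C. Sq Q (a + b - c) (n + c) (Sq Q c n x))"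
    using q_term qcl[OF trm] by (intro F2_finsum_cong[OF Q refl]) auto
  finally show "Sq Q a (n + b) (Sq Q b n x) =
      (\<Oplus>\<^bsub>gr Q ?N\<^esub> c \<in> ?C. Sq Q (a + b - c) (n + c) (Sq Q c n x))" .
qed

definition submodule :: "(nat \<Rightarrow> 'a set) \<Rightarrow> 'a umod \<Rightarrow> bool" where
  "submodule S M \<longleftrightarrow> (\<forall>n. F2_subspace (S n) (gr M n)) \<and> (\<forall>i n. \<forall>x\<in>S n. Sq M i n x \<in> S (n + i))"

lemma submodule_exists:
  assumes M: "M \<in> Ob U" and S: "submodule S M"
  obtains L i where "L \<in> Ob U" "i \<in> Hom U L M" "injective i" "\<And>n. app i n ` el L n = S n"
    "\<And>n. el L n = S n" "\<And>n. \<zero>\<^bsub>gr L n\<^esub> = \<zero>\<^bsub>gr M n\<^esub>"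
proof -
  have sub: "F2_subspace (S n) (gr M n)" and SqS: "x \<in> S n \<Longrightarrow> Sq M i n x \<in> S (n + i)" for i n x
    using S by (auto simp: submodule_def)
  note sub' = F2_subspaceD[OF sub]
  define L where "L = \<lparr>gr = (\<lambda>n. (gr M n)\<lparr>carrier := S n\<rparr>), Sq = Sq M\<rparr>"
  have L: "L \<in> Ob U"
  proof (rule unstable_embed[OF M, of L "\<lambda>n x. x"])
    show "F2_space (gr L n)" for n
      unfolding L_def using F2_space_subspace[OF mod_space[OF M] sub] by simp
    show "Sq L i n \<in> lin (gr L n) (gr L (n + i))" for i n
      using sub'(1) SqS lin_add[OF Sq_lin[OF M]] by (intro linI) (auto simp: L_def subset_iff)
    show "(\<lambda>x. x) \<in> lin (gr L n) (gr M n)" for n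
      using sub'(1) by (intro linI) (auto simp: L_def)
  qed (auto simp: L_def)
  have i: "uarr L M (\<lambda>n x. x) \<in> Hom U L M"
    using sub'(1) by (intro uarr_in_Hom[OF L] linI) (auto simp: L_def)
  show thesis
  proof (rule that[OF L i])
    show "injective (uarr L M (\<lambda>n x. x))"
      by (auto simp: injective_def inj_on_def uarr_def)
    show "app (uarr L M (\<lambda>n x. x)) n ` el L n = S n" for n
      by (auto simp: L_def uarr_def)
  qed (simp_all add: L_def)
qed

text \<open>The map is \<open>q = 1 + a\<close>, with \<open>a\<close> a linear retraction onto
  \<open>S\<close> obtained by applying \<open>lin_pinv\<close> to the inclusion. The image of
  \<open>q\<close> is a copy of \<open>V / S\<close> that consists of elements of
  \<open>V\<close>.\<close>

lemma F2_projection: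
  assumes V: "F2_space V" and S: "F2_subspace S V"
  shows "\<exists>q\<in>lin V V. \<forall>x\<in>carrier V. (q x = \<zero>\<^bsub>V\<^esub> \<longleftrightarrow> x \<in> S) \<and> q (q x) = q x"
proof -
  let ?S = "V\<lparr>carrier := S\<rparr>"
  note SD = F2_subspaceD[OF S]
  have "(\<lambda>x. x) \<in> lin ?S V" using SD(1) by (intro linI) auto
  then obtain a where a: "a \<in> lin V ?S" and "\<And>x. x \<in> carrier ?S \<Longrightarrow> a x = x"
    by (rule lin_pinv[OF F2_space_subspace[OF V S] V]) (rule that, assumption, simp)
  then have aid: "a x = x" if "x \<in> S" for x using that by simp
  have aV: "a \<in> lin V V"
    using lin_closed[OF a] lin_add[OF a] SD(1) by (intro linI) auto
  have aS: "a x \<in> S" "a x \<in> carrier V" if "x \<in> carrier V" for x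
    using lin_closed[OF a that] lin_closed[OF aV that] by simp_all
  let ?q = "\<lambda>x. x \<oplus>\<^bsub>V\<^esub> a x"
  have q: "?q \<in> lin V V" by (rule lin_plus[OF V lin_id aV])
  show ?thesis
  proof (intro bexI[of _ ?q] ballI conjI q)
    show *: "?q x = \<zero>\<^bsub>V\<^esub> \<longleftrightarrow> x \<in> S" if x: "x \<in> carrier V" for x
      using F2_add_eq_zero_iff[OF V x aS(2)[OF x]] aS(1)[OF x] aid by metis
    show "?q (?q x) = ?q x" if x: "x \<in> carrier V" for x
    proof -
      have "?q (x \<oplus>\<^bsub>V\<^esub> a x) = ?q x \<oplus>\<^bsub>V\<^esub> ?q (a x)"
        using lin_add[OF q x aS(2)[OF x]] .
      moreover have "?q (a x) = \<zero>\<^bsub>V\<^esub>" using * aS[OF x] by blast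
      ultimately show ?thesis using lin_closed[OF q x] V by (simp add: F2_add_zero)
    qed
  qed
qed

text \<open>The quotient must again have its elements in \<open>'a\<close>, so in each degree it is
  the image of the idempotent \<open>q\<close>, with operations \<open>q \<circ> Sq\<close>. The
  idempotents need not commute with the squares; they do so modulo \<open>S\<close>, which is
  enough.\<close>

lemma quotient_exists:
  assumes M: "M \<in> Ob U" and S: "submodule S M"
  obtains Q p where "Q \<in> Ob U" "p \<in> Hom U M Q" "surjective p"
    "\<And>n x. x \<in> el M n \<Longrightarrow> app p n x = \<zero>\<^bsub>gr Q n\<^esub> \<longleftrightarrow> x \<in> S n"
proof -
  have sub: "F2_subspace (S n) (gr M n)" and SqS: "x \<in> S n \<Longrightarrow> Sq M i n x \<in> S (n + i)" for i n x
    using S by (auto simp: submodule_def)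
  note sub' = F2_subspaceD[OF sub] and V = mod_space[OF M]
  have "\<forall>n. \<exists>q. q \<in> lin (gr M n) (gr M n) \<and>
      (\<forall>x\<in>el M n. (q x = \<zero>\<^bsub>gr M n\<^esub> \<longleftrightarrow> x \<in> S n) \<and> q (q x) = q x)"
    using F2_projection[OF V sub] by blast
  then obtain q where q: "\<And>n. q n \<in> lin (gr M n) (gr M n)"
    "\<And>n x. x \<in> el M n \<Longrightarrow> q n x = \<zero>\<^bsub>gr M n\<^esub> \<longleftrightarrow> x \<in> S n" "\<And>n x. x \<in> el M n \<Longrightarrow> q n (q n x) = q n x"
    by metis
  note qcl = lin_closed[OF q(1)]
  define Q where "Q = \<lparr>gr = (\<lambda>n. (gr M n)\<lparr>carrier := q n ` el M n\<rparr>),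
    Sq = (\<lambda>i n x. q (n + i) (Sq M i n x))\<rparr>"
  have QF: "F2_space (gr Q n)" for n
    unfolding Q_def using F2_space_subspace[OF V F2_subspace_image[OF V V q(1)]] by simp
  have qQ: "q n \<in> lin (gr M n) (gr Q n)" for n
    using lin_add[OF q(1)] by (intro linI) (auto simp: Q_def)
  have qSq: "q (n + i) (Sq M i n x) = Sq Q i n (q n x)" if x: "x \<in> el M n" for i n x
  proof -
    \<comment> \<open>\<open>x + q x\<close> lies in the submodule, hence so does its image under
      \<open>Sq M i n\<close>, and \<open>q\<close> kills that image.\<close>
    have y: "x \<oplus>\<^bsub>gr M n\<^esub> q n x \<in> el M n" using F2_add[OF V x qcl[OF x]] .
    have "q n (x \<oplus>\<^bsub>gr M n\<^esub> q n x) = \<zero>\<^bsub>gr M n\<^esub>"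
      using lin_add[OF q(1) x qcl[OF x]] q(3)[OF x] F2_add_self[OF V qcl[OF x]] by simp
    then have "x \<oplus>\<^bsub>gr M n\<^esub> q n x \<in> S n" using q(2)[OF y] by blast
    then have "q (n + i) (Sq M i n (x \<oplus>\<^bsub>gr M n\<^esub> q n x)) = \<zero>\<^bsub>gr M (n + i)\<^esub>"
      using SqS q(2) Sq_closed[OF M y] by blast
    then have "q (n + i) (Sq M i n x) \<oplus>\<^bsub>gr M (n + i)\<^esub> q (n + i) (Sq M i n (q n x)) = \<zero>\<^bsub>gr M (n + i)\<^esub>"
      using x qcl[OF x] by (simp add: lin_add[OF Sq_lin[OF M]] lin_add[OF q(1)] Sq_closed[OF M])
    then show ?thesis
      using x qcl by (simp add: F2_add_eq_zero_iff[OF V] Sq_closed[OF M] Q_def)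
  qed
  have im: "q n ` el M n = el Q n" for n by (simp add: Q_def)
  have Q: "Q \<in> Ob U"
  proof (rule unstable_quotient[OF M QF _ qQ im qSq])
    show "Sq Q i n \<in> lin (gr Q n) (gr Q (n + i))" for i n
    proof (rule linI)
      show "Sq Q i n x \<in> el Q (n + i)" if "x \<in> el Q n" for x
        using that qcl Sq_closed[OF M] by (auto simp: Q_def)
      show "Sq Q i n (x \<oplus>\<^bsub>gr Q n\<^esub> y) = Sq Q i n x \<oplus>\<^bsub>gr Q (n + i)\<^esub> Sq Q i n y"
        if "x \<in> el Q n" "y \<in> el Q n" for x y
        using that qcl Sq_closed[OF M]
        by (auto simp: Q_def lin_add[OF Sq_lin[OF M]] lin_add[OF q(1)])
    qed
  qed
  show thesis
  proof (rule that[OF Q])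
    show "uarr M Q q \<in> Hom U M Q" by (rule uarr_in_Hom[OF M qQ qSq])
    show "surjective (uarr M Q q)" by (simp add: surjective_def uarr_def im)
    show "app (uarr M Q q) n x = \<zero>\<^bsub>gr Q n\<^esub> \<longleftrightarrow> x \<in> S n" if "x \<in> el M n" for n x
      using that q(2) by (simp add: uarr_app) (simp add: Q_def)
  qed
qed

lemma submodule_kernel:
  assumes "M \<in> Ob U" "N \<in> Ob U" "f \<in> Hom U M N"
  shows "submodule (\<lambda>n. {x \<in> el M n. app f n x = \<zero>\<^bsub>gr N n\<^esub>}) M"
  unfolding submodule_def
  using assms F2_subspace_kernel[OF mod_space mod_space hom_lin]
  by (auto simp: Sq_closed hom_Sq Sq_zero)

lemma submodule_image:
  assumes "M \<in> Ob U" "N \<in> Ob U" "f \<in> Hom U M N"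
  shows "submodule (\<lambda>n. app f n ` el M n) N"
  unfolding submodule_def
proof (intro conjI allI ballI)
  fix i n x assume "x \<in> app f n ` el M n"
  then show "Sq N i n x \<in> app f (n + i) ` el M (n + i)"
    using assms by (auto simp: Sq_closed hom_Sq[symmetric])
qed (use assms F2_subspace_image[OF mod_space mod_space hom_lin] in blast)

lemma submodule_zero: "M \<in> Ob U \<Longrightarrow> submodule (\<lambda>n. {\<zero>\<^bsub>gr M n\<^esub>}) M"
  by (auto simp: submodule_def Sq_zero el_zero intro!: F2_subspaceI F2_add_self[OF mod_space])

lemma exact_atI:
  assumes "f \<in> Hom U L M" "g \<in> Hom U M N"
    and "\<And>n. app f n ` el L n = {x \<in> el M n. app g n x = \<zero>\<^bsub>gr N n\<^esub>}"
  shows "exact_at f g"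
  using assms by (simp add: exact_at_def hom_src hom_tgt)

lemma exact_atD:
  assumes "exact_at f g" "f \<in> Hom U L M" "g \<in> Hom U M N"
  shows "app f n ` el L n = {x \<in> el M n. app g n x = \<zero>\<^bsub>gr N n\<^esub>}"
  using assms by (simp add: exact_at_def hom_src hom_tgt)

lemma kernel_exists:
  assumes "M \<in> Ob U" "N \<in> Ob U" "f \<in> Hom U M N"
  obtains L i where "L \<in> Ob U" "i \<in> Hom U L M" "injective i" "exact_at i f"
proof (rule submodule_exists[OF assms(1) submodule_kernel[OF assms]])
  fix L i assume L: "L \<in> Ob U" "i \<in> Hom U L M" "injective i"
    "\<And>n. app i n ` el L n = {x \<in> el M n. app f n x = \<zero>\<^bsub>gr N n\<^esub>}"
  show thesis by (rule that[OF L(1-3) exact_atI[OF L(2) assms(3) L(4)]])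
qed

lemma cokernel_exists:
  assumes "M \<in> Ob U" "N \<in> Ob U" "f \<in> Hom U M N"
  obtains C p where "C \<in> Ob U" "p \<in> Hom U N C" "surjective p" "exact_at f p"
proof (rule quotient_exists[OF assms(2) submodule_image[OF assms]])
  fix C p assume C: "C \<in> Ob U" "p \<in> Hom U N C" "surjective p"
    "\<And>n x. x \<in> el N n \<Longrightarrow> app p n x = \<zero>\<^bsub>gr C n\<^esub> \<longleftrightarrow> x \<in> app f n ` el M n"
  have "exact_at f p"
    using C(4) hom_closed[OF assms(3)] by (intro exact_atI[OF assms(3) C(2)]) auto
  with C(1-3) show thesis by (rule that)
qed

section \<open>Nilpotent modules\<close>

text \<open>Below degree \<open>k\<close> the only element is the zero of \<open>gr M 0\<close>, and
  there each axiom says that zero equals zero; from degree \<open>k\<close> on it is the axiom of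
  \<open>M\<close> in the degree lowered by \<open>k\<close>.\<close>

lemma suspension_in_Ob:
  assumes M: "M \<in> Ob U"
  shows "suspension k M \<in> Ob U"
proof (rule unstableI)
  let ?S = "suspension k M"
  have F: "F2_space (gr ?S n)" for n
  proof (cases "k \<le> n")
    case False
    have "F2_subspace {\<zero>\<^bsub>gr M 0\<^esub>} (gr M 0)"
      using submodule_zero[OF M] by (simp add: submodule_def)
    then show ?thesis
      using F2_space_subspace[OF mod_space[OF M, of 0]] False by (simp add: suspension_def)
  qed (simp add: suspension_def mod_space[OF M])
  then show "F2_space (gr ?S n)" for n .
  have low: "x = \<zero>\<^bsub>gr M 0\<^esub>" if "x \<in> el ?S n" "n < k" for x n
    using that by (simp add: suspension_def)
  have Sq_low: "Sq ?S i n x = \<zero>\<^bsub>gr ?S (n + i)\<^esub>" if "n < k" for i n x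
    using that by (simp add: suspension_def)
  have zl: "\<zero>\<^bsub>gr ?S n\<^esub> = \<zero>\<^bsub>gr M 0\<^esub>" if "n < k" for n
    using that by (simp add: suspension_def)
  show lin: "Sq ?S i n \<in> lin (gr ?S n) (gr ?S (n + i))" for i n
  proof (cases "k \<le> n")
    case True
    then show ?thesis using Sq_lin[OF M, of i "n - k"] by (simp add: suspension_def)
  next
    case False
    then show ?thesis using Sq_low[of n i]
      by (intro linI) (simp_all add: F2_zero[OF F] F2_add_zero[OF F])
  qed
  show "Sq ?S 0 n x = x" if x: "x \<in> el ?S n" for n x
  proof (cases "k \<le> n")
    case True
    then show ?thesis using x Sq_0[OF M] by (simp add: suspension_def)
  next
    case False
    then show ?thesis using Sq_low[of n 0] low[OF x] zl[of n] by simp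
  qed
  show "Sq ?S i n x = \<zero>\<^bsub>gr ?S (n + i)\<^esub>" if "n < i" "x \<in> el ?S n" for i n x
  proof (cases "k \<le> n")
    case True
    then show ?thesis
      using that Sq_unstable[OF M, of "n - k" i x] by (simp add: suspension_def)
  qed (use Sq_low in simp)
  fix a b n :: nat and x assume ab: "0 < a" "a < 2 * b" and x: "x \<in> el ?S n"
  let ?C = "{c. 2 * c \<le> a \<and> odd ((b - c - 1) choose (a - 2 * c))}"
  show "Sq ?S a (n + b) (Sq ?S b n x) =
    (\<Oplus>\<^bsub>gr ?S (n + a + b)\<^esub> c \<in> ?C. Sq ?S (a + b - c) (n + c) (Sq ?S c n x))"
  proof (cases "k \<le> n")
    case True
    then show ?thesis
      using x Sq_adem[OF M ab, of x "n - k"] by (simp add: suspension_def)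
  next
    case False
    have z: "Sq ?S i m \<zero>\<^bsub>gr ?S m\<^esub> = \<zero>\<^bsub>gr ?S (m + i)\<^esub>" for i m
      by (rule lin_zero[OF F F lin])
    have "Sq ?S (a + b - c) (n + c) (Sq ?S c n x) = \<zero>\<^bsub>gr ?S (n + a + b)\<^esub>" if "c \<in> ?C" for c
    proof -
      have N: "n + c + (a + b - c) = n + a + b" using that ab by simp
      show ?thesis using Sq_low[of n c x] z[of "a + b - c" "n + c"] False unfolding N by simp
    qed
    then have "(\<Oplus>\<^bsub>gr ?S (n + a + b)\<^esub> c \<in> ?C. Sq ?S (a + b - c) (n + c) (Sq ?S c n x)) =
        \<zero>\<^bsub>gr ?S (n + a + b)\<^esub>"
      by (rule F2_finsum_zero[OF F])
    moreover have "Sq ?S a (n + b) (Sq ?S b n x) = \<zero>\<^bsub>gr ?S (n + a + b)\<^esub>"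
      using Sq_low[of n b x] z[of a "n + b"] False by (simp add: add_ac)
    ultimately show ?thesis by simp
  qed
qed

lemma localizing_Ob_U: "(Ob U :: 'a umod set) \<noteq> {} \<Longrightarrow> localizing (Ob U :: 'a umod set)"
  unfolding localizing_def serre_class_def by (auto simp: is_direct_sum_def)

section \<open>Closure properties of the nilpotent class\<close>

lemma nilpotentI: "(\<And>\<C>. localizing \<C> \<Longrightarrow> (\<And>M. M \<in> Ob U \<Longrightarrow> suspension k M \<in> \<C>) \<Longrightarrow> N \<in> \<C>) \<Longrightarrow> N \<in> nilpotent k"
  by (simp add: nilpotent_def)

lemma nilpotentD: "N \<in> nilpotent k \<Longrightarrow> localizing \<C> \<Longrightarrow> (\<And>M. M \<in> Ob U \<Longrightarrow> suspension k M \<in> \<C>) \<Longrightarrow> N \<in> \<C>"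
  by (simp add: nilpotent_def)

text \<open>The witness \<open>M\<close> guards against an empty intersection: it makes
  \<open>Ob U\<close> one of the classes that are intersected, and thus a bound for
  \<open>nilpotent k\<close>.\<close>

lemma nilpotent_Ob:
  fixes N :: "'a umod"
  assumes "N \<in> nilpotent k" "M \<in> Ob (U :: ('a umod, 'a uarr) category)"
  shows "N \<in> Ob U"
  by (rule nilpotentD[OF assms(1)]) (use localizing_Ob_U suspension_in_Ob assms(2) in blast)+

lemma suspension_nilpotent: "M \<in> Ob U \<Longrightarrow> suspension k M \<in> nilpotent k"
  by (rule nilpotentI)

lemma localizing_exact:
  assumes "localizing \<C>" "L \<in> Ob U" "M \<in> Ob U" "N \<in> Ob U" "f \<in> Hom U L M" "g \<in> Hom U M N"
    "injective f" "exact_at f g" "surjective g"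
  shows "M \<in> \<C> \<longleftrightarrow> L \<in> \<C> \<and> N \<in> \<C>"
  using assms unfolding localizing_def serre_class_def by blast

lemma nilpotent_exact:
  assumes "L \<in> Ob U" "M \<in> Ob U" "N \<in> Ob U" "f \<in> Hom U L M" "g \<in> Hom U M N"
    "injective f" "exact_at f g" "surjective g"
  shows "M \<in> nilpotent k \<longleftrightarrow> L \<in> nilpotent k \<and> N \<in> nilpotent k"
  using localizing_exact[OF _ assms] by (auto simp: nilpotent_def)

lemma nilpotent_direct_sum:
  fixes S :: "'a umod"
  assumes "is_direct_sum I D \<iota> S" "\<And>i. i \<in> I \<Longrightarrow> D i \<in> nilpotent k"
  shows "S \<in> nilpotent k"
proof (rule nilpotentI)
  fix \<C> :: "'a umod set" assume C: "localizing \<C>" "\<And>M. M \<in> Ob U \<Longrightarrow> suspension k M \<in> \<C>"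
  have "\<forall>i\<in>I. D i \<in> \<C>" using nilpotentD[OF assms(2) C] by blast
  with C(1) assms(1) show "S \<in> \<C>" unfolding localizing_def by blast
qed

text \<open>For any member \<open>M\<close> of the class the sequence
  \<open>Z \<rightarrow> M \<rightarrow> M\<close> ending in the identity is short exact, so a Serre
  class contains every zero module.\<close>

lemma nilpotent_zero:
  assumes Z: "Z \<in> Ob U" and z: "\<And>n. el Z n = {\<zero>\<^bsub>gr Z n\<^esub>}"
  shows "Z \<in> nilpotent k"
proof (rule nilpotentI)
  fix \<C> :: "'a umod set" assume C: "localizing \<C>"
  then obtain M where M: "M \<in> \<C>" "M \<in> Ob U" by (auto simp: localizing_def serre_class_def)
  let ?f = "uarr Z M (\<lambda>n x. \<zero>\<^bsub>gr M n\<^esub>)"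
  have f: "?f \<in> Hom U Z M" by (rule zero_in_Hom[OF Z M(2)])
  have inj: "injective ?f" using z by (auto simp: injective_def inj_on_def uarr_def)
  have surj: "surjective (Idn U M)" by (auto simp: surjective_def U_def)
  have ex: "exact_at ?f (Idn U M)"
    using z el_zero[OF M(2)]
    by (intro exact_atI[OF f id_in_Hom[OF M(2)]]) (auto simp: uarr_def id_app)
  show "Z \<in> \<C>"
    using localizing_exact[OF C Z M(2) M(2) f id_in_Hom[OF M(2)] inj ex surj] M(1) by blast
qed

text \<open>The cokernel completes the inclusion to a short exact sequence.\<close>

lemma nilpotent_sub:
  assumes N: "N \<in> nilpotent k" and L: "L \<in> Ob U" and i: "i \<in> Hom U L N" "injective i"
  shows "L \<in> nilpotent k"
proof -
  have N': "N \<in> Ob U" by (rule nilpotent_Ob[OF N L])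
  show ?thesis
  proof (rule cokernel_exists[OF L N' i(1)])
    fix C p assume C: "C \<in> Ob U" "p \<in> Hom U N C" "surjective p" "exact_at i p"
    show ?thesis using nilpotent_exact[OF L N' C(1) i(1) C(2) i(2) C(4,3)] N by blast
  qed
qed

lemma nilpotent_quotient:
  assumes M: "M \<in> nilpotent k" and N: "N \<in> Ob U" and p: "p \<in> Hom U M N" "surjective p"
  shows "N \<in> nilpotent k"
proof -
  have M': "M \<in> Ob U" by (rule nilpotent_Ob[OF M N])
  show ?thesis
  proof (rule kernel_exists[OF M' N p(1)])
    fix L i assume L: "L \<in> Ob U" "i \<in> Hom U L M" "injective i" "exact_at i p"
    show ?thesis using nilpotent_exact[OF L(1) M' N L(2) p(1) L(3,4) p(2)] M by blast
  qed
qed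

text \<open>The hypotheses say that \<open>P\<close> is a \<open>k\<close>-fold suspension of an unstable module.\<close>

lemma nilpotent_desuspend:
  assumes P: "P \<in> Ob U"
    and low: "\<And>n. n < k \<Longrightarrow> el P n = {\<zero>\<^bsub>gr P n\<^esub>}"
    and top: "\<And>i n x. n < i + k \<Longrightarrow> x \<in> el P n \<Longrightarrow> Sq P i n x = \<zero>\<^bsub>gr P (n + i)\<^esub>"
  shows "P \<in> nilpotent k"
proof -
  have top': "Sq P i n x = \<zero>\<^bsub>gr P (n + i)\<^esub>" if "n - k < i" "x \<in> el P n" for i n x
  proof (cases "n < k")
    case True
    then show ?thesis using low[OF True] that Sq_zero[OF P, of i n] by simp
  qed (use top[of n i x] that in simp)
  \<comment> \<open>The desuspension: \<open>P\<close> regraded down by \<open>k\<close>. The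
    sharpened vanishing in \<open>top\<close> is exactly instability for the new grading.\<close>
  let ?X = "\<lparr>gr = (\<lambda>n. gr P (n + k)), Sq = (\<lambda>i n. Sq P i (n + k))\<rparr>"
  have X: "?X \<in> Ob U"
  proof (rule unstableI)
    show "F2_space (gr ?X n)" for n using mod_space[OF P] by simp
    show "Sq ?X i n \<in> lin (gr ?X n) (gr ?X (n + i))" for i n
      using Sq_lin[OF P, of i "n + k"] by (simp add: add_ac)
    show "Sq ?X 0 n x = x" if "x \<in> el ?X n" for n x
      using that Sq_0[OF P] by simp
    show "Sq ?X i n x = \<zero>\<^bsub>gr ?X (n + i)\<^esub>" if "n < i" "x \<in> el ?X n" for i n x
      using that top[of "n + k" i x] by (simp add: add_ac)
    fix a b n :: nat and x assume "0 < a" "a < 2 * b" "x \<in> el ?X n"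
    then show "Sq ?X a (n + b) (Sq ?X b n x) =
      (\<Oplus>\<^bsub>gr ?X (n + a + b)\<^esub> c \<in> {c. 2 * c \<le> a \<and> odd ((b - c - 1) choose (a - 2 * c))}.
         Sq ?X (a + b - c) (n + c) (Sq ?X c n x))"
      using Sq_adem[OF P, of a b x "n + k"] by (simp add: add_ac)
  qed
  \<comment> \<open>Below degree \<open>k\<close> the zero of the suspension is by definition that
    of \<open>gr ?X 0\<close>, which may be a different element from the zero of \<open>P\<close> in
    that degree.\<close>
  let ?e = "\<lambda>n x. if n < k then \<zero>\<^bsub>gr ?X 0\<^esub> else x"
  have f: "uarr P (suspension k ?X) ?e \<in> Hom U P (suspension k ?X)"
  proof (rule uarr_in_Hom[OF P])
    show "?e n \<in> lin (gr P n) (gr (suspension k ?X) n)" for n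
      by (rule linI) (auto simp: suspension_def F2_add_zero[OF mod_space[OF P]] el_zero[OF P])
    fix i n x assume x: "x \<in> el P n"
    show "?e (n + i) (Sq P i n x) = Sq (suspension k ?X) i n (?e n x)"
    proof (cases "k \<le> n")
      case True
      then show ?thesis by (simp add: suspension_def)
    next
      case False
      then have "Sq P i n x = \<zero>\<^bsub>gr P (n + i)\<^esub>"
        using low[of n] x Sq_zero[OF P, of i n] by simp
      with False show ?thesis by (simp add: suspension_def)
    qed
  qed
  have "injective (uarr P (suspension k ?X) ?e)"
    using low by (auto simp: injective_def inj_on_def uarr_def)
  then show ?thesis
    by (rule nilpotent_sub[OF suspension_nilpotent[OF X] P f])
qed

text \<open>The kernel condition makes the value independent of the chosen preimage
  \<open>s n y\<close>; linearity and compatibility with the squares follow from this.\<close>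

lemma factor_surjective:
  assumes B: "B \<in> Ob U" and C: "C \<in> Ob U" and D: "D \<in> Ob U"
    and p: "p \<in> Hom U B C" "surjective p" and g: "g \<in> Hom U B D"
    and ker: "\<And>n x. x \<in> el B n \<Longrightarrow> app p n x = \<zero>\<^bsub>gr C n\<^esub> \<Longrightarrow> app g n x = \<zero>\<^bsub>gr D n\<^esub>"
  obtains h where "h \<in> Hom U C D" "\<And>n x. x \<in> el B n \<Longrightarrow> app h n (app p n x) = app g n x"
proof -
  have lift: "\<exists>x\<in>el B n. y = app p n x" if "y \<in> el C n" for y n
    using that p hom_src[OF p(1)] hom_tgt[OF p(1)] unfolding surjective_def by blast
  have eq: "app g n x = app g n x'" if "x \<in> el B n" "x' \<in> el B n" "app p n x = app p n x'" for n x x'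
  proof -
    have "app p n (x \<oplus>\<^bsub>gr B n\<^esub> x') = \<zero>\<^bsub>gr C n\<^esub>"
      using that by (simp add: hom_add[OF p(1)] F2_add_self[OF mod_space[OF C]] hom_closed[OF p(1)])
    then have "app g n (x \<oplus>\<^bsub>gr B n\<^esub> x') = \<zero>\<^bsub>gr D n\<^esub>"
      using that by (intro ker F2_add[OF mod_space[OF B]])
    then show ?thesis
      using that by (simp add: hom_add[OF g] F2_add_eq_zero_iff[OF mod_space[OF D]] hom_closed[OF g])
  qed
  define s where "s n y = (SOME x. x \<in> el B n \<and> app p n x = y)" for n y
  have s: "s n y \<in> el B n" "app p n (s n y) = y" if "y \<in> el C n" for n y
  proof -
    have "\<exists>x. x \<in> el B n \<and> app p n x = y" using lift[OF that] by blast
    from someI_ex[OF this] show "s n y \<in> el B n" "app p n (s n y) = y" by (simp_all add: s_def)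
  qed
  let ?h = "\<lambda>n y. app g n (s n y)"
  have hp: "?h n (app p n x) = app g n x" if "x \<in> el B n" for n x
    using that s[OF hom_closed[OF p(1) that]] by (intro eq) auto
  have h: "uarr C D ?h \<in> Hom U C D"
  proof (rule uarr_in_Hom[OF C])
    show "?h n \<in> lin (gr C n) (gr D n)" for n
    proof (rule linI)
      show "?h n x \<in> el D n" if "x \<in> el C n" for x
        using that s hom_closed[OF g] by blast
      fix x y assume "x \<in> el C n" "y \<in> el C n"
      then show "?h n (x \<oplus>\<^bsub>gr C n\<^esub> y) = ?h n x \<oplus>\<^bsub>gr D n\<^esub> ?h n y"
        using hp[OF F2_add[OF mod_space[OF B]], of "s n x" n "s n y"] s
        by (simp add: hom_add[OF p(1)] hom_add[OF g])
    qed
    fix i n x assume x: "x \<in> el C n"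
    show "?h (n + i) (Sq C i n x) = Sq D i n (?h n x)"
      using hp[OF Sq_closed[OF B s(1)[OF x]], of i] s[OF x]
      by (simp add: hom_Sq[OF p(1)] hom_Sq[OF g])
  qed
  show thesis
    by (rule that[OF h]) (simp add: uarr_app hom_closed[OF p(1)] hp)
qed

section \<open>The quotient category\<close>

lemma nil_isoD:
  assumes "nil_iso k f" "f \<in> Hom U M N"
  obtains L C i p where "L \<in> nilpotent k" "C \<in> nilpotent k" "i \<in> Hom U L M" "p \<in> Hom U N C"
    "injective i" "exact_at i f" "exact_at f p" "surjective p"
  using assms unfolding nil_iso_def by (auto simp: hom_src hom_tgt)

lemma nil_isoI:
  assumes "f \<in> Hom U M N" "L \<in> nilpotent k" "C \<in> nilpotent k" "i \<in> Hom U L M" "p \<in> Hom U N C"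
    "injective i" "exact_at i f" "exact_at f p" "surjective p"
  shows "nil_iso k f"
  using assms unfolding nil_iso_def by (auto simp: hom_src hom_tgt)

text \<open>\<open>nil_iso\<close> asks for kernel and cokernel as actual modules; here both turn
  out to be zero.\<close>

lemma nil_iso_id:
  assumes M: "M \<in> Ob U"
  shows "nil_iso k (Idn U M)"
proof (rule kernel_exists[OF M M id_in_Hom[OF M]], rule cokernel_exists[OF M M id_in_Hom[OF M]])
  fix L i C p
  assume L: "L \<in> Ob U" "i \<in> Hom U L M" "injective i" "exact_at i (Idn U M)"
    and C: "C \<in> Ob U" "p \<in> Hom U M C" "surjective p" "exact_at (Idn U M) p"
  have "app i n x = \<zero>\<^bsub>gr M n\<^esub>" if "x \<in> el L n" for n x
  proof -
    have "app i n x \<in> {y \<in> el M n. app (Idn U M) n y = \<zero>\<^bsub>gr M n\<^esub>}"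
      unfolding exact_atD[OF L(4,2) id_in_Hom[OF M], symmetric] using that by blast
    then show ?thesis by (auto simp: id_app)
  qed
  then have "x = \<zero>\<^bsub>gr L n\<^esub>" if "x \<in> el L n" for n x
    using that L(3) el_zero[OF L(1), of n] unfolding injective_def hom_src[OF L(2)]
    by (metis inj_onD)
  then have Ln: "L \<in> nilpotent k"
    using el_zero[OF L(1)] by (intro nilpotent_zero[OF L(1)]) blast
  have "app p n x = \<zero>\<^bsub>gr C n\<^esub>" if "x \<in> el M n" for n x
    using exact_atD[OF C(4) id_in_Hom[OF M] C(2), of n] that by (force simp: id_app)
  then have "x = \<zero>\<^bsub>gr C n\<^esub>" if "x \<in> el C n" for n x
    using that C(3) unfolding surjective_def hom_src[OF C(2)] hom_tgt[OF C(2)]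
    by (metis imageE)
  then have Cn: "C \<in> nilpotent k"
    using el_zero[OF C(1)] by (intro nilpotent_zero[OF C(1)]) blast
  show ?thesis
    by (rule nil_isoI[OF id_in_Hom[OF M] Ln Cn L(2) C(2) L(3,4) C(4,3)])
qed

lemma roofsI: "A \<in> Ob U \<Longrightarrow> s \<in> Hom U A M \<Longrightarrow> nil_iso k s \<Longrightarrow> f \<in> Hom U A N \<Longrightarrow> (s, f) \<in> roofs k M N"
  by (auto simp: roofs_def)

lemma roofsE:
  assumes "\<rho> \<in> roofs k M N"
  obtains A s f where "\<rho> = (s, f)" "A \<in> Ob U" "s \<in> Hom U A M" "nil_iso k s" "f \<in> Hom U A N"
  using assms by (auto simp: roofs_def)

lemma roof_equiv_refl:
  assumes "\<rho> \<in> roofs k M N" "M \<in> Ob U"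
  shows "roof_equiv k \<rho> \<rho>"
proof (rule roofsE[OF assms(1)])
  fix A s f assume *: "\<rho> = (s, f)" "A \<in> Ob U" "s \<in> Hom U A M" "nil_iso k s" "f \<in> Hom U A N"
  then show ?thesis
    unfolding roof_equiv_def using id_in_Hom[OF *(2)] comp_id(1)[OF *(3,2) assms(2)]
    by (intro bexI[of _ A] bexI[of _ "Idn U A"]) (auto simp: hom_src)
qed

lemma roof_equiv_sym: "roof_equiv k \<rho> \<sigma> \<Longrightarrow> roof_equiv k \<sigma> \<rho>"
  unfolding roof_equiv_def by metis

lemma app_frac: "\<sigma> \<in> app (frac k M N \<rho>) \<longleftrightarrow> \<sigma> \<in> roofs k M N \<and> roof_equiv k \<rho> \<sigma>"
  by (simp add: frac_def)

lemma is_functorD: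
  assumes "is_functor C D Fo Fm"
  shows "is_category C" "is_category D" "\<And>a. a \<in> Ob C \<Longrightarrow> Fo a \<in> Ob D"
    "\<And>a b f. a \<in> Ob C \<Longrightarrow> b \<in> Ob C \<Longrightarrow> f \<in> Hom C a b \<Longrightarrow> Fm f \<in> Hom D (Fo a) (Fo b)"
    "\<And>a. a \<in> Ob C \<Longrightarrow> Fm (Idn C a) = Idn D (Fo a)"
    "\<And>a b c f g. a \<in> Ob C \<Longrightarrow> b \<in> Ob C \<Longrightarrow> c \<in> Ob C \<Longrightarrow> f \<in> Hom C a b \<Longrightarrow> g \<in> Hom C b c \<Longrightarrow>
       Fm (Comp C g f) = Comp D (Fm g) (Fm f)"
  using assms unfolding is_functor_def by blast+

lemma is_categoryD:
  assumes "is_category C"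
  shows "\<And>a. a \<in> Ob C \<Longrightarrow> Idn C a \<in> Hom C a a"
    "\<And>a b c f g. a \<in> Ob C \<Longrightarrow> b \<in> Ob C \<Longrightarrow> c \<in> Ob C \<Longrightarrow> f \<in> Hom C a b \<Longrightarrow> g \<in> Hom C b c \<Longrightarrow> Comp C g f \<in>
        Hom C a c"
    "\<And>a b f. a \<in> Ob C \<Longrightarrow> b \<in> Ob C \<Longrightarrow> f \<in> Hom C a b \<Longrightarrow> Comp C f (Idn C a) = f"
    "\<And>a b f. a \<in> Ob C \<Longrightarrow> b \<in> Ob C \<Longrightarrow> f \<in> Hom C a b \<Longrightarrow> Comp C (Idn C b) f = f"
    "\<And>a b c d f g h. a \<in> Ob C \<Longrightarrow> b \<in> Ob C \<Longrightarrow> c \<in> Ob C \<Longrightarrow> d \<in> Ob C \<Longrightarrow>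
       f \<in> Hom C a b \<Longrightarrow> g \<in> Hom C b c \<Longrightarrow> h \<in> Hom C c d \<Longrightarrow>
       Comp C h (Comp C g f) = Comp C (Comp C h g) f"
  using assms unfolding is_category_def by blast+

definition local_module :: "nat \<Rightarrow> 'a umod \<Rightarrow> bool" where
  "local_module k X \<longleftrightarrow> X \<in> Ob U \<and>
    (\<forall>A\<in>Ob U. \<forall>B\<in>Ob U. \<forall>s\<in>Hom U A B. nil_iso k s \<longrightarrow>
      (\<forall>u\<in>Hom U A X. \<exists>!v. v \<in> Hom U B X \<and> Comp U v s = u))"

section \<open>The quotient category in the presence of a right adjoint\<close>

locale nil_localisation =
  fixes k :: nat and so :: "'a umod \<Rightarrow> 'a umod" and sm :: "'a qarr \<Rightarrow> 'a uarr"
    and \<phi> :: "'a umod \<Rightarrow> 'a umod \<Rightarrow> 'a qarr \<Rightarrow> 'a uarr"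
  assumes adj: "is_right_adjoint_r k so sm \<phi>"
begin

abbreviation Q :: "('a umod, 'a qarr) category" where "Q \<equiv> U_mod_nilpotent k"
abbreviation r :: "'a uarr \<Rightarrow> 'a qarr" where "r \<equiv> r_map k"
abbreviation \<eta> :: "'a umod \<Rightarrow> 'a uarr" where "\<eta> \<equiv> l_unit k \<phi>"
abbreviation lm :: "'a uarr \<Rightarrow> 'a uarr" where "lm \<equiv> l_map k sm"

lemma r_functor: "is_functor U Q (\<lambda>M. M) r"
  and s_functor: "is_functor Q U so sm"
  and phi_bij: "\<And>c d. c \<in> Ob U \<Longrightarrow> d \<in> Ob U \<Longrightarrow> bij_betw (\<phi> c d) (Hom Q c d) (Hom U c (so d))"
  and phi_nat: "\<And>c c' d d' h u v. c \<in> Ob U \<Longrightarrow> c' \<in> Ob U \<Longrightarrow> d \<in> Ob U \<Longrightarrow> d' \<in> Ob U \<Longrightarrow>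
    h \<in> Hom U c' c \<Longrightarrow> u \<in> Hom Q c d \<Longrightarrow> v \<in> Hom Q d d' \<Longrightarrow>
    \<phi> c' d' (Comp Q v (Comp Q u (r h))) = Comp U (sm v) (Comp U (\<phi> c d u) h)"
proof -
  have O: "Ob Q = Ob U" by (simp add: U_mod_nilpotent_def)
  show "is_functor U Q (\<lambda>M. M) r" "is_functor Q U so sm"
    "\<And>c d. c \<in> Ob U \<Longrightarrow> d \<in> Ob U \<Longrightarrow> bij_betw (\<phi> c d) (Hom Q c d) (Hom U c (so d))"
    "\<And>c c' d d' h u v. c \<in> Ob U \<Longrightarrow> c' \<in> Ob U \<Longrightarrow> d \<in> Ob U \<Longrightarrow> d' \<in> Ob U \<Longrightarrow>
    h \<in> Hom U c' c \<Longrightarrow> u \<in> Hom Q c d \<Longrightarrow> v \<in> Hom Q d d' \<Longrightarrow>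
    \<phi> c' d' (Comp Q v (Comp Q u (r h))) = Comp U (sm v) (Comp U (\<phi> c d u) h)"
    using adj unfolding is_right_adjoint_r_def is_adjunction_def O by simp_all
qed

lemma Ob_Q: "Ob Q = Ob U"
  by (simp add: U_mod_nilpotent_def)

lemma Hom_Q: "Hom Q M N = frac k M N ` roofs k M N"
  by (simp add: U_mod_nilpotent_def)

lemmas Q_cat = is_functorD(2)[OF r_functor]
lemmas Q_id = is_categoryD(1)[OF Q_cat, unfolded Ob_Q]
lemmas Q_comp = is_categoryD(2)[OF Q_cat, unfolded Ob_Q]
lemmas Q_comp_id = is_categoryD(3,4)[OF Q_cat, unfolded Ob_Q]
lemmas Q_assoc = is_categoryD(5)[OF Q_cat, unfolded Ob_Q]
lemmas r_Hom = is_functorD(4)[OF r_functor]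
lemmas r_id = is_functorD(5)[OF r_functor]
lemmas r_comp = is_functorD(6)[OF r_functor]

lemma Q_src: "F \<in> Hom Q M N \<Longrightarrow> src F = M" and Q_tgt: "F \<in> Hom Q M N \<Longrightarrow> tgt F = N"
  by (auto simp: Hom_Q frac_def)

lemma frac_Hom_Q: "\<rho> \<in> roofs k M N \<Longrightarrow> frac k M N \<rho> \<in> Hom Q M N"
  by (auto simp: Hom_Q)

lemma mem_frac: "\<rho> \<in> roofs k M N \<Longrightarrow> M \<in> Ob U \<Longrightarrow> \<rho> \<in> app (frac k M N \<rho>)"
  by (simp add: app_frac roof_equiv_refl)

text \<open>A composite in the quotient collects the roofs reached from any representatives by any
  completion to a square, so one such completion suffices for membership.\<close>

lemma comp_Q_mem:
  assumes "F \<in> Hom Q L M" "G \<in> Hom Q M N" "(s, f) \<in> app F" "(t, g) \<in> app G" "A \<in> Ob U"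
    "p \<in> Hom U A (src s)" "q \<in> Hom U A (src t)" "nil_iso k p" "Comp U f p = Comp U t q"
    "\<sigma> \<in> roofs k L N" "roof_equiv k (Comp U s p, Comp U g q) \<sigma>"
  shows "\<sigma> \<in> app (Comp Q G F)"
proof -
  have eq: "app (Comp Q G F) = {\<sigma> \<in> roofs k (src F) (tgt G).
      \<exists>(s, f)\<in>app F. \<exists>(t, g)\<in>app G. \<exists>A\<in>Ob U. \<exists>p\<in>Hom U A (src s). \<exists>q\<in>Hom U A (src t).
        nil_iso k p \<and> Comp U f p = Comp U t q \<and> roof_equiv k (Comp U s p, Comp U g q) \<sigma>}"
    by (simp add: U_mod_nilpotent_def)
  show ?thesis
    unfolding eq mem_Collect_eq Q_src[OF assms(1)] Q_tgt[OF assms(2)]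
    by (rule conjI[OF assms(10)], rule bexI[OF _ assms(3)], unfold prod.case,
      rule bexI[OF _ assms(4)], unfold prod.case,
      intro bexI[OF _ assms(5)] bexI[OF _ assms(6)] bexI[OF _ assms(7)] conjI assms)
qed

lemma id_roof: "M \<in> Ob U \<Longrightarrow> (Idn U M, Idn U M) \<in> app (Idn Q M)"
  using mem_frac[OF roofsI[OF _ id_in_Hom nil_iso_id id_in_Hom]] by (simp add: U_mod_nilpotent_def)

lemma r_roof:
  assumes "f \<in> Hom U M N" "M \<in> Ob U"
  shows "(Idn U M, f) \<in> app (r f)"
  unfolding r_map_def hom_src[OF assms(1)] hom_tgt[OF assms(1)]
  by (rule mem_frac[OF roofsI[OF _ id_in_Hom nil_iso_id assms(1)]]; rule assms)

text \<open>Transitivity of \<open>roof_equiv\<close> is not proved by the calculus of fractions, but read off from the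
  law \<open>1 \<circ> F = F\<close>, which is part of the assumption that the quotient is a category.\<close>

lemma roof_equiv_trans:
  fixes M N :: "'a umod"
  assumes M: "M \<in> Ob U" and N: "N \<in> Ob U" and \<rho>: "\<rho> \<in> roofs k M N" and \<sigma>: "\<sigma> \<in> roofs k M N"
    and \<tau>: "\<tau> \<in> roofs k M N" and eq: "roof_equiv k \<rho> \<sigma>" "roof_equiv k \<sigma> \<tau>"
  shows "roof_equiv k \<rho> \<tau>"
proof (rule roofsE[OF \<sigma>])
  fix A s f assume *: "\<sigma> = (s, f)" "A \<in> Ob U" "s \<in> Hom U A M" "nil_iso k s" "f \<in> Hom U A N"
  have F: "frac k M N \<rho> \<in> Hom Q M N" by (rule frac_Hom_Q[OF \<rho>])
  \<comment> \<open>The class of \<open>\<rho>\<close> contains \<open>\<sigma>\<close>. Composing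
    \<open>\<sigma>\<close> with the identity roof along the square formed by \<open>Idn U A\<close>
    and \<open>f\<close> returns \<open>\<sigma>\<close>, which is equivalent to
    \<open>\<tau>\<close>.\<close>
  have "\<tau> \<in> app (Comp Q (Idn Q N) (frac k M N \<rho>))"
  proof (rule comp_Q_mem[OF F Q_id[OF N] _ id_roof[OF N] *(2)])
    show "(s, f) \<in> app (frac k M N \<rho>)" using \<sigma> eq(1) *(1) by (simp add: app_frac)
    show "Idn U A \<in> Hom U A (src s)" "f \<in> Hom U A (src (Idn U N))"
      using * N id_in_Hom by (auto simp: hom_src[OF *(3)] hom_src[OF id_in_Hom])
    show "nil_iso k (Idn U A)" by (rule nil_iso_id[OF *(2)])
    show "Comp U f (Idn U A) = Comp U (Idn U N) f" using comp_id[OF *(5,2) N] by simp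
    show "roof_equiv k (Comp U s (Idn U A), Comp U (Idn U N) f) \<tau>"
      using eq(2) *(1) comp_id[OF *(5,2) N] comp_id[OF *(3,2) M] by simp
  qed (rule \<tau>)
  then show ?thesis using Q_comp_id(2)[OF M N F] by (simp add: app_frac)
qed

lemma frac_eq:
  assumes M: "M \<in> Ob U" and N: "N \<in> Ob U" and F: "F \<in> Hom Q M N" and \<rho>: "\<rho> \<in> app F"
  shows "F = frac k M N \<rho>"
proof -
  obtain \<sigma> where \<sigma>: "\<sigma> \<in> roofs k M N" "F = frac k M N \<sigma>" using F by (auto simp: Hom_Q)
  have \<rho>': "\<rho> \<in> roofs k M N" "roof_equiv k \<sigma> \<rho>" using \<rho> \<sigma>(2) by (auto simp: app_frac)
  have "roof_equiv k \<sigma> \<tau> \<longleftrightarrow> roof_equiv k \<rho> \<tau>" if "\<tau> \<in> roofs k M N" for \<tau>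
    using roof_equiv_trans[OF M N] roof_equiv_sym \<sigma>(1) \<rho>' that by blast
  then show ?thesis by (auto simp: \<sigma>(2) frac_def)
qed

text \<open>By transitivity an arrow of the quotient is a full equivalence class, so a common roof
  identifies two arrows. Equations in the quotient that do not follow formally from the category
  laws are proved by exhibiting one.\<close>

lemma Q_eqI:
  assumes "M \<in> Ob U" "N \<in> Ob U" "F \<in> Hom Q M N" "G \<in> Hom Q M N" "\<rho> \<in> app F" "\<rho> \<in> app G"
  shows "F = G"
  using frac_eq assms by metis

text \<open>Equality of fractions, specialised to denominator 1: the two legs of the common
  refinement coincide.\<close>

lemma r_eqD:
  assumes M: "M \<in> Ob U" and N: "N \<in> Ob U" and f: "f \<in> Hom U M N" and g: "g \<in> Hom U M N"
    and eq: "r f = r g"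
  obtains A t where "A \<in> Ob U" "t \<in> Hom U A M" "nil_iso k t" "Comp U f t = Comp U g t"
proof -
  have "(Idn U M, g) \<in> app (r f)" using r_roof[OF g M] eq by simp
  then have "roof_equiv k (Idn U M, f) (Idn U M, g)"
    by (simp add: r_map_def app_frac hom_src[OF f])
  then obtain A t u where *: "A \<in> Ob U" "t \<in> Hom U A M" "u \<in> Hom U A M"
    "Comp U (Idn U M) t = Comp U (Idn U M) u" "nil_iso k (Comp U (Idn U M) t)"
    "Comp U f t = Comp U g u"
    unfolding roof_equiv_def by (auto simp: hom_src[OF id_in_Hom[OF M]])
  have "t = u" using *(4) comp_id(2)[OF *(2,1) M] comp_id(2)[OF *(3,1) M] by simp
  with * show thesis using that comp_id(2)[OF *(2,1) M] by simp
qed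

section \<open>Invertible arrows of the quotient\<close>

definition iso_Q :: "'a umod \<Rightarrow> 'a umod \<Rightarrow> 'a qarr \<Rightarrow> bool" where
  "iso_Q A B F \<longleftrightarrow> F \<in> Hom Q A B \<and>
    (\<exists>G\<in>Hom Q B A. Comp Q G F = Idn Q A \<and> Comp Q F G = Idn Q B)"

text \<open>The inverse of \<open>r s\<close> is the reversed fraction, the roof
  \<open>(s, Idn U A)\<close>.\<close>

lemma nil_iso_imp_iso:
  assumes A: "A \<in> Ob U" and M: "M \<in> Ob U" and s: "s \<in> Hom U A M" "nil_iso k s"
  shows "iso_Q A M (r s)"
proof -
  have \<rho>: "(s, Idn U A) \<in> roofs k M A" by (rule roofsI[OF A s id_in_Hom[OF A]])
  let ?G = "frac k M A (s, Idn U A)"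
  note G = frac_Hom_Q[OF \<rho>] and rG = mem_frac[OF \<rho> M]
  note rs = r_Hom[OF A M s(1)] and idA = id_in_Hom[OF A] and idM = id_in_Hom[OF M]
  note cs = comp_id[OF s(1) A M] and cA = comp_id[OF idA A A] and cM = comp_id[OF idM M M]
  have "(s, s) \<in> roofs k M M" by (rule roofsI[OF A s s(1)])
  have "(s, s) \<in> app (Comp Q (r s) ?G)"
    by (rule comp_Q_mem[OF G rs rG r_roof[OF s(1) A] A _ _ nil_iso_id[OF A]])
      (use idA cs cA \<open>(s, s) \<in> _\<close> M in \<open>auto simp: hom_src[OF s(1)] hom_src[OF idA]
          intro: roof_equiv_refl\<close>)
  \<comment> \<open>Refining along \<open>s\<close> itself shows the roof \<open>(s, s)\<close> to
    be equivalent to the identity roof.\<close>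
  moreover have "(s, s) \<in> app (Idn Q M)"
  proof -
    have "roof_equiv k (Idn U M, Idn U M) (s, s)"
      unfolding roof_equiv_def using A idA s cs
      by (intro bexI[of _ A] bexI[of _ s] bexI[of _ "Idn U A"])
        (auto simp: hom_src[OF s(1)] hom_src[OF idM])
    with \<open>(s, s) \<in> roofs k M M\<close> show ?thesis by (simp add: U_mod_nilpotent_def app_frac)
  qed
  ultimately have 1: "Comp Q (r s) ?G = Idn Q M"
    using Q_eqI[OF M M Q_comp[OF M A M G rs] Q_id[OF M]] by blast
  have ii: "(Idn U A, Idn U A) \<in> roofs k A A" by (rule roofsI[OF A idA nil_iso_id[OF A] idA])
  have "(Idn U A, Idn U A) \<in> app (Comp Q ?G (r s))"
    by (rule comp_Q_mem[OF rs G r_roof[OF s(1) A] rG A _ _ nil_iso_id[OF A]])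
      (use idA cs cA ii A in \<open>auto simp: hom_src[OF s(1)] hom_src[OF idA] intro: roof_equiv_refl\<close>)
  then have 2: "Comp Q ?G (r s) = Idn Q A"
    using Q_eqI[OF A A Q_comp[OF A M A rs G] Q_id[OF A]] id_roof[OF A] by blast
  show ?thesis unfolding iso_Q_def using rs G 1 2 by blast
qed

lemma iso_Q_cancel:
  assumes "A \<in> Ob U" "B \<in> Ob U" "iso_Q A B F" "N \<in> Ob U"
  shows "u \<in> Hom Q B N \<Longrightarrow> v \<in> Hom Q B N \<Longrightarrow> Comp Q u F = Comp Q v F \<Longrightarrow> u = v"
    and "u \<in> Hom Q N A \<Longrightarrow> v \<in> Hom Q N A \<Longrightarrow> Comp Q F u = Comp Q F v \<Longrightarrow> u = v"
proof -
  obtain G where G: "F \<in> Hom Q A B" "G \<in> Hom Q B A" "Comp Q G F = Idn Q A" "Comp Q F G = Idn Q B"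
    using assms(3) by (auto simp: iso_Q_def)
  show "u = v" if "u \<in> Hom Q B N" "v \<in> Hom Q B N" "Comp Q u F = Comp Q v F"
  proof -
    have "w = Comp Q (Comp Q w F) G" if "w \<in> Hom Q B N" for w
      using Q_assoc[OF assms(2,1,2,4) G(2,1) that] Q_comp_id(1)[OF assms(2,4) that] G(4) by simp
    with that show ?thesis by metis
  qed
  show "u = v" if "u \<in> Hom Q N A" "v \<in> Hom Q N A" "Comp Q F u = Comp Q F v"
  proof -
    have "w = Comp Q G (Comp Q F w)" if "w \<in> Hom Q N A" for w
      using Q_assoc[OF assms(4,1,2,1) that G(1,2)] Q_comp_id(2)[OF assms(4,1) that] G(3) by simp
    with that show ?thesis by metis
  qed
qed

text \<open>The kernel inclusion \<open>i\<close> and the zero arrow have the same composite with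
  \<open>f\<close>, so they agree in the quotient, and some \<open>t\<close> with nilpotent kernel
  and cokernel equalises them. Dually for the cokernel projection \<open>p\<close>.\<close>

lemma iso_imp_nil_iso:
  assumes A: "A \<in> Ob U" and B: "B \<in> Ob U" and f: "f \<in> Hom U A B" and iso: "iso_Q A B (r f)"
  shows "nil_iso k f"
proof (rule kernel_exists[OF A B f], rule cokernel_exists[OF A B f])
  fix L i C p
  assume L: "L \<in> Ob U" "i \<in> Hom U L A" "injective i" "exact_at i f"
    and C: "C \<in> Ob U" "p \<in> Hom U B C" "surjective p" "exact_at f p"
  have "L \<in> nilpotent k"
  proof -
    let ?z = "uarr L A (\<lambda>n x. \<zero>\<^bsub>gr A n\<^esub>)"
    have z: "?z \<in> Hom U L A" by (rule zero_in_Hom[OF L(1) A])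
    have "Comp U f i = Comp U f ?z"
    proof (rule hom_eqI[OF comp_in_Hom[OF L(2) f L(1)] comp_in_Hom[OF z f L(1)]])
      fix n x assume x: "x \<in> el L n"
      have "app f n (app i n x) = \<zero>\<^bsub>gr B n\<^esub>"
        using exact_atD[OF L(4,2) f, of n] x by blast
      then show "app (Comp U f i) n x = app (Comp U f ?z) n x"
        using x hom_zero[OF f A B] by (simp add: comp_app[OF L(2)] comp_app[OF z] uarr_app)
    qed
    then have "Comp Q (r f) (r i) = Comp Q (r f) (r ?z)"
      using r_comp[OF L(1) A B L(2) f] r_comp[OF L(1) A B z f] by simp
    then have "r i = r ?z"
      using iso_Q_cancel(2)[OF A B iso L(1) r_Hom[OF L(1) A L(2)] r_Hom[OF L(1) A z]] by blast
    then show ?thesis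
    proof (rule r_eqD[OF L(1) A L(2) z])
      fix D t assume t: "D \<in> Ob U" "t \<in> Hom U D L" "nil_iso k t" "Comp U i t = Comp U ?z t"
      \<comment> \<open>\<open>i\<close> is injective, so \<open>t\<close> itself vanishes and its
        cokernel projection \<open>p'\<close> is injective: \<open>L\<close> embeds into a nilpotent
        module.\<close>
      have t0: "app t n x = \<zero>\<^bsub>gr L n\<^esub>" if x: "x \<in> el D n" for n x
      proof -
        have tx: "app t n x \<in> el L n" by (rule hom_closed[OF t(2) x])
        have "app i n (app t n x) = \<zero>\<^bsub>gr A n\<^esub>"
          using comp_app[OF t(2) x, of i] comp_app[OF t(2) x, of ?z] t(4) tx by (simp add: uarr_app)
        then show ?thesis
          using L(3) tx el_zero[OF L(1)] hom_zero[OF L(2,1) A]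
          unfolding injective_def hom_src[OF L(2)] by (metis inj_onD)
      qed
      show ?thesis
      proof (rule nil_isoD[OF t(3,2)])
        fix C' p' assume C': "C' \<in> nilpotent k" "p' \<in> Hom U L C'" "exact_at t p'"
        have C'O: "C' \<in> Ob U" by (rule nilpotent_Ob[OF C'(1) L(1)])
        have "inj_on (app p' n) (el L n)" for n
        proof (rule lin_injI[OF mod_space[OF L(1)] mod_space[OF C'O] hom_lin[OF C'(2)]])
          fix x assume "x \<in> el L n" "app p' n x = \<zero>\<^bsub>gr C' n\<^esub>"
          then have "x \<in> app t n ` el D n" using exact_atD[OF C'(3) t(2) C'(2), of n] by blast
          then show "x = \<zero>\<^bsub>gr L n\<^esub>" using t0 by auto
        qed
        then have "injective p'" by (simp add: injective_def hom_src[OF C'(2)])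
        then show ?thesis by (rule nilpotent_sub[OF C'(1) L(1) C'(2)])
      qed
    qed
  qed
  moreover have "C \<in> nilpotent k"
  proof -
    let ?z = "uarr B C (\<lambda>n x. \<zero>\<^bsub>gr C n\<^esub>)"
    have z: "?z \<in> Hom U B C" by (rule zero_in_Hom[OF B C(1)])
    have "Comp U p f = Comp U ?z f"
    proof (rule hom_eqI[OF comp_in_Hom[OF f C(2) A] comp_in_Hom[OF f z A]])
      fix n x assume x: "x \<in> el A n"
      have "app p n (app f n x) = \<zero>\<^bsub>gr C n\<^esub>"
        using exact_atD[OF C(4) f C(2), of n] x by blast
      then show "app (Comp U p f) n x = app (Comp U ?z f) n x"
        using x hom_closed[OF f] by (simp add: comp_app[OF f] uarr_app)
    qed
    then have "Comp Q (r p) (r f) = Comp Q (r ?z) (r f)"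
      using r_comp[OF A B C(1) f C(2)] r_comp[OF A B C(1) f z] by simp
    then have "r p = r ?z"
      using iso_Q_cancel(1)[OF A B iso C(1) r_Hom[OF B C(1,2)] r_Hom[OF B C(1) z]] by blast
    then show ?thesis
    proof (rule r_eqD[OF B C(1,2) z])
      fix D t assume t: "D \<in> Ob U" "t \<in> Hom U D B" "nil_iso k t" "Comp U p t = Comp U ?z t"
      have pt: "app p n (app t n x) = \<zero>\<^bsub>gr C n\<^esub>" if x: "x \<in> el D n" for n x
        using comp_app[OF t(2) x, of p] comp_app[OF t(2) x, of ?z] t(4) hom_closed[OF t(2) x]
        by (simp add: uarr_app)
      show ?thesis
      proof (rule nil_isoD[OF t(3,2)])
        fix C' p' assume C': "C' \<in> nilpotent k" "p' \<in> Hom U B C'" "exact_at t p'" "surjective p'"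
        have C'O: "C' \<in> Ob U" by (rule nilpotent_Ob[OF C'(1) B])
        \<comment> \<open>\<open>p\<close> vanishes on the image of \<open>t\<close>, hence factors
          through the nilpotent cokernel of \<open>t\<close>, of which \<open>C\<close> thus becomes
          a quotient.\<close>
        have "app p n x = \<zero>\<^bsub>gr C n\<^esub>" if "x \<in> el B n" "app p' n x = \<zero>\<^bsub>gr C' n\<^esub>" for n x
        proof -
          have "x \<in> app t n ` el D n" using exact_atD[OF C'(3) t(2) C'(2), of n] that by blast
          then show ?thesis using pt by auto
        qed
        then show ?thesis
        proof (rule factor_surjective[OF B C'O C(1) C'(2,4) C(2)])
          fix h assume h: "h \<in> Hom U C' C"
            "\<And>n x. x \<in> el B n \<Longrightarrow> app h n (app p' n x) = app p n x"
          have "app h n ` el C' n = el C n" for n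
          proof
            show "app h n ` el C' n \<subseteq> el C n" using hom_closed[OF h(1)] by blast
            show "el C n \<subseteq> app h n ` el C' n"
            proof
              fix y assume "y \<in> el C n"
              then obtain x where "x \<in> el B n" "y = app p n x"
                using C(3) unfolding surjective_def hom_src[OF C(2)] hom_tgt[OF C(2)] by blast
              then show "y \<in> app h n ` el C' n"
                using h(2)[of x n] hom_closed[OF C'(2), of x n] by (metis image_eqI)
            qed
          qed
          then have "surjective h" by (simp add: surjective_def hom_src[OF h(1)] hom_tgt[OF h(1)])
          then show ?thesis by (rule nilpotent_quotient[OF C'(1) C(1) h(1)])
        qed
      qed
    qed
  qed
  ultimately show ?thesis
    using nil_isoI[OF f _ _ L(2) C(2) L(3,4) C(4,3)] by blast
qed

text \<open>Passing to the quotient, where invertible arrows compose, replaces an analysis of the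
  six-term sequence of kernels and cokernels of a composite.\<close>

lemma nil_iso_comp:
  fixes A B C :: "'a umod"
  assumes O: "A \<in> Ob U" "B \<in> Ob U" "C \<in> Ob U" and f: "f \<in> Hom U A B" "nil_iso k f"
    and g: "g \<in> Hom U B C" "nil_iso k g"
  shows "nil_iso k (Comp U g f)"
proof (rule iso_imp_nil_iso[OF O(1,3) comp_in_Hom[OF f(1) g(1) O(1)]])
  obtain F where F: "r f \<in> Hom Q A B" "F \<in> Hom Q B A" "Comp Q F (r f) = Idn Q A" "Comp Q (r f) F =
      Idn Q B"
    using nil_iso_imp_iso[OF O(1,2) f] by (auto simp: iso_Q_def)
  obtain G where G: "r g \<in> Hom Q B C" "G \<in> Hom Q C B" "Comp Q G (r g) = Idn Q B" "Comp Q (r g) G =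
      Idn Q C"
    using nil_iso_imp_iso[OF O(2,3) g] by (auto simp: iso_Q_def)
  note gf = Q_comp[OF O F(1) G(1)] and FG = Q_comp[OF O(3,2,1) G(2) F(2)]
  have "Comp Q (Comp Q F G) (Comp Q (r g) (r f)) = Comp Q F (Comp Q (Comp Q G (r g)) (r f))"
    using Q_assoc[OF O(1,3,2,1) gf G(2) F(2)] Q_assoc[OF O(1,2,3,2) F(1) G(1,2)] by simp
  also have "\<dots> = Idn Q A" using G(3) F(3) Q_comp_id(2)[OF O(1,2) F(1)] by simp
  finally have 1: "Comp Q (Comp Q F G) (Comp Q (r g) (r f)) = Idn Q A" .
  have "Comp Q (Comp Q (r g) (r f)) (Comp Q F G) = Comp Q (r g) (Comp Q (Comp Q (r f) F) G)"
    using Q_assoc[OF O(3,1,2,3) FG F(1) G(1)] Q_assoc[OF O(3,2,1,2) G(2) F(2,1)] by simp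
  also have "\<dots> = Idn Q C" using F(4) G(4) Q_comp_id(2)[OF O(3,2) G(2)] by simp
  finally show "iso_Q A C (r (Comp U g f))"
    unfolding iso_Q_def r_comp[OF O f(1) g(1)] using gf FG 1 by blast
qed

section \<open>The localisation functor and its unit\<close>

lemma so_Ob: "M \<in> Ob U \<Longrightarrow> so M \<in> Ob U"
  using is_functorD(3)[OF s_functor] by (simp add: Ob_Q)

lemma phi_in: "c \<in> Ob U \<Longrightarrow> d \<in> Ob U \<Longrightarrow> u \<in> Hom Q c d \<Longrightarrow> \<phi> c d u \<in> Hom U c (so d)"
  using phi_bij by (rule bij_betw_apply)

lemma phi_inj: "c \<in> Ob U \<Longrightarrow> d \<in> Ob U \<Longrightarrow> u \<in> Hom Q c d \<Longrightarrow> v \<in> Hom Q c d \<Longrightarrow> \<phi> c d u = \<phi> c d v \<Longrightarrow> u = v"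
  using phi_bij by (meson bij_betw_imp_inj_on inj_onD)

lemma phi_surj: "c \<in> Ob U \<Longrightarrow> d \<in> Ob U \<Longrightarrow> v \<in> Hom U c (so d) \<Longrightarrow> \<exists>u\<in>Hom Q c d. v = \<phi> c d u"
  using phi_bij[of c d] unfolding bij_betw_def by blast

lemma phi_pre:
  assumes "c \<in> Ob U" "c' \<in> Ob U" "d \<in> Ob U" "h \<in> Hom U c' c" "u \<in> Hom Q c d"
  shows "\<phi> c' d (Comp Q u (r h)) = Comp U (\<phi> c d u) h"
proof -
  have uh: "Comp Q u (r h) \<in> Hom Q c' d"
    by (rule Q_comp[OF assms(2,1,3) r_Hom[OF assms(2,1,4)] assms(5)])
  have "\<phi> c' d (Comp Q (Idn Q d) (Comp Q u (r h))) = Comp U (sm (Idn Q d)) (Comp U (\<phi> c d u) h)"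
    by (rule phi_nat[OF assms(1,2,3,3,4,5) Q_id[OF assms(3)]])
  then show ?thesis
    using Q_comp_id(2)[OF assms(2,3) uh] is_functorD(5)[OF s_functor, of d] assms
      comp_id(2)[OF comp_in_Hom[OF assms(4) phi_in[OF assms(1,3,5)] assms(2)] assms(2)
          so_Ob[OF assms(3)]]
    by (simp add: Ob_Q)
qed

lemma phi_post:
  assumes "c \<in> Ob U" "d \<in> Ob U" "d' \<in> Ob U" "u \<in> Hom Q c d" "v \<in> Hom Q d d'"
  shows "\<phi> c d' (Comp Q v u) = Comp U (sm v) (\<phi> c d u)"
  using phi_nat[OF assms(1,1,2,3) id_in_Hom[OF assms(1)] assms(4,5)]
    Q_comp_id(1)[OF assms(1,2,4)] r_id[OF assms(1)]
    comp_id(1)[OF phi_in[OF assms(1,2,4)] assms(1) so_Ob[OF assms(2)]]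
  by simp

lemma unit_in: "M \<in> Ob U \<Longrightarrow> \<eta> M \<in> Hom U M (so M)"
  unfolding l_unit_def by (rule phi_in[OF _ _ Q_id])

lemma lm_functor: "is_functor U U (l_ob so) lm"
  unfolding is_functor_def
proof (intro conjI ballI is_category_U)
  fix a :: "'a umod" assume a: "a \<in> Ob U"
  show "l_ob so a \<in> Ob U" using so_Ob[OF a] by (simp add: l_ob_def)
  show "lm (Idn U a) = Idn U (l_ob so a)"
    using is_functorD(5)[OF s_functor, of a] r_id[OF a] a by (simp add: Ob_Q l_map_def l_ob_def)
  fix b :: "'a umod" assume b: "b \<in> Ob U"
  fix f assume f: "f \<in> Hom U a b"
  show "lm f \<in> Hom U (l_ob so a) (l_ob so b)"
    using is_functorD(4)[OF s_functor _ _ r_Hom[OF a b f]] a b by (simp add: Ob_Q l_map_def l_ob_def)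
  fix c :: "'a umod" and g assume c: "c \<in> Ob U" and g: "g \<in> Hom U b c"
  show "lm (Comp U g f) = Comp U (lm g) (lm f)"
    using is_functorD(6)[OF s_functor _ _ _ r_Hom[OF a b f] r_Hom[OF b c g]] a b c r_comp[OF a b c f g]
    by (simp add: Ob_Q l_map_def)
qed

lemma lm_Hom: "M \<in> Ob U \<Longrightarrow> N \<in> Ob U \<Longrightarrow> f \<in> Hom U M N \<Longrightarrow> lm f \<in> Hom U (so M) (so N)"
  using is_functorD(4)[OF lm_functor] by (simp add: l_ob_def)

text \<open>Both sides are the transpose of \<open>r f\<close>.\<close>

lemma unit_natural:
  assumes "M \<in> Ob U" "N \<in> Ob U" "f \<in> Hom U M N"
  shows "Comp U (lm f) (\<eta> M) = Comp U (\<eta> N) f"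
proof -
  note rf = r_Hom[OF assms]
  have "Comp U (lm f) (\<eta> M) = \<phi> M N (Comp Q (r f) (Idn Q M))"
    unfolding l_unit_def l_map_def by (rule phi_post[OF assms(1,1,2) Q_id[OF assms(1)] rf, symmetric])
  also have "\<dots> = \<phi> M N (Comp Q (Idn Q N) (r f))"
    using Q_comp_id[OF assms(1,2) rf] by simp
  also have "\<dots> = Comp U (\<eta> N) f"
    unfolding l_unit_def by (rule phi_pre[OF assms(2,1,2,3) Q_id[OF assms(2)]])
  finally show ?thesis .
qed

text \<open>\<open>\<phi>\<close> identifies arrows into \<open>so N\<close> with arrows of the
  quotient into \<open>N\<close>, naturally in the source; there precomposition with the invertible
  \<open>r s\<close> is bijective.\<close>

lemma local_so:
  assumes N: "N \<in> Ob U"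
  shows "local_module k (so N)"
  unfolding local_module_def
proof (intro conjI ballI impI so_Ob[OF N])
  fix A B :: "'a umod" and s u assume A: "A \<in> Ob U" and B: "B \<in> Ob U" and s: "s \<in> Hom U A B"
      "nil_iso k s"
    and u: "u \<in> Hom U A (so N)"
  obtain w where w: "w \<in> Hom Q A N" "u = \<phi> A N w" using phi_surj[OF A N u] by blast
  note iso = nil_iso_imp_iso[OF A B s]
  obtain G where G: "r s \<in> Hom Q A B" "G \<in> Hom Q B A" "Comp Q G (r s) = Idn Q A"
    using iso by (auto simp: iso_Q_def)
  note wG = Q_comp[OF B A N G(2) w(1)]
  have ex: "Comp U (\<phi> B N (Comp Q w G)) s = u"
    using phi_pre[OF B A N s(1) wG] Q_assoc[OF A B A N G(1,2) w(1)] G(3)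
      Q_comp_id(1)[OF A N w(1)] w(2) by simp
  show "\<exists>!v. v \<in> Hom U B (so N) \<and> Comp U v s = u"
  proof (rule ex1I[of _ "\<phi> B N (Comp Q w G)"])
    show "\<phi> B N (Comp Q w G) \<in> Hom U B (so N) \<and> Comp U (\<phi> B N (Comp Q w G)) s = u"
      using ex phi_in[OF B N wG] by blast
    fix v assume v: "v \<in> Hom U B (so N) \<and> Comp U v s = u"
    then obtain z where z: "z \<in> Hom Q B N" "v = \<phi> B N z" using phi_surj[OF B N] by blast
    have "\<phi> A N (Comp Q z (r s)) = \<phi> A N (Comp Q (Comp Q w G) (r s))"
      using phi_pre[OF B A N s(1) wG] phi_pre[OF B A N s(1) z(1)] ex v z(2) by simp
    then have "Comp Q z (r s) = Comp Q (Comp Q w G) (r s)"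
      by (rule phi_inj[OF A N Q_comp[OF A B N G(1) z(1)] Q_comp[OF A B N G(1) wG]])
    then have "z = Comp Q w G" by (rule iso_Q_cancel(1)[OF A B iso N z(1) wG])
    then show "v = \<phi> B N (Comp Q w G)" using z(2) by simp
  qed
qed

text \<open>\<open>\<eta> M\<close> becomes invertible in the quotient, with the counit as its
  inverse. One composite is a triangle identity. The other makes the counit invertible, that is,
  \<open>s\<^sub>k\<close> fully faithful, and uses that every arrow of the quotient, in particular
  the counit, is a fraction.\<close>

lemma nil_iso_unit:
  assumes M: "M \<in> Ob U"
  shows "nil_iso k (\<eta> M)"
proof (rule iso_imp_nil_iso[OF M so_Ob[OF M] unit_in[OF M]])
  let ?X = "so M"
  have X: "?X \<in> Ob U" by (rule so_Ob[OF M])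
  note \<eta> = unit_in[OF M]
  note r\<eta> = r_Hom[OF M X \<eta>]
  \<comment> \<open>The counit at \<open>M\<close>, as the arrow whose transpose is the identity of
    \<open>so M\<close>.\<close>
  obtain e where e: "e \<in> Hom Q ?X M" "Idn U ?X = \<phi> ?X M e"
    using phi_surj[OF X M id_in_Hom[OF X]] by blast
  have "\<phi> M M (Comp Q e (r (\<eta> M))) = \<phi> M M (Idn Q M)"
    using phi_pre[OF X M M \<eta> e(1)] e(2) comp_id(2)[OF \<eta> M X] by (simp add: l_unit_def)
  then have 1: "Comp Q e (r (\<eta> M)) = Idn Q M"
    by (rule phi_inj[OF M M Q_comp[OF M X M r\<eta> e(1)] Q_id[OF M]])
  obtain \<rho> where \<rho>r: "\<rho> \<in> roofs k ?X M" "e = frac k ?X M \<rho>" using e(1) unfolding Hom_Q by blast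
  obtain A s f where \<rho>: "\<rho> = (s, f)" "A \<in> Ob U" "s \<in> Hom U A ?X" "nil_iso k s" "f \<in> Hom U A M"
    by (rule roofsE[OF \<rho>r(1)])
  have "\<rho> \<in> app e" using mem_frac[OF \<rho>r(1) X] \<rho>r(2) by simp
  note A = \<rho>(2) and s = \<rho>(3,4) and f = \<rho>(5)
  note idA = id_in_Hom[OF A] and rs = r_Hom[OF A X s(1)] and rf = r_Hom[OF A M f]
  have idf: "(Idn U A, f) \<in> roofs k A M" by (rule roofsI[OF A idA nil_iso_id[OF A] f])
  have "(Idn U A, f) \<in> app (Comp Q e (r s))"
    by (rule comp_Q_mem[OF rs e(1) r_roof[OF s(1) A] _ A _ _ nil_iso_id[OF A]])
      (use \<rho>(1) \<open>\<rho> \<in> app e\<close> idA idf comp_id[OF s(1) A X] comp_id[OF f A M] comp_id[OF idA A A] A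
        in \<open>auto simp: hom_src[OF s(1)] hom_src[OF idA] intro: roof_equiv_refl\<close>)
  then have es: "Comp Q e (r s) = r f"
    by (rule Q_eqI[OF A M Q_comp[OF A X M rs e(1)] rf _ r_roof[OF f A]])
  \<comment> \<open>Transposing \<open>e \<circ> r s = r f\<close> yields
    \<open>s = \<eta> M \<circ> f\<close>; as \<open>r s\<close> is invertible, it can be cancelled,
    and \<open>e\<close> is a right inverse of \<open>r (\<eta> M)\<close>.\<close>
  have "s = \<phi> A M (Comp Q e (r s))"
    using phi_pre[OF X A M s(1) e(1)] e(2) comp_id(2)[OF s(1) A X] by simp
  also have "\<dots> = \<phi> A M (Comp Q (Idn Q M) (r f))"
    using es Q_comp_id(2)[OF A M rf] by simp
  also have "\<dots> = Comp U (\<eta> M) f"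
    unfolding l_unit_def by (rule phi_pre[OF M A M f Q_id[OF M]])
  finally have "r s = Comp Q (r (\<eta> M)) (r f)" using r_comp[OF A M X f \<eta>] by simp
  then have "Comp Q (Comp Q (r (\<eta> M)) e) (r s) = Comp Q (Idn Q ?X) (r s)"
    using Q_assoc[OF A X M X rs e(1) r\<eta>] es Q_comp_id(2)[OF A X rs] by simp
  then have "Comp Q (r (\<eta> M)) e = Idn Q ?X"
    by (rule iso_Q_cancel(1)[OF A X nil_iso_imp_iso[OF A X s] X Q_comp[OF X M X e(1) r\<eta>] Q_id[OF X]])
  with 1 r\<eta> e(1) show "iso_Q M ?X (r (\<eta> M))" unfolding iso_Q_def by blast
qed

end

lemma local_ext:
  assumes "local_module k X" "A \<in> Ob U" "B \<in> Ob U" "s \<in> Hom U A B" "nil_iso k s"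
    "u \<in> Hom U B X" "v \<in> Hom U B X" "\<And>n x. x \<in> el A n \<Longrightarrow> app u n (app s n x) = app v n (app s n x)"
  shows "u = v"
proof -
  have "Comp U u s = Comp U v s"
    using assms by (intro hom_eqI[OF comp_in_Hom comp_in_Hom, of s A B u X s B v])
        (simp_all add: comp_app)
  moreover have "Comp U v s \<in> Hom U A X" by (rule comp_in_Hom[OF assms(4,7,2)])
  ultimately show ?thesis
    using assms unfolding local_module_def by blast
qed

lemma local_extend:
  assumes "local_module k X" "A \<in> Ob U" "B \<in> Ob U" "s \<in> Hom U A B" "nil_iso k s" "u \<in> Hom U A X"
  shows "\<exists>v\<in>Hom U B X. Comp U v s = u"
  using assms unfolding local_module_def by blast

section \<open>Tensor products\<close>

lemma bilinear_pairingI: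
  assumes "\<And>i j x. x \<in> carrier (V i) \<Longrightarrow> (\<lambda>y. \<beta> i j x y) \<in> lin (W j) (P (i + j))"
    and "\<And>i j y. y \<in> carrier (W j) \<Longrightarrow> (\<lambda>x. \<beta> i j x y) \<in> lin (V i) (P (i + j))"
  shows "bilinear_pairing V W P \<beta>"
  using assms unfolding bilinear_pairing_def lin_def by blast

lemma bilinear_pairingD:
  assumes "bilinear_pairing V W P \<beta>"
  shows "x \<in> carrier (V i) \<Longrightarrow> (\<lambda>y. \<beta> i j x y) \<in> lin (W j) (P (i + j))"
    and "y \<in> carrier (W j) \<Longrightarrow> (\<lambda>x. \<beta> i j x y) \<in> lin (V i) (P (i + j))"
  using assms unfolding bilinear_pairing_def lin_def by blast+

text \<open>These are the pairings that are represented by arrows of \<open>U\<close> out of the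
  tensor product: see \<open>tensor_hom_exists\<close> for one direction and
  \<open>cartan_comp\<close> for the other.\<close>

definition cartan_pairing ::
  "'a umod \<Rightarrow> 'b umod \<Rightarrow> 'c umod \<Rightarrow> (nat \<Rightarrow> nat \<Rightarrow> 'a \<Rightarrow> 'b \<Rightarrow> 'c) \<Rightarrow> bool" where
  "cartan_pairing M N X \<beta> \<longleftrightarrow> bilinear_pairing (gr M) (gr N) (gr X) \<beta> \<and>
    (\<forall>r i j. \<forall>x\<in>el M i. \<forall>y\<in>el N j. Sq X r (i + j) (\<beta> i j x y) =
      (\<Oplus>\<^bsub>gr X (i + j + r)\<^esub> a \<in> {0..r}. \<beta> (i + a) (j + (r - a)) (Sq M a i x) (Sq N (r - a) j y)))"

lemma cartan_bilinear: "cartan_pairing M N X \<beta> \<Longrightarrow> bilinear_pairing (gr M) (gr N) (gr X) \<beta>"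
  by (simp add: cartan_pairing_def)

lemma cartan_Sq:
  "cartan_pairing M N X \<beta> \<Longrightarrow> x \<in> el M i \<Longrightarrow> y \<in> el N j \<Longrightarrow> Sq X r (i + j) (\<beta> i j x y) =
    (\<Oplus>\<^bsub>gr X (i + j + r)\<^esub> a \<in> {0..r}. \<beta> (i + a) (j + (r - a)) (Sq M a i x) (Sq N (r - a) j y))"
  by (simp add: cartan_pairing_def)

lemma cartan_lin:
  assumes "cartan_pairing M N X \<beta>"
  shows "x \<in> el M i \<Longrightarrow> (\<lambda>y. \<beta> i j x y) \<in> lin (gr N j) (gr X (i + j))"
    and "y \<in> el N j \<Longrightarrow> (\<lambda>x. \<beta> i j x y) \<in> lin (gr M i) (gr X (i + j))"
  using bilinear_pairingD[OF cartan_bilinear[OF assms]] by blast+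

lemma cartan_closed: "cartan_pairing M N X \<beta> \<Longrightarrow> x \<in> el M i \<Longrightarrow> y \<in> el N j \<Longrightarrow> \<beta> i j x y \<in> el X (i + j)"
  using lin_closed[OF cartan_lin(1)] .

lemma cartan_term_closed:
  assumes "cartan_pairing M N X \<beta>" "M \<in> Ob U" "N \<in> Ob U" "x \<in> el M i" "y \<in> el N j" "a \<le> r"
  shows "\<beta> (i + a) (j + (r - a)) (Sq M a i x) (Sq N (r - a) j y) \<in> el X (i + j + r)"
proof -
  have d: "(i + a) + (j + (r - a)) = i + j + r" using assms(6) by simp
  show ?thesis
    using cartan_closed[OF assms(1) Sq_closed[OF assms(2,4), of a] Sq_closed[OF assms(3,5), of "r - a"]]
    unfolding d .
qed

lemma cartan_comp:
  assumes \<beta>: "cartan_pairing M N X \<beta>" and h: "h \<in> Hom U X Y"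
    and O: "M \<in> Ob U" "N \<in> Ob U" "X \<in> Ob U" "Y \<in> Ob U"
  shows "cartan_pairing M N Y (\<lambda>i j x y. app h (i + j) (\<beta> i j x y))"
  unfolding cartan_pairing_def
proof (intro conjI bilinear_pairingI allI ballI)
  fix r i j x y assume x: "x \<in> el M i" and y: "y \<in> el N j"
  let ?t = "\<lambda>a. \<beta> (i + a) (j + (r - a)) (Sq M a i x) (Sq N (r - a) j y)"
  have t: "?t a \<in> el X (i + j + r)" if "a \<in> {0..r}" for a
    using cartan_term_closed[OF \<beta> O(1,2) x y] that by simp
  have "Sq Y r (i + j) (app h (i + j) (\<beta> i j x y)) = app h (i + j + r) (Sq X r (i + j) (\<beta> i j x y))"
    using hom_Sq[OF h cartan_closed[OF \<beta> x y]] by simp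
  also have "\<dots> = app h (i + j + r) (\<Oplus>\<^bsub>gr X (i + j + r)\<^esub> a \<in> {0..r}. ?t a)"
    using cartan_Sq[OF \<beta> x y] by simp
  also have "\<dots> = (\<Oplus>\<^bsub>gr Y (i + j + r)\<^esub> a \<in> {0..r}. app h (i + j + r) (?t a))"
    using t by (intro lin_finsum[OF mod_space[OF O(3)] mod_space[OF O(4)] hom_lin[OF h]]) auto
  also have "\<dots> = (\<Oplus>\<^bsub>gr Y (i + j + r)\<^esub> a \<in> {0..r}. app h (i + a + (j + (r - a))) (?t a))"
  proof (intro F2_finsum_cong[OF mod_space[OF O(4)] refl])
    fix a assume a: "a \<in> {0..r}"
    then have d: "i + a + (j + (r - a)) = i + j + r" by simp
    show "app h (i + j + r) (?t a) = app h (i + a + (j + (r - a))) (?t a)" unfolding d ..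
    show "app h (i + a + (j + (r - a))) (?t a) \<in> el Y (i + j + r)"
      unfolding d by (rule hom_closed[OF h t[OF a]])
  qed
  finally show "Sq Y r (i + j) (app h (i + j) (\<beta> i j x y)) =
    (\<Oplus>\<^bsub>gr Y (i + j + r)\<^esub> a \<in> {0..r}. app h (i + a + (j + (r - a))) (?t a))" .
qed (use lin_compose[OF cartan_lin(1)[OF \<beta>] hom_lin[OF h]] lin_compose[OF cartan_lin(2)[OF \<beta>]
    hom_lin[OF h]]
    in auto)

lemma cartan_pre:
  assumes \<beta>: "cartan_pairing M N X \<beta>" and f: "f \<in> Hom U M' M" and g: "g \<in> Hom U N' N"
    and O: "M \<in> Ob U" "N \<in> Ob U" "X \<in> Ob U"
  shows "cartan_pairing M' N' X (\<lambda>i j x y. \<beta> i j (app f i x) (app g j y))"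
  unfolding cartan_pairing_def
proof (intro conjI bilinear_pairingI allI ballI)
  fix r i j x y assume x: "x \<in> el M' i" and y: "y \<in> el N' j"
  note fx = hom_closed[OF f x] and gy = hom_closed[OF g y]
  show "Sq X r (i + j) (\<beta> i j (app f i x) (app g j y)) = (\<Oplus>\<^bsub>gr X (i + j + r)\<^esub> a \<in> {0..r}.
      \<beta> (i + a) (j + (r - a)) (app f (i + a) (Sq M' a i x)) (app g (j + (r - a)) (Sq N' (r - a) j y)))"
    unfolding hom_Sq[OF f x] hom_Sq[OF g y] by (rule cartan_Sq[OF \<beta> fx gy])
qed (use lin_compose[OF hom_lin[OF g] cartan_lin(1)[OF \<beta> hom_closed[OF f]]]
    lin_compose[OF hom_lin[OF f] cartan_lin(2)[OF \<beta> hom_closed[OF g]]] in auto)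

text \<open>Exchanging the arguments reverses the order of the Cartan sum, which
  \<open>F2_finsum_rev\<close> undoes.\<close>

lemma cartan_swap:
  assumes \<beta>: "cartan_pairing M N X \<beta>" and O: "M \<in> Ob U" "N \<in> Ob U" "X \<in> Ob U"
  shows "cartan_pairing N M X (\<lambda>i j x y. \<beta> j i y x)"
  unfolding cartan_pairing_def
proof (intro conjI bilinear_pairingI allI ballI)
  show "(\<lambda>y. \<beta> j i y x) \<in> lin (gr M j) (gr X (i + j))" if "x \<in> el N i" for i j x
    using cartan_lin(2)[OF \<beta> that, of j] by (simp add: add.commute)
  show "(\<lambda>x. \<beta> j i y x) \<in> lin (gr N i) (gr X (i + j))" if "y \<in> el M j" for i j y
    using cartan_lin(1)[OF \<beta> that, of i] by (simp add: add.commute)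
  fix r i j x y assume x: "x \<in> el N i" and y: "y \<in> el M j"
  let ?t = "\<lambda>a. \<beta> (j + a) (i + (r - a)) (Sq M a j y) (Sq N (r - a) i x)"
  have t: "?t a \<in> el X (i + j + r)" if "a \<le> r" for a
    using cartan_term_closed[OF \<beta> O(1,2) y x that] unfolding add.commute[of j i] .
  have "Sq X r (i + j) (\<beta> j i y x) = (\<Oplus>\<^bsub>gr X (i + j + r)\<^esub> a \<in> {0..r}. ?t a)"
    using cartan_Sq[OF \<beta> y x, of r] unfolding add.commute[of j i] .
  also have "\<dots> = (\<Oplus>\<^bsub>gr X (i + j + r)\<^esub> a \<in> {0..r}. ?t (r - a))"
    using t by (rule F2_finsum_rev[OF mod_space[OF O(3)], symmetric])
  also have "\<dots> = (\<Oplus>\<^bsub>gr X (i + j + r)\<^esub> a \<in> {0..r}.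
      \<beta> (j + (r - a)) (i + a) (Sq M (r - a) j y) (Sq N a i x))"
  proof (intro F2_finsum_cong[OF mod_space[OF O(3)] refl])
    fix a assume a: "a \<in> {0..r}"
    show "\<beta> (j + (r - a)) (i + (r - (r - a))) (Sq M (r - a) j y) (Sq N (r - (r - a)) i x) =
        \<beta> (j + (r - a)) (i + a) (Sq M (r - a) j y) (Sq N a i x)"
      using a by simp
    show "\<beta> (j + (r - a)) (i + a) (Sq M (r - a) j y) (Sq N a i x) \<in> el X (i + j + r)"
      using a t[of "r - a"] by simp
  qed
  finally show "Sq X r (i + j) (\<beta> j i y x) = (\<Oplus>\<^bsub>gr X (i + j + r)\<^esub> a \<in> {0..r}.
      \<beta> (j + (r - a)) (i + a) (Sq M (r - a) j y) (Sq N a i x))" .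
qed

section \<open>The universal property of the tensor product\<close>

locale tensor_choice =
  fixes T :: "'a tensor"
  assumes choice: "is_tensor_choice T" and infinite_UNIV: "infinite (UNIV :: 'a set)"
begin

lemma is_tensor_tob: "M \<in> Ob U \<Longrightarrow> N \<in> Ob U \<Longrightarrow> is_tensor M N (tob T M N) (tel T M N)"
  using choice by (simp add: is_tensor_choice_def)

lemma tob_Ob: "M \<in> Ob U \<Longrightarrow> N \<in> Ob U \<Longrightarrow> tob T M N \<in> Ob U"
  using is_tensor_tob by (simp add: is_tensor_def)

lemma cartan_tel: "M \<in> Ob U \<Longrightarrow> N \<in> Ob U \<Longrightarrow> cartan_pairing M N (tob T M N) (tel T M N)"
  using is_tensor_tob[of M N] unfolding is_tensor_def cartan_pairing_def by simp

lemma tel_closed: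
  "M \<in> Ob U \<Longrightarrow> N \<in> Ob U \<Longrightarrow> x \<in> el M i \<Longrightarrow> y \<in> el N j \<Longrightarrow> tel T M N i j x y \<in> el (tob T M N) (i + j)"
  using cartan_closed[OF cartan_tel] .

lemma tel_lin:
  assumes "M \<in> Ob U" "N \<in> Ob U"
  shows "x \<in> el M i \<Longrightarrow> (\<lambda>y. tel T M N i j x y) \<in> lin (gr N j) (gr (tob T M N) (i + j))"
    and "y \<in> el N j \<Longrightarrow> (\<lambda>x. tel T M N i j x y) \<in> lin (gr M i) (gr (tob T M N) (i + j))"
  using cartan_lin[OF cartan_tel[OF assms]] by auto

lemma tel_zero:
  assumes "M \<in> Ob U" "N \<in> Ob U"
  shows "x \<in> el M i \<Longrightarrow> tel T M N i j x \<zero>\<^bsub>gr N j\<^esub> = \<zero>\<^bsub>gr (tob T M N) (i + j)\<^esub>"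
    and "y \<in> el N j \<Longrightarrow> tel T M N i j \<zero>\<^bsub>gr M i\<^esub> y = \<zero>\<^bsub>gr (tob T M N) (i + j)\<^esub>"
  using lin_zero[OF mod_space[OF assms(2)] mod_space[OF tob_Ob[OF assms]] tel_lin(1)[OF assms]]
    lin_zero[OF mod_space[OF assms(1)] mod_space[OF tob_Ob[OF assms]] tel_lin(2)[OF assms]] by auto

text \<open>This is the existence half of the universal property; the uniqueness half enters through
  \<open>tensor_induct\<close>.\<close>

lemma tensor_univ:
  fixes W :: "nat \<Rightarrow> 'a ring"
  assumes O: "M \<in> Ob U" "N \<in> Ob U" and W: "\<And>n. F2_space (W n)"
    and \<beta>: "bilinear_pairing (gr M) (gr N) W \<beta>"
  shows "\<exists>h. (\<forall>n. h n \<in> lin (gr (tob T M N) n) (W n)) \<and>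
    (\<forall>i j. \<forall>x\<in>el M i. \<forall>y\<in>el N j. h (i + j) (tel T M N i j x y) = \<beta> i j x y)"
proof -
  have "\<exists>!h. (\<forall>n. h n \<in> F2_linear (gr (tob T M N) n) (W n) \<inter> extensional (el (tob T M N) n)) \<and>
      (\<forall>i j. \<forall>x\<in>el M i. \<forall>y\<in>el N j. h (i + j) (tel T M N i j x y) = \<beta> i j x y)"
    using is_tensor_tob[OF O] W \<beta> unfolding is_tensor_def by blast
  then show ?thesis unfolding lin_def by blast
qed

text \<open>Tensors of elements generate, by uniqueness in the universal property: let
  \<open>q\<close> be a linear projection whose kernel is the subspace on which \<open>Q\<close>
  holds; then \<open>1 + q\<close> and \<open>1\<close> agree on all tensors, so
  \<open>q = 0\<close>. Working with \<open>q\<close> on the tensor product itself keeps the target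
  in the type \<open>'a\<close>.\<close>

lemma tensor_induct:
  assumes O: "M \<in> Ob U" "N \<in> Ob U" and x: "x \<in> el (tob T M N) n"
    and Q0: "Q \<zero>\<^bsub>gr (tob T M N) n\<^esub>"
    and Qadd: "\<And>x y. x \<in> el (tob T M N) n \<Longrightarrow> y \<in> el (tob T M N) n \<Longrightarrow> Q x \<Longrightarrow> Q y \<Longrightarrow>
      Q (x \<oplus>\<^bsub>gr (tob T M N) n\<^esub> y)"
    and Qtel: "\<And>i j x y. i + j = n \<Longrightarrow> x \<in> el M i \<Longrightarrow> y \<in> el N j \<Longrightarrow> Q (tel T M N i j x y)"
  shows "Q x"
proof -
  let ?P = "tob T M N"
  note P = tob_Ob[OF O]
  note V = mod_space[OF P]
  \<comment> \<open>Only degree \<open>n\<close> matters; the other degrees are taken whole, so that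
    \<open>q\<close> vanishes there.\<close>
  define S where "S m = (if m = n then {x \<in> el ?P n. Q x} else el ?P m)" for m
  have S: "F2_subspace (S m) (gr ?P m)" for m
    using Q0 Qadd by (intro F2_subspaceI) (auto simp: S_def el_zero[OF P] F2_add[OF V])
  have "\<forall>m. \<exists>q. q \<in> lin (gr ?P m) (gr ?P m) \<and>
      (\<forall>x\<in>el ?P m. (q x = \<zero>\<^bsub>gr ?P m\<^esub> \<longleftrightarrow> x \<in> S m) \<and> q (q x) = q x)"
    using F2_projection[OF V S] by blast
  then obtain q where q: "\<And>m. q m \<in> lin (gr ?P m) (gr ?P m)"
    "\<And>m x. x \<in> el ?P m \<Longrightarrow> q m x = \<zero>\<^bsub>gr ?P m\<^esub> \<longleftrightarrow> x \<in> S m" by metis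
  define h where "h m = restrict (\<lambda>x. x \<oplus>\<^bsub>gr ?P m\<^esub> q m x) (el ?P m)" for m
  define e where "e m = restrict (\<lambda>x. x) (el ?P m)" for m
  let ?spec = "\<lambda>h. (\<forall>m. h m \<in> F2_linear (gr ?P m) (gr ?P m) \<inter> extensional (el ?P m)) \<and>
      (\<forall>i j. \<forall>x\<in>el M i. \<forall>y\<in>el N j. h (i + j) (tel T M N i j x y) = tel T M N i j x y)"
  have ex1: "\<exists>!h. ?spec h"
    using is_tensor_tob[OF O] V cartan_bilinear[OF cartan_tel[OF O]] unfolding is_tensor_def by blast
  have sh: "?spec h"
  proof (intro conjI allI ballI IntI)
    show "h m \<in> F2_linear (gr ?P m) (gr ?P m)" for m
      unfolding lin_def[symmetric]
      by (rule lin_cong[OF lin_plus[OF V lin_id q(1)] V]) (simp add: h_def)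
    show "h m \<in> extensional (el ?P m)" for m by (simp add: h_def)
    fix i j x y assume xy: "x \<in> el M i" "y \<in> el N j"
    then have t: "tel T M N i j x y \<in> el ?P (i + j)" by (rule tel_closed[OF O])
    then have "tel T M N i j x y \<in> S (i + j)" using Qtel xy by (cases "i + j = n") (auto simp: S_def)
    then show "h (i + j) (tel T M N i j x y) = tel T M N i j x y"
      using q(2)[OF t] t by (simp add: h_def F2_add_zero[OF V])
  qed
  have se: "?spec e"
  proof (intro conjI allI ballI IntI)
    show "e m \<in> F2_linear (gr ?P m) (gr ?P m)" for m
      unfolding lin_def[symmetric] by (rule lin_cong[OF lin_id V]) (simp add: e_def)
    show "e m \<in> extensional (el ?P m)" for m by (simp add: e_def)
  qed (simp add: e_def tel_closed[OF O])
  have "h = e"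
  proof (rule ex1E[OF ex1])
    fix z assume "\<forall>y. ?spec y \<longrightarrow> y = z"
    from mp[OF spec[OF this] sh] mp[OF spec[OF this] se] show ?thesis by simp
  qed
  then have "h n x = e n x" by simp
  then have e: "x \<oplus>\<^bsub>gr ?P n\<^esub> q n x = x"
    using x unfolding h_def e_def by simp
  have "q n x = \<zero>\<^bsub>gr ?P n\<^esub>"
    using F2_cancel_self[OF V x lin_closed[OF q(1) x]] F2_add_self[OF V x] unfolding e by simp
  then have "x \<in> S n" using q(2)[OF x] by blast
  then show ?thesis by (simp add: S_def)
qed

lemma tensor_lin_eqI:
  assumes O: "M \<in> Ob U" "N \<in> Ob U" and W: "F2_space W"
    and f: "f \<in> lin (gr (tob T M N) n) W" and g: "g \<in> lin (gr (tob T M N) n) W"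
    and eq: "\<And>i j x y. i + j = n \<Longrightarrow> x \<in> el M i \<Longrightarrow> y \<in> el N j \<Longrightarrow>
      f (tel T M N i j x y) = g (tel T M N i j x y)"
    and x: "x \<in> el (tob T M N) n"
  shows "f x = g x"
  using O x
proof (rule tensor_induct)
  show "f \<zero>\<^bsub>gr (tob T M N) n\<^esub> = g \<zero>\<^bsub>gr (tob T M N) n\<^esub>"
    using lin_zero[OF mod_space[OF tob_Ob[OF O]] W f] lin_zero[OF mod_space[OF tob_Ob[OF O]] W g]
        by simp
qed (simp_all add: lin_add[OF f] lin_add[OF g] eq)

lemma tensor_hom_eqI:
  assumes O: "M \<in> Ob U" "N \<in> Ob U" "X \<in> Ob U"
    and f: "f \<in> Hom U (tob T M N) X" and g: "g \<in> Hom U (tob T M N) X"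
    and eq: "\<And>i j x y. x \<in> el M i \<Longrightarrow> y \<in> el N j \<Longrightarrow>
      app f (i + j) (tel T M N i j x y) = app g (i + j) (tel T M N i j x y)"
  shows "f = g"
proof (rule hom_eqI[OF f g])
  fix n z assume z: "z \<in> el (tob T M N) n"
  show "app f n z = app g n z"
    by (rule tensor_lin_eqI[OF O(1,2) mod_space[OF O(3)] hom_lin[OF f] hom_lin[OF g] _ z])
      (use eq in auto)
qed

text \<open>Bilinearity alone gives a linear map. It commutes with the squares because it does so on
  tensors of elements, where both sides are Cartan sums.\<close>

lemma tensor_hom_exists:
  assumes O: "M \<in> Ob U" "N \<in> Ob U" "X \<in> Ob U" and \<beta>: "cartan_pairing M N X \<beta>"
  shows "\<exists>h\<in>Hom U (tob T M N) X. \<forall>i j. \<forall>x\<in>el M i. \<forall>y\<in>el N j.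
    app h (i + j) (tel T M N i j x y) = \<beta> i j x y"
proof -
  let ?P = "tob T M N"
  note P = tob_Ob[OF O(1,2)] and X = mod_space[OF O(3)]
  obtain h where h: "\<And>n. h n \<in> lin (gr ?P n) (gr X n)"
    "\<And>i j x y. x \<in> el M i \<Longrightarrow> y \<in> el N j \<Longrightarrow> h (i + j) (tel T M N i j x y) = \<beta> i j x y"
    using tensor_univ[OF O(1,2) X cartan_bilinear[OF \<beta>]] by metis
  have "uarr ?P X h \<in> Hom U ?P X"
  proof (rule uarr_in_Hom[OF P h(1)])
    fix r n z assume z: "z \<in> el ?P n"
    show "h (n + r) (Sq ?P r n z) = Sq X r n (h n z)"
    proof (rule tensor_lin_eqI[OF O(1,2) X lin_compose[OF Sq_lin[OF P] h(1)]
        lin_compose[OF h(1) Sq_lin[OF O(3)]] _ z])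
      fix i j x y assume n: "i + j = n" and x: "x \<in> el M i" and y: "y \<in> el N j"
      let ?t = "\<lambda>a. tel T M N (i + a) (j + (r - a)) (Sq M a i x) (Sq N (r - a) j y)"
      have "h (i + j + r) (Sq ?P r (i + j) (tel T M N i j x y)) =
          h (i + j + r) (\<Oplus>\<^bsub>gr ?P (i + j + r)\<^esub> a \<in> {0..r}. ?t a)"
        using cartan_Sq[OF cartan_tel[OF O(1,2)] x y] by simp
      also have "\<dots> = (\<Oplus>\<^bsub>gr X (i + j + r)\<^esub> a \<in> {0..r}. h (i + j + r) (?t a))"
        using cartan_term_closed[OF cartan_tel[OF O(1,2)] O(1,2) x y]
        by (intro lin_finsum[OF mod_space[OF P] X h(1)]) auto
      also have "\<dots> = (\<Oplus>\<^bsub>gr X (i + j + r)\<^esub> a \<in> {0..r}.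
          \<beta> (i + a) (j + (r - a)) (Sq M a i x) (Sq N (r - a) j y))"
      proof (intro F2_finsum_cong[OF X refl])
        fix a assume a: "a \<in> {0..r}"
        then have d: "i + a + (j + (r - a)) = i + j + r" by simp
        show "h (i + j + r) (?t a) = \<beta> (i + a) (j + (r - a)) (Sq M a i x) (Sq N (r - a) j y)"
          using h(2)[OF Sq_closed[OF O(1) x, of a] Sq_closed[OF O(2) y, of "r - a"]] unfolding d .
        show "\<beta> (i + a) (j + (r - a)) (Sq M a i x) (Sq N (r - a) j y) \<in> el X (i + j + r)"
          using a cartan_term_closed[OF \<beta> O(1,2) x y] by simp
      qed
      also have "\<dots> = Sq X r (i + j) (h (i + j) (tel T M N i j x y))"
        using cartan_Sq[OF \<beta> x y] h(2)[OF x y] by simp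
      finally show "h (n + r) (Sq ?P r n (tel T M N i j x y)) = Sq X r n (h n (tel T M N i j x y))"
        unfolding n .
    qed
  qed
  then show ?thesis
    using h(2) tel_closed[OF O(1,2)] by (intro bexI[of _ "uarr ?P X h"]) (auto simp: uarr_app)
qed

section \<open>Functoriality and associativity of the tensor product\<close>

lemma tmap_ex1:
  assumes O: "M \<in> Ob U" "N \<in> Ob U" "M' \<in> Ob U" "N' \<in> Ob U"
    and f: "f \<in> Hom U M M'" and g: "g \<in> Hom U N N'"
  shows "\<exists>!h. h \<in> Hom U (tob T M N) (tob T M' N') \<and>
     (\<forall>i j. \<forall>x\<in>el M i. \<forall>y\<in>el N j.
        app h (i + j) (tel T M N i j x y) = tel T M' N' i j (app f i x) (app g j y))"
proof (rule ex_ex1I)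
  show "\<exists>h. h \<in> Hom U (tob T M N) (tob T M' N') \<and>
     (\<forall>i j. \<forall>x\<in>el M i. \<forall>y\<in>el N j.
        app h (i + j) (tel T M N i j x y) = tel T M' N' i j (app f i x) (app g j y))"
    using tensor_hom_exists[OF O(1,2) tob_Ob[OF O(3,4)] cartan_pre[OF cartan_tel[OF O(3,4)] f g
        O(3,4) tob_Ob[OF O(3,4)]]]
    by blast
qed (rule tensor_hom_eqI[OF O(1,2) tob_Ob[OF O(3,4)]], auto)

lemma tmap_in:
  assumes O: "M \<in> Ob U" "N \<in> Ob U" "M' \<in> Ob U" "N' \<in> Ob U"
    and f: "f \<in> Hom U M M'" and g: "g \<in> Hom U N N'"
  shows "tmap T f g \<in> Hom U (tob T M N) (tob T M' N')"
  using theI'[OF tmap_ex1[OF assms]]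
  unfolding tmap_def hom_src[OF f] hom_src[OF g] hom_tgt[OF f] hom_tgt[OF g] by blast

lemma tmap_app:
  assumes O: "M \<in> Ob U" "N \<in> Ob U" "M' \<in> Ob U" "N' \<in> Ob U"
    and f: "f \<in> Hom U M M'" and g: "g \<in> Hom U N N'" and x: "x \<in> el M i" and y: "y \<in> el N j"
  shows "app (tmap T f g) (i + j) (tel T M N i j x y) = tel T M' N' i j (app f i x) (app g j y)"
  using theI'[OF tmap_ex1[OF O f g]] x y
  unfolding tmap_def hom_src[OF f] hom_src[OF g] hom_tgt[OF f] hom_tgt[OF g] by blast

lemma tmap_comp:
  assumes O: "M \<in> Ob U" "N \<in> Ob U" "M' \<in> Ob U" "N' \<in> Ob U" "M'' \<in> Ob U" "N'' \<in> Ob U"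
    and f: "f \<in> Hom U M M'" "f' \<in> Hom U M' M''" and g: "g \<in> Hom U N N'" "g' \<in> Hom U N' N''"
  shows "Comp U (tmap T f' g') (tmap T f g) = tmap T (Comp U f' f) (Comp U g' g)"
proof -
  note ff = comp_in_Hom[OF f O(1)] and gg = comp_in_Hom[OF g O(2)]
  note t = tmap_in[OF O(1-4) f(1) g(1)] and t' = tmap_in[OF O(3-6) f(2) g(2)]
  show ?thesis
  proof (rule tensor_hom_eqI[OF O(1,2) tob_Ob[OF O(5,6)] comp_in_Hom[OF t t' tob_Ob[OF O(1,2)]]
      tmap_in[OF O(1,2,5,6) ff gg]])
    fix i j x y assume x: "x \<in> el M i" and y: "y \<in> el N j"
    show "app (Comp U (tmap T f' g') (tmap T f g)) (i + j) (tel T M N i j x y) =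
        app (tmap T (Comp U f' f) (Comp U g' g)) (i + j) (tel T M N i j x y)"
      using comp_app[OF t tel_closed[OF O(1,2) x y]] tmap_app[OF O(1-4) f(1) g(1) x y]
        tmap_app[OF O(3-6) f(2) g(2) hom_closed[OF f(1) x] hom_closed[OF g(1) y]]
        tmap_app[OF O(1,2,5,6) ff gg x y] comp_app[OF f(1) x] comp_app[OF g(1) y] by simp
  qed
qed

text \<open>For fixed \<open>z\<close> the map is defined by the universal property of
  \<open>L \<otimes> M\<close>. Both sides of its Cartan formula are linear in \<open>w\<close>, so
  the formula is checked for \<open>w = x \<otimes> y\<close>, where each side is a sum over the
  ways to distribute \<open>s\<close> among three factors.\<close>

lemma assoc_pairing:
  assumes O: "L \<in> Ob U" "M \<in> Ob U" "N \<in> Ob U"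
  shows "\<exists>\<gamma>. cartan_pairing (tob T L M) N (tob T L (tob T M N)) \<gamma> \<and>
    (\<forall>i j r. \<forall>x\<in>el L i. \<forall>y\<in>el M j. \<forall>z\<in>el N r.
      \<gamma> (i + j) r (tel T L M i j x y) z = tel T L (tob T M N) i (j + r) x (tel T M N j r y z))"
proof -
  let ?LM = "tob T L M" and ?MN = "tob T M N"
  let ?X = "tob T L ?MN"
  note LM = tob_Ob[OF O(1,2)] and MN = tob_Ob[OF O(2,3)]
  note X = tob_Ob[OF O(1) MN]
  note VX = mod_space[OF X]
  have l1: "(\<lambda>y. tel T L ?MN i (j + r) x (tel T M N j r y z)) \<in> lin (gr M j) (gr ?X (i + j + r))"
    if "x \<in> el L i" "z \<in> el N r" for i j r x z
    using lin_compose[OF tel_lin(2)[OF O(2,3) that(2)] tel_lin(1)[OF O(1) MN that(1)]]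
    by (simp add: add.assoc)
  have l2: "(\<lambda>x. tel T L ?MN i (j + r) x (tel T M N j r y z)) \<in> lin (gr L i) (gr ?X (i + j + r))"
    if "y \<in> el M j" "z \<in> el N r" for i j r y z
    using tel_lin(2)[OF O(1) MN tel_closed[OF O(2,3) that]] by (simp add: add.assoc)
  have l3: "(\<lambda>z. tel T L ?MN i (j + r) x (tel T M N j r y z)) \<in> lin (gr N r) (gr ?X (i + j + r))"
    if "x \<in> el L i" "y \<in> el M j" for i j r x y
    using lin_compose[OF tel_lin(1)[OF O(2,3) that(2)] tel_lin(1)[OF O(1) MN that(1)]]
    by (simp add: add.assoc)
  let ?spec = "\<lambda>r z h. (\<forall>n. h n \<in> lin (gr ?LM n) (gr ?X (n + r))) \<and> (\<forall>i j. \<forall>x\<in>el L i. \<forall>y\<in>el M j.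
      h (i + j) (tel T L M i j x y) = tel T L ?MN i (j + r) x (tel T M N j r y z))"
  \<comment> \<open>The target is the triple product regraded by \<open>r\<close>. The universal
    property speaks of graded spaces and not of modules, so this shift is admissible.\<close>
  have ex: "\<exists>h. ?spec r z h" if "z \<in> el N r" for r z
    using that l1 l2
    by (intro tensor_univ[OF O(1,2), of "\<lambda>n. gr ?X (n + r)"] VX bilinear_pairingI)
  define A where "A r z = (SOME h. ?spec r z h)" for r z
  have A: "?spec r z (A r z)" if "z \<in> el N r" for r z
    unfolding A_def by (rule someI_ex[OF ex[OF that]])
  define \<gamma> where "\<gamma> n r w z = A r z n w" for n r w z
  have \<gamma>1: "(\<lambda>w. \<gamma> n r w z) \<in> lin (gr ?LM n) (gr ?X (n + r))" if "z \<in> el N r" for n r z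
    using A[OF that] by (simp add: \<gamma>_def)
  have \<gamma>_tel: "\<gamma> (i + j) r (tel T L M i j x y) z = tel T L ?MN i (j + r) x (tel T M N j r y z)"
    if "x \<in> el L i" "y \<in> el M j" "z \<in> el N r" for i j r x y z
    using A[OF that(3)] that(1,2) by (simp add: \<gamma>_def)
  \<comment> \<open>The maps \<open>A r z\<close> are chosen independently for each
    \<open>z\<close>; linearity in \<open>z\<close> is recovered from their values on tensors
    \<open>x \<otimes> y\<close>.\<close>
  have \<gamma>2: "(\<lambda>z. \<gamma> n r w z) \<in> lin (gr N r) (gr ?X (n + r))" if "w \<in> el ?LM n" for n r w
    using O(1,2) that
  proof (rule tensor_induct)
    show "(\<lambda>z. \<gamma> n r \<zero>\<^bsub>gr ?LM n\<^esub> z) \<in> lin (gr N r) (gr ?X (n + r))"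
      by (rule lin_cong[OF lin_const_zero[OF VX] mod_space[OF O(3)]])
        (simp add: lin_zero[OF mod_space[OF LM] VX \<gamma>1])
    show "(\<lambda>z. \<gamma> n r (w \<oplus>\<^bsub>gr ?LM n\<^esub> w') z) \<in> lin (gr N r) (gr ?X (n + r))"
      if "w \<in> el ?LM n" "w' \<in> el ?LM n" "(\<lambda>z. \<gamma> n r w z) \<in> lin (gr N r) (gr ?X (n + r))"
        "(\<lambda>z. \<gamma> n r w' z) \<in> lin (gr N r) (gr ?X (n + r))" for w w'
      by (rule lin_cong[OF lin_plus[OF VX that(3,4)] mod_space[OF O(3)]])
        (simp add: lin_add[OF \<gamma>1] that)
    show "(\<lambda>z. \<gamma> n r (tel T L M i j x y) z) \<in> lin (gr N r) (gr ?X (n + r))"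
      if "i + j = n" "x \<in> el L i" "y \<in> el M j" for i j x y
      unfolding that(1)[symmetric]
      by (rule lin_cong[OF l3[OF that(2,3)] mod_space[OF O(3)]]) (rule \<gamma>_tel[OF that(2,3), symmetric])
  qed
  have deg: "n + a + (r + (s - a)) = n + r + s" if "a \<in> {0..s}" for n r s a :: nat
    using that by simp
  have "Sq ?X s (n + r) (\<gamma> n r w z) =
      (\<Oplus>\<^bsub>gr ?X (n + r + s)\<^esub> a \<in> {0..s}. \<gamma> (n + a) (r + (s - a)) (Sq ?LM a n w) (Sq N (s - a) r z))"
    if w: "w \<in> el ?LM n" and z: "z \<in> el N r" for s n r w z
  proof (rule tensor_lin_eqI[OF O(1,2) VX lin_compose[OF \<gamma>1[OF z] Sq_lin[OF X]] lin_sum[OF VX] _ w])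
    show "(\<lambda>w. \<gamma> (n + a) (r + (s - a)) (Sq ?LM a n w) (Sq N (s - a) r z)) \<in> lin (gr ?LM n)
        (gr ?X (n + r + s))"
      if "a \<in> {0..s}" for a
      using lin_compose[OF Sq_lin[OF LM, of a n] \<gamma>1[OF Sq_closed[OF O(3) z, of "s - a"]]]
      unfolding deg[OF that] .
    fix i j x y assume n: "i + j = n" and x: "x \<in> el L i" and y: "y \<in> el M j"
    \<comment> \<open>The summand in which \<open>x\<close>, \<open>y\<close> and \<open>z\<close>
      receive squares of index \<open>a\<close>, \<open>b\<close> and
      \<open>s - a - b\<close>.\<close>
    define F where "F a b = tel T L ?MN (i + a) (j + b + (r + (s - a - b))) (Sq L a i x)
        (tel T M N (j + b) (r + (s - a - b)) (Sq M b j y) (Sq N (s - a - b) r z))" for a b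
    have F: "F a b \<in> el ?X (i + j + r + s)" if "a + b \<le> s" for a b
    proof -
      have d: "i + a + (j + b + (r + (s - a - b))) = i + j + r + s" using that by simp
      show ?thesis
        using tel_closed[OF O(1) MN Sq_closed[OF O(1) x, of a]
            tel_closed[OF O(2,3) Sq_closed[OF O(2) y, of b] Sq_closed[OF O(3) z, of "s - a - b"]]]
        unfolding F_def d .
    qed
    have "Sq ?X s (i + (j + r)) (tel T L ?MN i (j + r) x (tel T M N j r y z)) =
        (\<Oplus>\<^bsub>gr ?X (i + (j + r) + s)\<^esub> a \<in> {0..s}. tel T L ?MN (i + a) (j + r + (s - a))
          (Sq L a i x) (Sq ?MN (s - a) (j + r) (tel T M N j r y z)))"
      by (rule cartan_Sq[OF cartan_tel[OF O(1) MN] x tel_closed[OF O(2,3) y z]])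
    also have "\<dots> = (\<Oplus>\<^bsub>gr ?X (i + j + r + s)\<^esub> a \<in> {0..s}. \<Oplus>\<^bsub>gr ?X (i + j + r + s)\<^esub> b \<in> {0..s - a}. F a b)"
      unfolding add.assoc[of i j r, symmetric]
    proof (intro F2_finsum_cong[OF VX refl])
      fix a assume a: "a \<in> {0..s}"
      have d: "i + a + (j + r + (s - a)) = i + j + r + s" using a by simp
      let ?u = "\<lambda>b. tel T M N (j + b) (r + (s - a - b)) (Sq M b j y) (Sq N (s - a - b) r z)"
      have u: "?u b \<in> el ?MN (j + r + (s - a))" if "b \<in> {0..s - a}" for b
        by (rule cartan_term_closed[OF cartan_tel[OF O(2,3)] O(2,3) y z]) (use that in simp)
      have "tel T L ?MN (i + a) (j + r + (s - a)) (Sq L a i x) (Sq ?MN (s - a) (j + r)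
          (tel T M N j r y z)) =
          tel T L ?MN (i + a) (j + r + (s - a)) (Sq L a i x) (\<Oplus>\<^bsub>gr ?MN (j + r + (s - a))\<^esub> b \<in>
              {0..s - a}. ?u b)"
        using cartan_Sq[OF cartan_tel[OF O(2,3)] y z] by simp
      also have "\<dots> = (\<Oplus>\<^bsub>gr ?X (i + a + (j + r + (s - a)))\<^esub> b \<in> {0..s - a}.
          tel T L ?MN (i + a) (j + r + (s - a)) (Sq L a i x) (?u b))"
        using u by (intro lin_finsum[OF mod_space[OF MN] VX tel_lin(1)[OF O(1) MN Sq_closed[OF O(1)
            x]]]) auto
      also have "\<dots> = (\<Oplus>\<^bsub>gr ?X (i + j + r + s)\<^esub> b \<in> {0..s - a}. F a b)"
        unfolding d
      proof (intro F2_finsum_cong[OF VX refl])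
        fix b assume b: "b \<in> {0..s - a}"
        then have d': "j + b + (r + (s - a - b)) = j + r + (s - a)" using a by simp
        show "tel T L ?MN (i + a) (j + r + (s - a)) (Sq L a i x) (?u b) = F a b"
          unfolding F_def d' ..
        show "F a b \<in> el ?X (i + j + r + s)" using a b by (intro F) simp
      qed
      finally show "tel T L ?MN (i + a) (j + r + (s - a)) (Sq L a i x) (Sq ?MN (s - a) (j + r)
          (tel T M N j r y z)) =
          (\<Oplus>\<^bsub>gr ?X (i + j + r + s)\<^esub> b \<in> {0..s - a}. F a b)" .
      show "(\<Oplus>\<^bsub>gr ?X (i + j + r + s)\<^esub> b \<in> {0..s - a}. F a b) \<in> el ?X (i + j + r + s)"
        using a by (intro F2_finsum[OF VX] F) auto
    qed
    \<comment> \<open>The summands are collected by \<open>c = a + b\<close>, the index of the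
      square acting on \<open>x \<otimes> y\<close>.\<close>
    also have "\<dots> = (\<Oplus>\<^bsub>gr ?X (i + j + r + s)\<^esub> c \<in> {0..s}. \<Oplus>\<^bsub>gr ?X (i + j + r + s)\<^esub> a \<in> {0..c}. F a (c - a))"
      using F by (rule F2_finsum_triangle[OF VX])
    also have "\<dots> = (\<Oplus>\<^bsub>gr ?X (i + j + r + s)\<^esub> c \<in> {0..s}.
        \<gamma> (i + j + c) (r + (s - c)) (Sq ?LM c (i + j) (tel T L M i j x y)) (Sq N (s - c) r z))"
    proof (intro F2_finsum_cong[OF VX refl])
      fix c assume c: "c \<in> {0..s}"
      note z' = Sq_closed[OF O(3) z, of "s - c"]
      let ?v = "\<lambda>a. tel T L M (i + a) (j + (c - a)) (Sq L a i x) (Sq M (c - a) j y)"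
      have v: "?v a \<in> el ?LM (i + j + c)" if "a \<in> {0..c}" for a
        by (rule cartan_term_closed[OF cartan_tel[OF O(1,2)] O(1,2) x y]) (use that in simp)
      have "\<gamma> (i + j + c) (r + (s - c)) (Sq ?LM c (i + j) (tel T L M i j x y)) (Sq N (s - c) r z) =
          \<gamma> (i + j + c) (r + (s - c)) (\<Oplus>\<^bsub>gr ?LM (i + j + c)\<^esub> a \<in> {0..c}. ?v a) (Sq N (s - c) r z)"
        using cartan_Sq[OF cartan_tel[OF O(1,2)] x y] by simp
      also have "\<dots> = (\<Oplus>\<^bsub>gr ?X (i + j + c + (r + (s - c)))\<^esub> a \<in> {0..c}.
          \<gamma> (i + j + c) (r + (s - c)) (?v a) (Sq N (s - c) r z))"
        using v by (intro lin_finsum[OF mod_space[OF LM] VX \<gamma>1[OF z']]) auto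
      also have "\<dots> = (\<Oplus>\<^bsub>gr ?X (i + j + r + s)\<^esub> a \<in> {0..c}. F a (c - a))"
        unfolding deg[OF c]
      proof (intro F2_finsum_cong[OF VX refl])
        fix a assume a: "a \<in> {0..c}"
        have e: "i + a + (j + (c - a)) = i + j + c" "s - a - (c - a) = s - c" using a c by auto
        show "\<gamma> (i + j + c) (r + (s - c)) (?v a) (Sq N (s - c) r z) = F a (c - a)"
          using \<gamma>_tel[OF Sq_closed[OF O(1) x, of a] Sq_closed[OF O(2) y, of "c - a"] z']
          unfolding F_def e .
        show "F a (c - a) \<in> el ?X (i + j + r + s)" using a c by (intro F) simp
      qed
      finally show "(\<Oplus>\<^bsub>gr ?X (i + j + r + s)\<^esub> a \<in> {0..c}. F a (c - a)) =
          \<gamma> (i + j + c) (r + (s - c)) (Sq ?LM c (i + j) (tel T L M i j x y)) (Sq N (s - c) r z)" ..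
      show "\<gamma> (i + j + c) (r + (s - c)) (Sq ?LM c (i + j) (tel T L M i j x y)) (Sq N (s - c) r z)
          \<in> el ?X (i + j + r + s)"
        using lin_closed[OF \<gamma>1[OF z'] Sq_closed[OF LM tel_closed[OF O(1,2) x y], of c]]
        unfolding deg[OF c] .
    qed
    finally show "Sq ?X s (n + r) (\<gamma> n r (tel T L M i j x y) z) = (\<Oplus>\<^bsub>gr ?X (n + r + s)\<^esub> a \<in> {0..s}.
        \<gamma> (n + a) (r + (s - a)) (Sq ?LM a n (tel T L M i j x y)) (Sq N (s - a) r z))"
      unfolding n[symmetric] \<gamma>_tel[OF x y z] add.assoc[of i j r] .
  qed
  then have "cartan_pairing ?LM N ?X \<gamma>"
    unfolding cartan_pairing_def using \<gamma>1 \<gamma>2 by (auto intro: bilinear_pairingI)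
  with \<gamma>_tel show ?thesis by blast
qed

lemma tensor3_hom_eqI:
  assumes O: "L \<in> Ob U" "M \<in> Ob U" "N \<in> Ob U" "X \<in> Ob U"
    and f: "f \<in> Hom U (tob T (tob T L M) N) X" and g: "g \<in> Hom U (tob T (tob T L M) N) X"
    and eq: "\<And>i j r x y z. x \<in> el L i \<Longrightarrow> y \<in> el M j \<Longrightarrow> z \<in> el N r \<Longrightarrow>
      app f (i + j + r) (tel T (tob T L M) N (i + j) r (tel T L M i j x y) z) =
      app g (i + j + r) (tel T (tob T L M) N (i + j) r (tel T L M i j x y) z)"
  shows "f = g"
proof (rule tensor_hom_eqI[OF tob_Ob[OF O(1,2)] O(3,4) f g])
  note LM = tob_Ob[OF O(1,2)]
  fix n r w z assume w: "w \<in> el (tob T L M) n" and z: "z \<in> el N r"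
  show "app f (n + r) (tel T (tob T L M) N n r w z) = app g (n + r) (tel T (tob T L M) N n r w z)"
    by (rule tensor_lin_eqI[OF O(1,2) mod_space[OF O(4)] lin_compose[OF tel_lin(2)[OF LM O(3) z]
        hom_lin[OF f]]
          lin_compose[OF tel_lin(2)[OF LM O(3) z] hom_lin[OF g]] _ w])
      (use eq z in auto)
qed

lemma assoc_ex1:
  assumes O: "L \<in> Ob U" "M \<in> Ob U" "N \<in> Ob U"
  shows "\<exists>!h. h \<in> Hom U (tob T (tob T L M) N) (tob T L (tob T M N)) \<and>
     (\<forall>i j r. \<forall>x\<in>el L i. \<forall>y\<in>el M j. \<forall>z\<in>el N r.
        app h (i + j + r) (tel T (tob T L M) N (i + j) r (tel T L M i j x y) z) =
        tel T L (tob T M N) i (j + r) x (tel T M N j r y z))"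
proof (rule ex_ex1I)
  note LM = tob_Ob[OF O(1,2)] and X = tob_Ob[OF O(1) tob_Ob[OF O(2,3)]]
  obtain \<gamma> where \<gamma>: "cartan_pairing (tob T L M) N (tob T L (tob T M N)) \<gamma>"
    "\<And>i j r x y z. x \<in> el L i \<Longrightarrow> y \<in> el M j \<Longrightarrow> z \<in> el N r \<Longrightarrow>
      \<gamma> (i + j) r (tel T L M i j x y) z = tel T L (tob T M N) i (j + r) x (tel T M N j r y z)"
    using assoc_pairing[OF O] by metis
  show "\<exists>h. h \<in> Hom U (tob T (tob T L M) N) (tob T L (tob T M N)) \<and>
     (\<forall>i j r. \<forall>x\<in>el L i. \<forall>y\<in>el M j. \<forall>z\<in>el N r.
        app h (i + j + r) (tel T (tob T L M) N (i + j) r (tel T L M i j x y) z) =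
        tel T L (tob T M N) i (j + r) x (tel T M N j r y z))"
    using tensor_hom_exists[OF LM O(3) X \<gamma>(1)] \<gamma>(2) tel_closed[OF O(1,2)] by metis
qed (rule tensor3_hom_eqI[OF O tob_Ob[OF O(1) tob_Ob[OF O(2,3)]]], auto)

lemma assoc_in:
  assumes O: "L \<in> Ob U" "M \<in> Ob U" "N \<in> Ob U"
  shows "assoc T L M N \<in> Hom U (tob T (tob T L M) N) (tob T L (tob T M N))"
  using theI'[OF assoc_ex1[OF O]] unfolding assoc_def by blast

lemma assoc_app:
  assumes O: "L \<in> Ob U" "M \<in> Ob U" "N \<in> Ob U" and "x \<in> el L i" "y \<in> el M j" "z \<in> el N r"
  shows "app (assoc T L M N) (i + j + r) (tel T (tob T L M) N (i + j) r (tel T L M i j x y) z) =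
        tel T L (tob T M N) i (j + r) x (tel T M N j r y z)"
  using theI'[OF assoc_ex1[OF O]] assms(4-) unfolding assoc_def by blast

section \<open>The unit object\<close>

text \<open>Infinity of the type provides the two elements on which \<open>F2\<close> is
  realised.\<close>

lemma bits_distinct: "fst (bits :: 'a \<times> 'a) \<noteq> snd bits"
proof -
  obtain x y :: 'a where "x \<noteq> y"
    using infinite_UNIV by (metis (full_types) UNIV_I finite.emptyI finite.insertI finite_subset
        insertI1 subsetI)
  then have "\<exists>p :: 'a \<times> 'a. fst p \<noteq> snd p" by (metis fst_conv snd_conv)
  then show ?thesis unfolding bits_def by (rule someI_ex)
qed

lemma F2_zero_eq: "\<zero>\<^bsub>gr F2 n\<^esub> = fst bits" and el_F2: "el F2 n = (if n = 0 then {fst bits,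
    snd bits} else {fst bits})"
  and F2_add_eq: "x \<oplus>\<^bsub>gr F2 n\<^esub> y = (if x = y then fst bits else snd bits)"
  and Sq_F2: "Sq F2 i n x = (if i = 0 then x else fst bits)"
  by (simp_all add: F2_def)

lemma F2_Ob: "(F2 :: 'a umod) \<in> Ob U"
proof (rule unstableI)
  note b = bits_distinct bits_distinct[symmetric]
  show V: "F2_space (gr (F2 :: 'a umod) n)" for n
  proof (rule F2_spaceI)
    show "abelian_group (gr (F2 :: 'a umod) n)"
      by (rule abelian_groupI) (use b in \<open>auto simp: F2_zero_eq el_F2 F2_add_eq split: if_splits\<close>)
  qed (simp add: F2_zero_eq F2_add_eq)
  show "Sq (F2 :: 'a umod) i n \<in> lin (gr F2 n) (gr F2 (n + i))" for i n
    by (rule linI) (auto simp: F2_zero_eq el_F2 F2_add_eq Sq_F2 split: if_splits)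
  fix a b n :: nat and x :: 'a
  assume ab: "0 < a" "a < 2 * b"
  \<comment> \<open>Since \<open>a > 0\<close>, the outer square of every Adem term has positive
    index and is zero.\<close>
  have "(\<Oplus>\<^bsub>gr (F2 :: 'a umod) (n + a + b)\<^esub> c \<in> {c. 2 * c \<le> a \<and> odd ((b - c - 1) choose (a - 2 * c))}.
      Sq F2 (a + b - c) (n + c) (Sq F2 c n x)) = \<zero>\<^bsub>gr (F2 :: 'a umod) (n + a + b)\<^esub>"
    using ab by (intro F2_finsum_zero[OF V]) (auto simp: Sq_F2 F2_zero_eq)
  then show "Sq F2 a (n + b) (Sq F2 b n x) =
       (\<Oplus>\<^bsub>gr F2 (n + a + b)\<^esub> c \<in> {c. 2 * c \<le> a \<and> odd ((b - c - 1) choose (a - 2 * c))}.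
          Sq F2 (a + b - c) (n + c) (Sq F2 c n x))"
    using ab by (simp add: Sq_F2 F2_zero_eq)
qed (auto simp: Sq_F2 F2_zero_eq)

lemma F2_cases: "c \<in> el F2 i \<Longrightarrow> (i = 0 \<and> c = F2_gen) \<or> c = \<zero>\<^bsub>gr F2 i\<^esub>"
  by (auto simp: el_F2 F2_gen_def F2_zero_eq split: if_splits)

lemma F2_gen_el: "F2_gen \<in> el F2 0"
  by (simp add: el_F2 F2_gen_def)

text \<open>This is scalar multiplication, \<open>F2_gen\<close> being 1. Squares of positive index
  vanish on scalars, so only the term \<open>a = 0\<close> of the Cartan sum remains.\<close>

lemma unit_pairing:
  assumes M: "(M :: 'a umod) \<in> Ob U"
  shows "cartan_pairing (F2 :: 'a umod) M M (\<lambda>i j c x. if i = 0 \<and> c = F2_gen then x else \<zero>\<^bsub>gr M (i + j)\<^esub>)"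
    (is "cartan_pairing _ _ _ ?\<beta>")
  unfolding cartan_pairing_def
proof (intro conjI bilinear_pairingI allI ballI)
  note V = mod_space[OF M]
  show "(\<lambda>y. ?\<beta> i j x y) \<in> lin (gr M j) (gr M (i + j))" for i j x
    by (cases "i = 0 \<and> x = F2_gen") (auto simp: lin_id lin_const_zero[OF V])
  show "(\<lambda>x. ?\<beta> i j x y) \<in> lin (gr F2 i) (gr M (i + j))" if "y \<in> el M j" for i j y
    using that bits_distinct
    by (intro linI) (auto simp: F2_gen_def F2_add_eq el_F2 el_zero[OF M] F2_add_zero[OF V]
        F2_add_self[OF V] split: if_splits)
  fix r i j x and c :: 'a assume c: "c \<in> el F2 i" and x: "x \<in> el M j"
  have "(\<Oplus>\<^bsub>gr M (i + j + r)\<^esub> a \<in> {0..r}. ?\<beta> (i + a) (j + (r - a)) (Sq F2 a i c) (Sq M (r - a) j x)) =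
      ?\<beta> (i + 0) (j + (r - 0)) (Sq F2 0 i c) (Sq M (r - 0) j x)"
    using x c
    by (intro F2_finsum_single[OF V]) (auto simp: Sq_closed[OF M] el_zero[OF M] add.assoc)
  also have "\<dots> = Sq M r (i + j) (?\<beta> i j c x)"
    using Sq_zero[OF M, of r "i + j"] by (auto simp: Sq_F2 add.assoc)
  finally show "Sq M r (i + j) (?\<beta> i j c x) = (\<Oplus>\<^bsub>gr M (i + j + r)\<^esub> a \<in> {0..r}.
      ?\<beta> (i + a) (j + (r - a)) (Sq F2 a i c) (Sq M (r - a) j x))" ..
qed

lemma F2_tensor_hom_eqI:
  assumes O: "M \<in> Ob U" "X \<in> Ob U" and f: "f \<in> Hom U (tob T F2 M) X" and g: "g \<in> Hom U (tob T F2 M) X"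
    and eq: "\<And>i x. x \<in> el M i \<Longrightarrow> app f i (tel T F2 M 0 i F2_gen x) = app g i (tel T F2 M 0 i F2_gen x)"
  shows "f = g"
proof (rule tensor_hom_eqI[OF F2_Ob O f g])
  fix i j x and c :: 'a assume c: "c \<in> el F2 i" and x: "x \<in> el M j"
  from F2_cases[OF c] show "app f (i + j) (tel T F2 M i j c x) = app g (i + j) (tel T F2 M i j c x)"
  proof
    assume "c = \<zero>\<^bsub>gr F2 i\<^esub>"
    then show ?thesis
      using tel_zero(2)[OF F2_Ob O(1) x] hom_zero[OF f tob_Ob[OF F2_Ob O(1)] O(2)]
        hom_zero[OF g tob_Ob[OF F2_Ob O(1)] O(2)] by simp
  qed (use eq x in auto)
qed

lemma tensor_F2_hom_eqI:
  assumes O: "M \<in> Ob U" "X \<in> Ob U" and f: "f \<in> Hom U (tob T M F2) X" and g: "g \<in> Hom U (tob T M F2) X"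
    and eq: "\<And>i x. x \<in> el M i \<Longrightarrow> app f i (tel T M F2 i 0 x F2_gen) = app g i (tel T M F2 i 0 x F2_gen)"
  shows "f = g"
proof (rule tensor_hom_eqI[OF O(1) F2_Ob O(2) f g])
  fix i j x and c :: 'a assume x: "x \<in> el M i" and c: "c \<in> el F2 j"
  from F2_cases[OF c] show "app f (i + j) (tel T M F2 i j x c) = app g (i + j) (tel T M F2 i j x c)"
  proof
    assume "c = \<zero>\<^bsub>gr F2 j\<^esub>"
    then show ?thesis
      using tel_zero(1)[OF O(1) F2_Ob x] hom_zero[OF f tob_Ob[OF O(1) F2_Ob] O(2)]
        hom_zero[OF g tob_Ob[OF O(1) F2_Ob] O(2)] by simp
  qed (use eq x in auto)
qed

lemma lunit_ex1:
  assumes M: "M \<in> Ob U"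
  shows "\<exists>!h. h \<in> Hom U (tob T F2 M) M \<and> (\<forall>i. \<forall>x\<in>el M i. app h i (tel T F2 M 0 i F2_gen x) = x)"
proof (rule ex_ex1I)
  obtain h where h: "h \<in> Hom U (tob T F2 M) M" "\<forall>i j. \<forall>c\<in>el F2 i. \<forall>x\<in>el M j.
      app h (i + j) (tel T F2 M i j c x) = (if i = 0 \<and> c = F2_gen then x else \<zero>\<^bsub>gr M (i + j)\<^esub>)"
    using tensor_hom_exists[OF F2_Ob M M unit_pairing[OF M]] by blast
  then show "\<exists>h. h \<in> Hom U (tob T F2 M) M \<and> (\<forall>i. \<forall>x\<in>el M i. app h i (tel T F2 M 0 i F2_gen x) = x)"
    using F2_gen_el by (metis add_0)
qed (rule F2_tensor_hom_eqI[OF M M], auto)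

lemma runit_ex1:
  assumes M: "M \<in> Ob U"
  shows "\<exists>!h. h \<in> Hom U (tob T M F2) M \<and> (\<forall>i. \<forall>x\<in>el M i. app h i (tel T M F2 i 0 x F2_gen) = x)"
proof (rule ex_ex1I)
  obtain h where h: "h \<in> Hom U (tob T M F2) M" "\<forall>j i. \<forall>x\<in>el M j. \<forall>c\<in>el F2 i.
      app h (j + i) (tel T M F2 j i x c) = (if i = 0 \<and> c = F2_gen then x else \<zero>\<^bsub>gr M (i + j)\<^esub>)"
    using tensor_hom_exists[OF M F2_Ob M cartan_swap[OF unit_pairing[OF M] F2_Ob M M]] by blast
  then show "\<exists>h. h \<in> Hom U (tob T M F2) M \<and> (\<forall>i. \<forall>x\<in>el M i. app h i (tel T M F2 i 0 x F2_gen) = x)"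
    using F2_gen_el by (metis add_0_right)
qed (rule tensor_F2_hom_eqI[OF M M], auto)

lemma lunit_in: "M \<in> Ob U \<Longrightarrow> lunit T M \<in> Hom U (tob T F2 M) M"
  and lunit_app: "M \<in> Ob U \<Longrightarrow> x \<in> el M i \<Longrightarrow> app (lunit T M) i (tel T F2 M 0 i F2_gen x) = x"
  using theI'[OF lunit_ex1] unfolding lunit_def by blast+

lemma runit_in: "M \<in> Ob U \<Longrightarrow> runit T M \<in> Hom U (tob T M F2) M"
  and runit_app: "M \<in> Ob U \<Longrightarrow> x \<in> el M i \<Longrightarrow> app (runit T M) i (tel T M F2 i 0 x F2_gen) = x"
  using theI'[OF runit_ex1] unfolding runit_def by blast+

end

section \<open>Exact functors that preserve nilpotent modules\<close>

lemma F2_subspace_finsum: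
  assumes V: "F2_space V" and Z: "F2_subspace Z V" and f: "\<And>i. i \<in> J \<Longrightarrow> f i \<in> Z"
  shows "finsum V f J \<in> Z"
  using f
proof (induction J rule: infinite_finite_induct)
  case (infinite J)
  then show ?case
    using F2_subspaceD(2)[OF Z] by (simp add: abelian_monoid.finsum_infinite[OF F2_space_monoid[OF V]])
next
  case empty
  show ?case using F2_subspaceD(2)[OF Z] by (simp add: F2_finsum_empty[OF V])
next
  case (insert i J)
  have "finsum V f (insert i J) = f i \<oplus>\<^bsub>V\<^esub> finsum V f J"
    using insert.hyps insert.prems F2_subspaceD(1)[OF Z] by (intro F2_finsum_insert[OF V]) auto
  then show ?case using F2_subspaceD(3)[OF Z] insert.IH insert.prems by simp
qed

section \<open>Direct sums described by projections\<close>

lemma direct_sum_Ob: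
  assumes "is_direct_sum I D \<iota> S"
  shows "S \<in> Ob U" "i \<in> I \<Longrightarrow> D i \<in> Ob U" "i \<in> I \<Longrightarrow> \<iota> i \<in> Hom U (D i) S"
  using assms by (auto simp: is_direct_sum_def)

lemma direct_sum_ex:
  assumes ds: "is_direct_sum I D \<iota> S" and x: "x \<in> el S n"
  obtains J y where "finite J" "J \<subseteq> I" "\<And>i. i \<in> I \<Longrightarrow> y i \<in> el (D i) n"
    "\<And>i. i \<in> I - J \<Longrightarrow> y i = \<zero>\<^bsub>gr (D i) n\<^esub>" "x = (\<Oplus>\<^bsub>gr S n\<^esub> i\<in>J. app (\<iota> i) n (y i))"
proof -
  obtain y where y: "y \<in> (\<Pi>\<^sub>E i\<in>I. el (D i) n)" "finite {i\<in>I. y i \<noteq> \<zero>\<^bsub>gr (D i) n\<^esub>}"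
     "x = (\<Oplus>\<^bsub>gr S n\<^esub> i \<in> {i\<in>I. y i \<noteq> \<zero>\<^bsub>gr (D i) n\<^esub>}. app (\<iota> i) n (y i))"
    using ds x unfolding is_direct_sum_def by blast
  show thesis by (rule that[OF y(2) _ _ _ y(3)]) (use y(1) in auto)
qed

text \<open>Generation by the images of the summands, in the form without sums that
  \<open>direct_sumI\<close> asks for.\<close>

lemma direct_sum_span:
  assumes ds: "is_direct_sum I D \<iota> S" and Z: "F2_subspace Z (gr S n)"
    and im: "\<And>i x. i \<in> I \<Longrightarrow> x \<in> el (D i) n \<Longrightarrow> app (\<iota> i) n x \<in> Z" and x: "x \<in> el S n"
  shows "x \<in> Z"
proof (rule direct_sum_ex[OF ds x])
  fix J y assume "J \<subseteq> I" "\<And>i. i \<in> I \<Longrightarrow> y i \<in> el (D i) n" "x = (\<Oplus>\<^bsub>gr S n\<^esub> i\<in>J. app (\<iota> i) n (y i))"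
  then show "x \<in> Z"
    using im by (auto intro!: F2_subspace_finsum[OF mod_space[OF direct_sum_Ob(1)[OF ds]] Z])
qed

text \<open>\<open>is_direct_sum\<close> speaks of unique finitely supported families. Coordinates
  turn this into linear maps with equational properties, a form that additive functors carry along;
  \<open>direct_sumI\<close> leads back.\<close>

lemma direct_sum_projections:
  assumes ds: "is_direct_sum I D \<iota> S"
  obtains \<pi> where "\<And>i n. i \<in> I \<Longrightarrow> \<pi> i n \<in> lin (gr S n) (gr (D i) n)"
    "\<And>i n x. i \<in> I \<Longrightarrow> x \<in> el (D i) n \<Longrightarrow> \<pi> i n (app (\<iota> i) n x) = x"
    "\<And>i j n x. i \<in> I \<Longrightarrow> j \<in> I \<Longrightarrow> i \<noteq> j \<Longrightarrow> x \<in> el (D i) n \<Longrightarrow>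
      \<pi> j n (app (\<iota> i) n x) = \<zero>\<^bsub>gr (D j) n\<^esub>"
proof -
  note O = direct_sum_Ob[OF ds]
  note V = mod_space[OF O(1)] and VD = mod_space[OF O(2)]
  let ?supp = "\<lambda>n y. {i\<in>I. y i \<noteq> \<zero>\<^bsub>gr (D i) n\<^esub>}"
  let ?spec = "\<lambda>n x y. y \<in> (\<Pi>\<^sub>E i\<in>I. el (D i) n) \<and> finite (?supp n y) \<and>
     x = (\<Oplus>\<^bsub>gr S n\<^esub> i \<in> ?supp n y. app (\<iota> i) n (y i))"
  define fam where "fam n x = (THE y. ?spec n x y)" for n x
  \<comment> \<open>Allowing any finite \<open>J\<close> that contains the support makes the sum of
    two families computable over a common index set.\<close>
  have fam: "fam n (\<Oplus>\<^bsub>gr S n\<^esub> i\<in>J. app (\<iota> i) n (w i)) = restrict w I"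
    if J: "finite J" "J \<subseteq> I" and w: "\<And>i. i \<in> I \<Longrightarrow> w i \<in> el (D i) n"
      "\<And>i. i \<in> I - J \<Longrightarrow> w i = \<zero>\<^bsub>gr (D i) n\<^esub>" for n J w
  proof -
    let ?x = "\<Oplus>\<^bsub>gr S n\<^esub> i\<in>J. app (\<iota> i) n (w i)"
    have x: "?x \<in> el S n"
      using J w(1) hom_closed[OF O(3)] by (intro F2_finsum[OF V]) auto
    have sub: "?supp n (restrict w I) \<subseteq> J" using w(2) by auto
    have "(\<Oplus>\<^bsub>gr S n\<^esub> i \<in> ?supp n (restrict w I). app (\<iota> i) n (restrict w I i)) =
        (\<Oplus>\<^bsub>gr S n\<^esub> i \<in> ?supp n (restrict w I). app (\<iota> i) n (w i))"
      using w(1) hom_closed[OF O(3)] by (intro F2_finsum_cong[OF V refl]) auto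
    also have "\<dots> = ?x"
      using sub J w(1) hom_closed[OF O(3)] hom_zero[OF O(3,2,1)]
      by (intro F2_finsum_mono_neutral[OF V J(1)]) auto
    finally have "?spec n ?x (restrict w I)"
      using w(1) finite_subset[OF sub J(1)] by auto
    moreover have "\<exists>!y. ?spec n ?x y"
      using ds x unfolding is_direct_sum_def by blast
    ultimately show ?thesis unfolding fam_def by (intro the1_equality)
  qed
  define \<pi> where "\<pi> i n x = fam n x i" for i n x
  show thesis
  proof (rule that[of \<pi>])
    fix i n assume i: "i \<in> I"
    show "\<pi> i n \<in> lin (gr S n) (gr (D i) n)"
    proof (rule linI)
      fix x assume "x \<in> el S n"
      then show "\<pi> i n x \<in> el (D i) n"
      proof (rule direct_sum_ex[OF ds])
        fix J y assume *: "finite J" "J \<subseteq> I" "\<And>i. i \<in> I \<Longrightarrow> y i \<in> el (D i) n"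
          "\<And>i. i \<in> I - J \<Longrightarrow> y i = \<zero>\<^bsub>gr (D i) n\<^esub>" "x = (\<Oplus>\<^bsub>gr S n\<^esub> i\<in>J. app (\<iota> i) n (y i))"
        have "fam n x = restrict y I" unfolding *(5) by (rule fam[OF *(1-4)])
        then show ?thesis unfolding \<pi>_def using i *(3)[OF i] by simp
      qed
      fix x' assume x': "x' \<in> el S n"
      show "\<pi> i n (x \<oplus>\<^bsub>gr S n\<^esub> x') = \<pi> i n x \<oplus>\<^bsub>gr (D i) n\<^esub> \<pi> i n x'"
      proof (rule direct_sum_ex[OF ds \<open>x \<in> el S n\<close>], rule direct_sum_ex[OF ds x'])
        fix J y J' y'
        assume y: "finite J" "J \<subseteq> I" "\<And>i. i \<in> I \<Longrightarrow> y i \<in> el (D i) n"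
          "\<And>i. i \<in> I - J \<Longrightarrow> y i = \<zero>\<^bsub>gr (D i) n\<^esub>" "x = (\<Oplus>\<^bsub>gr S n\<^esub> i\<in>J. app (\<iota> i) n (y i))"
        assume y': "finite J'" "J' \<subseteq> I" "\<And>i. i \<in> I \<Longrightarrow> y' i \<in> el (D i) n"
          "\<And>i. i \<in> I - J' \<Longrightarrow> y' i = \<zero>\<^bsub>gr (D i) n\<^esub>" "x' = (\<Oplus>\<^bsub>gr S n\<^esub> i\<in>J'. app (\<iota> i) n (y' i))"
        let ?K = "J \<union> J'"
        let ?w = "\<lambda>i. y i \<oplus>\<^bsub>gr (D i) n\<^esub> y' i"
        have K: "finite ?K" "?K \<subseteq> I" using y y' by auto
        have x1: "x = (\<Oplus>\<^bsub>gr S n\<^esub> i\<in>?K. app (\<iota> i) n (y i))"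
          unfolding y(5) using K y hom_closed[OF O(3)] hom_zero[OF O(3,2,1)]
          by (intro F2_finsum_mono_neutral[OF V K(1)]) auto
        have x2: "x' = (\<Oplus>\<^bsub>gr S n\<^esub> i\<in>?K. app (\<iota> i) n (y' i))"
          unfolding y'(5) using K y' hom_closed[OF O(3)] hom_zero[OF O(3,2,1)]
          by (intro F2_finsum_mono_neutral[OF V K(1)]) auto
        have "(\<Oplus>\<^bsub>gr S n\<^esub> i\<in>?K. app (\<iota> i) n (?w i)) =
            (\<Oplus>\<^bsub>gr S n\<^esub> i\<in>?K. app (\<iota> i) n (y i) \<oplus>\<^bsub>gr S n\<^esub> app (\<iota> i) n (y' i))"
          using K(2) y(3) y'(3) hom_add[OF O(3)] hom_closed[OF O(3)]
          by (intro F2_finsum_cong[OF V refl] F2_add[OF V]) auto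
        also have "\<dots> = x \<oplus>\<^bsub>gr S n\<^esub> x'"
          unfolding x1 x2 using K(2) y(3) y'(3) hom_closed[OF O(3)]
          by (intro F2_finsum_add[OF V]) auto
        finally have sum: "x \<oplus>\<^bsub>gr S n\<^esub> x' = (\<Oplus>\<^bsub>gr S n\<^esub> i\<in>?K. app (\<iota> i) n (?w i))" ..
        have "fam n (x \<oplus>\<^bsub>gr S n\<^esub> x') = restrict ?w I"
          unfolding sum using y(3,4) y'(3,4) F2_add[OF VD] F2_add_zero[OF VD] F2_zero[OF VD]
          by (intro fam[OF K]) auto
        moreover have "fam n x = restrict y I" unfolding y(5) by (rule fam[OF y(1-4)])
        moreover have "fam n x' = restrict y' I" unfolding y'(5) by (rule fam[OF y'(1-4)])
        ultimately show ?thesis unfolding \<pi>_def using i by simp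
      qed
    qed
  next
    have one: "fam n (app (\<iota> i) n x) = restrict (\<lambda>j. if j = i then x else \<zero>\<^bsub>gr (D j) n\<^esub>) I"
      if i: "i \<in> I" and x: "x \<in> el (D i) n" for i n x
    proof -
      let ?w = "\<lambda>j. if j = i then x else \<zero>\<^bsub>gr (D j) n\<^esub>"
      have "(\<Oplus>\<^bsub>gr S n\<^esub> j\<in>{i}. app (\<iota> j) n (?w j)) = app (\<iota> i) n (?w i)"
        using i x hom_closed[OF O(3)] by (intro F2_finsum_single[OF V]) auto
      moreover have "fam n (\<Oplus>\<^bsub>gr S n\<^esub> j\<in>{i}. app (\<iota> j) n (?w j)) = restrict ?w I"
        using i x el_zero[OF O(2)] by (intro fam) auto
      ultimately show ?thesis by simp
    qed
    show "\<pi> i n (app (\<iota> i) n x) = x" if "i \<in> I" "x \<in> el (D i) n" for i n x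
      using one[OF that] that by (simp add: \<pi>_def)
    show "\<pi> j n (app (\<iota> i) n x) = \<zero>\<^bsub>gr (D j) n\<^esub>"
      if "i \<in> I" "j \<in> I" "i \<noteq> j" "x \<in> el (D i) n" for i j n x
      using one[OF that(1,4)] that by (simp add: \<pi>_def)
  qed
qed

text \<open>Existence of the coordinates comes from applying \<open>span\<close> to the subspace of
  elements that their coordinates recover; uniqueness comes from applying the maps
  \<open>\<pi> j\<close>.\<close>

lemma direct_sumI:
  assumes S: "S \<in> Ob U" and D: "\<And>i. i \<in> I \<Longrightarrow> D i \<in> Ob U" and \<iota>: "\<And>i. i \<in> I \<Longrightarrow> \<iota> i \<in> Hom U (D i) S"
    and \<pi>: "\<And>i n. i \<in> I \<Longrightarrow> \<pi> i n \<in> lin (gr S n) (gr (D i) n)"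
    and \<pi>\<iota>: "\<And>i n x. i \<in> I \<Longrightarrow> x \<in> el (D i) n \<Longrightarrow> \<pi> i n (app (\<iota> i) n x) = x"
    and \<pi>\<iota>0: "\<And>i j n x. i \<in> I \<Longrightarrow> j \<in> I \<Longrightarrow> i \<noteq> j \<Longrightarrow> x \<in> el (D i) n \<Longrightarrow>
      \<pi> j n (app (\<iota> i) n x) = \<zero>\<^bsub>gr (D j) n\<^esub>"
    and span: "\<And>n Z x. F2_subspace Z (gr S n) \<Longrightarrow>
      (\<And>i x. i \<in> I \<Longrightarrow> x \<in> el (D i) n \<Longrightarrow> app (\<iota> i) n x \<in> Z) \<Longrightarrow> x \<in> el S n \<Longrightarrow> x \<in> Z"
  shows "is_direct_sum I D \<iota> S"
  unfolding is_direct_sum_def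
proof (intro conjI ballI allI S D \<iota>)
  note V = mod_space[OF S] and VD = mod_space[OF D]
  fix n x assume x: "x \<in> el S n"
  let ?supp = "\<lambda>y. {i\<in>I. y i \<noteq> \<zero>\<^bsub>gr (D i) n\<^esub>}"
  let ?y = "restrict (\<lambda>i. \<pi> i n x) I"
  \<comment> \<open>Recovery from the coordinates is demanded over every finite \<open>J\<close>
    containing the support. This makes the set closed under addition, where supports may
    shrink.\<close>
  let ?Z = "{x \<in> el S n. finite (?supp (\<lambda>i. \<pi> i n x)) \<and>
    (\<forall>J. finite J \<and> ?supp (\<lambda>i. \<pi> i n x) \<subseteq> J \<and> J \<subseteq> I \<longrightarrow> x = (\<Oplus>\<^bsub>gr S n\<^esub> i\<in>J. app (\<iota> i) n (\<pi> i n x)))}"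
  have ZI: "z \<in> ?Z" if z: "z \<in> el S n" "finite (?supp (\<lambda>i. \<pi> i n z))"
      "\<And>J. finite J \<Longrightarrow> ?supp (\<lambda>i. \<pi> i n z) \<subseteq> J \<Longrightarrow> J \<subseteq> I \<Longrightarrow>
        z = (\<Oplus>\<^bsub>gr S n\<^esub> i\<in>J. app (\<iota> i) n (\<pi> i n z))" for z
  proof (intro CollectI conjI allI impI z(1,2))
    fix J assume "finite J \<and> ?supp (\<lambda>i. \<pi> i n z) \<subseteq> J \<and> J \<subseteq> I"
    then show "z = (\<Oplus>\<^bsub>gr S n\<^esub> i\<in>J. app (\<iota> i) n (\<pi> i n z))"
      by (elim conjE) (rule z(3))
  qed
  have Z: "F2_subspace ?Z (gr S n)"
  proof (rule F2_subspaceI)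
    have p0: "\<pi> i n \<zero>\<^bsub>gr S n\<^esub> = \<zero>\<^bsub>gr (D i) n\<^esub>" if "i \<in> I" for i
      using lin_zero[OF V VD[OF that] \<pi>[OF that]] .
    then have supp0: "?supp (\<lambda>i. \<pi> i n \<zero>\<^bsub>gr S n\<^esub>) = {}" by auto
    have "(\<Oplus>\<^bsub>gr S n\<^esub> i\<in>J. app (\<iota> i) n (\<pi> i n \<zero>\<^bsub>gr S n\<^esub>)) = \<zero>\<^bsub>gr S n\<^esub>" if "J \<subseteq> I" for J
      using that p0 hom_zero[OF \<iota> D S] by (intro F2_finsum_zero[OF V]) auto
    then show "\<zero>\<^bsub>gr S n\<^esub> \<in> ?Z"
      unfolding mem_Collect_eq supp0 using el_zero[OF S] by simp
    have all: "\<forall>J. finite J \<and> ?supp (\<lambda>i. \<pi> i n z) \<subseteq> J \<and> J \<subseteq> I \<longrightarrow>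
        z = (\<Oplus>\<^bsub>gr S n\<^esub> i\<in>J. app (\<iota> i) n (\<pi> i n z))" if "z \<in> ?Z" for z
      using CollectD[OF that] by (elim conjE)
    fix x y assume x: "x \<in> ?Z" and y: "y \<in> ?Z"
    have add: "\<pi> i n (x \<oplus>\<^bsub>gr S n\<^esub> y) = \<pi> i n x \<oplus>\<^bsub>gr (D i) n\<^esub> \<pi> i n y" if "i \<in> I" for i
      using lin_add[OF \<pi>[OF that]] x y by simp
    let ?K = "?supp (\<lambda>i. \<pi> i n x) \<union> ?supp (\<lambda>i. \<pi> i n y)"
    have K: "?supp (\<lambda>i. \<pi> i n (x \<oplus>\<^bsub>gr S n\<^esub> y)) \<subseteq> ?K" "finite ?K"
      using x y add F2_add_zero[OF VD F2_zero[OF VD]] by auto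
    have "x \<oplus>\<^bsub>gr S n\<^esub> y = (\<Oplus>\<^bsub>gr S n\<^esub> i\<in>J. app (\<iota> i) n (\<pi> i n (x \<oplus>\<^bsub>gr S n\<^esub> y)))"
      if J: "finite J" "?supp (\<lambda>i. \<pi> i n (x \<oplus>\<^bsub>gr S n\<^esub> y)) \<subseteq> J" "J \<subseteq> I" for J
    proof -
      let ?L = "?K \<union> J"
      have L: "finite ?L" "?L \<subseteq> I" using K J by auto
      have cl: "app (\<iota> i) n (\<pi> i n z) \<in> el S n" if "i \<in> I" "z \<in> el S n" for i z
        by (rule hom_closed[OF \<iota>[OF that(1)] lin_closed[OF \<pi>[OF that(1)] that(2)]])
      have xy: "x \<in> el S n" "y \<in> el S n" "x \<oplus>\<^bsub>gr S n\<^esub> y \<in> el S n"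
        using x y F2_add[OF V] by auto
      have "(\<Oplus>\<^bsub>gr S n\<^esub> i\<in>J. app (\<iota> i) n (\<pi> i n (x \<oplus>\<^bsub>gr S n\<^esub> y))) =
          (\<Oplus>\<^bsub>gr S n\<^esub> i\<in>?L. app (\<iota> i) n (\<pi> i n (x \<oplus>\<^bsub>gr S n\<^esub> y)))"
      proof (rule F2_finsum_mono_neutral[OF V L(1)])
        fix i assume i: "i \<in> ?L - J"
        then have "i \<in> I" "\<pi> i n (x \<oplus>\<^bsub>gr S n\<^esub> y) = \<zero>\<^bsub>gr (D i) n\<^esub>" using J L by auto
        then show "app (\<iota> i) n (\<pi> i n (x \<oplus>\<^bsub>gr S n\<^esub> y)) = \<zero>\<^bsub>gr S n\<^esub>"
          using hom_zero[OF \<iota> D S] by simp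
      qed (use J xy cl in auto)
      also have "\<dots> = (\<Oplus>\<^bsub>gr S n\<^esub> i\<in>?L. app (\<iota> i) n (\<pi> i n x) \<oplus>\<^bsub>gr S n\<^esub> app (\<iota> i) n (\<pi> i n y))"
      proof (intro F2_finsum_cong[OF V refl] F2_add[OF V] cl)
        fix i assume "i \<in> ?L"
        then have i: "i \<in> I" using L by auto
        show "app (\<iota> i) n (\<pi> i n (x \<oplus>\<^bsub>gr S n\<^esub> y)) =
            app (\<iota> i) n (\<pi> i n x) \<oplus>\<^bsub>gr S n\<^esub> app (\<iota> i) n (\<pi> i n y)"
          unfolding add[OF i] using xy
          by (intro hom_add[OF \<iota>[OF i]] lin_closed[OF \<pi>[OF i]])
      qed (use L xy in auto)
      also have "\<dots> = (\<Oplus>\<^bsub>gr S n\<^esub> i\<in>?L. app (\<iota> i) n (\<pi> i n x)) \<oplus>\<^bsub>gr S n\<^esub>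
          (\<Oplus>\<^bsub>gr S n\<^esub> i\<in>?L. app (\<iota> i) n (\<pi> i n y))"
        using L xy cl by (intro F2_finsum_add[OF V]) auto
      also have "(\<Oplus>\<^bsub>gr S n\<^esub> i\<in>?L. app (\<iota> i) n (\<pi> i n x)) = x"
      proof -
        have "x = (\<Oplus>\<^bsub>gr S n\<^esub> i\<in>?L. app (\<iota> i) n (\<pi> i n x))"
          by (rule mp[OF spec[OF all[OF x]]]) (intro conjI L, blast)
        then show ?thesis by (rule sym)
      qed
      also have "(\<Oplus>\<^bsub>gr S n\<^esub> i\<in>?L. app (\<iota> i) n (\<pi> i n y)) = y"
      proof -
        have "y = (\<Oplus>\<^bsub>gr S n\<^esub> i\<in>?L. app (\<iota> i) n (\<pi> i n y))"
          by (rule mp[OF spec[OF all[OF y]]]) (intro conjI L, blast)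
        then show ?thesis by (rule sym)
      qed
      finally show ?thesis ..
    qed
    then show "x \<oplus>\<^bsub>gr S n\<^esub> y \<in> ?Z"
      using x y by (intro ZI F2_add[OF V] finite_subset[OF K]) auto
  qed blast
  have "x \<in> ?Z"
  proof (rule span[OF Z _ x])
    fix i d assume i: "i \<in> I" and d: "d \<in> el (D i) n"
    let ?x = "app (\<iota> i) n d"
    have x: "?x \<in> el S n" by (rule hom_closed[OF \<iota>[OF i] d])
    have sub: "?supp (\<lambda>j. \<pi> j n ?x) \<subseteq> {i}" using \<pi>\<iota>0[OF i _ _ d] by auto
    have "?x = (\<Oplus>\<^bsub>gr S n\<^esub> j\<in>J. app (\<iota> j) n (\<pi> j n ?x))"
      if J: "finite J" "?supp (\<lambda>j. \<pi> j n ?x) \<subseteq> J" "J \<subseteq> I" for J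
    proof (cases "i \<in> J")
      case True
      have "(\<Oplus>\<^bsub>gr S n\<^esub> j\<in>J. app (\<iota> j) n (\<pi> j n ?x)) = app (\<iota> i) n (\<pi> i n ?x)"
        using J True x \<pi>\<iota>0[OF i _ _ d] \<pi>\<iota>[OF i d] hom_zero[OF \<iota> D S]
        by (intro F2_finsum_single[OF V]) auto
      then show ?thesis using \<pi>\<iota>[OF i d] by simp
    next
      case False
      then have "d = \<zero>\<^bsub>gr (D i) n\<^esub>" using J(2) i \<pi>\<iota>[OF i d] by auto
      then have x0: "?x = \<zero>\<^bsub>gr S n\<^esub>" using hom_zero[OF \<iota>[OF i] D[OF i] S] by simp
      have "(\<Oplus>\<^bsub>gr S n\<^esub> j\<in>J. app (\<iota> j) n (\<pi> j n ?x)) = \<zero>\<^bsub>gr S n\<^esub>"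
      proof (rule F2_finsum_zero[OF V])
        fix j assume "j \<in> J"
        then have j: "j \<in> I" using J by auto
        show "app (\<iota> j) n (\<pi> j n ?x) = \<zero>\<^bsub>gr S n\<^esub>"
          unfolding x0 using lin_zero[OF V VD[OF j] \<pi>[OF j]] hom_zero[OF \<iota>[OF j] D[OF j] S] by simp
      qed
      with x0 show ?thesis by simp
    qed
    then show "?x \<in> ?Z" by (intro ZI x finite_subset[OF sub]) auto
  qed
  then have fin: "finite (?supp (\<lambda>i. \<pi> i n x))"
    and sum: "x = (\<Oplus>\<^bsub>gr S n\<^esub> i\<in>?supp (\<lambda>i. \<pi> i n x). app (\<iota> i) n (\<pi> i n x))" by auto
  have supp: "?supp ?y = ?supp (\<lambda>i. \<pi> i n x)" by auto
  have cl: "app (\<iota> i) n (\<pi> i n x) \<in> el S n" if "i \<in> I" for i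
    by (rule hom_closed[OF \<iota>[OF that] lin_closed[OF \<pi>[OF that] x]])
  show "\<exists>!y. y \<in> (\<Pi>\<^sub>E i\<in>I. el (D i) n) \<and> finite (?supp y) \<and>
      x = (\<Oplus>\<^bsub>gr S n\<^esub> i \<in> ?supp y. app (\<iota> i) n (y i))"
  proof (rule ex1I[of _ ?y], intro conjI)
    show "?y \<in> (\<Pi>\<^sub>E i\<in>I. el (D i) n)" using lin_closed[OF \<pi> x] by auto
    show "finite (?supp ?y)" using fin unfolding supp .
    have "(\<Oplus>\<^bsub>gr S n\<^esub> i\<in>?supp ?y. app (\<iota> i) n (?y i)) =
        (\<Oplus>\<^bsub>gr S n\<^esub> i\<in>?supp (\<lambda>i. \<pi> i n x). app (\<iota> i) n (\<pi> i n x))"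
      using cl by (intro F2_finsum_cong[OF V supp]) auto
    then show "x = (\<Oplus>\<^bsub>gr S n\<^esub> i\<in>?supp ?y. app (\<iota> i) n (?y i))" using sum by simp
    fix y assume y: "y \<in> (\<Pi>\<^sub>E i\<in>I. el (D i) n) \<and> finite (?supp y) \<and>
      x = (\<Oplus>\<^bsub>gr S n\<^esub> i \<in> ?supp y. app (\<iota> i) n (y i))"
    have yD: "y i \<in> el (D i) n" if "i \<in> I" for i using y that by auto
    show "y = ?y"
    proof (rule extensionalityI[of _ I])
      fix j assume j: "j \<in> I"
      have "\<pi> j n x = \<pi> j n (\<Oplus>\<^bsub>gr S n\<^esub> i \<in> ?supp y. app (\<iota> i) n (y i))" using y by simp
      also have "\<dots> = (\<Oplus>\<^bsub>gr (D j) n\<^esub> i \<in> ?supp y. \<pi> j n (app (\<iota> i) n (y i)))"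
        using yD hom_closed[OF \<iota>] by (intro lin_finsum[OF V VD[OF j] \<pi>[OF j]]) auto
      also have "\<dots> = y j"
      proof (cases "j \<in> ?supp y")
        case True
        have "(\<Oplus>\<^bsub>gr (D j) n\<^esub> i \<in> ?supp y. \<pi> j n (app (\<iota> i) n (y i))) = \<pi> j n (app (\<iota> j) n (y j))"
          using y True yD \<pi>\<iota>0 \<pi>\<iota>[OF j yD[OF j]] by (intro F2_finsum_single[OF VD[OF j]]) auto
        then show ?thesis using \<pi>\<iota>[OF j yD[OF j]] by simp
      next
        case False
        have "(\<Oplus>\<^bsub>gr (D j) n\<^esub> i \<in> ?supp y. \<pi> j n (app (\<iota> i) n (y i))) = \<zero>\<^bsub>gr (D j) n\<^esub>"
        proof (rule F2_finsum_zero[OF VD[OF j]])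
          fix i assume i: "i \<in> ?supp y"
          then have "i \<in> I" "i \<noteq> j" using False by auto
          then show "\<pi> j n (app (\<iota> i) n (y i)) = \<zero>\<^bsub>gr (D j) n\<^esub>"
            by (intro \<pi>\<iota>0 j yD)
        qed
        then show ?thesis using False j by simp
      qed
      finally show "y j = ?y j" using j by simp
    qed (use y in \<open>auto simp: PiE_def\<close>)
  qed
qed

text \<open>A zero endomorphism replaces the arrow from a zero module. Injectivity, and below
  surjectivity, thus become instances of \<open>exact_at\<close>, and a functor that preserves
  \<open>exact_at\<close> and zero arrows preserves them.\<close>

lemma injective_iff_exact:
  assumes M: "M \<in> Ob U" and N: "N \<in> Ob U" and f: "f \<in> Hom U M N"
  shows "injective f \<longleftrightarrow> exact_at (uarr M M (\<lambda>n x. \<zero>\<^bsub>gr M n\<^esub>)) f"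
proof
  let ?z = "uarr M M (\<lambda>n x. \<zero>\<^bsub>gr M n\<^esub>)"
  have im: "app ?z n ` el M n = {\<zero>\<^bsub>gr M n\<^esub>}" for n
    using el_zero[OF M] by (auto simp: uarr_def)
  note z = zero_in_Hom[OF M M]
  show "exact_at ?z f" if "injective f"
  proof (rule exact_atI[OF z f])
    show "app ?z n ` el M n = {x \<in> el M n. app f n x = \<zero>\<^bsub>gr N n\<^esub>}" for n
    proof -
      have "inj_on (app f n) (el M n)" using that by (simp add: injective_def hom_src[OF f])
      then have "x = \<zero>\<^bsub>gr M n\<^esub>" if "x \<in> el M n" "app f n x = \<zero>\<^bsub>gr N n\<^esub>" for x
        using inj_onD[of "app f n" "el M n" x "\<zero>\<^bsub>gr M n\<^esub>"] that el_zero[OF M] hom_zero[OF f M N] by simp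
      then show ?thesis unfolding im using el_zero[OF M] hom_zero[OF f M N] by auto
    qed
  qed
  show "injective f" if "exact_at ?z f"
    unfolding injective_def hom_src[OF f]
  proof
    show "inj_on (app f n) (el M n)" for n
      using exact_atD[OF that z f, of n] im
      by (intro lin_injI[OF mod_space[OF M] mod_space[OF N] hom_lin[OF f]]) auto
  qed
qed

lemma surjective_iff_exact:
  assumes M: "M \<in> Ob U" and N: "N \<in> Ob U" and f: "f \<in> Hom U M N"
  shows "surjective f \<longleftrightarrow> exact_at f (uarr N N (\<lambda>n x. \<zero>\<^bsub>gr N n\<^esub>))"
  unfolding surjective_def exact_at_def hom_src[OF f] hom_tgt[OF f]
    hom_src[OF zero_in_Hom[OF N N]] hom_tgt[OF zero_in_Hom[OF N N]]
  by (auto simp: uarr_def)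

text \<open>The assumptions are those under which the modules sent into \<open>nilpotent k\<close>
  form a localizing class that contains the \<open>k\<close>-fold suspensions.\<close>

locale exact_functor =
  fixes k :: nat and Fo :: "'a umod \<Rightarrow> 'a umod" and Fm :: "'a uarr \<Rightarrow> 'a uarr"
  assumes F_Ob: "M \<in> Ob U \<Longrightarrow> Fo M \<in> Ob U"
    and F_Hom: "M \<in> Ob U \<Longrightarrow> N \<in> Ob U \<Longrightarrow> f \<in> Hom U M N \<Longrightarrow> Fm f \<in> Hom U (Fo M) (Fo N)"
    and F_exact: "L \<in> Ob U \<Longrightarrow> M \<in> Ob U \<Longrightarrow> N \<in> Ob U \<Longrightarrow> f \<in> Hom U L M \<Longrightarrow> g \<in> Hom U M N \<Longrightarrow>
      exact_at f g \<Longrightarrow> exact_at (Fm f) (Fm g)"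
    and F_zero: "M \<in> Ob U \<Longrightarrow> N \<in> Ob U \<Longrightarrow>
      Fm (uarr M N (\<lambda>n x. \<zero>\<^bsub>gr N n\<^esub>)) = uarr (Fo M) (Fo N) (\<lambda>n x. \<zero>\<^bsub>gr (Fo N) n\<^esub>)"
    and F_sum: "is_direct_sum I D \<iota> S \<Longrightarrow> is_direct_sum I (\<lambda>i. Fo (D i)) (\<lambda>i. Fm (\<iota> i)) (Fo S)"
    and F_suspension: "M \<in> Ob U \<Longrightarrow> Fo (suspension k M) \<in> nilpotent k"
begin

lemma F_injective:
  assumes M: "M \<in> Ob U" and N: "N \<in> Ob U" and f: "f \<in> Hom U M N" "injective f"
  shows "injective (Fm f)"
  using F_exact[OF M M N zero_in_Hom[OF M M] f(1)] f(2)
  unfolding injective_iff_exact[OF M N f(1)] injective_iff_exact[OF F_Ob[OF M] F_Ob[OF N]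
      F_Hom[OF M N f(1)]]
    F_zero[OF M M] .

lemma F_surjective:
  assumes M: "M \<in> Ob U" and N: "N \<in> Ob U" and f: "f \<in> Hom U M N" "surjective f"
  shows "surjective (Fm f)"
  using F_exact[OF M N N f(1) zero_in_Hom[OF N N]] f(2)
  unfolding surjective_iff_exact[OF M N f(1)] surjective_iff_exact[OF F_Ob[OF M] F_Ob[OF N]
      F_Hom[OF M N f(1)]]
    F_zero[OF N N] .

text \<open>\<open>nilpotent k\<close> is the smallest localizing class with all suspensions, so it
  lies inside its own preimage under \<open>Fo\<close>, which is another such class.
  \<open>M\<close> supplies a first member of that preimage.\<close>

lemma F_nilpotent:
  assumes N: "N \<in> nilpotent k" and M: "M \<in> Ob (U :: ('a umod, 'a uarr) category)"
  shows "Fo N \<in> nilpotent k"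
proof -
  let ?C = "{M \<in> Ob U. Fo M \<in> nilpotent k}"
  have "serre_class ?C"
    unfolding serre_class_def
  proof (intro conjI ballI impI)
    show "?C \<noteq> {}" using suspension_in_Ob[OF M] F_suspension[OF M] by blast
    fix A B C :: "'a umod" and f g
    assume O: "A \<in> Ob U" "B \<in> Ob U" "C \<in> Ob U" and f: "f \<in> Hom U A B" and g: "g \<in> Hom U B C"
      and *: "injective f \<and> exact_at f g \<and> surjective g"
    have "Fo B \<in> nilpotent k \<longleftrightarrow> Fo A \<in> nilpotent k \<and> Fo C \<in> nilpotent k"
      by (rule nilpotent_exact[OF F_Ob F_Ob F_Ob F_Hom F_Hom F_injective F_exact F_surjective])
        (use O f g * in blast)+
    with O show "B \<in> ?C \<longleftrightarrow> A \<in> ?C \<and> C \<in> ?C" by blast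
  qed blast
  moreover have "S \<in> ?C" if "is_direct_sum I D \<iota> S" "\<forall>i\<in>I. D i \<in> ?C" for I D \<iota> S
    using nilpotent_direct_sum[OF F_sum[OF that(1)]] that direct_sum_Ob(1)[OF that(1)] by blast
  ultimately have "localizing ?C" unfolding localizing_def by blast
  then have "N \<in> ?C"
    by (rule nilpotentD[OF N]) (use suspension_in_Ob F_suspension in blast)
  then show ?thesis by blast
qed

lemma F_nil_iso:
  assumes M: "M \<in> Ob U" and N: "N \<in> Ob U" and f: "f \<in> Hom U M N" "nil_iso k f"
  shows "nil_iso k (Fm f)"
proof (rule nil_isoD[OF f(2,1)])
  fix L C i p assume *: "L \<in> nilpotent k" "C \<in> nilpotent k" "i \<in> Hom U L M" "p \<in> Hom U N C"
    "injective i" "exact_at i f" "exact_at f p" "surjective p"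
  have L: "L \<in> Ob U" and C: "C \<in> Ob U" using nilpotent_Ob * M by blast+
  show ?thesis
    by (rule nil_isoI[OF F_Hom[OF M N f(1)] F_nilpotent[OF *(1) M] F_nilpotent[OF *(2) M]
      F_Hom[OF L M *(3)] F_Hom[OF N C *(4)] F_injective[OF L M *(3,5)] F_exact[OF L M N *(3) f(1) *(6)]
      F_exact[OF M N C f(1) *(4,7)] F_surjective[OF N C *(4,8)]])
qed

end

lemma suspension_low: "n < k \<Longrightarrow> el (suspension k M) n = {\<zero>\<^bsub>gr (suspension k M) n\<^esub>}"
  by (simp add: suspension_def)

lemma suspension_top:
  "M \<in> Ob U \<Longrightarrow> n < i + k \<Longrightarrow> x \<in> el (suspension k M) n \<Longrightarrow>
    Sq (suspension k M) i n x = \<zero>\<^bsub>gr (suspension k M) (n + i)\<^esub>"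
  by (auto simp: suspension_def Sq_unstable)

section \<open>Tensoring with a fixed module\<close>

context tensor_choice
begin

text \<open>Stated for degreewise linear maps, because the generalised inverses to which it is
  applied need not commute with the squares.\<close>

lemma tensor_lin:
  assumes O: "M \<in> Ob U" "M' \<in> Ob U" "N \<in> Ob U" and f: "\<And>n. f n \<in> lin (gr M n) (gr M' n)"
  shows "\<exists>h. (\<forall>n. h n \<in> lin (gr (tob T M N) n) (gr (tob T M' N) n)) \<and>
    (\<forall>i j. \<forall>x\<in>el M i. \<forall>y\<in>el N j. h (i + j) (tel T M N i j x y) = tel T M' N i j (f i x) y)"
  using lin_compose[OF f tel_lin(2)[OF O(2,3)]] tel_lin(1)[OF O(2,3) lin_closed[OF f]]
  by (intro tensor_univ[OF O(1,3) mod_space[OF tob_Ob[OF O(2,3)]]] bilinear_pairingI)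

text \<open>The linear splitting \<open>f b + a g = 1\<close> is tensored with \<open>N\<close> and
  then verified on tensors; an element killed by the second map is therefore a value of the
  first.\<close>

lemma tensor_exact:
  assumes O: "L \<in> Ob U" "M \<in> Ob U" "M' \<in> Ob U" "N \<in> Ob U" and f: "f \<in> Hom U L M" and g: "g \<in> Hom U M M'"
    and ex: "exact_at f g"
  shows "exact_at (tmap T f (Idn U N)) (tmap T g (Idn U N))"
proof -
  note idN = id_in_Hom[OF O(4)]
  note F = tmap_in[OF O(1,4,2,4) f idN] and G = tmap_in[OF O(2,4,3,4) g idN]
  note LN = tob_Ob[OF O(1,4)] and MN = tob_Ob[OF O(2,4)] and M'N = tob_Ob[OF O(3,4)]
  have "\<exists>b a. b \<in> lin (gr M n) (gr L n) \<and> a \<in> lin (gr M' n) (gr M n) \<and>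
      (\<forall>x\<in>el M n. app f n (b x) \<oplus>\<^bsub>gr M n\<^esub> a (app g n x) = x)" for n
    by (rule lin_exact_split[OF mod_space[OF O(1)] mod_space[OF O(2)] mod_space[OF O(3)] hom_lin[OF f]
          hom_lin[OF g] exact_atD[OF ex f g]]) blast
  then obtain b a where b: "\<And>n. b n \<in> lin (gr M n) (gr L n)" and a: "\<And>n. a n \<in> lin (gr M' n) (gr M n)"
    and ba: "\<And>n x. x \<in> el M n \<Longrightarrow> app f n (b n x) \<oplus>\<^bsub>gr M n\<^esub> a n (app g n x) = x" by metis
  obtain B where B: "\<And>n. B n \<in> lin (gr (tob T M N) n) (gr (tob T L N) n)"
    "\<And>i j x y. x \<in> el M i \<Longrightarrow> y \<in> el N j \<Longrightarrow> B (i + j) (tel T M N i j x y) = tel T L N i j (b i x) y"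
    using tensor_lin[OF O(2,1,4), of b] b by blast
  obtain A where A: "\<And>n. A n \<in> lin (gr (tob T M' N) n) (gr (tob T M N) n)"
    "\<And>i j x y. x \<in> el M' i \<Longrightarrow> y \<in> el N j \<Longrightarrow> A (i + j) (tel T M' N i j x y) = tel T M N i j (a i x) y"
    using tensor_lin[OF O(3,2,4), of a] a by blast
  let ?f = "app (tmap T f (Idn U N))" and ?g = "app (tmap T g (Idn U N))"
  have split: "?f n (B n z) \<oplus>\<^bsub>gr (tob T M N) n\<^esub> A n (?g n z) = z" if z: "z \<in> el (tob T M N) n" for n z
  proof (rule tensor_lin_eqI[OF O(2,4) mod_space[OF MN]
        lin_plus[OF mod_space[OF MN] lin_compose[OF B(1) hom_lin[OF F]]
            lin_compose[OF hom_lin[OF G] A(1)]] lin_id _ z])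
    fix i j x y assume n: "i + j = n" and x: "x \<in> el M i" and y: "y \<in> el N j"
    have "?f (i + j) (B (i + j) (tel T M N i j x y)) \<oplus>\<^bsub>gr (tob T M N) (i + j)\<^esub> A (i + j) (?g (i + j)
        (tel T M N i j x y)) =
        tel T M N i j (app f i (b i x)) y \<oplus>\<^bsub>gr (tob T M N) (i + j)\<^esub> tel T M N i j (a i (app g i x)) y"
      using B(2)[OF x y] tmap_app[OF O(1,4,2,4) f idN lin_closed[OF b x] y]
        tmap_app[OF O(2,4,3,4) g idN x y] A(2)[OF hom_closed[OF g x] y] id_app[OF y] by simp
    also have "\<dots> = tel T M N i j (app f i (b i x) \<oplus>\<^bsub>gr M i\<^esub> a i (app g i x)) y"
      using lin_add[OF tel_lin(2)[OF O(2,4) y] hom_closed[OF f lin_closed[OF b x]]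
          lin_closed[OF a hom_closed[OF g x]]]
      by simp
    finally show "?f n (B n (tel T M N i j x y)) \<oplus>\<^bsub>gr (tob T M N) n\<^esub> A n (?g n (tel T M N i j x y)) =
        tel T M N i j x y"
      unfolding ba[OF x] n .
  qed
  have gf: "?g n (?f n z) = \<zero>\<^bsub>gr (tob T M' N) n\<^esub>" if z: "z \<in> el (tob T L N) n" for n z
  proof (rule tensor_lin_eqI[OF O(1,4) mod_space[OF M'N] lin_compose[OF hom_lin[OF F] hom_lin[OF G]]
        lin_const_zero[OF mod_space[OF M'N]] _ z])
    fix i j x y assume n: "i + j = n" and x: "x \<in> el L i" and y: "y \<in> el N j"
    have "app g i (app f i x) = \<zero>\<^bsub>gr M' i\<^esub>" using exact_atD[OF ex f g, of i] x by blast
    then have "?g (i + j) (?f (i + j) (tel T L N i j x y)) = \<zero>\<^bsub>gr (tob T M' N) (i + j)\<^esub>"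
      using tmap_app[OF O(1,4,2,4) f idN x y] tmap_app[OF O(2,4,3,4) g idN hom_closed[OF f x] y]
        id_app[OF y] tel_zero(2)[OF O(3,4) y] by simp
    then show "?g n (?f n (tel T L N i j x y)) = \<zero>\<^bsub>gr (tob T M' N) n\<^esub>" unfolding n .
  qed
  show ?thesis
  proof (rule exact_atI[OF F G])
    fix n
    show "?f n ` el (tob T L N) n = {z \<in> el (tob T M N) n. ?g n z = \<zero>\<^bsub>gr (tob T M' N) n\<^esub>}"
    proof (intro equalityI subsetI)
      fix z assume "z \<in> {z \<in> el (tob T M N) n. ?g n z = \<zero>\<^bsub>gr (tob T M' N) n\<^esub>}"
      then have z: "z \<in> el (tob T M N) n" "?g n z = \<zero>\<^bsub>gr (tob T M' N) n\<^esub>" by auto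
      have Bz: "B n z \<in> el (tob T L N) n" by (rule lin_closed[OF B(1) z(1)])
      have "A n (?g n z) = \<zero>\<^bsub>gr (tob T M N) n\<^esub>"
        unfolding z(2) by (rule lin_zero[OF mod_space[OF M'N] mod_space[OF MN] A(1)])
      then have "?f n (B n z) = z"
        using split[OF z(1)] F2_add_zero(1)[OF mod_space[OF MN] hom_closed[OF F Bz]] by simp
      with Bz show "z \<in> ?f n ` el (tob T L N) n" by (metis image_eqI)
    qed (use gf hom_closed[OF F] in auto)
  qed
qed

text \<open>The projections of \<open>S\<close> are tensored with \<open>N\<close>, and their
  relations are checked on tensors.\<close>

lemma tensor_direct_sum:
  assumes ds: "is_direct_sum I D \<iota> S" and N: "N \<in> Ob U"
  shows "is_direct_sum I (\<lambda>i. tob T (D i) N) (\<lambda>i. tmap T (\<iota> i) (Idn U N)) (tob T S N)"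
proof (rule direct_sum_projections[OF ds])
  fix \<pi>
  assume \<pi>: "\<And>i n. i \<in> I \<Longrightarrow> \<pi> i n \<in> lin (gr S n) (gr (D i) n)"
    "\<And>i n x. i \<in> I \<Longrightarrow> x \<in> el (D i) n \<Longrightarrow> \<pi> i n (app (\<iota> i) n x) = x"
    "\<And>i j n x. i \<in> I \<Longrightarrow> j \<in> I \<Longrightarrow> i \<noteq> j \<Longrightarrow> x \<in> el (D i) n \<Longrightarrow> \<pi> j n (app (\<iota> i) n x) = \<zero>\<^bsub>gr (D j) n\<^esub>"
  note O = direct_sum_Ob[OF ds]
  note idN = id_in_Hom[OF N]
  note \<iota>N = tmap_in[OF O(2) N O(1) N O(3) idN]
  note VDN = mod_space[OF tob_Ob[OF O(2) N]]
  have "\<forall>i\<in>I. \<exists>h. (\<forall>n. h n \<in> lin (gr (tob T S N) n) (gr (tob T (D i) N) n)) \<and>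
    (\<forall>a c. \<forall>x\<in>el S a. \<forall>y\<in>el N c. h (a + c) (tel T S N a c x y) = tel T (D i) N a c (\<pi> i a x) y)"
    using \<pi>(1) by (intro ballI tensor_lin[OF O(1,2) N])
  then obtain \<Psi> where "\<forall>i\<in>I. (\<forall>n. \<Psi> i n \<in> lin (gr (tob T S N) n) (gr (tob T (D i) N) n)) \<and>
    (\<forall>a c. \<forall>x\<in>el S a. \<forall>y\<in>el N c. \<Psi> i (a + c) (tel T S N a c x y) = tel T (D i) N a c (\<pi> i a x) y)"
    by (rule bchoice[THEN exE])
  then have \<Psi>: "\<And>i n. i \<in> I \<Longrightarrow> \<Psi> i n \<in> lin (gr (tob T S N) n) (gr (tob T (D i) N) n)"
    "\<And>i a c x y. i \<in> I \<Longrightarrow> x \<in> el S a \<Longrightarrow> y \<in> el N c \<Longrightarrow>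
      \<Psi> i (a + c) (tel T S N a c x y) = tel T (D i) N a c (\<pi> i a x) y" by blast+
  show ?thesis
  proof (rule direct_sumI[where \<pi> = \<Psi>])
    show "tob T S N \<in> Ob U" by (rule tob_Ob[OF O(1) N])
    show "tob T (D i) N \<in> Ob U" if "i \<in> I" for i by (rule tob_Ob[OF O(2)[OF that] N])
    show "tmap T (\<iota> i) (Idn U N) \<in> Hom U (tob T (D i) N) (tob T S N)" if "i \<in> I" for i
      using that by (rule \<iota>N) (rule that)+
    show "\<Psi> i n \<in> lin (gr (tob T S N) n) (gr (tob T (D i) N) n)" if "i \<in> I" for i n
      by (rule \<Psi>(1)[OF that])
    note tm = tmap_app[OF O(2) N O(1) N O(3) idN]
    fix i n assume i: "i \<in> I"
    show "\<Psi> i n (app (tmap T (\<iota> i) (Idn U N)) n z) = z" if z: "z \<in> el (tob T (D i) N) n" for z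
    proof (rule tensor_lin_eqI[OF O(2)[OF i] N VDN[OF i] lin_compose[OF hom_lin[OF \<iota>N[OF i i]]
        \<Psi>(1)[OF i]] lin_id _ z])
      fix a c x y assume n: "a + c = n" and x: "x \<in> el (D i) a" and y: "y \<in> el N c"
      have "\<Psi> i (a + c) (app (tmap T (\<iota> i) (Idn U N)) (a + c) (tel T (D i) N a c x y)) = tel T (D i)
          N a c x y"
        using tm[OF i i x y] \<Psi>(2)[OF i hom_closed[OF O(3)[OF i] x] y] \<pi>(2)[OF i x] id_app[OF y] by simp
      then show "\<Psi> i n (app (tmap T (\<iota> i) (Idn U N)) n (tel T (D i) N a c x y)) = tel T (D i) N a c x y"
        unfolding n .
    qed
    fix j assume j: "j \<in> I" and ij: "i \<noteq> j"
    show "\<Psi> j n (app (tmap T (\<iota> i) (Idn U N)) n z) = \<zero>\<^bsub>gr (tob T (D j) N) n\<^esub>" if z: "z \<in>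
        el (tob T (D i) N) n" for z
    proof (rule tensor_lin_eqI[OF O(2)[OF i] N VDN[OF j] lin_compose[OF hom_lin[OF \<iota>N[OF i i]]
        \<Psi>(1)[OF j]]
          lin_const_zero[OF VDN[OF j]] _ z])
      fix a c x y assume n: "a + c = n" and x: "x \<in> el (D i) a" and y: "y \<in> el N c"
      have "\<Psi> j (a + c) (app (tmap T (\<iota> i) (Idn U N)) (a + c) (tel T (D i) N a c x y)) =
          \<zero>\<^bsub>gr (tob T (D j) N) (a + c)\<^esub>"
        using tm[OF i i x y] \<Psi>(2)[OF j hom_closed[OF O(3)[OF i] x] y] \<pi>(3)[OF i j ij x] id_app[OF y]
          tel_zero(2)[OF O(2)[OF j] N y] by simp
      then show "\<Psi> j n (app (tmap T (\<iota> i) (Idn U N)) n (tel T (D i) N a c x y)) = \<zero>\<^bsub>gr (tob T (D j) N) n\<^esub>"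
        unfolding n .
    qed
  next
    fix n Z z assume Z: "F2_subspace Z (gr (tob T S N) n)"
      and im: "\<And>i x. i \<in> I \<Longrightarrow> x \<in> el (tob T (D i) N) n \<Longrightarrow> app (tmap T (\<iota> i) (Idn U N)) n x \<in> Z"
      and z: "z \<in> el (tob T S N) n"
    note ZD = F2_subspaceD[OF Z]
    show "z \<in> Z"
      using O(1) N z
    proof (rule tensor_induct)
      fix a c x y assume n: "a + c = n" and x: "x \<in> el S a" and y: "y \<in> el N c"
      \<comment> \<open>With \<open>y\<close> fixed, the elements whose tensor with \<open>y\<close>
        lies in \<open>Z\<close> form a subspace of \<open>S\<close> that contains the images of the
        summands.\<close>
      have "x \<in> {x \<in> el S a. tel T S N a c x y \<in> Z}"
      proof (rule direct_sum_span[OF ds _ _ x])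
        note l = tel_lin(2)[OF O(1) N y, of a]
        have "\<zero>\<^bsub>gr S a\<^esub> \<in> {x \<in> el S a. tel T S N a c x y \<in> Z}"
          using ZD(2) tel_zero(2)[OF O(1) N y, of a] el_zero[OF O(1)] n by simp
        moreover have "u \<oplus>\<^bsub>gr S a\<^esub> v \<in> {x \<in> el S a. tel T S N a c x y \<in> Z}"
          if "u \<in> {x \<in> el S a. tel T S N a c x y \<in> Z}" "v \<in> {x \<in> el S a. tel T S N a c x y \<in> Z}" for u v
          using that ZD(3)[of "tel T S N a c u y" "tel T S N a c v y"] lin_add[OF l, of u v]
              n F2_add[OF mod_space[OF O(1)], of u a v]
          by simp
        ultimately show "F2_subspace {x \<in> el S a. tel T S N a c x y \<in> Z} (gr S a)"
          by (intro F2_subspaceI) auto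
        fix i d assume i: "i \<in> I" and d: "d \<in> el (D i) a"
        have "app (tmap T (\<iota> i) (Idn U N)) n (tel T (D i) N a c d y) \<in> Z"
          using im[OF i] tel_closed[OF O(2)[OF i] N d y] unfolding n .
        moreover have "app (tmap T (\<iota> i) (Idn U N)) n (tel T (D i) N a c d y) =
            tel T S N a c (app (\<iota> i) a d) y"
          using tmap_app[OF O(2)[OF i] N O(1) N O(3)[OF i] idN d y] id_app[OF y] unfolding n by simp
        ultimately show "app (\<iota> i) a d \<in> {x \<in> el S a. tel T S N a c x y \<in> Z}"
          using hom_closed[OF O(3)[OF i] d] by simp
      qed
      then show "tel T S N a c x y \<in> Z" by blast
    qed (use ZD in auto)
  qed
qed

text \<open>The product is a \<open>k\<close>-fold suspension of \<open>M \<otimes> N\<close>. It is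
  recognised through \<open>nilpotent_desuspend\<close> instead of an explicit isomorphism, and both
  conditions are read off from tensors of elements.\<close>

lemma tensor_suspension_nilpotent:
  assumes M: "M \<in> Ob U" and N: "N \<in> Ob U"
  shows "tob T (suspension k M) N \<in> nilpotent k"
proof -
  let ?S = "suspension k M"
  let ?P = "tob T ?S N"
  note S = suspension_in_Ob[OF M, of k]
  note P = tob_Ob[OF S N]
  note VP = mod_space[OF P]
  show ?thesis
  proof (rule nilpotent_desuspend[OF P])
    fix n assume n: "n < k"
    have "z = \<zero>\<^bsub>gr ?P n\<^esub>" if z: "z \<in> el ?P n" for z
    proof (rule tensor_lin_eqI[OF S N VP lin_id lin_const_zero[OF VP] _ z])
      fix i j x y assume ij: "i + j = n" and x: "x \<in> el ?S i" and y: "y \<in> el N j"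
      have "x = \<zero>\<^bsub>gr ?S i\<^esub>" using suspension_low[of i k M] x n ij by simp
      then show "tel T ?S N i j x y = \<zero>\<^bsub>gr ?P n\<^esub>"
        using tel_zero(2)[OF S N y, of i] ij by simp
    qed
    then show "el ?P n = {\<zero>\<^bsub>gr ?P n\<^esub>}" using el_zero[OF P, of n] by blast
  next
    fix s n z assume n: "n < s + k" and z: "z \<in> el ?P n"
    show "Sq ?P s n z = \<zero>\<^bsub>gr ?P (n + s)\<^esub>"
    proof (rule tensor_lin_eqI[OF S N VP Sq_lin[OF P] lin_const_zero[OF VP] _ z])
      fix i j x y assume ij: "i + j = n" and x: "x \<in> el ?S i" and y: "y \<in> el N j"
      have "tel T ?S N (i + a) (j + (s - a)) (Sq ?S a i x) (Sq N (s - a) j y) = \<zero>\<^bsub>gr ?P (i + j + s)\<^esub>"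
        if a: "a \<in> {0..s}" for a
      proof -
        have d: "i + a + (j + (s - a)) = i + j + s" using a by simp
        show ?thesis
        \<comment> \<open>From \<open>i + j < s + k\<close> it follows that either the square on the
          suspended factor exceeds the desuspended degree \<open>i - k\<close>, or the square on
          \<open>y\<close> exceeds \<open>j\<close>.\<close>
        proof (cases "i < a + k")
          case True
          then show ?thesis
            using suspension_top[OF M True x] tel_zero(2)[OF S N Sq_closed[OF N y, of "s - a"],
                of "i + a"]
            unfolding d by simp
        next
          case False
          then have "j < s - a" using n ij a by simp
          then show ?thesis
            using Sq_unstable[OF N _ y] tel_zero(1)[OF S N Sq_closed[OF S x, of a], of "j + (s - a)"]
            unfolding d by simp
        qed
      qed
      then have "Sq ?P s (i + j) (tel T ?S N i j x y) = \<zero>\<^bsub>gr ?P (i + j + s)\<^esub>"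
        unfolding cartan_Sq[OF cartan_tel[OF S N] x y] by (rule F2_finsum_zero[OF VP])
      then show "Sq ?P s n (tel T ?S N i j x y) = \<zero>\<^bsub>gr ?P (n + s)\<^esub>" unfolding ij .
    qed
  qed
qed

lemma exact_functor_tensor:
  assumes N: "N \<in> Ob U"
  shows "exact_functor k (\<lambda>M. tob T M N) (\<lambda>f. tmap T f (Idn U N))"
proof
  note idN = id_in_Hom[OF N]
  show "tob T M N \<in> Ob U" if "M \<in> Ob U" for M by (rule tob_Ob[OF that N])
  show "tmap T f (Idn U N) \<in> Hom U (tob T M N) (tob T M' N)"
    if "M \<in> Ob U" "M' \<in> Ob U" "f \<in> Hom U M M'" for M M' f
    by (rule tmap_in[OF that(1) N that(2) N that(3) idN])
  show "exact_at (tmap T f (Idn U N)) (tmap T g (Idn U N))"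
    if "L \<in> Ob U" "M \<in> Ob U" "M' \<in> Ob U" "f \<in> Hom U L M" "g \<in> Hom U M M'" "exact_at f g" for L M M' f g
    by (rule tensor_exact[OF that(1-3) N that(4-6)])
  show "is_direct_sum I (\<lambda>i. tob T (D i) N) (\<lambda>i. tmap T (\<iota> i) (Idn U N)) (tob T S N)"
    if "is_direct_sum I D \<iota> S" for I D \<iota> S
    by (rule tensor_direct_sum[OF that N])
  show "tob T (suspension k M) N \<in> nilpotent k" if "M \<in> Ob U" for M
    by (rule tensor_suspension_nilpotent[OF that N])
  fix M M' :: "'a umod" assume M: "M \<in> Ob U" and M': "M' \<in> Ob U"
  let ?z = "uarr M M' (\<lambda>n x. \<zero>\<^bsub>gr M' n\<^esub>)"
  let ?zN = "uarr (tob T M N) (tob T M' N) (\<lambda>n x. \<zero>\<^bsub>gr (tob T M' N) n\<^esub>)"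
  note z = zero_in_Hom[OF M M']
  note MN = tob_Ob[OF M N] and M'N = tob_Ob[OF M' N]
  show "tmap T ?z (Idn U N) = ?zN"
  proof (rule tensor_hom_eqI[OF M N M'N tmap_in[OF M N M' N z idN] zero_in_Hom[OF MN M'N]])
    fix i j x y assume x: "x \<in> el M i" and y: "y \<in> el N j"
    show "app (tmap T ?z (Idn U N)) (i + j) (tel T M N i j x y) = app ?zN (i + j) (tel T M N i j x y)"
      using tmap_app[OF M N M' N z idN x y] tel_zero(2)[OF M' N y, of i] x y
      by (simp add: uarr_app tel_closed[OF M N] id_app)
  qed
qed

end

section \<open>The doubling functor\<close>

text \<open>By absorption, \<open>2 t + 1\<close> times the coefficient is \<open>2 m\<close> times
  another one, and \<open>2 t + 1\<close> is odd.\<close>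

lemma even_choose_odd: "even ((2 * m) choose (Suc (2 * t)))"
proof -
  have "Suc (2 * t) * ((2 * m) choose (Suc (2 * t))) = 2 * m * ((2 * m - 1) choose (2 * t))"
    by (rule binomial_absorption)
  then have "even (Suc (2 * t) * ((2 * m) choose (Suc (2 * t))))" by simp
  then show ?thesis by simp
qed

text \<open>Lucas' congruence modulo 2 for even entries, by induction with Pascal's rule applied
  twice: the middle term appears doubled and drops out.\<close>

lemma odd_choose_double: "odd ((2 * m) choose (2 * t)) \<longleftrightarrow> odd (m choose t)"
proof (induction m arbitrary: t)
  case 0
  then show ?case by (cases t) auto
next
  case (Suc m)
  show ?case
  proof (cases t)
    case (Suc s)
    have "(2 * Suc m) choose (2 * Suc s) = Suc (Suc (2 * m)) choose Suc (Suc (2 * s))" by simp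
    also have "\<dots> = ((2 * m) choose (2 * s)) + 2 * ((2 * m) choose (Suc (2 * s))) + ((2 * m)
        choose (2 * Suc s))"
      by simp
    finally have "odd ((2 * Suc m) choose (2 * Suc s)) \<longleftrightarrow>
        odd ((2 * m) choose (2 * s)) \<noteq> odd ((2 * m) choose (2 * Suc s))"
      by (simp only: even_add even_mult_iff) simp
    then show ?thesis unfolding Suc Suc.IH by simp
  qed simp
qed

text \<open>The form that Adem coefficients need: doubling both \<open>b\<close> and
  \<open>c\<close> turns the upper entry \<open>b - c - 1\<close> into
  \<open>2 (b - c - 1) + 1\<close>.\<close>

lemma odd_choose_Suc_double: "odd ((Suc (2 * m)) choose (2 * t)) \<longleftrightarrow> odd (m choose t)"
proof (cases t)
  case (Suc s)
  have "Suc (2 * m) choose (2 * Suc s) = ((2 * m) choose (Suc (2 * s))) + ((2 * m) choose (2 * Suc s))"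
    by simp
  then have "odd (Suc (2 * m) choose (2 * Suc s)) \<longleftrightarrow> odd ((2 * m) choose (2 * Suc s))"
    using even_choose_odd[of m s] by (simp only: even_add) simp
  then show ?thesis unfolding Suc odd_choose_double .
qed simp

text \<open>This is the functor \<open>\<Phi>\<close>. Odd degrees are the zero subspace of
  \<open>gr M 0\<close>, as are the low degrees of \<open>suspension\<close>; the grading is named
  first because the vanishing operations refer to its zeros.\<close>

definition doubling :: "'a umod \<Rightarrow> 'a umod" where
  "doubling M = (let G = (\<lambda>n. if even n then gr M (n div 2) else (gr M 0)\<lparr>carrier := {\<zero>\<^bsub>gr M 0\<^esub>}\<rparr>) in
    \<lparr>gr = G, Sq = (\<lambda>i n x. if even n \<and> even i then Sq M (i div 2) (n div 2) x else \<zero>\<^bsub>G (n + i)\<^esub>)\<rparr>)"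

lemma gr_doubling:
  "gr (doubling M) (2 * n) = gr M n"
  "el (doubling M) (Suc (2 * n)) = {\<zero>\<^bsub>gr (doubling M) (Suc (2 * n))\<^esub>}"
  by (simp_all add: doubling_def Let_def)

lemma Sq_doubling:
  "Sq (doubling M) (2 * i) (2 * n) x = Sq M i n x"
  "odd i \<or> odd n \<Longrightarrow> Sq (doubling M) i n x = \<zero>\<^bsub>gr (doubling M) (n + i)\<^esub>"
  by (auto simp: doubling_def Let_def)

text \<open>The Adem relation is the point. For even \<open>a\<close>, \<open>b\<close> and
  \<open>n\<close> the terms with odd \<open>c\<close> vanish, and the coefficients with even
  \<open>c\<close> agree modulo 2 with those for \<open>a / 2\<close> and \<open>b / 2\<close>. For
  other parities each term vanishes or has an even coefficient.\<close>

lemma doubling_Ob: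
  assumes M: "M \<in> Ob U"
  shows "doubling M \<in> Ob U"
proof (rule unstableI)
  let ?D = "doubling M"
  show V: "F2_space (gr ?D n)" for n
  proof (cases "even n")
    case True
    then obtain m where "n = 2 * m" by (rule evenE)
    then show ?thesis using mod_space[OF M] by (simp add: gr_doubling)
  next
    case False
    have "F2_subspace {\<zero>\<^bsub>gr M 0\<^esub>} (gr M 0)"
      using submodule_zero[OF M] by (simp add: submodule_def)
    from F2_space_subspace[OF mod_space[OF M] this] show ?thesis
      using False by (simp add: doubling_def Let_def)
  qed
  show L: "Sq ?D i n \<in> lin (gr ?D n) (gr ?D (n + i))" for i n
  proof (cases "odd i \<or> odd n")
    case True
    then show ?thesis
      by (intro lin_cong[OF lin_const_zero[OF V] V]) (simp add: Sq_doubling(2))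
  next
    case False
    then obtain i' n' where in': "i = 2 * i'" "n = 2 * n'" by (auto elim!: evenE)
    have "Sq ?D (2 * i') (2 * n') = Sq M i' n'" by (rule ext) (rule Sq_doubling(1))
    then show ?thesis
      using Sq_lin[OF M, of i' n'] unfolding in' distrib_left[symmetric] gr_doubling by simp
  qed
  have z: "Sq ?D i n \<zero>\<^bsub>gr ?D n\<^esub> = \<zero>\<^bsub>gr ?D (n + i)\<^esub>" for i n
    by (rule lin_zero[OF V V L])
  have odd_zero: "x = \<zero>\<^bsub>gr ?D n\<^esub>" if "odd n" "x \<in> el ?D n" for n x
    using that by (auto elim!: oddE simp: gr_doubling)
  show "Sq ?D 0 n x = x" if "x \<in> el ?D n" for n x
  proof (cases "even n")
    case True
    then obtain m where "n = 2 * m" by (rule evenE)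
    then show ?thesis
      using that Sq_0[OF M] Sq_doubling(1)[of M 0 m x] by (simp add: gr_doubling)
  qed (use that odd_zero Sq_doubling(2)[of 0 n M x] in simp)
  show "Sq ?D i n x = \<zero>\<^bsub>gr ?D (n + i)\<^esub>" if "n < i" "x \<in> el ?D n" for i n x
  proof (cases "odd i \<or> odd n")
    case False
    then obtain i' n' where in': "i = 2 * i'" "n = 2 * n'" by (auto elim!: evenE)
    then show ?thesis
      using that Sq_unstable[OF M, of n' i' x]
      unfolding in' distrib_left[symmetric] gr_doubling Sq_doubling by simp
  qed (rule Sq_doubling(2))
  fix a b n :: nat and x assume ab: "0 < a" "a < 2 * b" and x: "x \<in> el ?D n"
  let ?C = "\<lambda>a b. {c. 2 * c \<le> a \<and> odd ((b - c - 1) choose (a - 2 * c))}"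
  let ?N = "n + a + b"
  let ?t = "\<lambda>c. Sq ?D (a + b - c) (n + c) (Sq ?D c n x)"
  have deg: "n + c + (a + b - c) = ?N" if "c \<in> ?C a b" for c using that ab by simp
  have t_zero: "?t c = \<zero>\<^bsub>gr ?D ?N\<^esub>" if c: "c \<in> ?C a b" and od: "odd c \<or> odd (a + b) \<or> odd n" for c
  proof (cases "odd c \<or> odd n")
    case True
    then show ?thesis
      using Sq_doubling(2)[of c n M x] z[of "a + b - c" "n + c"] deg[OF c] by simp
  next
    case False
    then have "odd (a + b - c)" using od c ab by auto
    then show ?thesis
      using Sq_doubling(2)[of "a + b - c" "n + c" M] deg[OF c] by simp
  qed
  have fin: "finite (?C a b)" by (rule finite_subset[of _ "{..a}"]) auto
  show "Sq ?D a (n + b) (Sq ?D b n x) = (\<Oplus>\<^bsub>gr ?D ?N\<^esub> c \<in> ?C a b. ?t c)"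
  proof (cases "even n \<and> even a \<and> even b")
    case True
    then obtain n' a' b' where nab: "n = 2 * n'" "a = 2 * a'" "b = 2 * b'" by (auto elim!: evenE)
    have ab': "0 < a'" "a' < 2 * b'" using ab nab by auto
    have x': "x \<in> el M n'" using x nab by (simp add: gr_doubling)
    have N: "gr ?D ?N = gr M (n' + a' + b')"
      unfolding nab distrib_left[symmetric] gr_doubling ..
    have im: "(\<lambda>c. 2 * c) ` ?C a' b' = {c \<in> ?C a b. even c}"
    proof -
      \<comment> \<open>The upper entry is odd and the lower one even, so
        \<open>odd_choose_Suc_double\<close> compares the coefficient with that of the halved
        indices.\<close>
      have key: "2 * c' \<in> ?C a b \<longleftrightarrow> c' \<in> ?C a' b'" for c'
      proof (cases "2 * c' \<le> a'")
        case True
        then have "b - 2 * c' - 1 = Suc (2 * (b' - c' - 1))" "a - 2 * (2 * c') = 2 * (a' - 2 * c')"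
          using ab' nab by auto
        then show ?thesis using True nab odd_choose_Suc_double by simp
      qed (use nab in auto)
      show ?thesis
      proof (intro equalityI subsetI)
        fix c assume "c \<in> (\<lambda>c. 2 * c) ` ?C a' b'"
        then obtain c' where c': "c = 2 * c'" "c' \<in> ?C a' b'" by blast
        from c'(2) have "c \<in> ?C a b" unfolding c'(1) key .
        then show "c \<in> {c \<in> ?C a b. even c}" using c'(1) by simp
      next
        fix c assume "c \<in> {c \<in> ?C a b. even c}"
        then obtain c' where c': "c = 2 * c'" "c \<in> ?C a b" by blast
        from c'(2) have "c' \<in> ?C a' b'" unfolding c'(1) key .
        then show "c \<in> (\<lambda>c. 2 * c) ` ?C a' b'" unfolding c'(1) by (rule imageI)
      qed
    qed
    have t: "?t (2 * c) = Sq M (a' + b' - c) (n' + c) (Sq M c n' x)" for c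
      unfolding nab distrib_left[symmetric] diff_mult_distrib2[symmetric] Sq_doubling ..
    have tcl: "Sq M (a' + b' - c) (n' + c) (Sq M c n' x) \<in> el M (n' + a' + b')" if "c \<in> ?C a' b'" for c
      using adem_term_closed[OF Sq_closed[OF M] x', of c a' b'] that ab' by simp
    have "(\<Oplus>\<^bsub>gr ?D ?N\<^esub> c \<in> ?C a b. ?t c) = (\<Oplus>\<^bsub>gr ?D ?N\<^esub> c \<in> (\<lambda>c. 2 * c) ` ?C a' b'. ?t c)"
    proof (rule F2_finsum_mono_neutral[OF V fin, symmetric])
      show "(\<lambda>c. 2 * c) ` ?C a' b' \<subseteq> ?C a b" unfolding im by blast
      show "?t c = \<zero>\<^bsub>gr ?D ?N\<^esub>" if "c \<in> ?C a b - (\<lambda>c. 2 * c) ` ?C a' b'" for c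
        using that unfolding im by (intro t_zero) blast+
      show "?t \<in> (\<lambda>c. 2 * c) ` ?C a' b' \<rightarrow> el ?D ?N"
      proof (rule funcsetI, erule imageE)
        fix c c' assume "c = 2 * c'" "c' \<in> ?C a' b'"
        then show "?t c \<in> el ?D ?N" using tcl by (simp only: t N)
      qed
    qed
    also have "\<dots> = (\<Oplus>\<^bsub>gr ?D ?N\<^esub> c \<in> ?C a' b'. ?t (2 * c))"
      using tcl by (intro F2_finsum_reindex[OF V]) (auto simp: t N inj_on_def)
    also have "\<dots> = Sq M a' (n' + b') (Sq M b' n' x)"
      unfolding t N by (rule Sq_adem[OF M ab' x', symmetric])
    also have "\<dots> = Sq ?D a (n + b) (Sq ?D b n x)"
      unfolding nab distrib_left[symmetric] Sq_doubling ..
    finally show ?thesis ..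
  next
    case False
    have "Sq ?D a (n + b) (Sq ?D b n x) = \<zero>\<^bsub>gr ?D ?N\<^esub>"
    proof (cases "odd b \<or> odd n")
      case True
      then show ?thesis
        using Sq_doubling(2)[of b n M x] z[of a "n + b"] by (simp add: add_ac)
    next
      case False
      then have "odd a" using \<open>\<not> (even n \<and> even a \<and> even b)\<close> by blast
      then show ?thesis using Sq_doubling(2)[of a "n + b" M] by (simp add: add_ac)
    qed
    \<comment> \<open>A surviving term needs \<open>c\<close>, \<open>n\<close> and
      \<open>a + b\<close> even, so \<open>a\<close> and \<open>b\<close> are both odd here; then
      the coefficient has an even upper and an odd lower entry and is even.\<close>
    moreover have "?t c = \<zero>\<^bsub>gr ?D ?N\<^esub>" if c: "c \<in> ?C a b" for c
    proof (rule t_zero[OF c], rule ccontr)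
      assume "\<not> (odd c \<or> odd (a + b) \<or> odd n)"
      then have ev: "even c" "even n" "odd a" "odd b" using False by auto
      then obtain c' a' b' where cab: "c = 2 * c'" "a = Suc (2 * a')" "b = Suc (2 * b')"
        by (auto elim!: evenE oddE)
      have "b - c - 1 = 2 * (b' - c')" "a - 2 * c = Suc (2 * (a' - 2 * c'))"
        using c ab unfolding cab by auto
      then have "even ((b - c - 1) choose (a - 2 * c))" using even_choose_odd by simp
      then show False using c by simp
    qed
    then have "(\<Oplus>\<^bsub>gr ?D ?N\<^esub> c \<in> ?C a b. ?t c) = \<zero>\<^bsub>gr ?D ?N\<^esub>"
      by (rule F2_finsum_zero[OF V])
    ultimately show ?thesis by simp
  qed
qed

section \<open>Functoriality and exactness of the double\<close>

definition doubling_map :: "'a uarr \<Rightarrow> 'a uarr" where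
  "doubling_map f = uarr (doubling (src f)) (doubling (tgt f))
    (\<lambda>n. if even n then app f (n div 2) else (\<lambda>x. \<zero>\<^bsub>gr (doubling (tgt f)) n\<^esub>))"

lemma doubling_odd:
  assumes "odd n" "x \<in> el (doubling M) n"
  shows "x = \<zero>\<^bsub>gr (doubling M) n\<^esub>"
  using assms by (auto elim!: oddE simp: gr_doubling)

lemma doubling_map_in:
  assumes M: "M \<in> Ob U" and N: "N \<in> Ob U" and f: "f \<in> Hom U M N"
  shows "doubling_map f \<in> Hom U (doubling M) (doubling N)"
  unfolding doubling_map_def hom_src[OF f] hom_tgt[OF f]
proof (rule uarr_in_Hom[OF doubling_Ob[OF M]])
  note DM = doubling_Ob[OF M] and DN = doubling_Ob[OF N]
  let ?f = "\<lambda>n. if even n then app f (n div 2) else (\<lambda>x. \<zero>\<^bsub>gr (doubling N) n\<^esub>)"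
  show L: "?f n \<in> lin (gr (doubling M) n) (gr (doubling N) n)" for n
  proof (cases "even n")
    case True
    then show ?thesis using hom_lin[OF f] by (auto elim!: evenE simp: gr_doubling)
  qed (simp add: lin_const_zero[OF mod_space[OF DN]])
  fix i n x assume x: "x \<in> el (doubling M) n"
  show "?f (n + i) (Sq (doubling M) i n x) = Sq (doubling N) i n (?f n x)"
  proof (cases "odd i \<or> odd n")
    case True
    then show ?thesis
      using lin_zero[OF mod_space[OF DM] mod_space[OF DN] L, of "n + i"]
      by (simp only: Sq_doubling(2))
  next
    case False
    then obtain i' n' where in': "i = 2 * i'" "n = 2 * n'" by (auto elim!: evenE)
    then show ?thesis using x hom_Sq[OF f, of x n' i']
      unfolding in' distrib_left[symmetric] by (simp add: gr_doubling Sq_doubling)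
  qed
qed

lemma doubling_map_app: "f \<in> Hom U M N \<Longrightarrow> x \<in> el M n \<Longrightarrow> app (doubling_map f) (2 * n) x = app f n x"
  by (simp add: doubling_map_def hom_src uarr_app gr_doubling)

text \<open>Unlike for the tensor product, inspection suffices: even degrees repeat the given
  sequence and odd degrees are zero.\<close>

lemma doubling_exact:
  assumes O: "L \<in> Ob U" "M \<in> Ob U" "N \<in> Ob U" and f: "f \<in> Hom U L M" and g: "g \<in> Hom U M N"
    and ex: "exact_at f g"
  shows "exact_at (doubling_map f) (doubling_map g)"
proof (rule exact_atI[OF doubling_map_in[OF O(1,2) f] doubling_map_in[OF O(2,3) g]])
  fix n
  note DL = doubling_Ob[OF O(1)] and DM = doubling_Ob[OF O(2)] and DN = doubling_Ob[OF O(3)]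
  show "app (doubling_map f) n ` el (doubling L) n =
      {x \<in> el (doubling M) n. app (doubling_map g) n x = \<zero>\<^bsub>gr (doubling N) n\<^esub>}"
  proof (cases "even n")
    case True
    then obtain m where n: "n = 2 * m" by (rule evenE)
    show ?thesis
      unfolding n gr_doubling using exact_atD[OF ex f g, of m]
      by (simp add: doubling_map_app[OF f] doubling_map_app[OF g] cong: image_cong conj_cong)
  next
    case False
    have "el (doubling L) n = {\<zero>\<^bsub>gr (doubling L) n\<^esub>}"
      using doubling_odd[OF False, of _ L] el_zero[OF DL, of n] by blast
    moreover have "el (doubling M) n = {\<zero>\<^bsub>gr (doubling M) n\<^esub>}"
      using doubling_odd[OF False, of _ M] el_zero[OF DM, of n] by blast
    ultimately show ?thesis
      using hom_zero[OF doubling_map_in[OF O(1,2) f] DL DM] hom_zero[OF doubling_map_in[OF O(2,3) g]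
          DM DN] by auto
  qed
qed

lemma doubling_direct_sum:
  assumes ds: "is_direct_sum I D \<iota> S"
  shows "is_direct_sum I (\<lambda>i. doubling (D i)) (\<lambda>i. doubling_map (\<iota> i)) (doubling S)"
proof (rule direct_sum_projections[OF ds])
  fix \<pi>
  assume \<pi>: "\<And>i n. i \<in> I \<Longrightarrow> \<pi> i n \<in> lin (gr S n) (gr (D i) n)"
    "\<And>i n x. i \<in> I \<Longrightarrow> x \<in> el (D i) n \<Longrightarrow> \<pi> i n (app (\<iota> i) n x) = x"
    "\<And>i j n x. i \<in> I \<Longrightarrow> j \<in> I \<Longrightarrow> i \<noteq> j \<Longrightarrow> x \<in> el (D i) n \<Longrightarrow> \<pi> j n (app (\<iota> i) n x) = \<zero>\<^bsub>gr (D j) n\<^esub>"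
  note O = direct_sum_Ob[OF ds]
  let ?\<pi> = "\<lambda>i n. if even n then \<pi> i (n div 2) else (\<lambda>x. \<zero>\<^bsub>gr (doubling (D i)) n\<^esub>)"
  show ?thesis
  proof (rule direct_sumI[where \<pi> = ?\<pi>])
    show "doubling S \<in> Ob U" by (rule doubling_Ob[OF O(1)])
    show "doubling (D i) \<in> Ob U" if "i \<in> I" for i by (rule doubling_Ob[OF O(2)[OF that]])
    show "doubling_map (\<iota> i) \<in> Hom U (doubling (D i)) (doubling S)" if "i \<in> I" for i
      by (rule doubling_map_in[OF O(2)[OF that] O(1) O(3)[OF that]])
    show "?\<pi> i n \<in> lin (gr (doubling S) n) (gr (doubling (D i)) n)" if "i \<in> I" for i n
    proof (cases "even n")
      case True
      then show ?thesis using \<pi>(1)[OF that] by (auto elim!: evenE simp: gr_doubling)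
    qed (simp add: lin_const_zero[OF mod_space[OF doubling_Ob[OF O(2)[OF that]]]])
    fix i n x assume i: "i \<in> I" and x: "x \<in> el (doubling (D i)) n"
    show "?\<pi> i n (app (doubling_map (\<iota> i)) n x) = x"
    proof (cases "even n")
      case True
      then obtain m where n: "n = 2 * m" by (rule evenE)
      show ?thesis using x \<pi>(2)[OF i] unfolding n by (simp add: gr_doubling doubling_map_app[OF
          O(3)[OF i]])
    next
      case False
      then show ?thesis using doubling_odd[OF False x] by simp
    qed
    fix j assume j: "j \<in> I" and ij: "i \<noteq> j"
    show "?\<pi> j n (app (doubling_map (\<iota> i)) n x) = \<zero>\<^bsub>gr (doubling (D j)) n\<^esub>"
    proof (cases "even n")
      case True
      then obtain m where n: "n = 2 * m" by (rule evenE)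
      show ?thesis using x \<pi>(3)[OF i j ij] unfolding n by (simp add: gr_doubling doubling_map_app[OF
          O(3)[OF i]])
    qed simp
  next
    fix n Z x assume Z: "F2_subspace Z (gr (doubling S) n)"
      and im: "\<And>i x. i \<in> I \<Longrightarrow> x \<in> el (doubling (D i)) n \<Longrightarrow> app (doubling_map (\<iota> i)) n x \<in> Z"
      and x: "x \<in> el (doubling S) n"
    show "x \<in> Z"
    proof (cases "even n")
      case True
      then obtain m where n: "n = 2 * m" by (rule evenE)
      show ?thesis
      proof (rule direct_sum_span[OF ds])
        show "F2_subspace Z (gr S m)" "x \<in> el S m" using Z x unfolding n by (simp_all add: gr_doubling)
        fix i d assume i: "i \<in> I" and d: "d \<in> el (D i) m"
        show "app (\<iota> i) m d \<in> Z"
          using im[OF i, of d] d doubling_map_app[OF O(3)[OF i] d] unfolding n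
              by (simp add: gr_doubling)
      qed
    next
      case False
      then show ?thesis using doubling_odd[OF False x] F2_subspaceD(2)[OF Z] by simp
    qed
  qed
qed

text \<open>Doubling turns a \<open>k\<close>-fold suspension into a \<open>2k\<close>-fold one,
  which is in particular a \<open>k\<close>-fold one.\<close>

lemma doubling_suspension_nilpotent:
  assumes M: "M \<in> Ob U"
  shows "doubling (suspension k M) \<in> nilpotent k"
proof -
  let ?S = "suspension k M"
  note S = suspension_in_Ob[OF M, of k]
  note D = doubling_Ob[OF S]
  show ?thesis
  proof (rule nilpotent_desuspend[OF D])
    fix n assume n: "n < k"
    show "el (doubling ?S) n = {\<zero>\<^bsub>gr (doubling ?S) n\<^esub>}"
    proof (cases "even n")
      case True
      then obtain m where "n = 2 * m" by (rule evenE)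
      then show ?thesis using suspension_low[of m k M] n by (simp add: gr_doubling)
    next
      case False
      then show ?thesis using doubling_odd[OF False, of _ ?S] el_zero[OF D, of n] by blast
    qed
  next
    fix i n x assume n: "n < i + k" and x: "x \<in> el (doubling ?S) n"
    show "Sq (doubling ?S) i n x = \<zero>\<^bsub>gr (doubling ?S) (n + i)\<^esub>"
    proof (cases "odd i \<or> odd n")
      case False
      then obtain i' n' where in': "i = 2 * i'" "n = 2 * n'" by (auto elim!: evenE)
      show ?thesis
        using x n suspension_top[OF M, of n' i' k x]
        unfolding in' distrib_left[symmetric] gr_doubling Sq_doubling by simp
    qed (rule Sq_doubling(2))
  qed
qed

lemma exact_functor_doubling: "exact_functor k doubling doubling_map"
proof
  fix M N :: "'a umod" assume M: "M \<in> Ob U" and N: "N \<in> Ob U"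
  let ?z = "uarr M N (\<lambda>n x. \<zero>\<^bsub>gr N n\<^esub>)"
  note DM = doubling_Ob[OF M] and DN = doubling_Ob[OF N] and z = zero_in_Hom[OF M N]
  show "doubling_map ?z = uarr (doubling M) (doubling N) (\<lambda>n x. \<zero>\<^bsub>gr (doubling N) n\<^esub>)"
  proof (rule hom_eqI[OF doubling_map_in[OF M N z] zero_in_Hom[OF DM DN]])
    fix n x assume x: "x \<in> el (doubling M) n"
    show "app (doubling_map ?z) n x = app (uarr (doubling M) (doubling N) (\<lambda>n x. \<zero>\<^bsub>gr (doubling N)
        n\<^esub>)) n x"
    proof (cases "even n")
      case True
      then obtain m where n: "n = 2 * m" by (rule evenE)
      show ?thesis using x unfolding n by (simp add: gr_doubling doubling_map_app[OF z] uarr_app)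
    next
      case False
      then show ?thesis using x
        by (simp add: uarr_app doubling_map_def hom_src[OF z] hom_tgt[OF z])
    qed
  qed
qed (fact doubling_Ob doubling_map_in doubling_exact doubling_direct_sum doubling_suspension_nilpotent)+

section \<open>The top square\<close>

text \<open>With \<open>top_square_even\<close> this is the classical fact that the top square is a
  morphism from the double. As \<open>a\<close> is odd, the Adem terms have \<open>2 c < a\<close>,
  so the outer square exceeds the degree \<open>m + c\<close> on which it acts; outside the range of
  the relation instability applies directly.\<close>

lemma top_square_odd:
  assumes M: "M \<in> Ob U" and x: "x \<in> el M m" and a: "odd a"
  shows "Sq M a (m + m) (Sq M m m x) = \<zero>\<^bsub>gr M (m + m + a)\<^esub>"
proof (cases "a < 2 * m")
  case True
  have "Sq M a (m + m) (Sq M m m x) = \<zero>\<^bsub>gr M (m + a + m)\<^esub>"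
    unfolding Sq_adem[OF M odd_pos[OF a] True x]
  proof (rule F2_finsum_zero[OF mod_space[OF M]])
    fix c assume "c \<in> {c. 2 * c \<le> a \<and> odd ((m - c - 1) choose (a - 2 * c))}"
    then have "2 * c \<le> a" by simp
    moreover have "2 * c \<noteq> a" using a by auto
    ultimately have c: "2 * c < a" by simp
    then have d: "m + c + (a + m - c) = m + a + m" "m + c < a + m - c" by simp_all
    show "Sq M (a + m - c) (m + c) (Sq M c m x) = \<zero>\<^bsub>gr M (m + a + m)\<^esub>"
      using Sq_unstable[OF M d(2) Sq_closed[OF M x]] unfolding d(1) .
  qed
  then show ?thesis by (simp add: add_ac)
next
  case False
  moreover have "a \<noteq> 2 * m" using a by auto
  ultimately have "m + m < a" by simp
  then show ?thesis using Sq_unstable[OF M _ Sq_closed[OF M x]] by blast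
qed

text \<open>For \<open>0 < i < m\<close> the Adem terms with \<open>c < i\<close> vanish by
  instability and \<open>c = i\<close> is left. Outside that range of the relation,
  \<open>i = 0\<close> and \<open>i = m\<close> are immediate, and for \<open>i > m\<close> both
  sides are zero.\<close>

lemma top_square_even:
  assumes M: "M \<in> Ob U" and x: "x \<in> el M m"
  shows "Sq M (2 * i) (m + m) (Sq M m m x) = Sq M (m + i) (m + i) (Sq M i m x)"
proof -
  consider "i = 0" | "0 < i" "i < m" | "i = m" | "m < i" by linarith
  then show ?thesis
  proof cases
    case 1
    then show ?thesis using Sq_0[OF M] Sq_closed[OF M x] x by simp
  next
    case 2
    let ?C = "{c. 2 * c \<le> 2 * i \<and> odd ((m - c - 1) choose (2 * i - 2 * c))}"
    \<comment> \<open>The term \<open>c = i\<close> occurs because its binomial coefficient has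
      lower entry 0.\<close>
    have C: "finite ?C" "i \<in> ?C" by (auto intro: finite_subset[of _ "{..i}"])
    have "Sq M (2 * i) (m + m) (Sq M m m x) =
        (\<Oplus>\<^bsub>gr M (m + 2 * i + m)\<^esub> c \<in> ?C. Sq M (2 * i + m - c) (m + c) (Sq M c m x))"
      using 2 by (intro Sq_adem[OF M _ _ x]) auto
    also have "\<dots> = Sq M (2 * i + m - i) (m + i) (Sq M i m x)"
    proof (rule F2_finsum_single[OF mod_space[OF M] C])
      fix c assume "c \<in> ?C" "c \<noteq> i"
      then have d: "m + c + (2 * i + m - c) = m + 2 * i + m" "m + c < 2 * i + m - c" by auto
      show "Sq M (2 * i + m - c) (m + c) (Sq M c m x) = \<zero>\<^bsub>gr M (m + 2 * i + m)\<^esub>"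
        using Sq_unstable[OF M d(2) Sq_closed[OF M x]] unfolding d(1) .
    next
      have d: "m + i + (2 * i + m - i) = m + 2 * i + m" by simp
      show "Sq M (2 * i + m - i) (m + i) (Sq M i m x) \<in> el M (m + 2 * i + m)"
        using Sq_closed[OF M Sq_closed[OF M x], of "2 * i + m - i" i] unfolding d .
    qed
    also have "2 * i + m - i = m + i" by simp
    finally show ?thesis .
  next
    case 3
    then show ?thesis by (simp add: mult_2)
  next
    case 4
    have "Sq M (2 * i) (m + m) (Sq M m m x) = \<zero>\<^bsub>gr M (m + m + 2 * i)\<^esub>"
      using 4 by (intro Sq_unstable[OF M _ Sq_closed[OF M x]]) simp
    moreover have d: "m + i + (m + i) = m + m + 2 * i" by simp
    ultimately show ?thesis
      using Sq_unstable[OF M 4 x] Sq_zero[OF M, of "m + i" "m + i"] unfolding d by simp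
  qed
qed

text \<open>The natural map from the double that is usually called \<open>\<lambda>\<close> or
  \<open>Sq\<^sub>0\<close>. The condition \<open>Sq\<^sup>n x = x\<^sup>2\<close> on an unstable
  algebra says that it equals \<open>pairing_square\<close> of the multiplication.\<close>

definition top_square :: "'a umod \<Rightarrow> 'a uarr" where
  "top_square M = uarr (doubling M) M
    (\<lambda>n. if even n then Sq M (n div 2) (n div 2) else (\<lambda>x. \<zero>\<^bsub>gr M n\<^esub>))"

text \<open>The common part of \<open>top_square\<close> and \<open>pairing_square\<close>.
  Operations of odd index vanish on the double, which accounts for \<open>odd_Sq\<close>; those of
  even index are halved, which accounts for \<open>even_Sq\<close>.\<close>

lemma doubling_uarr_in_Hom:
  assumes M: "M \<in> Ob U" and N: "N \<in> Ob U"
    and s: "\<And>m. s m \<in> lin (gr M m) (gr N (m + m))"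
    and odd_Sq: "\<And>a m x. odd a \<Longrightarrow> x \<in> el M m \<Longrightarrow> Sq N a (m + m) (s m x) = \<zero>\<^bsub>gr N (m + m + a)\<^esub>"
    and even_Sq: "\<And>i m x. x \<in> el M m \<Longrightarrow> Sq N (2 * i) (m + m) (s m x) = s (m + i) (Sq M i m x)"
  shows "uarr (doubling M) N (\<lambda>n. if even n then s (n div 2) else (\<lambda>x. \<zero>\<^bsub>gr N n\<^esub>)) \<in> Hom U (doubling M) N"
proof (rule uarr_in_Hom[OF doubling_Ob[OF M]])
  let ?f = "\<lambda>n. if even n then s (n div 2) else (\<lambda>x. \<zero>\<^bsub>gr N n\<^esub>)"
  note DM = doubling_Ob[OF M]
  show L: "?f n \<in> lin (gr (doubling M) n) (gr N n)" for n
  proof (cases "even n")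
    case True
    then obtain m where n: "n = 2 * m" by (rule evenE)
    show ?thesis using s[of m] unfolding n gr_doubling by (simp add: mult_2)
  qed (simp add: lin_const_zero[OF mod_space[OF N]])
  fix i n x assume x: "x \<in> el (doubling M) n"
  show "?f (n + i) (Sq (doubling M) i n x) = Sq N i n (?f n x)"
  proof (cases "odd n")
    case True
    have "?f (n + i) (Sq (doubling M) i n x) = \<zero>\<^bsub>gr N (n + i)\<^esub>"
      using True Sq_doubling(2)[of i n M x] lin_zero[OF mod_space[OF DM] mod_space[OF N]
          L[of "n + i"]] by simp
    moreover have "Sq N i n (?f n x) = \<zero>\<^bsub>gr N (n + i)\<^esub>" using True Sq_zero[OF N] by simp
    ultimately show ?thesis by simp
  next
    case False
    then obtain m where n: "n = m + m" by (auto elim!: evenE simp: mult_2)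
    then have x': "x \<in> el M m" using x gr_doubling(1)[of M m] by (simp add: mult_2)
    show ?thesis
    proof (cases "odd i")
      case True
      have "?f (n + i) (Sq (doubling M) i n x) = \<zero>\<^bsub>gr N (n + i)\<^esub>"
        using True n by simp
      moreover have "Sq N i n (?f n x) = \<zero>\<^bsub>gr N (n + i)\<^esub>"
        using odd_Sq[OF True x'] n by (simp add: mult_2[symmetric])
      ultimately show ?thesis by simp
    next
      case False
      then obtain i' where i: "i = 2 * i'" by (auto elim!: evenE)
      have "Sq (doubling M) i n x = Sq M i' m x"
        using Sq_doubling(1)[of M i' m x] i n by (simp add: mult_2)
      moreover have "(n + i) div 2 = m + i'" "even (n + i)" "n div 2 = m" "even n" using i n by auto
      ultimately show ?thesis using even_Sq[OF x', of i'] i n by simp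
    qed
  qed
qed

lemma top_square_in: "M \<in> Ob U \<Longrightarrow> top_square M \<in> Hom U (doubling M) M"
  unfolding top_square_def
  by (rule doubling_uarr_in_Hom) (auto simp: Sq_lin top_square_odd top_square_even)

lemma top_square_app: "x \<in> el M m \<Longrightarrow> app (top_square M) (2 * m) x = Sq M m m x"
  by (simp add: top_square_def uarr_app gr_doubling)

definition pairing_square :: "'a umod \<Rightarrow> (nat \<Rightarrow> nat \<Rightarrow> 'a \<Rightarrow> 'a \<Rightarrow> 'a) \<Rightarrow> 'a uarr" where
  "pairing_square M \<beta> = uarr (doubling M) M
    (\<lambda>n. if even n then (\<lambda>x. \<beta> (n div 2) (n div 2) x x) else (\<lambda>x. \<zero>\<^bsub>gr M n\<^esub>))"

text \<open>Commutativity enters twice: it cancels the mixed terms of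
  \<open>\<beta> (x + y) (x + y)\<close>, which gives linearity, and it makes the Cartan sum
  symmetric, so that at most its middle term is left.\<close>

lemma pairing_square_in:
  assumes M: "M \<in> Ob U" and \<beta>: "cartan_pairing M M M \<beta>"
    and comm: "\<And>i j x y. x \<in> el M i \<Longrightarrow> y \<in> el M j \<Longrightarrow> \<beta> i j x y = \<beta> j i y x"
  shows "pairing_square M \<beta> \<in> Hom U (doubling M) M"
  unfolding pairing_square_def
proof (rule doubling_uarr_in_Hom[OF M M, where s = "\<lambda>m x. \<beta> m m x x"])
  note V = mod_space[OF M]
  show "(\<lambda>x. \<beta> m m x x) \<in> lin (gr M m) (gr M (m + m))" for m
  proof (rule linI)
    fix x y assume x: "x \<in> el M m" and y: "y \<in> el M m"
    note cl = cartan_closed[OF \<beta>, of _ m _ m]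
    have "\<beta> m m (x \<oplus>\<^bsub>gr M m\<^esub> y) (x \<oplus>\<^bsub>gr M m\<^esub> y) =
        (\<beta> m m x x \<oplus>\<^bsub>gr M (m + m)\<^esub> \<beta> m m x y) \<oplus>\<^bsub>gr M (m + m)\<^esub> (\<beta> m m x y \<oplus>\<^bsub>gr M (m + m)\<^esub> \<beta> m m y y)"
      using lin_add[OF cartan_lin(2)[OF \<beta> F2_add[OF V x y]] x y] lin_add[OF cartan_lin(1)[OF \<beta> x] x y]
        lin_add[OF cartan_lin(1)[OF \<beta> y] x y] comm[OF y x] by simp
    also have "\<dots> = \<beta> m m x x \<oplus>\<^bsub>gr M (m + m)\<^esub> \<beta> m m y y"
      using cl x y by (simp add: F2_assoc[OF V] F2_cancel_self[OF V] F2_add[OF V])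
    finally show "\<beta> m m (x \<oplus>\<^bsub>gr M m\<^esub> y) (x \<oplus>\<^bsub>gr M m\<^esub> y) = \<beta> m m x x \<oplus>\<^bsub>gr M (m + m)\<^esub> \<beta> m m y y" .
  qed (rule cartan_closed[OF \<beta>])
  \<comment> \<open>The two branches, from \<open>F2_finsum_symmetric\<close>, are what the odd and
    the even condition of \<open>doubling_uarr_in_Hom\<close> require.\<close>
  have Sq_sq: "Sq M r (m + m) (\<beta> m m x x) =
      (if even r then \<beta> (m + r div 2) (m + (r - r div 2)) (Sq M (r div 2) m x) (Sq M (r - r div 2) m x)
       else \<zero>\<^bsub>gr M (m + m + r)\<^esub>)" if x: "x \<in> el M m" for r m x
    unfolding cartan_Sq[OF \<beta> x x]
  proof (rule F2_finsum_symmetric[OF V])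
    fix a assume a: "a \<le> r"
    show "\<beta> (m + a) (m + (r - a)) (Sq M a m x) (Sq M (r - a) m x) \<in> el M (m + m + r)"
      by (rule cartan_term_closed[OF \<beta> M M x x a])
    show "\<beta> (m + (r - a)) (m + (r - (r - a))) (Sq M (r - a) m x) (Sq M (r - (r - a)) m x) =
        \<beta> (m + a) (m + (r - a)) (Sq M a m x) (Sq M (r - a) m x)"
      using comm[OF Sq_closed[OF M x, of "r - a"] Sq_closed[OF M x, of a]] a by simp
  qed
  show "Sq M a (m + m) (\<beta> m m x x) = \<zero>\<^bsub>gr M (m + m + a)\<^esub>" if "odd a" "x \<in> el M m" for a m x
    using Sq_sq[OF that(2), of a] that(1) by simp
  show "Sq M (2 * i) (m + m) (\<beta> m m x x) = \<beta> (m + i) (m + i) (Sq M i m x) (Sq M i m x)"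
    if "x \<in> el M m" for i m x
    using Sq_sq[OF that, of "2 * i"] by simp
qed

lemma pairing_square_app: "x \<in> el M m \<Longrightarrow> app (pairing_square M \<beta>) (2 * m) x = \<beta> m m x x"
  by (simp add: pairing_square_def uarr_app gr_doubling)

section \<open>Density of the localisation unit\<close>

locale localised_tensor = tensor_choice T + nil_localisation k so sm \<phi>
  for T :: "'a tensor" and k :: nat and so :: "'a umod \<Rightarrow> 'a umod" and sm :: "'a qarr \<Rightarrow> 'a uarr"
    and \<phi> :: "'a umod \<Rightarrow> 'a umod \<Rightarrow> 'a qarr \<Rightarrow> 'a uarr"
begin

lemma nil_iso_of_iso:
  fixes A B :: "'a umod"
  assumes A: "A \<in> Ob U" and B: "B \<in> Ob U" and f: "f \<in> Hom U A B" and g: "g \<in> Hom U B A"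
    and gf: "Comp U g f = Idn U A" and fg: "Comp U f g = Idn U B"
  shows "nil_iso k f"
proof (rule iso_imp_nil_iso[OF A B f])
  show "iso_Q A B (r f)"
    unfolding iso_Q_def
    using r_Hom[OF A B f] r_Hom[OF B A g] r_comp[OF A B A f g] r_comp[OF B A B g f] gf fg r_id[OF A]
        r_id[OF B]
    by (intro conjI bexI[of _ "r g"]) simp_all
qed

lemma twist_exists:
  assumes M: "M \<in> Ob U" and N: "N \<in> Ob U"
  shows "\<exists>\<sigma>\<in>Hom U (tob T M N) (tob T N M). \<forall>i j. \<forall>x\<in>el M i. \<forall>y\<in>el N j.
    app \<sigma> (i + j) (tel T M N i j x y) = tel T N M j i y x"
  by (rule tensor_hom_exists[OF M N tob_Ob[OF N M] cartan_swap[OF cartan_tel[OF N M] N M tob_Ob[OF N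
      M]]])

lemma nil_iso_tensor_left:
  assumes O: "A \<in> Ob U" "A' \<in> Ob U" "N \<in> Ob U" and f: "f \<in> Hom U A A'" "nil_iso k f"
  shows "nil_iso k (tmap T f (Idn U N))"
  by (rule exact_functor.F_nil_iso[OF exact_functor_tensor[OF O(3)] O(1,2) f])

text \<open>The exactness argument treats the first factor. The twist is an isomorphism, hence
  itself has nilpotent kernel and cokernel, and conjugating by it moves \<open>g\<close> into the
  first factor.\<close>

lemma nil_iso_tensor_right:
  assumes O: "B \<in> Ob U" "B' \<in> Ob U" "N \<in> Ob U" and g: "g \<in> Hom U B B'" "nil_iso k g"
  shows "nil_iso k (tmap T (Idn U N) g)"
proof -
  note idN = id_in_Hom[OF O(3)]
  have twist_inv: "Comp U \<sigma>' \<sigma> = Idn U (tob T M N)"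
    if M: "M \<in> Ob U" and N: "N \<in> Ob U" and \<sigma>: "\<sigma> \<in> Hom U (tob T M N) (tob T N M)" "\<sigma>' \<in>
        Hom U (tob T N M) (tob T M N)"
      and \<sigma>_tel: "\<forall>i j. \<forall>x\<in>el M i. \<forall>y\<in>el N j. app \<sigma> (i + j) (tel T M N i j x y) = tel T N M j i y x"
      "\<forall>i j. \<forall>x\<in>el N i. \<forall>y\<in>el M j. app \<sigma>' (i + j) (tel T N M i j x y) = tel T M N j i y x" for M N \<sigma> \<sigma>'
  proof (rule tensor_hom_eqI[OF M N tob_Ob[OF M N] comp_in_Hom[OF \<sigma> tob_Ob[OF M N]]
      id_in_Hom[OF tob_Ob[OF M N]]])
    fix i j x y assume x: "x \<in> el M i" and y: "y \<in> el N j"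
    note t = tel_closed[OF M N x y]
    have "app \<sigma>' (i + j) (tel T N M j i y x) = tel T M N i j x y"
      using \<sigma>_tel(2) x y by (metis add.commute)
    then show "app (Comp U \<sigma>' \<sigma>) (i + j) (tel T M N i j x y) = app (Idn U (tob T M N)) (i + j)
        (tel T M N i j x y)"
      using \<sigma>_tel(1) x y by (simp add: comp_app[OF \<sigma>(1) t] id_app[OF t])
  qed
  obtain s where s: "s \<in> Hom U (tob T N B) (tob T B N)"
    "\<forall>i j. \<forall>x\<in>el N i. \<forall>y\<in>el B j. app s (i + j) (tel T N B i j x y) = tel T B N j i y x"
    using twist_exists[OF O(3,1)] by blast
  obtain s' where s': "s' \<in> Hom U (tob T B N) (tob T N B)"
    "\<forall>i j. \<forall>x\<in>el B i. \<forall>y\<in>el N j. app s' (i + j) (tel T B N i j x y) = tel T N B j i y x"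
    using twist_exists[OF O(1,3)] by blast
  obtain t where t: "t \<in> Hom U (tob T B' N) (tob T N B')"
    "\<forall>i j. \<forall>x\<in>el B' i. \<forall>y\<in>el N j. app t (i + j) (tel T B' N i j x y) = tel T N B' j i y x"
    using twist_exists[OF O(2,3)] by blast
  obtain t' where t': "t' \<in> Hom U (tob T N B') (tob T B' N)"
    "\<forall>i j. \<forall>x\<in>el N i. \<forall>y\<in>el B' j. app t' (i + j) (tel T N B' i j x y) = tel T B' N j i y x"
    using twist_exists[OF O(3,2)] by blast
  note NB = tob_Ob[OF O(3,1)] and BN = tob_Ob[OF O(1,3)] and NB' = tob_Ob[OF O(3,2)] and B'N =
      tob_Ob[OF O(2,3)]
  have sn: "nil_iso k s"
    by (rule nil_iso_of_iso[OF NB BN s(1) s'(1) twist_inv[OF O(3,1) s(1) s'(1) s(2) s'(2)]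
      twist_inv[OF O(1,3) s'(1) s(1) s'(2) s(2)]])
  have tn: "nil_iso k t"
    by (rule nil_iso_of_iso[OF B'N NB' t(1) t'(1) twist_inv[OF O(2,3) t(1) t'(1) t(2) t'(2)]
      twist_inv[OF O(3,2) t'(1) t(1) t'(2) t(2)]])
  note gN = tmap_in[OF O(1,3,2,3) g(1) idN]
  have 1: "nil_iso k (Comp U (tmap T g (Idn U N)) s)"
    by (rule nil_iso_comp[OF NB BN B'N s(1) sn gN nil_iso_tensor_left[OF O g]])
  note gs = comp_in_Hom[OF s(1) gN NB]
  have "nil_iso k (Comp U t (Comp U (tmap T g (Idn U N)) s))"
    by (rule nil_iso_comp[OF NB B'N NB' gs 1 t(1) tn])
  moreover have "Comp U t (Comp U (tmap T g (Idn U N)) s) = tmap T (Idn U N) g"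
  proof (rule tensor_hom_eqI[OF O(3,1) NB' comp_in_Hom[OF gs t(1) NB] tmap_in[OF O(3,1,3,2) idN g(1)]])
    fix i j x y assume x: "x \<in> el N i" and y: "y \<in> el B j"
    note z = tel_closed[OF O(3,1) x y]
    have "app (tmap T g (Idn U N)) (i + j) (tel T B N j i y x) = tel T B' N j i (app g j y) x"
      using tmap_app[OF O(1,3,2,3) g(1) idN y x] id_app[OF x] by (simp add: add.commute)
    moreover have "app t (i + j) (tel T B' N j i (app g j y) x) = tel T N B' i j x (app g j y)"
      using t(2) x hom_closed[OF g(1) y] by (metis add.commute)
    ultimately show "app (Comp U t (Comp U (tmap T g (Idn U N)) s)) (i + j) (tel T N B i j x y) =
        app (tmap T (Idn U N) g) (i + j) (tel T N B i j x y)"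
      using comp_app[OF gs z, of t] comp_app[OF s(1) z] s(2) x y tmap_app[OF O(3,1,3,2) idN g(1)
          x y] id_app[OF x]
      by simp
  qed
  ultimately show ?thesis by simp
qed

text \<open>\<open>f \<otimes> g\<close> is \<open>f \<otimes> 1\<close> followed by
  \<open>1 \<otimes> g\<close>.\<close>

lemma nil_iso_tensor:
  assumes O: "A \<in> Ob U" "A' \<in> Ob U" "B \<in> Ob U" "B' \<in> Ob U" and f: "f \<in> Hom U A A'" "nil_iso k f"
    and g: "g \<in> Hom U B B'" "nil_iso k g"
  shows "nil_iso k (tmap T f g)"
proof -
  note idA' = id_in_Hom[OF O(2)] and idB = id_in_Hom[OF O(3)]
  have "nil_iso k (Comp U (tmap T (Idn U A') g) (tmap T f (Idn U B)))"
    by (rule nil_iso_comp[OF tob_Ob[OF O(1,3)] tob_Ob[OF O(2,3)] tob_Ob[OF O(2,4)]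
      tmap_in[OF O(1,3,2,3) f(1) idB] nil_iso_tensor_left[OF O(1,2,3) f]
      tmap_in[OF O(2,3,2,4) idA' g(1)] nil_iso_tensor_right[OF O(3,4,2) g]])
  then show ?thesis
    unfolding tmap_comp[OF O(1,3,2,3,2,4) f(1) idA' idB g(1)] comp_id(2)[OF f(1) O(1,2)]
        comp_id(1)[OF g(1) O(3,4)] .
qed

text \<open>\<open>f \<otimes> g\<close> has nilpotent kernel and cokernel, so an arrow into a local
  module is determined by its values on the image, which is spanned by tensors of values of
  \<open>f\<close> and \<open>g\<close>.\<close>

lemma density2:
  assumes X: "local_module k X" and O: "A \<in> Ob U" "A' \<in> Ob U" "B \<in> Ob U" "B' \<in> Ob U"
    and f: "f \<in> Hom U A A'" "nil_iso k f" and g: "g \<in> Hom U B B'" "nil_iso k g"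
    and u: "u \<in> Hom U (tob T A' B') X" and v: "v \<in> Hom U (tob T A' B') X"
    and eq: "\<And>i j x y. x \<in> el A i \<Longrightarrow> y \<in> el B j \<Longrightarrow>
      app u (i + j) (tel T A' B' i j (app f i x) (app g j y)) =
      app v (i + j) (tel T A' B' i j (app f i x) (app g j y))"
  shows "u = v"
proof (rule local_ext[OF X tob_Ob[OF O(1,3)] tob_Ob[OF O(2,4)] _ nil_iso_tensor[OF O f g] u v])
  note s = tmap_in[OF O(1,3,2,4) f(1) g(1)] and AB = tob_Ob[OF O(1,3)]
  have XO: "X \<in> Ob U" using X by (simp add: local_module_def)
  show "tmap T f g \<in> Hom U (tob T A B) (tob T A' B')" by (rule s)
  have c: "Comp U u (tmap T f g) = Comp U v (tmap T f g)"
  proof (rule tensor_hom_eqI[OF O(1,3) XO comp_in_Hom[OF s u AB] comp_in_Hom[OF s v AB]])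
    fix i j x y assume x: "x \<in> el A i" and y: "y \<in> el B j"
    note z = tel_closed[OF O(1,3) x y]
    show "app (Comp U u (tmap T f g)) (i + j) (tel T A B i j x y) =
        app (Comp U v (tmap T f g)) (i + j) (tel T A B i j x y)"
      unfolding comp_app[OF s z] tmap_app[OF O(1,3,2,4) f(1) g(1) x y] by (rule eq[OF x y])
  qed
  show "app u n (app (tmap T f g) n z) = app v n (app (tmap T f g) n z)" if z: "z \<in> el (tob T A B)
      n" for n z
    using comp_app[OF s z, of u] comp_app[OF s z, of v] c by simp
qed

text \<open>\<open>density2\<close> with \<open>f \<otimes> g\<close> as its first arrow. Its
  hypothesis then concerns all elements of \<open>A \<otimes> B\<close>, which
  \<open>tensor3_hom_eqI\<close> reduces to tensors.\<close>

lemma density3: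
  assumes X: "local_module k X" and O: "A \<in> Ob U" "A' \<in> Ob U" "B \<in> Ob U" "B' \<in> Ob U" "C \<in> Ob U"
      "C' \<in> Ob U"
    and f: "f \<in> Hom U A A'" "nil_iso k f" and g: "g \<in> Hom U B B'" "nil_iso k g" and h: "h \<in>
        Hom U C C'" "nil_iso k h"
    and u: "u \<in> Hom U (tob T (tob T A' B') C') X" and v: "v \<in> Hom U (tob T (tob T A' B') C') X"
    and eq: "\<And>i j r x y z. x \<in> el A i \<Longrightarrow> y \<in> el B j \<Longrightarrow> z \<in> el C r \<Longrightarrow>
      app u (i + j + r) (tel T (tob T A' B') C' (i + j) r (tel T A' B' i j (app f i x) (app g j y))
          (app h r z)) =
      app v (i + j + r) (tel T (tob T A' B') C' (i + j) r (tel T A' B' i j (app f i x) (app g j y))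
          (app h r z))"
  shows "u = v"
proof -
  let ?fg = "tmap T f g"
  note AB = tob_Ob[OF O(1,3)] and AB' = tob_Ob[OF O(2,4)]
  note fg = tmap_in[OF O(1,3,2,4) f(1) g(1)]
  note s = tmap_in[OF AB O(5) AB' O(6) fg h(1)] and ABC = tob_Ob[OF AB O(5)]
  have XO: "X \<in> Ob U" using X by (simp add: local_module_def)
  have c: "Comp U u (tmap T ?fg h) = Comp U v (tmap T ?fg h)"
  proof (rule tensor3_hom_eqI[OF O(1,3,5) XO comp_in_Hom[OF s u ABC] comp_in_Hom[OF s v ABC]])
    fix i j r x y z assume x: "x \<in> el A i" and y: "y \<in> el B j" and z: "z \<in> el C r"
    note xy = tel_closed[OF O(1,3) x y]
    show "app (Comp U u (tmap T ?fg h)) (i + j + r) (tel T (tob T A B) C (i + j)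
        r (tel T A B i j x y) z) =
        app (Comp U v (tmap T ?fg h)) (i + j + r) (tel T (tob T A B) C (i + j) r (tel T A B i j x y) z)"
      unfolding comp_app[OF s tel_closed[OF AB O(5) xy z]] tmap_app[OF AB O(5) AB' O(6) fg h(1) xy z]
        tmap_app[OF O(1,3,2,4) f(1) g(1) x y] by (rule eq[OF x y z])
  qed
  show ?thesis
  proof (rule density2[OF X AB AB' O(5,6) fg nil_iso_tensor[OF O(1-4) f g] h u v])
    fix n r w z assume w: "w \<in> el (tob T A B) n" and z: "z \<in> el C r"
    show "app u (n + r) (tel T (tob T A' B') C' n r (app ?fg n w) (app h r z)) =
        app v (n + r) (tel T (tob T A' B') C' n r (app ?fg n w) (app h r z))"
      using c comp_app[OF s tel_closed[OF AB O(5) w z], of u]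
          comp_app[OF s tel_closed[OF AB O(5) w z], of v]
        tmap_app[OF AB O(5) AB' O(6) fg h(1) w z] by simp
  qed
qed

text \<open>\<open>F2\<close> stays unlocalised: its identity serves as the first arrow in
  \<open>density2\<close>, and in that factor only \<open>F2_gen\<close> remains to be
  tested.\<close>

lemma density_F2_left:
  assumes X: "local_module k X" and O: "B \<in> Ob U" "B' \<in> Ob U" and g: "g \<in> Hom U B B'" "nil_iso k g"
    and u: "u \<in> Hom U (tob T F2 B') X" and v: "v \<in> Hom U (tob T F2 B') X"
    and eq: "\<And>j y. y \<in> el B j \<Longrightarrow>
      app u j (tel T F2 B' 0 j F2_gen (app g j y)) = app v j (tel T F2 B' 0 j F2_gen (app g j y))"
  shows "u = v"
proof (rule density2[OF X F2_Ob F2_Ob O id_in_Hom[OF F2_Ob] nil_iso_id[OF F2_Ob] g u v])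
  have XO: "X \<in> Ob U" using X by (simp add: local_module_def)
  note P = tob_Ob[OF F2_Ob O(2)]
  fix i j y and c :: 'a assume c: "c \<in> el F2 i" and y: "y \<in> el B j"
  from F2_cases[OF c] show "app u (i + j) (tel T F2 B' i j (app (Idn U F2) i c) (app g j y)) =
      app v (i + j) (tel T F2 B' i j (app (Idn U F2) i c) (app g j y))"
  proof
    assume "c = \<zero>\<^bsub>gr F2 i\<^esub>"
    then show ?thesis
      unfolding id_app[OF c]
      using tel_zero(2)[OF F2_Ob O(2) hom_closed[OF g(1) y], of i] hom_zero[OF u P XO]
          hom_zero[OF v P XO] by simp
  qed (use eq[OF y] id_app[OF c] in simp)
qed

lemma density_F2_right:
  assumes X: "local_module k X" and O: "B \<in> Ob U" "B' \<in> Ob U" and g: "g \<in> Hom U B B'" "nil_iso k g"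
    and u: "u \<in> Hom U (tob T B' F2) X" and v: "v \<in> Hom U (tob T B' F2) X"
    and eq: "\<And>j y. y \<in> el B j \<Longrightarrow>
      app u j (tel T B' F2 j 0 (app g j y) F2_gen) = app v j (tel T B' F2 j 0 (app g j y) F2_gen)"
  shows "u = v"
proof (rule density2[OF X O F2_Ob F2_Ob g id_in_Hom[OF F2_Ob] nil_iso_id[OF F2_Ob] u v])
  have XO: "X \<in> Ob U" using X by (simp add: local_module_def)
  note P = tob_Ob[OF O(2) F2_Ob]
  fix i j y and c :: 'a assume y: "y \<in> el B j" and c: "c \<in> el F2 i"
  from F2_cases[OF c] show "app u (j + i) (tel T B' F2 j i (app g j y) (app (Idn U F2) i c)) =
      app v (j + i) (tel T B' F2 j i (app g j y) (app (Idn U F2) i c))"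
  proof
    assume "c = \<zero>\<^bsub>gr F2 i\<^esub>"
    then show ?thesis
      unfolding id_app[OF c]
      using tel_zero(1)[OF O(2) F2_Ob hom_closed[OF g(1) y], of i] hom_zero[OF u P XO]
          hom_zero[OF v P XO] by simp
  qed (use eq[OF y] id_app[OF c] in simp)
qed

lemma unit_natural_app:
  assumes "M \<in> Ob U" "N \<in> Ob U" "f \<in> Hom U M N" "x \<in> el M n"
  shows "app (lm f) n (app (\<eta> M) n x) = app (\<eta> N) n (app f n x)"
  using unit_natural[OF assms(1-3)] comp_app[OF unit_in[OF assms(1)] assms(4), of "lm f"]
    comp_app[OF assms(3,4), of "\<eta> N"] by simp

lemma unit_closed: "M \<in> Ob U \<Longrightarrow> x \<in> el M n \<Longrightarrow> app (\<eta> M) n x \<in> el (so M) n"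
  by (rule hom_closed[OF unit_in])

section \<open>The lax monoidal structure\<close>

text \<open>Isolates from \<open>l_lax\<close> the condition that determines \<open>\<mu>\<close>;
  naturality, associativity and the unit laws are consequences by density, as
  \<open>l_lax_iff\<close> records.\<close>

definition unit_extension :: "('a umod \<Rightarrow> 'a umod \<Rightarrow> 'a uarr) \<Rightarrow> bool" where
  "unit_extension \<mu> \<longleftrightarrow> (\<forall>M\<in>Ob U. \<forall>N\<in>Ob U. \<mu> M N \<in> Hom U (tob T (so M) (so N)) (so (tob T M N)) \<and>
    Comp U (\<mu> M N) (tmap T (\<eta> M) (\<eta> N)) = \<eta> (tob T M N))"

lemma mu_in:
  "unit_extension \<mu> \<Longrightarrow> M \<in> Ob U \<Longrightarrow> N \<in> Ob U \<Longrightarrow> \<mu> M N \<in> Hom U (tob T (so M) (so N)) (so (tob T M N))"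
  by (simp add: unit_extension_def)

lemma mu_app:
  assumes \<mu>: "unit_extension \<mu>" and M: "M \<in> Ob U" and N: "N \<in> Ob U" and x: "x \<in> el M i" and y: "y \<in>
      el N j"
  shows "app (\<mu> M N) (i + j) (tel T (so M) (so N) i j (app (\<eta> M) i x) (app (\<eta> N) j y)) =
    app (\<eta> (tob T M N)) (i + j) (tel T M N i j x y)"
proof -
  note t = tmap_in[OF M N so_Ob[OF M] so_Ob[OF N] unit_in[OF M] unit_in[OF N]]
  have "Comp U (\<mu> M N) (tmap T (\<eta> M) (\<eta> N)) = \<eta> (tob T M N)"
    using \<mu> M N by (simp add: unit_extension_def)
  then show ?thesis
    using comp_app[OF t tel_closed[OF M N x y], of "\<mu> M N"]
      tmap_app[OF M N so_Ob[OF M] so_Ob[OF N] unit_in[OF M] unit_in[OF N] x y] by simp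
qed

lemma unit_extension_exists: "\<exists>\<mu>. unit_extension \<mu>"
proof -
  have ex: "\<exists>v. v \<in> Hom U (tob T (so M) (so N)) (so (tob T M N)) \<and>
    Comp U v (tmap T (\<eta> M) (\<eta> N)) = \<eta> (tob T M N)" if M: "M \<in> Ob U" and N: "N \<in> Ob U" for M N
    using local_extend[OF local_so[OF tob_Ob[OF M N]] tob_Ob[OF M N] tob_Ob[OF so_Ob[OF M] so_Ob[OF N]]
      tmap_in[OF M N so_Ob[OF M] so_Ob[OF N] unit_in[OF M] unit_in[OF N]]
      nil_iso_tensor[OF M so_Ob[OF M] N so_Ob[OF N] unit_in[OF M] nil_iso_unit[OF M] unit_in[OF N]
          nil_iso_unit[OF N]]
      unit_in[OF tob_Ob[OF M N]]] by blast
  have "unit_extension (\<lambda>M N. SOME v. v \<in> Hom U (tob T (so M) (so N)) (so (tob T M N)) \<and>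
    Comp U v (tmap T (\<eta> M) (\<eta> N)) = \<eta> (tob T M N))"
    unfolding unit_extension_def by (intro ballI) (rule someI_ex, rule ex)
  then show ?thesis by (rule exI[of unit_extension])
qed

lemma mu_natural:
  assumes \<mu>: "unit_extension \<mu>" and O: "M \<in> Ob U" "M' \<in> Ob U" "N \<in> Ob U" "N' \<in> Ob U"
    and f: "f \<in> Hom U M M'" and g: "g \<in> Hom U N N'"
  shows "Comp U (\<mu> M' N') (tmap T (lm f) (lm g)) = Comp U (lm (tmap T f g)) (\<mu> M N)"
proof -
  note P = tob_Ob[OF O(1,3)] and P' = tob_Ob[OF O(2,4)]
  note S = so_Ob[OF O(1)] so_Ob[OF O(2)] so_Ob[OF O(3)] so_Ob[OF O(4)]
  note lf = lm_Hom[OF O(1,2) f] and lg = lm_Hom[OF O(3,4) g] and fg = tmap_in[OF O(1,3,2,4) f g]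
  note lfg = tmap_in[OF S(1,3,2,4) lf lg] and SP = tob_Ob[OF S(1,3)]
  note m = mu_in[OF \<mu> O(1,3)] and m' = mu_in[OF \<mu> O(2,4)] and l = lm_Hom[OF P P' fg]
  show ?thesis
  proof (rule density2[OF local_so[OF P'] O(1) S(1) O(3) S(3) unit_in[OF O(1)] nil_iso_unit[OF O(1)]
        unit_in[OF O(3)] nil_iso_unit[OF O(3)] comp_in_Hom[OF lfg m' SP] comp_in_Hom[OF m l SP]])
    fix i j x y assume x: "x \<in> el M i" and y: "y \<in> el N j"
    note ux = unit_closed[OF O(1) x] and uy = unit_closed[OF O(3) y]
    note t = tel_closed[OF S(1,3) ux uy]
    show "app (Comp U (\<mu> M' N') (tmap T (lm f) (lm g))) (i + j) (tel T (so M) (so N) i j (app (\<eta> M)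
        i x) (app (\<eta> N) j y)) =
      app (Comp U (lm (tmap T f g)) (\<mu> M N)) (i + j) (tel T (so M) (so N) i j (app (\<eta> M) i x)
          (app (\<eta> N) j y))"
      unfolding comp_app[OF lfg t] comp_app[OF m t] tmap_app[OF S(1,3,2,4) lf lg ux uy]
        unit_natural_app[OF O(1,2) f x] unit_natural_app[OF O(3,4) g y]
        mu_app[OF \<mu> O(2,4) hom_closed[OF f x] hom_closed[OF g y]] mu_app[OF \<mu> O(1,3) x y]
        unit_natural_app[OF P P' fg tel_closed[OF O(1,3) x y]] tmap_app[OF O(1,3,2,4) f g x y] ..
  qed
qed

text \<open>On \<open>\<eta> x \<otimes> \<eta> y \<otimes> \<eta> z\<close> both composites give
  \<open>\<eta>\<close> of \<open>x \<otimes> (y \<otimes> z)\<close>.\<close>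

lemma mu_assoc:
  assumes \<mu>: "unit_extension \<mu>" and O: "L \<in> Ob U" "M \<in> Ob U" "N \<in> Ob U"
  shows "Comp U (lm (assoc T L M N)) (Comp U (\<mu> (tob T L M) N) (tmap T (\<mu> L M) (Idn U (so N)))) =
       Comp U (\<mu> L (tob T M N)) (Comp U (tmap T (Idn U (so L)) (\<mu> M N)) (assoc T (so L) (so M) (so N)))"
proof -
  note S = so_Ob[OF O(1)] so_Ob[OF O(2)] so_Ob[OF O(3)]
  note LM = tob_Ob[OF O(1,2)] and MN = tob_Ob[OF O(2,3)]
  note SLM = so_Ob[OF LM] and SMN = so_Ob[OF MN]
  note LSM = tob_Ob[OF S(1,2)] and MSN = tob_Ob[OF S(2,3)]
  note P = tob_Ob[OF LM O(3)] and P' = tob_Ob[OF O(1) MN] and X = tob_Ob[OF LSM S(3)]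
  note idL = id_in_Hom[OF S(1)] and idN = id_in_Hom[OF S(3)]
  note m1 = mu_in[OF \<mu> O(1,2)] and m2 = mu_in[OF \<mu> LM O(3)] and m3 = mu_in[OF \<mu> O(2,3)] and m4 =
      mu_in[OF \<mu> O(1) MN]
  note t1 = tmap_in[OF LSM S(3) SLM S(3) m1 idN] and t3 = tmap_in[OF S(1) MSN S(1) SMN idL m3]
  note as = assoc_in[OF S] and la = lm_Hom[OF P P' assoc_in[OF O]]
  note c1 = comp_in_Hom[OF t1 m2 X] and c3 = comp_in_Hom[OF as t3 X]
  show ?thesis
  proof (rule density3[OF local_so[OF P'] O(1) S(1) O(2) S(2) O(3) S(3) unit_in[OF O(1)]
      nil_iso_unit[OF O(1)]
        unit_in[OF O(2)] nil_iso_unit[OF O(2)] unit_in[OF O(3)] nil_iso_unit[OF O(3)]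
        comp_in_Hom[OF c1 la X] comp_in_Hom[OF c3 m4 X]])
    fix i j r x y z assume x: "x \<in> el L i" and y: "y \<in> el M j" and z: "z \<in> el N r"
    note ux = unit_closed[OF O(1) x] and uy = unit_closed[OF O(2) y] and uz = unit_closed[OF O(3) z]
    note xy = tel_closed[OF O(1,2) x y] and yz = tel_closed[OF O(2,3) y z]
    note uxy = tel_closed[OF S(1,2) ux uy] and uyz = tel_closed[OF S(2,3) uy uz]
    note w = tel_closed[OF LSM S(3) uxy uz]
    let ?w = "tel T (tob T (so L) (so M)) (so N) (i + j) r
      (tel T (so L) (so M) i j (app (\<eta> L) i x) (app (\<eta> M) j y)) (app (\<eta> N) r z)"
    have "app (Comp U (lm (assoc T L M N)) (Comp U (\<mu> (tob T L M) N) (tmap T (\<mu> L M)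
        (Idn U (so N))))) (i + j + r) ?w =
        app (\<eta> (tob T L (tob T M N))) (i + j + r) (tel T L (tob T M N) i (j + r) x (tel T M N j r y z))"
      unfolding comp_app[OF c1 w] comp_app[OF t1 w] tmap_app[OF LSM S(3) SLM S(3) m1 idN uxy uz]
          id_app[OF uz]
        mu_app[OF \<mu> O(1,2) x y] mu_app[OF \<mu> LM O(3) xy z]
        unit_natural_app[OF P P' assoc_in[OF O] tel_closed[OF LM O(3) xy z]] assoc_app[OF O x y z] ..
    moreover have "app (Comp U (\<mu> L (tob T M N)) (Comp U (tmap T (Idn U (so L)) (\<mu> M N))
        (assoc T (so L) (so M) (so N)))) (i + j + r) ?w =
        app (\<eta> (tob T L (tob T M N))) (i + j + r) (tel T L (tob T M N) i (j + r) x (tel T M N j r y z))"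
      unfolding comp_app[OF c3 w] comp_app[OF as w] assoc_app[OF S ux uy uz]
      using tmap_app[OF S(1) MSN S(1) SMN idL m3 ux uyz] mu_app[OF \<mu> O(2,3) y z] mu_app[OF \<mu> O(1)
          MN x yz] id_app[OF ux]
      by (simp add: add.assoc)
    ultimately show "app (Comp U (lm (assoc T L M N)) (Comp U (\<mu> (tob T L M) N) (tmap T (\<mu> L M)
        (Idn U (so N))))) (i + j + r) ?w =
      app (Comp U (\<mu> L (tob T M N)) (Comp U (tmap T (Idn U (so L)) (\<mu> M N)) (assoc T (so L) (so M)
          (so N)))) (i + j + r) ?w"
      by simp
  qed
qed

text \<open>In the source \<open>F2 \<otimes> so M\<close> only the second factor is localised,
  which is the situation of \<open>density_F2_left\<close>.\<close>

lemma mu_lunit: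
  assumes \<mu>: "unit_extension \<mu>" and M: "M \<in> Ob U"
  shows "Comp U (lm (lunit T M)) (Comp U (\<mu> F2 M) (tmap T (\<eta> F2) (Idn U (so M)))) = lunit T (so M)"
proof -
  note S = so_Ob[OF M] and F = so_Ob[OF F2_Ob] and idM = id_in_Hom[OF so_Ob[OF M]]
  note P = tob_Ob[OF F2_Ob M] and X = tob_Ob[OF F2_Ob so_Ob[OF M]]
  note t = tmap_in[OF F2_Ob S F S unit_in[OF F2_Ob] idM] and m = mu_in[OF \<mu> F2_Ob M]
  note l = lm_Hom[OF P M lunit_in[OF M]]
  note c = comp_in_Hom[OF t m X]
  show ?thesis
  proof (rule density_F2_left[OF local_so[OF M] M S unit_in[OF M] nil_iso_unit[OF M]
      comp_in_Hom[OF c l X] lunit_in[OF S]])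
    fix j y assume y: "y \<in> el M j"
    note uy = unit_closed[OF M y]
    note w = tel_closed[OF F2_Ob S F2_gen_el uy, simplified]
    have t_app: "app (tmap T (\<eta> F2) (Idn U (so M))) j (tel T F2 (so M) 0 j F2_gen (app (\<eta> M) j y)) =
        tel T (so F2) (so M) 0 j (app (\<eta> F2) 0 F2_gen) (app (\<eta> M) j y)"
      using tmap_app[OF F2_Ob S F S unit_in[OF F2_Ob] idM F2_gen_el uy] id_app[OF uy] by simp
    have m_app: "app (\<mu> F2 M) j (tel T (so F2) (so M) 0 j (app (\<eta> F2) 0 F2_gen) (app (\<eta> M) j y)) =
        app (\<eta> (tob T F2 M)) j (tel T F2 M 0 j F2_gen y)"
      using mu_app[OF \<mu> F2_Ob M F2_gen_el y] by simp
    show "app (Comp U (lm (lunit T M)) (Comp U (\<mu> F2 M) (tmap T (\<eta> F2) (Idn U (so M))))) j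
        (tel T F2 (so M) 0 j F2_gen (app (\<eta> M) j y)) =
      app (lunit T (so M)) j (tel T F2 (so M) 0 j F2_gen (app (\<eta> M) j y))"
      unfolding comp_app[OF c w] comp_app[OF t w] t_app m_app lunit_app[OF S uy]
        unit_natural_app[OF P M lunit_in[OF M] tel_closed[OF F2_Ob M F2_gen_el y, simplified]]
            lunit_app[OF M y] ..
  qed
qed

lemma mu_runit:
  assumes \<mu>: "unit_extension \<mu>" and M: "M \<in> Ob U"
  shows "Comp U (lm (runit T M)) (Comp U (\<mu> M F2) (tmap T (Idn U (so M)) (\<eta> F2))) = runit T (so M)"
proof -
  note S = so_Ob[OF M] and F = so_Ob[OF F2_Ob] and idM = id_in_Hom[OF so_Ob[OF M]]
  note P = tob_Ob[OF M F2_Ob] and X = tob_Ob[OF so_Ob[OF M] F2_Ob]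
  note t = tmap_in[OF S F2_Ob S F idM unit_in[OF F2_Ob]] and m = mu_in[OF \<mu> M F2_Ob]
  note l = lm_Hom[OF P M runit_in[OF M]]
  note c = comp_in_Hom[OF t m X]
  show ?thesis
  proof (rule density_F2_right[OF local_so[OF M] M S unit_in[OF M] nil_iso_unit[OF M]
      comp_in_Hom[OF c l X] runit_in[OF S]])
    fix j y assume y: "y \<in> el M j"
    note uy = unit_closed[OF M y]
    note w = tel_closed[OF S F2_Ob uy F2_gen_el, simplified]
    have t_app: "app (tmap T (Idn U (so M)) (\<eta> F2)) j (tel T (so M) F2 j 0 (app (\<eta> M) j y) F2_gen) =
        tel T (so M) (so F2) j 0 (app (\<eta> M) j y) (app (\<eta> F2) 0 F2_gen)"
      using tmap_app[OF S F2_Ob S F idM unit_in[OF F2_Ob] uy F2_gen_el] id_app[OF uy] by simp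
    have m_app: "app (\<mu> M F2) j (tel T (so M) (so F2) j 0 (app (\<eta> M) j y) (app (\<eta> F2) 0 F2_gen)) =
        app (\<eta> (tob T M F2)) j (tel T M F2 j 0 y F2_gen)"
      using mu_app[OF \<mu> M F2_Ob y F2_gen_el] by simp
    show "app (Comp U (lm (runit T M)) (Comp U (\<mu> M F2) (tmap T (Idn U (so M)) (\<eta> F2)))) j
        (tel T (so M) F2 j 0 (app (\<eta> M) j y) F2_gen) =
      app (runit T (so M)) j (tel T (so M) F2 j 0 (app (\<eta> M) j y) F2_gen)"
      unfolding comp_app[OF c w] comp_app[OF t w] t_app m_app runit_app[OF S uy]
        unit_natural_app[OF P M runit_in[OF M] tel_closed[OF M F2_Ob y F2_gen_el, simplified]]
            runit_app[OF M y] ..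
  qed
qed

lemma l_ob_so: "l_ob so = so"
  by (rule ext) (simp add: l_ob_def)

text \<open>Through this equivalence the theorem covers every lax structure compatible with
  \<open>\<eta>\<close>, and not merely one that has been constructed.\<close>

lemma l_lax_iff: "l_lax T k so sm \<phi> \<mu> \<epsilon> \<longleftrightarrow> unit_extension \<mu> \<and> \<epsilon> = \<eta> F2"
proof
  assume *: "unit_extension \<mu> \<and> \<epsilon> = \<eta> F2"
  then have \<mu>: "unit_extension \<mu>" and \<epsilon>: "\<epsilon> = \<eta> F2" by auto
  have "lax_monoidal T so lm \<mu> \<epsilon>"
    unfolding lax_monoidal_def \<epsilon>
    by (intro conjI ballI lm_functor[unfolded l_ob_so] unit_in[OF F2_Ob] mu_in[OF \<mu>] mu_natural[OF \<mu>]
      mu_assoc[OF \<mu>] mu_lunit[OF \<mu>] mu_runit[OF \<mu>])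
  with * show "l_lax T k so sm \<phi> \<mu> \<epsilon>"
    unfolding l_lax_def l_ob_so unit_extension_def by blast
next
  assume "l_lax T k so sm \<phi> \<mu> \<epsilon>"
  then show "unit_extension \<mu> \<and> \<epsilon> = \<eta> F2"
    unfolding l_lax_def l_ob_so unit_extension_def lax_monoidal_def by blast
qed

section \<open>Induced algebras and modules\<close>

abbreviation LK :: "('a umod \<Rightarrow> 'a umod \<Rightarrow> 'a uarr) \<Rightarrow> 'a ualg \<Rightarrow> 'a ualg" where
  "LK \<mu> K \<equiv> induced_alg so lm \<mu> (\<eta> F2) K"

abbreviation LX :: "('a umod \<Rightarrow> 'a umod \<Rightarrow> 'a uarr) \<Rightarrow> 'a ualg \<Rightarrow> 'a kmod \<Rightarrow> 'a kmod" where
  "LX \<mu> K X \<equiv> induced_ob so lm \<mu> K X"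

lemma induced_simps:
  "umod_of (LK \<mu> K) = so (umod_of K)" "amul (LK \<mu> K) = Comp U (lm (amul K)) (\<mu> (umod_of K) (umod_of K))"
  "aunit (LK \<mu> K) = Comp U (lm (aunit K)) (\<eta> F2)"
  "fst (LX \<mu> K X) = so (fst X)" "snd (LX \<mu> K X) = Comp U (lm (snd X)) (\<mu> (umod_of K) (fst X))"
  by (simp_all add: induced_alg_def induced_ob_def)

text \<open>The elementwise formula is the bridge for every transfer below: density asks for
  comparison on elements \<open>\<eta> x\<close> and \<open>\<eta> v\<close>, where the formula
  reduces the induced action to the original one.\<close>

lemma induced_action:
  assumes \<mu>: "unit_extension \<mu>" and A: "A \<in> Ob U" and M: "M \<in> Ob U" and a: "a \<in> Hom U (tob T A M) M"
  shows "Comp U (lm a) (\<mu> A M) \<in> Hom U (tob T (so A) (so M)) (so M)"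
    and "x \<in> el A i \<Longrightarrow> v \<in> el M j \<Longrightarrow>
      app (Comp U (lm a) (\<mu> A M)) (i + j) (tel T (so A) (so M) i j (app (\<eta> A) i x) (app (\<eta> M) j v)) =
      app (\<eta> M) (i + j) (app a (i + j) (tel T A M i j x v))"
proof -
  note P = tob_Ob[OF A M] and m = mu_in[OF \<mu> A M] and X = tob_Ob[OF so_Ob[OF A] so_Ob[OF M]]
  note l = lm_Hom[OF P M a]
  show "Comp U (lm a) (\<mu> A M) \<in> Hom U (tob T (so A) (so M)) (so M)" by (rule comp_in_Hom[OF m l X])
  assume x: "x \<in> el A i" and v: "v \<in> el M j"
  show "app (Comp U (lm a) (\<mu> A M)) (i + j) (tel T (so A) (so M) i j (app (\<eta> A) i x) (app (\<eta> M) j v)) =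
      app (\<eta> M) (i + j) (app a (i + j) (tel T A M i j x v))"
    unfolding comp_app[OF m tel_closed[OF so_Ob[OF A] so_Ob[OF M] unit_closed[OF A x] unit_closed[OF
        M v]]]
      mu_app[OF \<mu> A M x v] by (rule unit_natural_app[OF P M a tel_closed[OF A M x v]])
qed

text \<open>The axioms are rewritten as equations between arrows into the local module
  \<open>so (fst X)\<close>, to which density applies. For \<open>K\<close> acting on itself this
  also yields the associativity and unit laws of the localised algebra.\<close>

lemma induced_kmod:
  assumes \<mu>: "unit_extension \<mu>" and A: "umod_of K \<in> Ob U"
    and m: "amul K \<in> Hom U (tob T (umod_of K) (umod_of K)) (umod_of K)" and e: "aunit K \<in>
        Hom U F2 (umod_of K)"
    and X: "is_kmod T K X"
  shows "is_kmod T (LK \<mu> K) (LX \<mu> K X)"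
proof -
  let ?A = "umod_of K" and ?M = "fst X"
  have M: "?M \<in> Ob U" and a: "snd X \<in> Hom U (tob T ?A ?M) ?M" using X by (simp_all add: is_kmod_def)
  define m' where "m' = Comp U (lm (amul K)) (\<mu> ?A ?A)"
  define a' where "a' = Comp U (lm (snd X)) (\<mu> ?A ?M)"
  define e' where "e' = Comp U (lm (aunit K)) (\<eta> F2)"
  note m'_in = induced_action(1)[OF \<mu> A A m, folded m'_def]
    and m'_app = induced_action(2)[OF \<mu> A A m, folded m'_def]
    and a'_in = induced_action(1)[OF \<mu> A M a, folded a'_def]
    and a'_app = induced_action(2)[OF \<mu> A M a, folded a'_def]
  note SA = so_Ob[OF A] and SM = so_Ob[OF M]
  note AA = tob_Ob[OF SA SA] and AM = tob_Ob[OF SA SM]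
  note AAM = tob_Ob[OF AA SM]
  note idA = id_in_Hom[OF SA] and idM = id_in_Hom[OF SM]
  note le = lm_Hom[OF F2_Ob A e]
  note uF = unit_in[OF F2_Ob]
  have e'_in: "e' \<in> Hom U F2 (so ?A)" unfolding e'_def by (rule comp_in_Hom[OF uF le F2_Ob])
  have e'_app: "app e' 0 F2_gen = app (\<eta> ?A) 0 (unity K)"
    unfolding e'_def comp_app[OF uF F2_gen_el] by (rule unit_natural_app[OF F2_Ob A e F2_gen_el])
  note ma = tmap_in[OF AA SM SA SM m'_in idM] and am = tmap_in[OF SA AM SA SM idA a'_in]
  note as = assoc_in[OF SA SA SM]
  note c1 = comp_in_Hom[OF ma a'_in AAM]
  note c2 = comp_in_Hom[OF as am AAM]
  note c3 = comp_in_Hom[OF c2 a'_in AAM]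
  have c1_app: "app (Comp U a' (tmap T m' (Idn U (so ?M)))) (i + j + r) (tel T (tob T (so ?A)
      (so ?A)) (so ?M) (i + j) r (tel T (so ?A) (so ?A) i j x y) v)
      = app a' (i + j + r) (tel T (so ?A) (so ?M) (i + j) r (app m' (i + j) (tel T (so ?A) (so ?A)
          i j x y)) v)"
    if x: "x \<in> el (so ?A) i" and y: "y \<in> el (so ?A) j" and v: "v \<in> el (so ?M) r" for i j r x y v
    unfolding comp_app[OF ma tel_closed[OF AA SM tel_closed[OF SA SA x y] v]]
      tmap_app[OF AA SM SA SM m'_in idM tel_closed[OF SA SA x y] v] id_app[OF v] ..
  have c3_app: "app (Comp U a' (Comp U (tmap T (Idn U (so ?A)) a') (assoc T (so ?A) (so ?A)
      (so ?M)))) (i + j + r)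
        (tel T (tob T (so ?A) (so ?A)) (so ?M) (i + j) r (tel T (so ?A) (so ?A) i j x y) v)
      = app a' (i + (j + r)) (tel T (so ?A) (so ?M) i (j + r) x (app a' (j + r) (tel T (so ?A)
          (so ?M) j r y v)))"
    if x: "x \<in> el (so ?A) i" and y: "y \<in> el (so ?A) j" and v: "v \<in> el (so ?M) r" for i j r x y v
  proof -
    note w = tel_closed[OF AA SM tel_closed[OF SA SA x y] v]
    show ?thesis
      unfolding comp_app[OF c2 w] comp_app[OF as w] assoc_app[OF SA SA SM x y v]
      using tmap_app[OF SA AM SA SM idA a'_in x tel_closed[OF SA SM y v]] id_app[OF x]
          by (simp add: add.assoc)
  qed
  \<comment> \<open>The associator brings the second bracketing to the same source, so that both
    sides are arrows out of one triple product.\<close>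
  have assoc_eq: "Comp U a' (tmap T m' (Idn U (so ?M))) =
      Comp U a' (Comp U (tmap T (Idn U (so ?A)) a') (assoc T (so ?A) (so ?A) (so ?M)))"
  proof (rule density3[OF local_so[OF M] A SA A SA M SM unit_in[OF A] nil_iso_unit[OF A]
      unit_in[OF A] nil_iso_unit[OF A]
        unit_in[OF M] nil_iso_unit[OF M] c1 c3])
    fix i j r x y v assume x: "x \<in> el ?A i" and y: "y \<in> el ?A j" and v: "v \<in> el ?M r"
    note ux = unit_closed[OF A x] and uy = unit_closed[OF A y] and uv = unit_closed[OF M v]
    have "app (snd X) (i + j + r) (tel T ?A ?M (i + j) r (app (amul K) (i + j)
        (tel T ?A ?A i j x y)) v) =
        app (snd X) (i + (j + r)) (tel T ?A ?M i (j + r) x (app (snd X) (j + r) (tel T ?A ?M j r y v)))"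
      using X x y v unfolding is_kmod_def by blast
    then show "app (Comp U a' (tmap T m' (Idn U (so ?M)))) (i + j + r)
        (tel T (tob T (so ?A) (so ?A)) (so ?M) (i + j) r (tel T (so ?A) (so ?A) i j (app (\<eta> ?A) i x)
            (app (\<eta> ?A) j y)) (app (\<eta> ?M) r v)) =
      app (Comp U a' (Comp U (tmap T (Idn U (so ?A)) a') (assoc T (so ?A) (so ?A) (so ?M)))) (i + j + r)
        (tel T (tob T (so ?A) (so ?A)) (so ?M) (i + j) r (tel T (so ?A) (so ?A) i j (app (\<eta> ?A) i x)
            (app (\<eta> ?A) j y)) (app (\<eta> ?M) r v))"
      unfolding c1_app[OF ux uy uv] c3_app[OF ux uy uv] m'_app[OF x y] a'_app[OF y v]
        a'_app[OF hom_closed[OF m tel_closed[OF A A x y]] v] a'_app[OF x hom_closed[OF a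
            tel_closed[OF A M y v]]]
      by (simp add: add.assoc)
  qed
  note ta = tmap_in[OF F2_Ob SM SA SM e'_in idM] and F2M = tob_Ob[OF F2_Ob SM]
  note c4 = comp_in_Hom[OF ta a'_in F2M]
  have c4_app: "app (Comp U a' (tmap T e' (Idn U (so ?M)))) i (tel T F2 (so ?M) 0 i F2_gen v) =
      app a' i (tel T (so ?A) (so ?M) 0 i (app e' 0 F2_gen) v)" if v: "v \<in> el (so ?M) i" for i v
    using comp_app[OF ta tel_closed[OF F2_Ob SM F2_gen_el v], of a']
      tmap_app[OF F2_Ob SM SA SM e'_in idM F2_gen_el v] id_app[OF v] by simp
  \<comment> \<open>The unit law as an equation between arrows out of
    \<open>F2 \<otimes> so ?M\<close>.\<close>
  have unit_eq: "Comp U a' (tmap T e' (Idn U (so ?M))) = lunit T (so ?M)"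
  proof (rule density_F2_left[OF local_so[OF M] M SM unit_in[OF M] nil_iso_unit[OF M]
      c4 lunit_in[OF SM]])
    fix i v assume v: "v \<in> el ?M i"
    note uv = unit_closed[OF M v]
    have "app (snd X) i (tel T ?A ?M 0 i (unity K) v) = v"
      using X v unfolding is_kmod_def by fastforce
    then show "app (Comp U a' (tmap T e' (Idn U (so ?M)))) i (tel T F2 (so ?M)
        0 i F2_gen (app (\<eta> ?M) i v)) =
        app (lunit T (so ?M)) i (tel T F2 (so ?M) 0 i F2_gen (app (\<eta> ?M) i v))"
      unfolding c4_app[OF uv] lunit_app[OF SM uv] e'_app
      using a'_app[OF hom_closed[OF e F2_gen_el] v] by simp
  qed
  show ?thesis
    unfolding is_kmod_def induced_simps m'_def[symmetric] a'_def[symmetric] e'_def[symmetric]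
  proof (intro conjI allI ballI SM a'_in)
    fix i j r x y v assume "x \<in> el (so ?A) i" "y \<in> el (so ?A) j" "v \<in> el (so ?M) r"
    then show "app a' (i + j + r) (tel T (so ?A) (so ?M) (i + j) r (app m' (i + j) (tel T (so ?A)
        (so ?A) i j x y)) v) =
        app a' (i + (j + r)) (tel T (so ?A) (so ?M) i (j + r) x (app a' (j + r) (tel T (so ?A)
            (so ?M) j r y v)))"
      using c1_app c3_app assoc_eq by metis
  next
    fix i v assume v: "v \<in> el (so ?M) i"
    show "app a' (0 + i) (tel T (so ?A) (so ?M) 0 i (app e' 0 F2_gen) v) = v"
      using c4_app[OF v] lunit_app[OF SM v] unfolding unit_eq by simp
  qed
qed

lemma algebra_kmod: "unstable_algebra T K \<Longrightarrow> is_kmod T K (umod_of K, amul K)"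
  by (simp add: unstable_algebra_def is_kmod_def)

lemma induced_algebra:
  assumes \<mu>: "unit_extension \<mu>" and K: "unstable_algebra T K"
  shows "unstable_algebra T (LK \<mu> K)"
proof -
  let ?A = "umod_of K"
  have A: "?A \<in> Ob U" and m: "amul K \<in> Hom U (tob T ?A ?A) ?A" and e: "aunit K \<in> Hom U F2 ?A"
    using K by (simp_all add: unstable_algebra_def)
  define m' where "m' = Comp U (lm (amul K)) (\<mu> ?A ?A)"
  note m'_in = induced_action(1)[OF \<mu> A A m, folded m'_def]
    and m'_app = induced_action(2)[OF \<mu> A A m, folded m'_def]
  note SA = so_Ob[OF A]
  note AA = tob_Ob[OF SA SA]
  let ?\<beta> = "\<lambda>i j x y. app m' (i + j) (tel T (so ?A) (so ?A) i j x y)"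
  \<comment> \<open>The module axioms of the algebra over itself are its associativity and left unit
    laws.\<close>
  have kmod: "is_kmod T (LK \<mu> K) (LX \<mu> K (?A, amul K))"
    by (rule induced_kmod[OF \<mu> A m e algebra_kmod[OF K]])
  \<comment> \<open>Composing with the twist makes commutativity an equation between two arrows with
    the same source.\<close>
  obtain \<sigma> where \<sigma>: "\<sigma> \<in> Hom U (tob T (so ?A) (so ?A)) (tob T (so ?A) (so ?A))"
    "\<And>i j x y. x \<in> el (so ?A) i \<Longrightarrow> y \<in> el (so ?A) j \<Longrightarrow>
      app \<sigma> (i + j) (tel T (so ?A) (so ?A) i j x y) = tel T (so ?A) (so ?A) j i y x"
    using twist_exists[OF SA SA] by blast
  have \<sigma>_app: "app (Comp U m' \<sigma>) (i + j) (tel T (so ?A) (so ?A) i j x y) = ?\<beta> j i y x"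
    if x: "x \<in> el (so ?A) i" and y: "y \<in> el (so ?A) j" for i j x y
    unfolding comp_app[OF \<sigma>(1) tel_closed[OF SA SA x y]] \<sigma>(2)[OF x y] by (simp add: add.commute)
  have "m' = Comp U m' \<sigma>"
  proof (rule density2[OF local_so[OF A] A SA A SA unit_in[OF A] nil_iso_unit[OF A] unit_in[OF A]
      nil_iso_unit[OF A]
        m'_in comp_in_Hom[OF \<sigma>(1) m'_in AA]])
    fix i j x y assume x: "x \<in> el ?A i" and y: "y \<in> el ?A j"
    have "mult_el T K i j x y = mult_el T K j i y x"
      using K x y unfolding unstable_algebra_def by blast
    then show "?\<beta> i j (app (\<eta> ?A) i x) (app (\<eta> ?A) j y) =
        app (Comp U m' \<sigma>) (i + j) (tel T (so ?A) (so ?A) i j (app (\<eta> ?A) i x) (app (\<eta> ?A) j y))"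
      unfolding \<sigma>_app[OF unit_closed[OF A x] unit_closed[OF A y]] m'_app[OF x y] m'_app[OF y x]
      by (simp add: add.commute)
  qed
  then have comm: "?\<beta> i j x y = ?\<beta> j i y x" if "x \<in> el (so ?A) i" "y \<in> el (so ?A) j" for i j x y
    using \<sigma>_app[OF that] by simp
  have \<beta>: "cartan_pairing (so ?A) (so ?A) (so ?A) ?\<beta>"
    by (rule cartan_comp[OF cartan_tel[OF SA SA] m'_in SA SA AA SA])
  \<comment> \<open>Commutativity, just proved, is what makes \<open>pairing_square\<close> an
    arrow. The double of \<open>\<eta>\<close> has nilpotent kernel and cokernel, so it remains to
    compare the two arrows on the elements \<open>\<eta> x\<close>.\<close>
  have sq: "top_square (so ?A) = pairing_square (so ?A) ?\<beta>"
  proof (rule local_ext[OF local_so[OF A] doubling_Ob[OF A] doubling_Ob[OF SA]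
      doubling_map_in[OF A SA unit_in[OF A]]
        exact_functor.F_nil_iso[OF exact_functor_doubling A SA unit_in[OF A] nil_iso_unit[OF A]]
        top_square_in[OF SA] pairing_square_in[OF SA \<beta> comm]])
    fix n x assume x: "x \<in> el (doubling ?A) n"
    show "app (top_square (so ?A)) n (app (doubling_map (\<eta> ?A)) n x) =
        app (pairing_square (so ?A) ?\<beta>) n (app (doubling_map (\<eta> ?A)) n x)"
    proof (cases "even n")
      case True
      then obtain i where n: "n = 2 * i" by (rule evenE)
      have x': "x \<in> el ?A i" using x unfolding n gr_doubling .
      have "Sq ?A i i x = mult_el T K i i x x"
        using K x' unfolding unstable_algebra_def by blast
      then show ?thesis
        unfolding n doubling_map_app[OF unit_in[OF A] x'] top_square_app[OF unit_closed[OF A x']]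
          pairing_square_app[OF unit_closed[OF A x']] m'_app[OF x' x'] hom_Sq[OF unit_in[OF A] x',
              symmetric]
        by simp
    next
      case False
      then show ?thesis
        using doubling_odd[OF False x] hom_zero[OF doubling_map_in[OF A SA unit_in[OF A]]
            doubling_Ob[OF A] doubling_Ob[OF SA]]
          hom_zero[OF top_square_in[OF SA] doubling_Ob[OF SA] SA]
          hom_zero[OF pairing_square_in[OF SA \<beta> comm] doubling_Ob[OF SA] SA] by simp
    qed
  qed
  have Sq_eq: "Sq (so ?A) i i x = ?\<beta> i i x x" if "x \<in> el (so ?A) i" for i x
    by (rule trans[OF top_square_app[OF that, unfolded sq, symmetric] pairing_square_app[OF that]])
  have e': "aunit (LK \<mu> K) \<in> Hom U F2 (so ?A)"
    unfolding induced_simps by (rule comp_in_Hom[OF unit_in[OF F2_Ob] lm_Hom[OF F2_Ob A e] F2_Ob])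
  note kmod' = kmod[unfolded is_kmod_def induced_simps fst_conv snd_conv, folded m'_def]
  note assoc_unit = kmod'[THEN conjunct2, THEN conjunct2]
  show ?thesis
    unfolding unstable_algebra_def induced_simps m'_def[symmetric]
    by (intro conjI; (rule SA m'_in e'[unfolded induced_simps] assoc_unit[THEN conjunct1]
        assoc_unit[THEN conjunct2]
      | intro allI ballI, (rule comm Sq_eq; assumption)))
qed

end

section \<open>The category of modules over an unstable algebra\<close>

lemma KU_Hom:
  "f \<in> Hom (KU T K) X Y \<longleftrightarrow> src f = X \<and> tgt f = Y \<and> under f \<in> Hom U (fst X) (fst Y) \<and>
      (\<forall>i j. \<forall>x\<in>el (umod_of K) i. \<forall>v\<in>el (fst X) j.
         app f (i + j) (act T K X i j x v) = act T K Y i j x (app f j v))"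
  by (simp add: KU_def)

lemma KU_Ob: "X \<in> Ob (KU T K) \<longleftrightarrow> is_kmod T K X"
  by (simp add: KU_def)

lemma src_under: "src (under f) = fst (src f)" and tgt_under: "tgt (under f) = fst (tgt f)"
  and app_under: "app (under f) = app f"
  by (simp_all add: under_def)

lemma under_Idn: "under (Idn (KU T K) X) = Idn U (fst X)"
  by (simp add: under_def KU_def U_def)

lemma under_Comp: "under (Comp (KU T K) g f) = Comp U (under g) (under f)"
  by (simp add: under_def KU_def U_def)

lemma KU_arrow_eqI: "src f = src g \<Longrightarrow> tgt f = tgt g \<Longrightarrow> under f = under g \<Longrightarrow> f = g"
  by (metis app_under arrow.expand)

lemma KU_Idn_simps: "src (Idn (KU T K) X) = X" "tgt (Idn (KU T K) X) = X"
  and KU_Comp_simps: "src (Comp (KU T K) g f) = src f" "tgt (Comp (KU T K) g f) = tgt g"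
  by (simp_all add: KU_def)

context tensor_choice
begin

text \<open>Source, target and underlying arrow determine an arrow of modules, so the laws are those
  of \<open>U\<close>; what remains is that identities and composites respect the action.\<close>

lemma is_category_KU:
  assumes A: "umod_of K \<in> Ob U"
  shows "is_category (KU T K)"
proof -
  have M: "fst X \<in> Ob U" and a: "snd X \<in> Hom U (tob T (umod_of K) (fst X)) (fst X)"
    if "X \<in> Ob (KU T K)" for X using that by (simp_all add: KU_Ob is_kmod_def)
  have act: "act T K X i j x v \<in> el (fst X) (i + j)"
    if "X \<in> Ob (KU T K)" "x \<in> el (umod_of K) i" "v \<in> el (fst X) j" for X i j x v
    by (rule hom_closed[OF a[OF that(1)] tel_closed[OF A M[OF that(1)] that(2,3)]])
  have u: "under f \<in> Hom U (fst X) (fst Y)" if "f \<in> Hom (KU T K) X Y" for f X Y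
    using that by (simp add: KU_Hom)
  have st: "src f = X" "tgt f = Y" if "f \<in> Hom (KU T K) X Y" for f X Y
    using that by (simp_all add: KU_Hom)
  show ?thesis
    unfolding is_category_def
  proof (intro conjI ballI)
    fix X assume X: "X \<in> Ob (KU T K)"
    have "app (Idn (KU T K) X) n v = v" if "v \<in> el (fst X) n" for n v
      using id_app[OF that] under_Idn[of T K X] app_under[of "Idn (KU T K) X"] by simp
    with act[OF X] id_in_Hom[OF M[OF X]] show "Idn (KU T K) X \<in> Hom (KU T K) X X"
      unfolding KU_Hom under_Idn KU_Idn_simps by simp
  next
    fix X Y Z f g assume O: "X \<in> Ob (KU T K)" "Y \<in> Ob (KU T K)" "Z \<in> Ob (KU T K)"
      and f: "f \<in> Hom (KU T K) X Y" and g: "g \<in> Hom (KU T K) Y Z"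
    have gf: "app (Comp (KU T K) g f) n v = app g n (app f n v)" if "v \<in> el (fst X) n" for n v
      using comp_app[OF u[OF f] that, of "under g"] under_Comp[of T K g f]
          app_under[of "Comp (KU T K) g f"]
        app_under[of f] app_under[of g] by simp
    have fcl: "app f n v \<in> el (fst Y) n" if "v \<in> el (fst X) n" for n v
      using hom_closed[OF u[OF f] that] by (simp add: app_under)
    have "app (Comp (KU T K) g f) (i + j) (act T K X i j x v) = act T K Z i j x (app (Comp (KU T K)
        g f) j v)"
      if x: "x \<in> el (umod_of K) i" and v: "v \<in> el (fst X) j" for i j x v
    proof -
      have "app f (i + j) (act T K X i j x v) = act T K Y i j x (app f j v)"
        using f x v unfolding KU_Hom by blast
      moreover have "app g (i + j) (act T K Y i j x (app f j v)) =
          act T K Z i j x (app g j (app f j v))"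
        using g x fcl[OF v] unfolding KU_Hom by blast
      ultimately show ?thesis unfolding gf[OF act[OF O(1) x v]] gf[OF v] by simp
    qed
    then show "Comp (KU T K) g f \<in> Hom (KU T K) X Z"
      using comp_in_Hom[OF u[OF f] u[OF g] M[OF O(1)]] st(1)[OF f] st(2)[OF g]
      unfolding KU_Hom under_Comp KU_Comp_simps by blast
  next
    fix X Y f assume O: "X \<in> Ob (KU T K)" "Y \<in> Ob (KU T K)" and f: "f \<in> Hom (KU T K) X Y"
    show "Comp (KU T K) f (Idn (KU T K) X) = f" "Comp (KU T K) (Idn (KU T K) Y) f = f"
      by (rule KU_arrow_eqI; simp add: KU_Idn_simps KU_Comp_simps under_Comp under_Idn st[OF f]
        comp_id[OF u[OF f] M[OF O(1)] M[OF O(2)]])+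
  next
    fix W X Y Z f g h assume O: "W \<in> Ob (KU T K)" "X \<in> Ob (KU T K)" "Y \<in> Ob (KU T K)" "Z \<in> Ob (KU T K)"
      and f: "f \<in> Hom (KU T K) W X" and g: "g \<in> Hom (KU T K) X Y" and h: "h \<in> Hom (KU T K) Y Z"
    show "Comp (KU T K) h (Comp (KU T K) g f) = Comp (KU T K) (Comp (KU T K) h g) f"
      by (rule KU_arrow_eqI) (simp_all add: KU_Comp_simps under_Comp
        comp_assoc[OF u[OF f] u[OF g] u[OF h] M[OF O(1)] M[OF O(2)] M[OF O(3)]])
  qed
qed

end

section \<open>The induced functor\<close>

context localised_tensor
begin

text \<open>That \<open>lm\<close> of an underlying arrow respects the induced actions is an
  equation between arrows out of \<open>so ?A \<otimes> so (fst X)\<close>, settled by density.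
  Identities and composites are inherited from \<open>lm\<close>.\<close>

lemma induced_functor:
  assumes \<mu>: "unit_extension \<mu>" and K: "unstable_algebra T K"
  shows "is_functor (KU T K) (KU T (LK \<mu> K)) (induced_ob so lm \<mu> K) (induced_map so lm \<mu> K)"
proof -
  let ?A = "umod_of K"
  have A: "?A \<in> Ob U" and m: "amul K \<in> Hom U (tob T ?A ?A) ?A" and e: "aunit K \<in> Hom U F2 ?A"
    using K by (simp_all add: unstable_algebra_def)
  note SA = so_Ob[OF A]
  have M: "fst X \<in> Ob U" and a: "snd X \<in> Hom U (tob T ?A (fst X)) (fst X)"
    if "X \<in> Ob (KU T K)" for X using that by (simp_all add: KU_Ob is_kmod_def)
  have u: "under f \<in> Hom U (fst X) (fst Y)" if "f \<in> Hom (KU T K) X Y" for f X Y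
    using that by (simp add: KU_Hom)
  have st: "src f = X" "tgt f = Y" if "f \<in> Hom (KU T K) X Y" for f X Y
    using that by (simp_all add: KU_Hom)
  let ?F = "induced_map so lm \<mu> K"
  have F_simps: "src (?F f) = LX \<mu> K (src f)" "tgt (?F f) = LX \<mu> K (tgt f)" for f
    by (simp_all add: induced_map_def)
  have uF: "under (?F f) = lm (under f)"
    if "X \<in> Ob (KU T K)" "Y \<in> Ob (KU T K)" "f \<in> Hom (KU T K) X Y" for f X Y
  proof -
    have l: "lm (under f) \<in> Hom U (so (fst X)) (so (fst Y))" by (rule lm_Hom[OF M[OF that(1)]
        M[OF that(2)] u[OF that(3)]])
    show ?thesis
      by (rule arrow.expand) (simp add: src_under tgt_under app_under F_simps st[OF that(3)]
          induced_simps
        hom_src[OF l] hom_tgt[OF l], simp add: induced_map_def)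
  qed
  note C = is_category_KU[OF A]
  have C': "is_category (KU T (LK \<mu> K))" by (rule is_category_KU) (simp add: induced_simps SA)
  show ?thesis
    unfolding is_functor_def
  proof (intro conjI ballI C C')
    fix X assume X: "X \<in> Ob (KU T K)"
    show "LX \<mu> K X \<in> Ob (KU T (LK \<mu> K))"
      using induced_kmod[OF \<mu> A m e] X by (simp add: KU_Ob)
    show "?F (Idn (KU T K) X) = Idn (KU T (LK \<mu> K)) (LX \<mu> K X)"
      by (rule KU_arrow_eqI) (simp_all add: F_simps KU_Idn_simps under_Idn uF[OF X X
          is_categoryD(1)[OF C X]]
        induced_simps is_functorD(5)[OF lm_functor M[OF X], unfolded l_ob_so])
  next
    fix X Y f assume X: "X \<in> Ob (KU T K)" and Y: "Y \<in> Ob (KU T K)" and f: "f \<in> Hom (KU T K) X Y"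
    note SX = so_Ob[OF M[OF X]] and SY = so_Ob[OF M[OF Y]]
    note l = lm_Hom[OF M[OF X] M[OF Y] u[OF f]]
    note aX = induced_action[OF \<mu> A M[OF X] a[OF X]] and aY = induced_action[OF \<mu> A M[OF Y] a[OF Y]]
    let ?aX = "Comp U (lm (snd X)) (\<mu> ?A (fst X))" and ?aY = "Comp U (lm (snd Y)) (\<mu> ?A (fst Y))"
    note idA = id_in_Hom[OF SA]
    note t = tmap_in[OF SA SX SA SY idA l]
    note AX = tob_Ob[OF SA SX]
    note c1 = comp_in_Hom[OF aX(1) l AX] and c2 = comp_in_Hom[OF t aY(1) AX]
    have c1_app: "app (Comp U (lm (under f)) ?aX) (i + j) (tel T (so ?A) (so (fst X)) i j x v) =
        app (lm (under f)) (i + j) (app ?aX (i + j) (tel T (so ?A) (so (fst X)) i j x v))"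
      if "x \<in> el (so ?A) i" "v \<in> el (so (fst X)) j" for i j x v
      by (rule comp_app[OF aX(1) tel_closed[OF SA SX that]])
    have c2_app: "app (Comp U ?aY (tmap T (Idn U (so ?A)) (lm (under f)))) (i + j) (tel T (so ?A)
        (so (fst X)) i j x v) =
        app ?aY (i + j) (tel T (so ?A) (so (fst Y)) i j x (app (lm (under f)) j v))"
      if "x \<in> el (so ?A) i" "v \<in> el (so (fst X)) j" for i j x v
      unfolding comp_app[OF t tel_closed[OF SA SX that]] tmap_app[OF SA SX SA SY idA l that]
          id_app[OF that(1)] ..
    have "Comp U (lm (under f)) ?aX = Comp U ?aY (tmap T (Idn U (so ?A)) (lm (under f)))"
    proof (rule density2[OF local_so[OF M[OF Y]] A SA M[OF X] SX unit_in[OF A] nil_iso_unit[OF A]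
          unit_in[OF M[OF X]] nil_iso_unit[OF M[OF X]] c1 c2])
      fix i j x v assume x: "x \<in> el ?A i" and v: "v \<in> el (fst X) j"
      note ux = unit_closed[OF A x] and uv = unit_closed[OF M[OF X] v]
      have "app (under f) (i + j) (act T K X i j x v) = act T K Y i j x (app (under f) j v)"
        using f x v unfolding KU_Hom app_under by blast
      then show "app (Comp U (lm (under f)) ?aX) (i + j) (tel T (so ?A) (so (fst X)) i j (app (\<eta> ?A)
          i x) (app (\<eta> (fst X)) j v)) =
          app (Comp U ?aY (tmap T (Idn U (so ?A)) (lm (under f)))) (i + j) (tel T (so ?A)
              (so (fst X)) i j (app (\<eta> ?A) i x) (app (\<eta> (fst X)) j v))"
        unfolding c1_app[OF ux uv] c2_app[OF ux uv] aX(2)[OF x v]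
          unit_natural_app[OF M[OF X] M[OF Y] u[OF f] hom_closed[OF a[OF X] tel_closed[OF A M[OF X]
              x v]]]
          unit_natural_app[OF M[OF X] M[OF Y] u[OF f] v] aY(2)[OF x hom_closed[OF u[OF f] v]] by simp
    qed
    then have "app (lm (under f)) (i + j) (app ?aX (i + j) (tel T (so ?A) (so (fst X)) i j x v)) =
        app ?aY (i + j) (tel T (so ?A) (so (fst Y)) i j x (app (lm (under f)) j v))"
      if "x \<in> el (so ?A) i" "v \<in> el (so (fst X)) j" for i j x v
      using c1_app[OF that] c2_app[OF that] by simp
    moreover have "app (?F f) = app (lm (under f))" by (simp add: induced_map_def)
    ultimately show "?F f \<in> Hom (KU T (LK \<mu> K)) (LX \<mu> K X) (LX \<mu> K Y)"
      unfolding KU_Hom F_simps uF[OF X Y f] induced_simps using l st[OF f] by simp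
    fix Z g assume Z: "Z \<in> Ob (KU T K)" and g: "g \<in> Hom (KU T K) Y Z"
    note gf = is_categoryD(2)[OF C X Y Z f g]
    show "?F (Comp (KU T K) g f) = Comp (KU T (LK \<mu> K)) (?F g) (?F f)"
      by (rule KU_arrow_eqI) (simp_all add: F_simps KU_Comp_simps under_Comp uF[OF X Z gf]
          uF[OF X Y f] uF[OF Y Z g]
        is_functorD(6)[OF lm_functor M[OF X] M[OF Y] M[OF Z] u[OF f] u[OF g]])
  qed
qed

end

theorem proposition3p8:
  fixes k :: nat
    and T :: "'a tensor"
    and so :: "'a umod \<Rightarrow> 'a umod"
    and sm :: "'a qarr \<Rightarrow> 'a uarr"
    and \<phi> :: "'a umod \<Rightarrow> 'a umod \<Rightarrow> 'a qarr \<Rightarrow> 'a uarr"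
  assumes "infinite (UNIV :: 'a set)"
    and "1 \<le> k"
    and "is_tensor_choice T"
    and "is_right_adjoint_r k so sm \<phi>"
  shows "(\<exists>\<mu> \<epsilon>. l_lax T k so sm \<phi> \<mu> \<epsilon>) \<and>
    (\<forall>\<mu> \<epsilon> K. l_lax T k so sm \<phi> \<mu> \<epsilon> \<and> unstable_algebra T K \<longrightarrow>
       unstable_algebra T (induced_alg (l_ob so) (l_map k sm) \<mu> \<epsilon> K) \<and>
       is_functor (KU T K) (KU T (induced_alg (l_ob so) (l_map k sm) \<mu> \<epsilon> K))
         (induced_ob (l_ob so) (l_map k sm) \<mu> K)
         (induced_map (l_ob so) (l_map k sm) \<mu> K))"
proof -
  interpret localised_tensor T k so sm \<phi>
    by unfold_locales (use assms in auto)
  show ?thesis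
    unfolding l_ob_so l_lax_iff
    using unit_extension_exists induced_algebra induced_functor by blast
qed

end
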